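(* Let $f$ be a weak Maass form of weight $0$ for $\Gamma$ with eigenvalue $\lambda=s'(1-s')$, whose constant term at each cusp $\ell$ is $A_\ell y^{s'}+B_\ell y^{1-s'}$ with $A_\ell,B_\ell\in\mathbb C$. Then $$4\Delta_\tau I^{reg}(\tau,f)=\begin{cases}\lambda I^{reg}(\tau,f),&s'\ne0,1,\\ -\sum_{\ell\in\Gamma\backslash\mathrm{Iso}(V)}\frac{A_\ell\varepsilon_\ell}{\sqrt N}\tilde\Theta_{K_\ell}(\tau),&s'=0,\\ -\sum_{\ell\in\Gamma\backslash\mathrm{Iso}(V)}\frac{B_\ell\varepsilon_\ell}{\sqrt N}\tilde\Theta_{K_\ell}(\tau),&s'=1.\end{cases}$$
   Context: $\Delta_\tau=-v^2(\partial_u^2+\partial_v^2)+\frac i2v(\partial_u+i\partial_v)$ for $\tau=u+iv$, applied componentwise. Setup: $N\ge1$, $V$ the rational $2\times2$ trace-zero matrices with $Q(X)=-N\det X$, $(X,Y)=N\operatorname{tr}(XY)$; $\mathrm{SL}_2$ acts by $g.X=gXg^{-1}$. For $z=x+iy\in\mathbb H$, $X(z)=\frac1{\sqrt Ny}\begin{pmatrix}-x&z\bar z\\-1&x\end{pmatrix}$. $L\subset V$ even lattice of full rank, dual $L'$; $\Gamma\subset\mathrm{SL}_2(\mathbb Z)$ congruence subgroup preserving $L$, acting trivially on $L'/L$; $d\mu=dx\,dy/y^2$; $e(w)=e^{2\pi iw}$. Cusps: isotropic lines $\ell\subset V$; $\ell_0=\mathbb Qu_0$, $u_0=\begin{pmatrix}0&1\\0&0\end{pmatrix}$;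 fix $\sigma_\ell\in\mathrm{SL}_2(\mathbb Z)$ with $\sigma_\ell.\ell_0=\ell$, $u_\ell=\sigma_\ell.u_0$; $\alpha_\ell$ the cusp width, $\beta_\ell\in\mathbb Q_{>0}$ with $\beta_\ell u_\ell$ primitive in $\ell\cap L$, $\varepsilon_\ell=\alpha_\ell/\beta_\ell$. $K_\ell=(L\cap\ell^\perp)/(L\cap\ell)$; for $h\in L'/L$ with a representative in $L'\cap\ell^\perp$ let $\bar h$ be its image in $K_\ell'/K_\ell$, $\theta_{K_\ell,\bar h}(\tau)=\sum_{\lambda\in\bar h}e(Q(\lambda)\tau)$; $\tilde\Theta_{K_\ell}(\tau)=\sum_h\theta_{K_\ell,\bar h}(\tau)\mathfrak e_h$ (sum over such $h$). $\varphi_0(X,\tau,z)=\sqrt v\exp\big(\pi i(X,X)u-\pi v[(X,X)+(X,X(z))^2]\big)$, $\Theta_L(\tau,z,\varphi_0)=\sum_{h\in L'/L}\sum_{X\in L+h}\varphi_0(X,\tau,z)\mathfrak e_h$. $\mathcal F=\{|x|\le1/2,|z|\ge1\}$, $\mathcal F^a=\bigcup_{j=0}^{a-1}\begin{pmatrix}1&j\\0&1\end{pmatrix}\mathcal F$, $\mathcal F^a_T=\{z\in\mathcal F^a:y\le T\}$; $I^{reg}(\tau,s,f)=\sum_{\ell\in\Gamma\backslash\mathrm{Iso}(V)}\lim_{T\to\infty}\int_{\mathcal F^{\alpha_\ell}_T}f(\sigma_\ell z)\Theta_L(\tau,\sigma_\ell z,\varphi_0)y^{-s}d\mu(z)$ (meromorphically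 continued in $s$), $I^{reg}(\tau,f)$ its constant term at $s=0$. Weak Maass form of weight 0 for $\Gamma$ with eigenvalue $\lambda$: smooth $\Gamma$-invariant $f$ with $-y^2(\partial_x^2+\partial_y^2)f=\lambda f$ and $f(\sigma_\ell z)=O(e^{Cy})$ at all cusps; constant term at $\ell$: $\frac1{\alpha_\ell}\int_0^{\alpha_\ell}f(\sigma_\ell(x+iy))dx$. *)

theory Defs
  imports
    "HOL-Analysis.Analysis"
    "HOL-Complex_Analysis.Complex_Analysis"
    "HOL-Library.Landau_Symbols"
begin

section \<open>The upper half plane and partial derivatives\<close>

definition upper_half :: "complex set" where
  "upper_half = {z. Im z > 0}"

text \<open>Partial derivatives with respect to the real and the imaginary part of the argument.\<close>

definition d_re :: "(complex \<Rightarrow> complex) \<Rightarrow> complex \<Rightarrow> complex" where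
  "d_re g z = vector_derivative (\<lambda>t. g (z + complex_of_real t)) (at 0)"

definition d_im :: "(complex \<Rightarrow> complex) \<Rightarrow> complex \<Rightarrow> complex" where
  "d_im g z = vector_derivative (\<lambda>t. g (z + \<i> * complex_of_real t)) (at 0)"

text \<open>\<open>n\<close> times continuously differentiable in the real sense on an open set: all iterated
  partial derivatives up to order \<open>n\<close> exist and are continuous.\<close>

fun C_k_on :: "nat \<Rightarrow> (complex \<Rightarrow> complex) \<Rightarrow> complex set \<Rightarrow> bool" where
  "C_k_on 0 g S \<longleftrightarrow> continuous_on S g"
| "C_k_on (Suc n) g S \<longleftrightarrow> continuous_on S g \<and>
     (\<forall>z\<in>S. (\<lambda>t::real. g (z + complex_of_real t)) differentiable (at 0) \<and>
            (\<lambda>t::real. g (z + \<i> * complex_of_real t)) differentiable (at 0)) \<and>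
     C_k_on n (d_re g) S \<and> C_k_on n (d_im g) S"

definition smooth_real_on :: "(complex \<Rightarrow> complex) \<Rightarrow> complex set \<Rightarrow> bool" where
  "smooth_real_on g S \<longleftrightarrow> (\<forall>n. C_k_on n g S)"

text \<open>\<open>\<Delta>\<^sub>\<tau>\<close>, the Laplacian of weight \<open>1/2\<close>, and the Laplacian of weight \<open>0\<close>.\<close>

definition Delta_half :: "(complex \<Rightarrow> complex) \<Rightarrow> complex \<Rightarrow> complex" where
  "Delta_half g \<tau> =
     - (complex_of_real (Im \<tau>))\<^sup>2 * (d_re (d_re g) \<tau> + d_im (d_im g) \<tau>)
     + \<i> / 2 * complex_of_real (Im \<tau>) * (d_re g \<tau> + \<i> * d_im g \<tau>)"

definition Delta_zero :: "(complex \<Rightarrow> complex) \<Rightarrow> complex \<Rightarrow> complex" where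
  "Delta_zero g z = - (complex_of_real (Im z))\<^sup>2 * (d_re (d_re g) z + d_im (d_im g) z)"

section \<open>Matrices and the quadratic space\<close>

text \<open>All matrices are real; rationality and integrality are imposed on the entries. In this way
  elements of \<open>V\<close> can be paired with the real matrix \<open>X(z)\<close> without any coercion.\<close>

definition mat2 :: "real \<Rightarrow> real \<Rightarrow> real \<Rightarrow> real \<Rightarrow> real^2^2" where
  "mat2 a b c d = vector [vector [a, b], vector [c, d]]"

definition SL2Z :: "(real^2^2) set" where
  "SL2Z = {g. det g = 1 \<and> (\<forall>i j. g $ i $ j \<in> \<int>)}"

definition V_space :: "(real^2^2) set" where
  "V_space = {X. trace X = 0 \<and> (\<forall>i j. X $ i $ j \<in> \<rat>)}"

definition Q_form :: "nat \<Rightarrow> real^2^2 \<Rightarrow> real" where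
  "Q_form N X = - real N * det X"

definition bil :: "nat \<Rightarrow> real^2^2 \<Rightarrow> real^2^2 \<Rightarrow> real" where
  "bil N X Y = real N * trace (X ** Y)"

definition act :: "real^2^2 \<Rightarrow> real^2^2 \<Rightarrow> real^2^2" where
  "act g X = g ** X ** matrix_inv g"

definition moebius_act :: "real^2^2 \<Rightarrow> complex \<Rightarrow> complex" where
  "moebius_act g z =
     (complex_of_real (g $ 1 $ 1) * z + complex_of_real (g $ 1 $ 2)) /
     (complex_of_real (g $ 2 $ 1) * z + complex_of_real (g $ 2 $ 2))"

definition X_pt :: "nat \<Rightarrow> complex \<Rightarrow> real^2^2" where
  "X_pt N z = (1 / (sqrt (real N) * Im z)) *\<^sub>R mat2 (- Re z) ((cmod z)\<^sup>2) (- 1) (Re z)"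

definition trans_mat :: "nat \<Rightarrow> real^2^2" where
  "trans_mat n = mat2 1 (real n) 0 1"

section \<open>Lattices and congruence subgroups\<close>

text \<open>A full rank lattice is the \<open>\<int>\<close>-span of a basis of the three-dimensional rational space
  \<open>V\<close>. Linear independence over \<open>\<real>\<close> and over \<open>\<rat>\<close> agree for vectors with rational entries.\<close>

definition full_lattice :: "(real^2^2) set \<Rightarrow> bool" where
  "full_lattice L \<longleftrightarrow>
     (\<exists>B. B \<subseteq> V_space \<and> card B = 3 \<and> independent B \<and>
          L = {\<Sum>b\<in>B. of_int (c b) *\<^sub>R b | c :: real^2^2 \<Rightarrow> int. True})"

definition even_lattice :: "nat \<Rightarrow> (real^2^2) set \<Rightarrow> bool" where
  "even_lattice N L \<longleftrightarrow> full_lattice L \<and> (\<forall>X\<in>L. Q_form N X \<in> \<int>)"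

definition dual_lattice :: "nat \<Rightarrow> (real^2^2) set \<Rightarrow> (real^2^2) set" where
  "dual_lattice N L = {X \<in> V_space. \<forall>Y\<in>L. bil N X Y \<in> \<int>}"

text \<open>The elements of \<open>L'/L\<close> are the cosets themselves. A vector \<open>\<Sum>\<^sub>h F\<^sub>h e\<^sub>h\<close> of the group ring
  \<open>\<complex>[L'/L]\<close> is represented by its coefficient function \<open>h \<mapsto> F\<^sub>h\<close> on \<open>L'/L\<close>.\<close>

definition disc_group :: "nat \<Rightarrow> (real^2^2) set \<Rightarrow> (real^2^2) set set" where
  "disc_group N L = (\<lambda>X. (+) X ` L) ` dual_lattice N L"

definition principal_congruence :: "nat \<Rightarrow> (real^2^2) set" where
  "principal_congruence M =
     {g \<in> SL2Z. \<forall>i j. (g $ i $ j - (mat 1 :: real^2^2) $ i $ j) / real M \<in> \<int>}"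

definition congruence_subgroup :: "(real^2^2) set \<Rightarrow> bool" where
  "congruence_subgroup \<Gamma> \<longleftrightarrow>
     \<Gamma> \<subseteq> SL2Z \<and> (\<forall>g\<in>\<Gamma>. \<forall>h\<in>\<Gamma>. g ** h \<in> \<Gamma>) \<and> (\<forall>g\<in>\<Gamma>. matrix_inv g \<in> \<Gamma>) \<and>
     (\<exists>M\<ge>1. principal_congruence M \<subseteq> \<Gamma>)"

definition compatible_group :: "nat \<Rightarrow> (real^2^2) set \<Rightarrow> (real^2^2) set \<Rightarrow> bool" where
  "compatible_group N L \<Gamma> \<longleftrightarrow>
     (\<forall>g\<in>\<Gamma>. act g ` L = L) \<and> (\<forall>g\<in>\<Gamma>. \<forall>X\<in>dual_lattice N L. act g X - X \<in> L)"

section \<open>Cusps\<close>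

definition rat_line :: "real^2^2 \<Rightarrow> (real^2^2) set" where
  "rat_line X = {q *\<^sub>R X | q. q \<in> \<rat>}"

definition Iso :: "nat \<Rightarrow> (real^2^2) set set" where
  "Iso N = {rat_line X | X. X \<in> V_space \<and> X \<noteq> 0 \<and> Q_form N X = 0}"

definition u_zero :: "real^2^2" where
  "u_zero = mat2 0 1 0 0"

definition line_zero :: "(real^2^2) set" where
  "line_zero = rat_line u_zero"

text \<open>A choice of the matrices \<open>\<sigma>\<^sub>\<l>\<close>.\<close>

definition cusp_matrices :: "nat \<Rightarrow> ((real^2^2) set \<Rightarrow> real^2^2) \<Rightarrow> bool" where
  "cusp_matrices N \<sigma> \<longleftrightarrow> (\<forall>\<l>\<in>Iso N. \<sigma> \<l> \<in> SL2Z \<and> act (\<sigma> \<l>) ` line_zero = \<l>)"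

text \<open>A system of representatives of \<open>\<Gamma>\<setminus>Iso(V)\<close>.\<close>

definition cusp_reps :: "nat \<Rightarrow> (real^2^2) set \<Rightarrow> (real^2^2) set set \<Rightarrow> bool" where
  "cusp_reps N \<Gamma> R \<longleftrightarrow>
     R \<subseteq> Iso N \<and> (\<forall>\<l>\<in>Iso N. \<exists>!r. r \<in> R \<and> (\<exists>g\<in>\<Gamma>. act g ` \<l> = r))"

text \<open>The width of the cusp \<open>\<sigma>\<infinity>\<close> is taken in \<open>\<Gamma>/{\<plusminus>1}\<close>, so \<open>-1\<close> need not lie in \<open>\<Gamma>\<close>.\<close>

definition cusp_width :: "(real^2^2) set \<Rightarrow> real^2^2 \<Rightarrow> nat" where
  "cusp_width \<Gamma> s =
     (LEAST n. n > 0 \<and> (s ** trans_mat n ** matrix_inv s \<in> \<Gamma> \<or>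
                        - (s ** trans_mat n ** matrix_inv s) \<in> \<Gamma>))"

text \<open>\<open>\<beta>\<^sub>\<l> u\<^sub>\<l>\<close> is primitive in the rank one lattice \<open>\<l> \<inter> L\<close>, i.e. it generates it.\<close>

definition beta_cusp :: "(real^2^2) set \<Rightarrow> (real^2^2) set \<Rightarrow> real^2^2 \<Rightarrow> real" where
  "beta_cusp L \<l> s =
     (THE b. b \<in> \<rat> \<and> b > 0 \<and> \<l> \<inter> L = {of_int k *\<^sub>R (b *\<^sub>R act s u_zero) | k. True})"

definition eps_cusp ::
  "(real^2^2) set \<Rightarrow> (real^2^2) set \<Rightarrow> (real^2^2) set \<Rightarrow> real^2^2 \<Rightarrow> real" where
  "eps_cusp L \<Gamma> \<l> s = real (cusp_width \<Gamma> s) / beta_cusp L \<l> s"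

section \<open>Unary theta functions at the cusps\<close>

definition perp :: "nat \<Rightarrow> (real^2^2) set \<Rightarrow> (real^2^2) set" where
  "perp N \<l> = {X \<in> V_space. \<forall>Y\<in>\<l>. bil N X Y = 0}"

text \<open>The rational quadratic space \<open>\<l>\<^sup>\<bottom>/\<l>\<close> contains \<open>K\<^sub>\<l>\<close> and its dual. Its elements are cosets
  of \<open>\<l>\<close>, and the form \<open>Q\<close> is constant on those contained in \<open>\<l>\<^sup>\<bottom>\<close>.\<close>

definition line_coset :: "(real^2^2) set \<Rightarrow> real^2^2 \<Rightarrow> (real^2^2) set" where
  "line_coset \<l> X = (+) X ` \<l>"

definition Q_quot :: "nat \<Rightarrow> (real^2^2) set \<Rightarrow> real" where
  "Q_quot N \<kappa> = the_elem (Q_form N ` \<kappa>)"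

text \<open>The element \<open>h\<close>-bar of \<open>K\<^sub>\<l>'/K\<^sub>\<l>\<close>, as a subset of \<open>\<l>\<^sup>\<bottom>/\<l>\<close>. By \<open>hbar_eq\<close> below it is the
  coset modulo \<open>K\<^sub>\<l>\<close> of the image of any representative of \<open>h\<close> in \<open>L' \<inter> \<l>\<^sup>\<bottom>\<close>.\<close>

definition hbar :: "nat \<Rightarrow> (real^2^2) set \<Rightarrow> (real^2^2) set \<Rightarrow> (real^2^2) set set" where
  "hbar N \<l> h = line_coset \<l> ` (h \<inter> perp N \<l>)"

lemma hbar_eq:
  assumes "full_lattice L" and "h \<in> disc_group N L" and "X \<in> h \<inter> perp N \<l>"
  shows "hbar N \<l> h = {line_coset \<l> (X + Y) | Y. Y \<in> L \<inter> perp N \<l>}"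
proof -
  have bil_add: "bil N (P + P') Z = bil N P Z + bil N P' Z"
    and bil_diff: "bil N (P - P') Z = bil N P Z - bil N P' Z" for P P' Z
    by (simp_all add: bil_def trace_def matrix_matrix_mult_def sum_2 algebra_simps)
  have perp_add: "P + P' \<in> perp N \<l>" and perp_diff: "P - P' \<in> perp N \<l>"
    if "P \<in> perp N \<l>" "P' \<in> perp N \<l>" for P P'
    using that by (auto simp: perp_def V_space_def bil_add bil_diff trace_add trace_sub)
  obtain B where L: "L = {\<Sum>b\<in>B. of_int (c b) *\<^sub>R b | c :: real^2^2 \<Rightarrow> int. True}"
    using assms(1) unfolding full_lattice_def by blast
  have L_add: "P + P' \<in> L" if "P \<in> L" "P' \<in> L" for P P'
  proof -
    from that obtain c c' :: "real^2^2 \<Rightarrow> int"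
      where c: "P = (\<Sum>b\<in>B. of_int (c b) *\<^sub>R b)" "P' = (\<Sum>b\<in>B. of_int (c' b) *\<^sub>R b)"
      unfolding L by blast
    have "P + P' = (\<Sum>b\<in>B. of_int (c b + c' b) *\<^sub>R b)"
      by (simp add: c sum.distrib scaleR_left_distrib)
    then show ?thesis unfolding L by (intro CollectI exI[of _ "\<lambda>b. c b + c' b"]) simp
  qed
  have L_diff: "P - P' \<in> L" if "P \<in> L" "P' \<in> L" for P P'
  proof -
    from that obtain c c' :: "real^2^2 \<Rightarrow> int"
      where c: "P = (\<Sum>b\<in>B. of_int (c b) *\<^sub>R b)" "P' = (\<Sum>b\<in>B. of_int (c' b) *\<^sub>R b)"
      unfolding L by blast
    have "P - P' = (\<Sum>b\<in>B. of_int (c b - c' b) *\<^sub>R b)"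
      by (simp add: c sum_subtractf scaleR_left_diff_distrib)
    then show ?thesis unfolding L by (intro CollectI exI[of _ "\<lambda>b. c b - c' b"]) simp
  qed
  obtain X0 where h: "h = (+) X0 ` L" using assms(2) unfolding disc_group_def by blast
  obtain Y0 where Y0: "Y0 \<in> L" "X = X0 + Y0" using assms(3) h by blast
  have "h \<inter> perp N \<l> = (+) X ` (L \<inter> perp N \<l>)"
  proof (intro set_eqI iffI)
    fix Z assume Z: "Z \<in> h \<inter> perp N \<l>"
    then obtain Y where Y: "Y \<in> L" "Z = X0 + Y" using h by blast
    then have "Z - X = Y - Y0" using Y0 by simp
    then have "Z - X \<in> L \<inter> perp N \<l>"
      using L_diff[OF Y(1) Y0(1)] perp_diff[of Z X] Z assms(3) by auto
    then show "Z \<in> (+) X ` (L \<inter> perp N \<l>)"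
      by (metis add_diff_cancel_left' diff_add_cancel add.commute image_eqI)
  next
    fix Z assume "Z \<in> (+) X ` (L \<inter> perp N \<l>)"
    then obtain Y where Y: "Y \<in> L \<inter> perp N \<l>" "Z = X + Y" by blast
    then have "Z = X0 + (Y0 + Y)" using Y0 by (simp add: add.assoc)
    then show "Z \<in> h \<inter> perp N \<l>"
      using L_add[OF Y0(1), of Y] perp_add[of X Y] Y assms(3) h by auto
  qed
  then show ?thesis unfolding hbar_def by (auto simp: image_image)
qed

definition theta_K :: "nat \<Rightarrow> (real^2^2) set \<Rightarrow> (real^2^2) set \<Rightarrow> complex \<Rightarrow> complex" where
  "theta_K N \<l> h \<tau> =
     (\<Sum>\<^sub>\<infinity>\<kappa>\<in>hbar N \<l> h. exp (2 * complex_of_real pi * \<i> * complex_of_real (Q_quot N \<kappa>) * \<tau>))"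

text \<open>The \<open>h\<close>-component of \<open>\<Theta>\<close>-tilde; \<open>h\<close> contributes only if it meets \<open>L' \<inter> \<l>\<^sup>\<bottom>\<close>.\<close>

definition theta_K_tilde ::
  "nat \<Rightarrow> (real^2^2) set \<Rightarrow> (real^2^2) set \<Rightarrow> complex \<Rightarrow> complex" where
  "theta_K_tilde N \<l> h \<tau> = (if h \<inter> perp N \<l> \<noteq> {} then theta_K N \<l> h \<tau> else 0)"

section \<open>The Siegel theta function and the regularized lift\<close>

definition phi_zero :: "nat \<Rightarrow> real^2^2 \<Rightarrow> complex \<Rightarrow> complex \<Rightarrow> complex" where
  "phi_zero N X \<tau> z =
     complex_of_real (sqrt (Im \<tau>)) *
     exp (complex_of_real pi * \<i> * complex_of_real (bil N X X * Re \<tau>)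
          - complex_of_real (pi * Im \<tau> * (bil N X X + (bil N X (X_pt N z))\<^sup>2)))"

text \<open>The \<open>h\<close>-component of \<open>\<Theta>\<^sub>L(\<tau>, z, \<phi>\<^sub>0)\<close>; the coset \<open>h\<close> is \<open>L + h\<close> itself.\<close>

definition Theta_L :: "nat \<Rightarrow> (real^2^2) set \<Rightarrow> complex \<Rightarrow> complex \<Rightarrow> complex" where
  "Theta_L N h \<tau> z = (\<Sum>\<^sub>\<infinity>X\<in>h. phi_zero N X \<tau> z)"

definition fund_dom :: "complex set" where
  "fund_dom = {z \<in> upper_half. \<bar>Re z\<bar> \<le> 1 / 2 \<and> 1 \<le> cmod z}"

definition fund_dom_trunc :: "nat \<Rightarrow> real \<Rightarrow> complex set" where
  "fund_dom_trunc a T = {z \<in> (\<Union>j<a. moebius_act (trans_mat j) ` fund_dom). Im z \<le> T}"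

definition trunc_integral ::
  "nat \<Rightarrow> (real^2^2) set \<Rightarrow> real^2^2 \<Rightarrow> (complex \<Rightarrow> complex) \<Rightarrow> (real^2^2) set \<Rightarrow>
   complex \<Rightarrow> complex \<Rightarrow> real \<Rightarrow> complex" where
  "trunc_integral N \<Gamma> sg f h \<tau> s T =
     (LINT z : fund_dom_trunc (cusp_width \<Gamma> sg) T | lborel.
        f (moebius_act sg z) * Theta_L N h \<tau> (moebius_act sg z) *
        complex_of_real (Im z) powr (- s) / (complex_of_real (Im z))\<^sup>2)"

text \<open>\<open>F\<close> is the meromorphic continuation of the \<open>h\<close>-component of \<open>s \<mapsto> I\<^sup>r\<^sup>e\<^sup>g(\<tau>, s, f)\<close>, whose
  defining limits exist in some right half plane.\<close>

definition is_reg_continuation ::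
  "nat \<Rightarrow> (real^2^2) set \<Rightarrow> (real^2^2) set set \<Rightarrow> ((real^2^2) set \<Rightarrow> real^2^2) \<Rightarrow>
   (complex \<Rightarrow> complex) \<Rightarrow> (real^2^2) set \<Rightarrow> complex \<Rightarrow> (complex \<Rightarrow> complex) \<Rightarrow> bool" where
  "is_reg_continuation N \<Gamma> R \<sigma> f h \<tau> F \<longleftrightarrow>
     F meromorphic_on UNIV \<and>
     (\<exists>s\<^sub>0::real. \<forall>s. Re s > s\<^sub>0 \<longrightarrow>
        (\<exists>c. (\<forall>\<l>\<in>R. ((\<lambda>T. trunc_integral N \<Gamma> (\<sigma> \<l>) f h \<tau> s T) \<longlongrightarrow> c \<l>) at_top) \<and>
             F s = (\<Sum>\<l>\<in>R. c \<l>)))"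

text \<open>The \<open>h\<close>-component of \<open>I\<^sup>r\<^sup>e\<^sup>g(\<tau>, f)\<close>: the constant term of the Laurent expansion at \<open>s = 0\<close>.\<close>

definition I_reg ::
  "nat \<Rightarrow> (real^2^2) set \<Rightarrow> (real^2^2) set set \<Rightarrow> ((real^2^2) set \<Rightarrow> real^2^2) \<Rightarrow>
   (complex \<Rightarrow> complex) \<Rightarrow> (real^2^2) set \<Rightarrow> complex \<Rightarrow> complex" where
  "I_reg N \<Gamma> R \<sigma> f h \<tau> =
     (THE c. \<exists>F G. is_reg_continuation N \<Gamma> R \<sigma> f h \<tau> F \<and> F has_laurent_expansion G \<and>
                   c = fls_nth G 0)"

section \<open>Weak Maass forms\<close>

definition weak_Maass_form ::
  "nat \<Rightarrow> (real^2^2) set \<Rightarrow> ((real^2^2) set \<Rightarrow> real^2^2) \<Rightarrow> complex \<Rightarrow> (complex \<Rightarrow> complex) \<Rightarrow> bool"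
  where
  "weak_Maass_form N \<Gamma> \<sigma> lam f \<longleftrightarrow>
     smooth_real_on f upper_half \<and>
     (\<forall>g\<in>\<Gamma>. \<forall>z\<in>upper_half. f (moebius_act g z) = f z) \<and>
     (\<forall>z\<in>upper_half. Delta_zero f z = lam * f z) \<and>
     (\<forall>\<l>\<in>Iso N. \<exists>C::real. (\<lambda>z. f (moebius_act (\<sigma> \<l>) z))
        \<in> O[filtercomap Im at_top](\<lambda>z. complex_of_real (exp (C * Im z))))"

text \<open>The constant term at the cusp \<open>\<sigma>\<infinity>\<close>, as a function of \<open>y\<close>.\<close>

definition const_term ::
  "(real^2^2) set \<Rightarrow> real^2^2 \<Rightarrow> (complex \<Rightarrow> complex) \<Rightarrow> real \<Rightarrow> complex" where
  "const_term \<Gamma> s f y =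
     1 / complex_of_real (real (cusp_width \<Gamma> s)) *
     integral {0..real (cusp_width \<Gamma> s)} (\<lambda>x. f (moebius_act s (Complex x y)))"

end

theory Submission
  imports Defs "HOL-Probability.Probability"
begin

text \<open>At a cusp, Poisson summation in the isotropic direction writes the theta kernel as
  \<open>y \<cdot> theta_K\<close> plus a remainder that decays like \<open>exp (- \<delta> y\<^sup>2)\<close>, and every term of the transformed
  series satisfies \<open>4 \<Delta>\<^sub>\<tau> = \<Delta>\<^sub>z\<close>. The remainder contributes an entire function of \<open>s\<close>, and the
  leading part only sees the constant term of \<open>f\<close>, which gives the poles \<open>s'\<close> and \<open>1 - s'\<close>.
  Green's formula then moves \<open>\<Delta>\<^sub>z\<close> onto \<open>f\<close>. The boundary terms on the translates of the
  fundamental domain cancel because \<open>z \<mapsto> z + 1\<close> and \<open>z \<mapsto> - 1 / z\<close> permute the cosets of \<open>\<Gamma>\<close>. At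
  height \<open>T\<close> the leading part contributes \<open>A (1 - s') + B s'\<close> up to a multiple of \<open>\<lambda>\<close>, while the
  remainder contributes the derivative of a function that tends to zero; no bound on the
  derivatives of \<open>f\<close> is needed, since such a derivative can only converge to zero.\<close>

section \<open>Directional derivatives\<close>

text \<open>In the original series the terms along the isotropic line do not decay as y grows. A
  transformed term carries exp(- \<pi> y^2 |k - N c \<tau>|^2 / (N v)), which beats the exponential
  growth of f unless c = k = 0. The surviving terms give y times a unary theta series \<theta>,
  harmonic in z and annihilated by \<Delta>_\<tau>, so all subtlety sits in how this piece is
  truncated.

  Write \<kappa> = 1 / (sqrt N \<beta>) for the Poisson factor; then \<kappa> times the cusp width
  is \<epsilon> / sqrt N. Green's formula leaves d0 = A (1 - s') + B s' at each cusp, while the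
  regularised integral of the leading part contributes c0 = - A / s' + B / (s' - 1) to the constant
  term. As \<lambda> c0 = - d0, the boundary value is exactly what completes \<lambda> I. For s' = 0
  or 1 the eigenvalue is 0 and the offending fraction is a pole at s = 0, which the constant term
  discards; d0, now equal to A or B, is then left over as the inhomogeneous term.

  The obstacle to arguing cusp by cusp is that the lower boundary of the domain at one cusp is glued
  to domains at other cusps. Each cusp therefore has a defect in Green's identity, and only the sum
  of the defects vanishes.\<close>

lemma open_upper: "open upper_half"
  by (auto simp: upper_half_def intro!: open_halfspace_Im_gt)

text \<open>A relation, so that existence of the derivative is part of the claim. Direction 1 gives
  \<open>d_re\<close> and direction \<i> gives \<open>d_im\<close>; other directions occur when a
  holomorphic change of variable rotates the axes.\<close>

definition has_dir :: "complex \<Rightarrow> (complex \<Rightarrow> complex) \<Rightarrow> complex \<Rightarrow> complex \<Rightarrow> bool" where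
  "has_dir e g g' z \<longleftrightarrow> ((\<lambda>t. g (z + e * complex_of_real t)) has_vector_derivative g') (at 0)"

lemma has_dir_d_re: "has_dir 1 g g' z \<Longrightarrow> d_re g z = g'"
  by (simp add: has_dir_def d_re_def vector_derivative_at)

lemma has_dir_d_im: "has_dir \<i> g g' z \<Longrightarrow> d_im g z = g'"
  by (simp add: has_dir_def d_im_def vector_derivative_at)

text \<open>Moving the anchor from 0 to an arbitrary t gives differentiability along a whole
  segment, which the mean value arguments require.\<close>

lemma has_dir_at:
  assumes "has_dir e g g' (z + e * complex_of_real t)"
  shows "((\<lambda>s. g (z + e * complex_of_real s)) has_vector_derivative g') (at t)"
proof -
  have "((\<lambda>s. g (z + e * complex_of_real t + e * complex_of_real s)) has_vector_derivative g') (at (t - t))"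
    using assms by (simp add: has_dir_def)
  moreover have "((\<lambda>s::real. s - t) has_vector_derivative 1) (at t)"
    by (auto intro!: derivative_eq_intros)
  ultimately have "((\<lambda>s. g (z + e * complex_of_real t + e * complex_of_real s)) \<circ> (\<lambda>s. s - t)
      has_vector_derivative 1 *\<^sub>R g') (at t)"
    by (intro vector_diff_chain_at) auto
  then show ?thesis by (simp add: o_def algebra_simps)
qed

lemma has_dir_cong:
  assumes "open S" "z \<in> S" "\<And>w. w \<in> S \<Longrightarrow> g w = h w"
  shows "has_dir e g g' z \<longleftrightarrow> has_dir e h g' z"
proof -
  have "isCont (\<lambda>t. z + e * complex_of_real t) 0" by (intro continuous_intros)
  then have "((\<lambda>t. z + e * complex_of_real t) \<longlongrightarrow> z) (nhds 0)"
    using tendsto_at_iff_tendsto_nhds[of "\<lambda>t. z + e * complex_of_real t" 0] by (simp add: isCont_def)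
  then have "\<forall>\<^sub>F t in nhds 0. z + e * complex_of_real t \<in> S"
    using assms(1,2) topological_tendstoD by blast
  then have "\<forall>\<^sub>F t in nhds (0::real). g (z + e * complex_of_real t) = h (z + e * complex_of_real t)"
    by eventually_elim (use assms(3) in auto)
  then show ?thesis unfolding has_dir_def by (intro has_vector_derivative_cong_ev) (auto simp: assms)
qed

lemma has_dir_const: "has_dir e (\<lambda>_. c) 0 z"
  by (simp add: has_dir_def)

lemma has_dir_add: "has_dir e g g' z \<Longrightarrow> has_dir e h h' z \<Longrightarrow> has_dir e (\<lambda>z. g z + h z) (g' + h') z"
  unfolding has_dir_def by (rule has_vector_derivative_add)

lemma has_dir_diff: "has_dir e g g' z \<Longrightarrow> has_dir e h h' z \<Longrightarrow> has_dir e (\<lambda>z. g z - h z) (g' - h') z"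
  unfolding has_dir_def by (rule has_vector_derivative_diff)

lemma has_dir_mult:
  "has_dir e g g' z \<Longrightarrow> has_dir e h h' z \<Longrightarrow> has_dir e (\<lambda>z. g z * h z) (g z * h' + g' * h z) z"
  unfolding has_dir_def by (drule (1) has_vector_derivative_mult) simp

lemma has_dir_cmult: "has_dir e g g' z \<Longrightarrow> has_dir e (\<lambda>z. c * g z) (c * g') z"
  unfolding has_dir_def by (rule has_vector_derivative_mult_right)

lemma has_dir_sum:
  "(\<And>i. i \<in> I \<Longrightarrow> has_dir e (g i) (g' i) z) \<Longrightarrow> has_dir e (\<lambda>z. \<Sum>i\<in>I. g i z) (\<Sum>i\<in>I. g' i) z"
  unfolding has_dir_def by (rule has_vector_derivative_sum)

lemma has_dir_shift: "has_dir e g g' (z + c) \<Longrightarrow> has_dir e (\<lambda>z. g (z + c)) g' z"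
  unfolding has_dir_def by (simp add: algebra_simps)

lemma has_dir_unique: "has_dir e g g' z \<Longrightarrow> has_dir e g g'' z \<Longrightarrow> g' = g''"
  unfolding has_dir_def by (rule vector_derivative_unique_at)

text \<open>A derivative at a point of an open set only sees nearby values, so agreement on
  \<open>S\<close> descends to \<open>d_re\<close> and \<open>d_im\<close>; this is why the
  induction lets \<open>g\<close> and \<open>h\<close> vary.\<close>

lemma C_k_on_cong:
  assumes "open S" "\<And>z. z \<in> S \<Longrightarrow> g z = h z"
  shows "C_k_on n g S \<longleftrightarrow> C_k_on n h S"
  using assms(2)
proof (induction n arbitrary: g h)
  case 0
  then show ?case by (auto cong: continuous_on_cong)
next
  case (Suc n)
  have *: "has_dir e g g' z \<longleftrightarrow> has_dir e h g' z" if "z \<in> S" for e g' z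
    by (rule has_dir_cong[OF assms(1) that Suc.prems])
  have re: "d_re g z = d_re h z" and im: "d_im g z = d_im h z" if "z \<in> S" for z
    using *[OF that, of 1] *[OF that, of \<i>]
    by (simp_all add: d_re_def d_im_def vector_derivative_def has_dir_def)
  have d: "(\<lambda>t::real. g (z + e * complex_of_real t)) differentiable (at 0) \<longleftrightarrow>
      (\<lambda>t::real. h (z + e * complex_of_real t)) differentiable (at 0)" if "z \<in> S" for e z
    using *[OF that, of e] unfolding has_dir_def
    by (metis differentiableI_vector vector_derivative_works)
  have "continuous_on S g \<longleftrightarrow> continuous_on S h"
    using Suc.prems by (auto cong: continuous_on_cong)
  moreover have "(\<lambda>t::real. g (z + complex_of_real t)) differentiable (at 0) \<longleftrightarrow>
      (\<lambda>t::real. h (z + complex_of_real t)) differentiable (at 0)" if "z \<in> S" for z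
    using d[OF that, of 1] by simp
  moreover note d[of _ \<i>] Suc.IH[OF re] Suc.IH[OF im]
  ultimately show ?case by auto
qed

text \<open>Trades the total functions \<open>d_re g\<close> and \<open>d_im g\<close> of the
  definition for derivatives that are known by a formula on \<open>S\<close>.\<close>

lemma C_k_on_SucI:
  assumes "open S" "continuous_on S g"
    and "\<And>z. z \<in> S \<Longrightarrow> has_dir 1 g (g1 z) z" "\<And>z. z \<in> S \<Longrightarrow> has_dir \<i> g (g2 z) z"
    and "C_k_on n g1 S" "C_k_on n g2 S"
  shows "C_k_on (Suc n) g S"
proof -
  have "C_k_on n (d_re g) S" "C_k_on n (d_im g) S"
    using assms C_k_on_cong[OF assms(1), of "d_re g" g1 n] C_k_on_cong[OF assms(1), of "d_im g" g2 n]
    by (auto simp: has_dir_d_re has_dir_d_im)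
  with assms(2-4) show ?thesis
    by (auto simp: has_dir_def intro: differentiableI_vector)
qed

lemma C_k_on_has_dir:
  assumes "C_k_on (Suc n) g S" "z \<in> S"
  shows "has_dir 1 g (d_re g z) z" "has_dir \<i> g (d_im g z) z"
  using assms by (auto simp: has_dir_def d_re_def d_im_def vector_derivative_works[symmetric])

section \<open>Total differentiability from continuous partial derivatives, and the chain
  rule\<close>

lemma onorm_scaleR_bound:
  fixes v :: "'a::real_normed_vector"
  assumes "norm v \<le> B"
  shows "onorm (\<lambda>h::real. h *\<^sub>R v) \<le> B"
proof (rule onorm_le)
  fix h :: real
  show "norm (h *\<^sub>R v) \<le> B * norm h"
    using mult_left_mono[OF assms, of "\<bar>h\<bar>"] by (simp add: mult.commute)
qed

text \<open>The classical argument along a path with one horizontal and one vertical leg: on each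
  leg the mean value inequality is applied to g minus its linear approximation, and continuity of
  the partial derivatives keeps their variation below \<epsilon>.\<close>

lemma partials_has_derivative:
  fixes g :: "complex \<Rightarrow> complex"
  assumes "open S" "z \<in> S"
    and d1: "\<And>w. w \<in> S \<Longrightarrow> has_dir 1 g (g1 w) w" and d2: "\<And>w. w \<in> S \<Longrightarrow> has_dir \<i> g (g2 w) w"
    and c: "continuous_on S g1" "continuous_on S g2"
  shows "(g has_derivative (\<lambda>h. of_real (Re h) * g1 z + of_real (Im h) * g2 z)) (at z)"
  unfolding has_derivative_at_alt
proof (intro conjI allI impI)
  show "bounded_linear (\<lambda>h. of_real (Re h) * g1 z + of_real (Im h) * g2 z)"
    by (intro bounded_linear_add bounded_linear_mult_const bounded_linear_of_real[THEN bounded_linear_compose]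
        bounded_linear_Re bounded_linear_Im)
  fix e :: real assume "e > 0"
  \<comment> \<open>Two legs, each no longer than |y - z|, cost \<epsilon> apiece.\<close>
  define \<epsilon> where "\<epsilon> = e / 2"
  have "\<epsilon> > 0" using \<open>e > 0\<close> by (simp add: \<epsilon>_def)
  have "isCont g1 z" "isCont g2 z" using c assms(1,2) by (auto simp: continuous_on_eq_continuous_at)
  then obtain r1 r2 where r: "r1 > 0" "r2 > 0"
    "\<And>w. dist w z < r1 \<Longrightarrow> dist (g1 w) (g1 z) < \<epsilon>" "\<And>w. dist w z < r2 \<Longrightarrow> dist (g2 w) (g2 z) < \<epsilon>"
    using \<open>\<epsilon> > 0\<close> unfolding continuous_at_eps_delta by metis
  obtain r3 where r3: "r3 > 0" "ball z r3 \<subseteq> S" using assms(1,2) openE by blast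
  define r where "r = min r1 (min r2 r3)"
  have r0: "r > 0" using r r3 by (simp add: r_def)
  have rS: "w \<in> S" "norm (g1 w - g1 z) \<le> \<epsilon>" "norm (g2 w - g2 z) \<le> \<epsilon>" if "norm (w - z) < r" for w
  proof -
    have d: "dist w z < r" using that by (simp add: dist_norm)
    show "w \<in> S" using d r3(2) by (auto simp: r_def dist_commute)
    show "norm (g1 w - g1 z) \<le> \<epsilon>" "norm (g2 w - g2 z) \<le> \<epsilon>"
      using r(3)[of w] r(4)[of w] d by (simp_all add: r_def dist_norm less_imp_le)
  qed
  show "\<exists>d>0. \<forall>y. norm (y - z) < d \<longrightarrow>
     norm (g y - g z - (of_real (Re (y - z)) * g1 z + of_real (Im (y - z)) * g2 z)) \<le> e * norm (y - z)"
  proof (intro exI[of _ r] conjI allI impI r0)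
    fix y assume y: "norm (y - z) < r"
    define a b m where "a = Re (y - z)" and "b = Im (y - z)" and "m = z + complex_of_real a"
    have ab: "\<bar>a\<bar> \<le> norm (y - z)" "\<bar>b\<bar> \<le> norm (y - z)"
      unfolding a_def b_def by (rule abs_Re_le_cmod abs_Im_le_cmod)+
    have yz: "y = m + \<i> * complex_of_real b" by (simp add: m_def a_def b_def complex_eq_iff)
    have lin: "norm (k 1 - k 0 - c * of_real l) \<le> \<bar>l\<bar> * \<epsilon>"
      if k: "\<And>t. t \<in> {0..1} \<Longrightarrow> (k has_vector_derivative of_real l * k' t) (at t)"
        "\<And>t. t \<in> {0..1} \<Longrightarrow> norm (k' t - c) \<le> \<epsilon>" for k k' :: "real \<Rightarrow> complex" and c l
    proof -
      have "norm ((k 1 - c * of_real (l * 1)) - (k 0 - c * of_real (l * 0))) \<le> (\<bar>l\<bar> * \<epsilon>) * norm (1 - 0 :: real)"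
      proof (rule differentiable_bound[where S="{0..1}"])
        fix t :: real assume t: "t \<in> {0..1}"
        show "((\<lambda>t. k t - c * of_real (l * t)) has_derivative (\<lambda>h. h *\<^sub>R (of_real l * k' t - c * of_real l))) (at t within {0..1})"
          unfolding has_vector_derivative_def[symmetric]
          by (rule has_vector_derivative_at_within)
            (auto intro!: derivative_eq_intros has_vector_derivative_real_field k(1) t simp: scaleR_conv_of_real)
        have "norm (of_real l * k' t - c * of_real l) = \<bar>l\<bar> * norm (k' t - c)"
          by (metis (no_types, lifting) mult.commute norm_mult norm_of_real right_diff_distrib')
        also have "\<dots> \<le> \<bar>l\<bar> * \<epsilon>" by (intro mult_left_mono k(2) t) auto
        finally show "onorm (\<lambda>h. h *\<^sub>R (of_real l * k' t - c * of_real l)) \<le> \<bar>l\<bar> * \<epsilon>"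
          by (rule onorm_scaleR_bound)
      qed auto
      then show ?thesis by (simp add: algebra_simps)
    qed
    have in1: "norm (z + complex_of_real (a * t) - z) < r" if "t \<in> {0..1}" for t
    proof -
      have "\<bar>a * t\<bar> \<le> \<bar>a\<bar>" using that by (simp add: abs_mult mult_left_le)
      then show ?thesis using ab(1) y by (simp del: of_real_mult)
    qed
    have in2: "norm (m + \<i> * complex_of_real (b * t) - z) < r" if "t \<in> {0..1}" for t
    proof -
      have "\<bar>b * t\<bar> \<le> \<bar>b\<bar>" using that by (simp add: abs_mult mult_left_le)
      then have "norm (Complex a (b * t)) \<le> norm (Complex a b)"
        using abs_le_square_iff[of "b * t" b] by (simp add: complex_norm)
      moreover have "Complex a b = y - z" by (simp add: a_def b_def complex_eq_iff)
      moreover have "Complex a (b * t) = m + \<i> * complex_of_real (b * t) - z" by (simp add: m_def complex_eq_iff)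
      ultimately show ?thesis using y by simp
    qed
    have chain: "((\<lambda>t. g (w + e * complex_of_real (l * t))) has_vector_derivative of_real l * d) (at t)"
      if "has_dir e g d (w + e * complex_of_real (l * t))" for e w l d and t :: real
    proof -
      have "((\<lambda>s. g (w + e * complex_of_real s)) \<circ> (\<lambda>t. l * t) has_vector_derivative l *\<^sub>R d) (at t)"
        by (rule vector_diff_chain_at) (auto intro!: derivative_eq_intros has_dir_at that)
      then show ?thesis by (simp add: o_def scaleR_conv_of_real)
    qed
    have c1: "((\<lambda>t. g (z + 1 * complex_of_real (a * t))) has_vector_derivative of_real a * g1 (z + 1 * complex_of_real (a * t))) (at t)"
      if "t \<in> {0..1}" for t
      using in1[OF that] by (intro chain d1 rS(1)) simp
    have c2: "((\<lambda>t. g (m + \<i> * complex_of_real (b * t))) has_vector_derivative of_real b * g2 (m + \<i> * complex_of_real (b * t))) (at t)"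
      if "t \<in> {0..1}" for t
      using in2[OF that] by (intro chain d2 rS(1)) simp
    have "norm (g (z + 1 * complex_of_real (a * 1)) - g (z + 1 * complex_of_real (a * 0)) - g1 z * of_real a) \<le> \<bar>a\<bar> * \<epsilon>"
      by (rule lin[where k="\<lambda>t. g (z + 1 * complex_of_real (a * t))" and k'="\<lambda>t. g1 (z + 1 * complex_of_real (a * t))"])
        (rule c1 rS(2), use in1 in simp)+
    moreover have "norm (g (m + \<i> * complex_of_real (b * 1)) - g (m + \<i> * complex_of_real (b * 0)) - g2 z * of_real b) \<le> \<bar>b\<bar> * \<epsilon>"
      by (rule lin[where k="\<lambda>t. g (m + \<i> * complex_of_real (b * t))" and k'="\<lambda>t. g2 (m + \<i> * complex_of_real (b * t))"])
        (rule c2 rS(3), use in2 in simp)+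
    ultimately have "norm (g m - g z - g1 z * of_real a) + norm (g y - g m - g2 z * of_real b) \<le> (\<bar>a\<bar> + \<bar>b\<bar>) * \<epsilon>"
      by (simp add: yz m_def algebra_simps)
    moreover have "norm (g y - g z - (of_real a * g1 z + of_real b * g2 z)) \<le> norm (g m - g z - g1 z * of_real a) + norm (g y - g m - g2 z * of_real b)"
      by (rule order_trans[OF _ norm_triangle_ineq]) (simp add: algebra_simps)
    moreover have "(\<bar>a\<bar> + \<bar>b\<bar>) * \<epsilon> \<le> e * norm (y - z)"
      using mult_right_mono[of "\<bar>a\<bar> + \<bar>b\<bar>" "2 * norm (y - z)" \<epsilon>] ab \<open>\<epsilon> > 0\<close> by (simp add: \<epsilon>_def)
    ultimately show "norm (g y - g z - (of_real (Re (y - z)) * g1 z + of_real (Im (y - z)) * g2 z)) \<le> e * norm (y - z)"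
      unfolding a_def b_def by linarith
  qed
qed

text \<open>The holomorphic map carries direction e to \<gamma>' e, which in general is not an axis,
  so the total derivative assembled from the two partials is what gets evaluated.\<close>

lemma has_dir_compose:
  assumes "open S" "\<gamma> z \<in> S"
    and "\<And>w. w \<in> S \<Longrightarrow> has_dir 1 g (g1 w) w" "\<And>w. w \<in> S \<Longrightarrow> has_dir \<i> g (g2 w) w"
    and "continuous_on S g1" "continuous_on S g2"
    and "(\<gamma> has_field_derivative \<gamma>') (at z)"
  shows "has_dir e (\<lambda>z. g (\<gamma> z)) (of_real (Re (\<gamma>' * e)) * g1 (\<gamma> z) + of_real (Im (\<gamma>' * e)) * g2 (\<gamma> z)) z"
proof -
  have "((\<lambda>t. z + e * complex_of_real t) has_vector_derivative e) (at 0)"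
    by (auto intro!: derivative_eq_intros has_vector_derivative_real_field)
  then have "((\<gamma> \<circ> (\<lambda>t. z + e * complex_of_real t)) has_vector_derivative e * \<gamma>') (at 0)"
    by (rule field_vector_diff_chain_at) (simp add: assms)
  then have "((\<lambda>t. \<gamma> (z + e * complex_of_real t)) has_vector_derivative \<gamma>' * e) (at 0)"
    by (simp add: o_def mult.commute)
  moreover have "(g has_derivative (\<lambda>h. of_real (Re h) * g1 (\<gamma> z) + of_real (Im h) * g2 (\<gamma> z)))
      (at (\<gamma> (z + e * complex_of_real 0)) within range (\<lambda>t. \<gamma> (z + e * complex_of_real t)))"
    using partials_has_derivative[OF assms(1-6)] by (auto intro: has_derivative_at_withinI)
  ultimately show ?thesis
    unfolding has_dir_def by (auto dest: vector_derivative_diff_chain_within simp only: o_def)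
qed

section \<open>Dominated families\<close>

text \<open>The hypotheses of dominated convergence for a family with a complex parameter, with a
  majorant that is only locally uniform. Over \<open>count_space\<close> it governs the theta
  series, over \<open>lborel\<close> the integrals over the fundamental domain and the Mellin
  transforms in s, so one set of lemmas differentiates them all.\<close>

definition dominated :: "'p measure \<Rightarrow> complex set \<Rightarrow> (complex \<Rightarrow> 'p \<Rightarrow> complex) \<Rightarrow> bool" where
  "dominated M S \<phi> \<longleftrightarrow>
     (\<forall>\<tau>\<in>S. \<phi> \<tau> \<in> borel_measurable M) \<and>
     (\<forall>p\<in>space M. continuous_on S (\<lambda>\<tau>. \<phi> \<tau> p)) \<and>
     (\<forall>\<tau>0\<in>S. \<exists>\<epsilon>>0. \<exists>g. integrable M g \<and> (\<forall>\<tau>\<in>ball \<tau>0 \<epsilon> \<inter> S. \<forall>p\<in>space M. norm (\<phi> \<tau> p) \<le> g p))"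

lemma dominated_integrable:
  assumes "dominated M S \<phi>" "\<tau> \<in> S"
  shows "integrable M (\<phi> \<tau>)"
proof -
  obtain \<epsilon> g where *: "\<epsilon> > 0" "integrable M g"
      "\<forall>\<tau>'\<in>ball \<tau> \<epsilon> \<inter> S. \<forall>p\<in>space M. norm (\<phi> \<tau>' p) \<le> g p"
    using assms unfolding dominated_def by meson
  have "norm (\<phi> \<tau> p) \<le> norm (g p)" if "p \<in> space M" for p
    using *(3) *(1) assms(2) that by force
  then show ?thesis
    by (intro Bochner_Integration.integrable_bound[OF *(2)]) (use assms in \<open>auto simp: dominated_def\<close>)
qed

text \<open>Continuity is tested on sequences because the convergence theorem is sequential; the
  finitely many members outside the ball of the majorant are dropped by an index shift.\<close>

lemma dominated_continuous:
  assumes "dominated M S \<phi>"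
  shows "continuous_on S (\<lambda>\<tau>. integral\<^sup>L M (\<phi> \<tau>))"
  unfolding continuous_on_sequentially o_def
proof (intro ballI allI impI, elim conjE)
  fix X \<tau> assume \<tau>: "\<tau> \<in> S" and X: "\<forall>n::nat. X n \<in> S" and lim: "X \<longlonglongrightarrow> \<tau>"
  obtain \<epsilon> g where *: "\<epsilon> > 0" "integrable M g"
      "\<forall>\<tau>'\<in>ball \<tau> \<epsilon> \<inter> S. \<forall>p\<in>space M. norm (\<phi> \<tau>' p) \<le> g p"
    using assms \<tau> unfolding dominated_def by meson
  obtain k where k: "\<And>n. n \<ge> k \<Longrightarrow> dist (X n) \<tau> < \<epsilon>"
    using lim *(1) unfolding lim_sequentially by blast
  have "(\<lambda>n. integral\<^sup>L M (\<phi> (X (n + k)))) \<longlonglongrightarrow> integral\<^sup>L M (\<phi> \<tau>)"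
  proof (rule integral_dominated_convergence[where w=g])
    show "AE p in M. (\<lambda>n. \<phi> (X (n + k)) p) \<longlonglongrightarrow> \<phi> \<tau> p"
    proof (rule AE_I2)
      fix p assume "p \<in> space M"
      then have "continuous_on S (\<lambda>\<tau>. \<phi> \<tau> p)" using assms by (auto simp: dominated_def)
      then have "(\<lambda>n. \<phi> (X n) p) \<longlonglongrightarrow> \<phi> \<tau> p"
        using X \<tau> lim unfolding continuous_on_sequentially o_def by blast
      then show "(\<lambda>n. \<phi> (X (n + k)) p) \<longlonglongrightarrow> \<phi> \<tau> p" by (rule LIMSEQ_ignore_initial_segment)
    qed
    show "AE p in M. norm (\<phi> (X (n + k)) p) \<le> g p" for n
      using *(3) k[of "n + k"] X by (intro AE_I2) (auto simp: dist_commute)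
  qed (use assms \<tau> X * in \<open>auto simp: dominated_def\<close>)
  then show "(\<lambda>n. integral\<^sup>L M (\<phi> (X n))) \<longlonglongrightarrow> integral\<^sup>L M (\<phi> \<tau>)"
    by (rule LIMSEQ_offset)
qed

text \<open>The common core of real and complex differentiation under the integral. Here X n is the
  increment, and the bound g |X n|, which comes from a mean value inequality, dominates the
  quotients.\<close>

lemma integral_difference_quotient_tendsto:
  fixes X :: "nat \<Rightarrow> complex"
  assumes "integrable M g" "\<And>n. integrable M (\<psi> n)" "integrable M \<psi>0"
    and "\<psi>' \<in> borel_measurable M" and "\<And>n. X n \<noteq> 0"
    and "\<And>n p. p \<in> space M \<Longrightarrow> norm (\<psi> n p - \<psi>0 p) \<le> g p * norm (X n)"
    and "\<And>p. p \<in> space M \<Longrightarrow> (\<lambda>n. (\<psi> n p - \<psi>0 p) / X n) \<longlonglongrightarrow> \<psi>' p"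
  shows "(\<lambda>n. (integral\<^sup>L M (\<psi> n) - integral\<^sup>L M \<psi>0) / X n) \<longlonglongrightarrow> integral\<^sup>L M \<psi>'"
proof -
  have "(\<lambda>n. integral\<^sup>L M (\<lambda>p. (\<psi> n p - \<psi>0 p) / X n)) \<longlonglongrightarrow> integral\<^sup>L M \<psi>'"
    by (rule integral_dominated_convergence[where w=g])
      (use assms in \<open>auto simp: norm_divide divide_le_eq\<close>)
  moreover have "integral\<^sup>L M (\<lambda>p. (\<psi> n p - \<psi>0 p) / X n) = (integral\<^sup>L M (\<psi> n) - integral\<^sup>L M \<psi>0) / X n" for n
    using Bochner_Integration.integral_diff[OF assms(2)[of n] assms(3)] by (simp add: integral_divide_zero)
  ultimately show ?thesis by (simp only:)
qed

lemma has_vector_derivative_at_0_iff_quotient: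
  fixes f :: "real \<Rightarrow> complex"
  shows "(f has_vector_derivative D) (at 0) \<longleftrightarrow> ((\<lambda>t. (f t - f 0) / complex_of_real t) \<longlongrightarrow> D) (at 0)"
proof -
  have eq: "norm (f h - f 0 - h *\<^sub>R D) / norm h = norm ((f h - f 0) / complex_of_real h - D)" if "h \<noteq> 0" for h
  proof -
    have "(f h - f 0) / complex_of_real h - D = (f h - f 0 - h *\<^sub>R D) / complex_of_real h"
      using that by (simp add: scaleR_conv_of_real divide_simps mult.commute)
    then show ?thesis by (simp add: norm_divide)
  qed
  have "(f has_vector_derivative D) (at 0) \<longleftrightarrow> ((\<lambda>h. norm (f h - f 0 - h *\<^sub>R D) / norm h) \<longlongrightarrow> 0) (at 0)"
    by (simp add: has_vector_derivative_def has_derivative_at bounded_linear_scaleR_left)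
  also have "\<dots> \<longleftrightarrow> ((\<lambda>h. norm ((f h - f 0) / complex_of_real h - D)) \<longlongrightarrow> 0) (at 0)"
    using eq by (intro Lim_cong_within) auto
  also have "\<dots> \<longleftrightarrow> ((\<lambda>t. (f t - f 0) / complex_of_real t) \<longlongrightarrow> D) (at 0)"
    by (simp add: tendsto_norm_zero_iff LIM_zero_iff)
  finally show ?thesis .
qed

lemma dominated_has_dir:
  assumes "open S" "dominated M S \<phi>" "dominated M S \<phi>'" "\<tau> \<in> S"
    and der: "\<And>\<tau> p. \<tau> \<in> S \<Longrightarrow> p \<in> space M \<Longrightarrow> has_dir e (\<lambda>\<tau>. \<phi> \<tau> p) (\<phi>' \<tau> p) \<tau>"
  shows "has_dir e (\<lambda>\<tau>. integral\<^sup>L M (\<phi> \<tau>)) (integral\<^sup>L M (\<phi>' \<tau>)) \<tau>"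
proof -
  obtain \<epsilon>1 g where *: "\<epsilon>1 > 0" "integrable M g"
      "\<forall>\<tau>'\<in>ball \<tau> \<epsilon>1 \<inter> S. \<forall>p\<in>space M. norm (\<phi>' \<tau>' p) \<le> g p"
    using assms unfolding dominated_def by meson
  obtain \<epsilon>2 where \<epsilon>2: "\<epsilon>2 > 0" "ball \<tau> \<epsilon>2 \<subseteq> S" using assms openE by blast
  \<comment> \<open>The added 1 keeps the denominator positive when e = 0.\<close>
  define \<epsilon> where "\<epsilon> = min \<epsilon>1 \<epsilon>2 / (norm e + 1)"
  have \<epsilon>: "\<epsilon> > 0" using * \<epsilon>2 by (auto simp: \<epsilon>_def add_nonneg_pos)
  have ball: "\<tau> + e * complex_of_real t \<in> ball \<tau> \<epsilon>1 \<inter> S" if "\<bar>t\<bar> < \<epsilon>" for t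
  proof -
    have "\<bar>t\<bar> * (norm e + 1) < min \<epsilon>1 \<epsilon>2"
      using that unfolding \<epsilon>_def by (simp add: pos_less_divide_eq add_nonneg_pos)
    then have "norm (e * complex_of_real t) < min \<epsilon>1 \<epsilon>2"
      by (simp add: norm_mult algebra_simps) (smt (verit) abs_ge_zero)
    then show ?thesis using \<epsilon>2(2) by (auto simp: dist_norm subset_iff)
  qed
  have lim: "((\<lambda>t. (integral\<^sup>L M (\<phi> (\<tau> + e * complex_of_real t)) - integral\<^sup>L M (\<phi> \<tau>)) / complex_of_real t)
      \<longlongrightarrow> integral\<^sup>L M (\<phi>' \<tau>)) (at 0)"
    unfolding tendsto_at_iff_sequentially
  proof (intro allI impI)
    fix X :: "nat \<Rightarrow> real" assume X: "\<forall>i. X i \<in> UNIV - {0}" "X \<longlonglongrightarrow> 0"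
    obtain k where k: "\<And>n. n \<ge> k \<Longrightarrow> \<bar>X n\<bar> < \<epsilon>"
      using X(2) \<epsilon> unfolding lim_sequentially by (auto simp: dist_norm)
    have b: "\<tau> + e * complex_of_real (X (n + k)) \<in> S" for n
      using ball[OF k[of "n + k"]] by auto
    have "(\<lambda>n. (integral\<^sup>L M (\<phi> (\<tau> + e * complex_of_real (X (n + k)))) - integral\<^sup>L M (\<phi> \<tau>)) / complex_of_real (X (n + k))) \<longlonglongrightarrow> integral\<^sup>L M (\<phi>' \<tau>)"
    proof (rule integral_difference_quotient_tendsto[OF *(2)])
      fix n p assume p: "p \<in> space M"
      have "norm (\<phi> (\<tau> + e * complex_of_real (X (n + k))) p - \<phi> (\<tau> + e * complex_of_real 0) p) \<le> g p * norm (X (n + k) - 0)"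
      proof (rule differentiable_bound[where S="ball 0 \<epsilon>" and f="\<lambda>t. \<phi> (\<tau> + e * complex_of_real t) p"])
        fix t :: real assume "t \<in> ball 0 \<epsilon>"
        then have t: "\<bar>t\<bar> < \<epsilon>" by (simp add: dist_norm)
        show "((\<lambda>t. \<phi> (\<tau> + e * complex_of_real t) p) has_derivative (\<lambda>h. h *\<^sub>R \<phi>' (\<tau> + e * complex_of_real t) p)) (at t within ball 0 \<epsilon>)"
          unfolding has_vector_derivative_def[symmetric]
          by (rule has_vector_derivative_at_within, rule has_dir_at[where g="\<lambda>\<tau>. \<phi> \<tau> p"], rule der)
            (use ball[OF t] p in auto)
        have "norm (\<phi>' (\<tau> + e * complex_of_real t) p) \<le> g p" using ball[OF t] *(3) p by blast
        then show "onorm (\<lambda>h. h *\<^sub>R \<phi>' (\<tau> + e * complex_of_real t) p) \<le> g p"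
          by (rule onorm_scaleR_bound)
      qed (use k[of "n + k"] \<epsilon> in \<open>auto simp: dist_norm\<close>)
      then show "norm (\<phi> (\<tau> + e * complex_of_real (X (n + k))) p - \<phi> \<tau> p) \<le> g p * norm (complex_of_real (X (n + k)))"
        by simp
    next
      fix p assume "p \<in> space M"
      then have "((\<lambda>t. \<phi> (\<tau> + e * complex_of_real t) p) has_vector_derivative \<phi>' \<tau> p) (at 0)"
        using der assms(4) by (simp add: has_dir_def)
      then have "((\<lambda>y. (\<phi> (\<tau> + e * complex_of_real y) p - \<phi> \<tau> p) / complex_of_real y) \<longlongrightarrow> \<phi>' \<tau> p) (at 0)"
        by (simp add: has_vector_derivative_at_0_iff_quotient)
      then have "(\<lambda>n. (\<phi> (\<tau> + e * complex_of_real (X n)) p - \<phi> \<tau> p) / complex_of_real (X n)) \<longlonglongrightarrow> \<phi>' \<tau> p"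
        using X unfolding tendsto_at_iff_sequentially o_def by blast
      then show "(\<lambda>n. (\<phi> (\<tau> + e * complex_of_real (X (n + k))) p - \<phi> \<tau> p) / complex_of_real (X (n + k))) \<longlonglongrightarrow> \<phi>' \<tau> p"
        by (rule LIMSEQ_ignore_initial_segment)
    qed (use X b assms in \<open>auto intro: dominated_integrable simp: dominated_def\<close>)
    then show "((\<lambda>t. (integral\<^sup>L M (\<phi> (\<tau> + e * complex_of_real t)) - integral\<^sup>L M (\<phi> \<tau>)) / complex_of_real t) \<circ> X) \<longlonglongrightarrow> integral\<^sup>L M (\<phi>' \<tau>)"
      unfolding o_def by (rule LIMSEQ_offset)
  qed
  show ?thesis
    using lim by (simp add: has_dir_def has_vector_derivative_at_0_iff_quotient)
qed

text \<open>Serves the dependence on s. The argument is that for directional derivatives, with the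
  complex mean value inequality on a ball in place of the one along a segment.\<close>

lemma dominated_holomorphic:
  assumes "open S" "dominated M S \<phi>" "dominated M S \<phi>'"
    and der: "\<And>\<tau> p. \<tau> \<in> S \<Longrightarrow> p \<in> space M \<Longrightarrow> ((\<lambda>\<tau>. \<phi> \<tau> p) has_field_derivative \<phi>' \<tau> p) (at \<tau>)"
  shows "(\<lambda>\<tau>. integral\<^sup>L M (\<phi> \<tau>)) holomorphic_on S"
  unfolding holomorphic_on_open[OF assms(1)]
proof
  fix \<tau> assume \<tau>: "\<tau> \<in> S"
  obtain \<epsilon>1 g where *: "\<epsilon>1 > 0" "integrable M g"
      "\<forall>\<tau>'\<in>ball \<tau> \<epsilon>1 \<inter> S. \<forall>p\<in>space M. norm (\<phi>' \<tau>' p) \<le> g p"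
    using assms \<tau> unfolding dominated_def by meson
  obtain \<epsilon>2 where \<epsilon>2: "\<epsilon>2 > 0" "ball \<tau> \<epsilon>2 \<subseteq> S" using assms \<tau> openE by blast
  define \<epsilon> where "\<epsilon> = min \<epsilon>1 \<epsilon>2"
  have \<epsilon>: "\<epsilon> > 0" using * \<epsilon>2 by (auto simp: \<epsilon>_def)
  have ball: "ball \<tau> \<epsilon> \<subseteq> ball \<tau> \<epsilon>1 \<inter> S" using \<epsilon>2 by (auto simp: \<epsilon>_def subset_iff)
  have "((\<lambda>w. (integral\<^sup>L M (\<phi> w) - integral\<^sup>L M (\<phi> \<tau>)) / (w - \<tau>)) \<longlongrightarrow> integral\<^sup>L M (\<phi>' \<tau>)) (at \<tau>)"
    unfolding tendsto_at_iff_sequentially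
  proof (intro allI impI)
    fix X :: "nat \<Rightarrow> complex" assume X: "\<forall>i. X i \<in> UNIV - {\<tau>}" "X \<longlonglongrightarrow> \<tau>"
    obtain k where k: "\<And>n. n \<ge> k \<Longrightarrow> dist (X n) \<tau> < \<epsilon>"
      using X(2) \<epsilon> unfolding lim_sequentially by blast
    have kb: "X (n + k) \<in> ball \<tau> \<epsilon>" for n using k[of "n + k"] by (simp add: dist_commute)
    have b: "X (n + k) \<in> S" for n using subsetD[OF ball kb] by (rule IntD2)
    have "(\<lambda>n. (integral\<^sup>L M (\<phi> (X (n + k))) - integral\<^sup>L M (\<phi> \<tau>)) / (X (n + k) - \<tau>)) \<longlonglongrightarrow> integral\<^sup>L M (\<phi>' \<tau>)"
    proof (rule integral_difference_quotient_tendsto[OF *(2), where \<psi>="\<lambda>n. \<phi> (X (n + k))" and ?\<psi>0.0="\<phi> \<tau>"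
          and \<psi>'="\<phi>' \<tau>" and X="\<lambda>n. X (n + k) - \<tau>"])
      fix n p assume p: "p \<in> space M"
      show "norm (\<phi> (X (n + k)) p - \<phi> \<tau> p) \<le> g p * norm (X (n + k) - \<tau>)"
      proof (rule field_differentiable_bound[where S="ball \<tau> \<epsilon>" and f'="\<lambda>w. \<phi>' w p" and f="\<lambda>w. \<phi> w p"])
        fix w assume "w \<in> ball \<tau> \<epsilon>"
        then have w: "w \<in> ball \<tau> \<epsilon>1 \<inter> S" by (rule subsetD[OF ball])
        show "((\<lambda>w. \<phi> w p) has_field_derivative \<phi>' w p) (at w within ball \<tau> \<epsilon>)"
          by (rule has_field_derivative_at_within, rule der) (use w p in auto)
        show "norm (\<phi>' w p) \<le> g p" using *(3) w p by blast
      qed (use kb \<epsilon> in auto)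
    next
      fix p assume "p \<in> space M"
      then have "((\<lambda>w. (\<phi> w p - \<phi> \<tau> p) / (w - \<tau>)) \<longlongrightarrow> \<phi>' \<tau> p) (at \<tau>)"
        using der \<tau> by (simp add: has_field_derivative_iff)
      then have "(\<lambda>n. (\<phi> (X n) p - \<phi> \<tau> p) / (X n - \<tau>)) \<longlonglongrightarrow> \<phi>' \<tau> p"
        using X unfolding tendsto_at_iff_sequentially o_def by blast
      then show "(\<lambda>n. (\<phi> (X (n + k)) p - \<phi> \<tau> p) / (X (n + k) - \<tau>)) \<longlonglongrightarrow> \<phi>' \<tau> p"
        by (rule LIMSEQ_ignore_initial_segment)
    qed (use X b \<tau> assms in \<open>auto intro: dominated_integrable simp: dominated_def\<close>)
    then show "((\<lambda>w. (integral\<^sup>L M (\<phi> w) - integral\<^sup>L M (\<phi> \<tau>)) / (w - \<tau>)) \<circ> X) \<longlonglongrightarrow> integral\<^sup>L M (\<phi>' \<tau>)"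
      unfolding o_def by (rule LIMSEQ_offset)
  qed
  then show "\<exists>f'. ((\<lambda>\<tau>. integral\<^sup>L M (\<phi> \<tau>)) has_field_derivative f') (at \<tau>)"
    unfolding has_field_derivative_iff by blast
qed

section \<open>Poisson summation for Gaussians\<close>

text \<open>Integration theorems for series are stated for sums over the natural numbers; absolute
  convergence allows any enumeration of the integers.\<close>

lemma infsum_int_decode:
  fixes f :: "int \<Rightarrow> 'a::banach"
  assumes "(\<lambda>n. norm (f n)) summable_on UNIV"
  shows "summable (\<lambda>i. norm (f (int_decode i)))" "(\<Sum>i. f (int_decode i)) = (\<Sum>\<^sub>\<infinity>n. f n)"
    "(\<lambda>i. f (int_decode i)) sums (\<Sum>\<^sub>\<infinity>n. f n)"
proof -
  have "(\<lambda>i. norm (f (int_decode i))) summable_on UNIV"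
    using assms summable_on_reindex_bij_betw[OF bij_int_decode, of "\<lambda>n. norm (f n)"] by simp
  then show s: "summable (\<lambda>i. norm (f (int_decode i)))"
    by (simp add: summable_on_UNIV_nonneg_real_iff)
  have "((\<lambda>i. f (int_decode i)) has_sum (\<Sum>i. f (int_decode i))) UNIV"
    by (rule norm_summable_imp_has_sum[OF s]) (simp add: s summable_norm_cancel summable_sums)
  then have "((\<lambda>n. f n) has_sum (\<Sum>i. f (int_decode i))) UNIV"
    using has_sum_reindex_bij_betw[OF bij_int_decode, of f] by simp
  then show "(\<Sum>i. f (int_decode i)) = (\<Sum>\<^sub>\<infinity>n. f n)"
    using infsumI by force
  with s show "(\<lambda>i. f (int_decode i)) sums (\<Sum>\<^sub>\<infinity>n. f n)"
    by (metis summable_norm_cancel summable_sums)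
qed

lemma integrable_count_space_iff_summable:
  fixes f :: "'a \<Rightarrow> 'b::{banach, second_countable_topology}"
  shows "integrable (count_space A) f \<longleftrightarrow> (\<lambda>x. norm (f x)) summable_on A"
  by (metis Infinite_Set_Sum.abs_summable_on_def abs_summable_equivalent)

lemma integrable_count_space_nonneg:
  fixes f :: "'a \<Rightarrow> real"
  assumes "f summable_on A" "\<And>x. f x \<ge> 0"
  shows "integrable (count_space A) f"
  using assms by (simp add: integrable_count_space_iff_summable)

lemma integral_count_space_eq_infsum:
  fixes f :: "'a \<Rightarrow> complex"
  assumes "(\<lambda>x. norm (f x)) summable_on A"
  shows "integral\<^sup>L (count_space A) f = infsum f A"
  using infsetsum_infsum[of f A] assms by (simp add: infsetsum_def abs_summable_equivalent)

lemma integral_infsum_int: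
  fixes f :: "int \<Rightarrow> 'p \<Rightarrow> complex"
  assumes "\<And>n. integrable M (f n)"
    and "\<And>x. (\<lambda>n. norm (f n x)) summable_on UNIV"
    and "(\<lambda>n. \<integral>x. norm (f n x) \<partial>M) summable_on UNIV"
  shows "(\<integral>x. (\<Sum>\<^sub>\<infinity>n. f n x) \<partial>M) = (\<Sum>\<^sub>\<infinity>n. \<integral>x. f n x \<partial>M)"
proof -
  have s: "(\<lambda>n. norm (\<integral>x. f n x \<partial>M)) summable_on UNIV"
    by (rule summable_on_comparison_test[OF assms(3)]) (auto intro: integral_norm_bound)
  have "(\<lambda>i. \<integral>x. f (int_decode i) x \<partial>M) sums (\<integral>x. (\<Sum>i. f (int_decode i) x) \<partial>M)"
  proof (rule sums_integral)
    show "AE x in M. summable (\<lambda>i. norm (f (int_decode i) x))"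
      by (rule AE_I2, rule infsum_int_decode(1)[OF assms(2)])
    have "(\<lambda>n. norm (\<integral>x. norm (f n x) \<partial>M)) summable_on UNIV"
      using assms(3) by simp
    from infsum_int_decode(1)[OF this] show "summable (\<lambda>i. \<integral>x. norm (f (int_decode i) x) \<partial>M)"
      by simp
  qed (use assms in auto)
  then have "(\<lambda>i. \<integral>x. f (int_decode i) x \<partial>M) sums (\<integral>x. (\<Sum>\<^sub>\<infinity>n. f n x) \<partial>M)"
    by (simp add: infsum_int_decode(2)[OF assms(2)])
  with infsum_int_decode(3)[OF s] show ?thesis by (rule sums_unique2[symmetric])
qed

lemma summable_on_power_nat_abs:
  fixes q :: real
  assumes "0 \<le> q" "q < 1"
  shows "(\<lambda>n::int. q ^ nat \<bar>n\<bar>) summable_on UNIV"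
proof -
  have 1: "(\<lambda>n::nat. q ^ n) summable_on UNIV"
    using assms by (simp add: summable_on_UNIV_nonneg_real_iff)
  have "(\<lambda>n::int. q ^ nat \<bar>n\<bar>) summable_on (int ` UNIV)"
    by (subst summable_on_reindex) (use 1 in \<open>auto simp: o_def\<close>)
  moreover have "(\<lambda>n::int. q ^ nat \<bar>n\<bar>) summable_on ((\<lambda>n. - int n) ` UNIV)"
    by (subst summable_on_reindex) (use 1 in \<open>auto simp: o_def inj_on_def\<close>)
  ultimately have "(\<lambda>n::int. q ^ nat \<bar>n\<bar>) summable_on (range int \<union> range (\<lambda>n. - int n))"
    by (intro summable_on_union)
  moreover have "range int \<union> range (\<lambda>n. - int n) = UNIV"
    by (auto simp: image_iff) (metis int_cases2)
  ultimately show ?thesis by simp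
qed

text \<open>From (|w + n| - 1)^2 \<ge> 0 the square is at least 2 |w + n| - 1. The geometric
  majorant obtained in this way is uniform for w in a bounded set.\<close>

lemma gauss_shift_le:
  fixes s w :: real and n :: int
  assumes "s > 0"
  shows "exp (- s * (w + n)\<^sup>2) \<le> exp (s * (2 * \<bar>w\<bar> + 1)) * exp (- 2 * s) ^ nat \<bar>n\<bar>"
proof -
  have "0 \<le> (\<bar>w + n\<bar> - 1)\<^sup>2" by simp
  then have "(w + n)\<^sup>2 \<ge> 2 * \<bar>w + n\<bar> - 1" by (simp add: power2_diff)
  moreover have "\<bar>w + n\<bar> \<ge> \<bar>real_of_int n\<bar> - \<bar>w\<bar>" by linarith
  from mult_left_mono[OF this, of 2]
  have "2 * \<bar>real_of_int n\<bar> - 2 * \<bar>w\<bar> - 1 \<le> 2 * \<bar>w + n\<bar> - 1" by (simp add: algebra_simps)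
  ultimately have "(w + n)\<^sup>2 \<ge> 2 * \<bar>real_of_int n\<bar> - 2 * \<bar>w\<bar> - 1" by (meson order_trans)
  then have "s * (w + n)\<^sup>2 \<ge> s * (2 * \<bar>real_of_int n\<bar> - 2 * \<bar>w\<bar> - 1)"
    using assms by (simp add: mult_left_mono)
  then have "exp (- s * (w + n)\<^sup>2) \<le> exp (s * (2 * \<bar>w\<bar> + 1) + real (nat \<bar>n\<bar>) * (- 2 * s))"
    by (simp add: algebra_simps)
  also have "\<dots> = exp (s * (2 * \<bar>w\<bar> + 1)) * exp (- 2 * s) ^ nat \<bar>n\<bar>"
    by (subst exp_add, subst exp_of_nat_mult) simp
  finally show ?thesis .
qed

lemma summable_on_gauss_bound:
  fixes s :: real
  assumes "s > 0"
  shows "(\<lambda>n::int. C * exp (- 2 * s) ^ nat \<bar>n\<bar>) summable_on UNIV"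
  by (rule summable_on_cmult_right[OF summable_on_power_nat_abs]) (use assms in auto)

text \<open>With c = 1 / sqrt (2 \<pi> s), the substitution t -> c t turns the integrand into sqrt
  (2 \<pi>) times the standard normal density times a character, so the value is the characteristic
  function of the normal distribution at 2 \<pi> x c.\<close>

lemma gauss_fourier:
  fixes s x :: real
  assumes "s > 0"
  shows "(\<lambda>t. exp (of_real (- pi * s * t\<^sup>2) + 2 * pi * \<i> * of_real (x * t))) integrable_on UNIV"
    "integrable lborel (\<lambda>t. exp (of_real (- pi * s * t\<^sup>2) + 2 * pi * \<i> * of_real (x * t)))" (is "integrable _ ?f")
    "(\<integral>t. exp (of_real (- pi * s * t\<^sup>2) + 2 * pi * \<i> * of_real (x * t)) \<partial>lborel)
      = of_real (exp (- pi * x\<^sup>2 / s) / sqrt s)"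
proof -
  define c where "c = 1 / sqrt (2 * pi * s)"
  have c: "c > 0" "c\<^sup>2 = 1 / (2 * pi * s)" using assms by (auto simp: c_def power_divide)
  have eq: "?f (0 + c * t) = of_real (sqrt (2 * pi)) * (of_real (std_normal_density t) * exp (\<i> * of_real ((2 * pi * x * c) * t)))" for t
  proof -
    have "- pi * s * (c * t)\<^sup>2 = - t\<^sup>2 / 2"
      using assms by (simp add: power_mult_distrib c(2))
    moreover have "2 * pi * \<i> * of_real (x * (0 + c * t)) = \<i> * of_real ((2 * pi * x * c) * t)"
      by (simp add: algebra_simps)
    ultimately have "?f (0 + c * t) = exp (of_real (- t\<^sup>2 / 2)) * exp (\<i> * of_real ((2 * pi * x * c) * t))"
      by (simp only: exp_add add_0)
    then show ?thesis
      by (simp add: std_normal_density_def flip: exp_of_real)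
  qed
  have i: "integrable lborel (\<lambda>t. of_real (std_normal_density t) * exp (\<i> * of_real ((2 * pi * x * c) * t)))"
  proof (rule Bochner_Integration.integrable_bound)
    show "integrable lborel (\<lambda>t. std_normal_density t)" by simp
    show "(\<lambda>t. of_real (std_normal_density t) * exp (\<i> * of_real ((2 * pi * x * c) * t))) \<in> borel_measurable lborel"
      by measurable
  qed (auto simp: norm_mult)
  have "integrable lborel (\<lambda>t. ?f (0 + c * t))"
    unfolding eq using i by simp
  then show int: "integrable lborel ?f"
    using lborel_integrable_real_affine_iff[of c ?f 0] c by simp
  then show "?f integrable_on UNIV"
    using integrable_on_lborel by blast
  have "char std_normal_distribution (2 * pi * x * c) = of_real (exp (- (2 * pi * x * c)\<^sup>2 / 2))"
    by (simp add: char_std_normal_distribution)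
  moreover have "char std_normal_distribution (2 * pi * x * c)
     = (\<integral>t. of_real (std_normal_density t) * exp (\<i> * of_real ((2 * pi * x * c) * t)) \<partial>lborel)"
    unfolding char_def by (subst integral_density) (auto simp: scaleR_conv_of_real)
  moreover have "(2 * pi * x * c)\<^sup>2 / 2 = pi * x\<^sup>2 / s"
    using assms by (simp add: power_mult_distrib c(2)) (simp add: power2_eq_square)
  ultimately have "(\<integral>t. of_real (std_normal_density t) * exp (\<i> * of_real ((2 * pi * x * c) * t)) \<partial>lborel) = of_real (exp (- pi * x\<^sup>2 / s))"
    by simp
  then have "(\<integral>t. ?f t \<partial>lborel) = \<bar>c\<bar> *\<^sub>R (of_real (sqrt (2 * pi)) * of_real (exp (- pi * x\<^sup>2 / s)))"
    using c(1) by (subst lborel_integral_real_affine[where c=c and t=0]) (auto simp only: eq integral_mult_right_zero)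
  also have "\<dots> = of_real ((c * sqrt (2 * pi)) * exp (- pi * x\<^sup>2 / s))"
    using c(1) by (simp add: scaleR_conv_of_real)
  also have "c * sqrt (2 * pi) = 1 / sqrt s"
    using assms by (simp add: c_def real_sqrt_mult)
  finally show "(\<integral>t. ?f t \<partial>lborel) = of_real (exp (- pi * x\<^sup>2 / s) / sqrt s)" by simp
qed

text \<open>Polynomials restricted to the unit circle are trigonometric polynomials, so their
  product with \<open>D\<close> integrates to 0. By Stone-Weierstrass they approximate the conjugate
  of \<open>D\<close> uniformly, hence the integral of |D|^2 vanishes.\<close>

lemma fourier_unique:
  fixes D :: "real \<Rightarrow> complex"
  assumes cont: "continuous_on {0..1} D" and per: "D 0 = D 1"
    and z: "\<And>k::int. integral {0..1} (\<lambda>w. D w * exp (2 * pi * \<i> * of_real (of_int k * w))) = 0"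
    and w: "w \<in> {0..1}"
  shows "D w = 0"
proof -
  define e where "e k w = exp (2 * pi * \<i> * of_real (of_int k * w))" for k :: int and w :: real
  \<comment> \<open>The integrals against all k are asked for, not only the one with k = 0: this
    makes the class stable under multiplication by characters, and hence under products of
    polynomials in the induction.\<close>
  define og where "og h \<longleftrightarrow> continuous_on {0..1} h \<and> (\<forall>k. integral {0..1} (\<lambda>w. D w * h w * e k w) = 0)"
    for h :: "real \<Rightarrow> complex"
  have e_cont: "continuous_on A (e k)" for A k
    unfolding e_def by (intro continuous_intros)
  have ecis: "e k w = cis (2 * pi * of_int k * w)" for k w
    by (simp add: e_def cis_conv_exp algebra_simps)
  have e_add: "e j w * e k w = e (j + k) w" for j k w
    unfolding e_def by (simp add: exp_add[symmetric] algebra_simps)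
  have int: "(\<lambda>w. D w * h w * e k w) integrable_on {0..1}" if "continuous_on {0..1} h" for h k
    by (intro integrable_continuous_interval continuous_intros cont that e_cont)
  have og_add: "og (\<lambda>w. h1 w + h2 w)" if "og h1" "og h2" for h1 h2
  proof -
    have "integral {0..1} (\<lambda>w. D w * (h1 w + h2 w) * e k w) =
        integral {0..1} (\<lambda>w. D w * h1 w * e k w) + integral {0..1} (\<lambda>w. D w * h2 w * e k w)" for k
      using that integral_add[OF int[of h1 k] int[of h2 k]] by (simp add: og_def algebra_simps)
    then show ?thesis using that by (auto simp: og_def intro!: continuous_intros)
  qed
  have og_scale: "og (\<lambda>w. c * h w)" if "og h" for c h
  proof -
    have "(\<lambda>w. D w * (c * h w) * e k w) = (\<lambda>w. c * (D w * h w * e k w))" for k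
      by (simp add: algebra_simps)
    then show ?thesis using that by (auto simp: og_def intro!: continuous_intros)
  qed
  have og_e: "og (\<lambda>w. e j w * h w)" if "og h" for j h
  proof -
    have "(\<lambda>w. D w * (e j w * h w) * e k w) = (\<lambda>w. D w * h w * e (j + k) w)" for k
      by (simp add: e_add[symmetric] algebra_simps)
    then show ?thesis using that by (auto simp: og_def intro!: continuous_intros e_cont)
  qed
  have poly: "og h \<Longrightarrow> og (\<lambda>w. of_real (p (cis (2 * pi * w))) * h w)"
    if "real_polynomial_function p" for p h
    using that
  proof (induction arbitrary: h)
    case (linear p)
    interpret p: bounded_linear p by fact
    have pc: "p (cis x) = cos x * p 1 + sin x * p \<i>" for x
    proof -
      have "cis x = cos x *\<^sub>R 1 + sin x *\<^sub>R \<i>" by (simp add: complex_eq_iff)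
      then show ?thesis by (simp only: p.add p.scaleR) simp
    qed
    have "complex_of_real (cos (2 * pi * w)) = (e 1 w + e (-1) w) / 2"
      "complex_of_real (sin (2 * pi * w)) = \<i> * (e (-1) w - e 1 w) / 2" for w
      by (simp_all add: ecis complex_eq_iff)
    note csn = this
    have "of_real (p (cis (2 * pi * w))) * h w =
       ((p 1 - \<i> * p \<i>) / 2) * (e 1 w * h w) + ((p 1 + \<i> * p \<i>) / 2) * (e (-1) w * h w)" for w
    proof -
      have "of_real (p (cis (2 * pi * w))) = (e 1 w + e (-1) w) / 2 * of_real (p 1) + \<i> * (e (-1) w - e 1 w) / 2 * of_real (p \<i>)"
        by (simp only: pc of_real_add of_real_mult csn)
      then show ?thesis by (simp only:) (simp add: field_simps)
    qed
    then show ?case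
      by (simp only:) (intro og_add og_scale og_e linear.prems)
  next
    case (const c)
    then show ?case by (rule og_scale)
  next
    case (add p q)
    then show ?case by (simp add: distrib_right) (intro og_add; blast)
  next
    case (mult p q)
    then show ?case by (simp add: mult.assoc)
  qed
  have "og (\<lambda>_. 1)"
    using z by (simp add: og_def e_def)
  note poly1 = poly[OF _ this, simplified]
  \<comment> \<open>Equal end values make \<open>D\<close> a loop; the correspondence between loops
    and maps of the circle yields continuity across the cut of \<open>Arg2pi\<close>.\<close>
  have circ: "continuous_on (sphere 0 1) (\<lambda>z. g (D (Arg2pi z / (2 * pi))))"
    if "continuous_on UNIV g" for g :: "complex \<Rightarrow> real"
  proof -
    have "path (\<lambda>w. g (D w))"
      unfolding path_def using cont that by (intro continuous_on_compose2[OF that cont]) auto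
    then have "homotopic_loops UNIV (\<lambda>w. g (D w)) (\<lambda>w. g (D w))"
      by (simp add: homotopic_loops_refl pathfinish_def pathstart_def per)
    from homotopic_with_imp_continuous[OF homotopic_loops_imp_homotopic_circlemaps[OF this]]
    show ?thesis by (simp add: o_def)
  qed
  have Dcis: "D (Arg2pi (cis (2 * pi * w)) / (2 * pi)) = D w" if "w \<in> {0..1}" for w
  proof (cases "w = 1")
    case True
    have "cis (2 * pi) = 1" by (simp add: complex_eq_iff)
    then show ?thesis using True per by (simp add: Arg2pi_of_real[of 1, simplified])
  next
    case False
    have "Arg2pi (cis (2 * pi * w)) = 2 * pi * w"
      by (rule Arg2pi_unique[where r=1]) (use that False in \<open>auto simp: cis_conv_exp\<close>)
    then show ?thesis by simp
  qed
  obtain M where M: "\<And>w. w \<in> {0..1} \<Longrightarrow> norm (D w) \<le> M"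
  proof -
    have "bounded (D ` {0..1})"
      by (rule compact_imp_bounded[OF compact_continuous_image[OF cont]]) simp
    then obtain b where "\<forall>x\<in>D ` {0..1}. norm x \<le> b" unfolding bounded_iff by blast
    then show ?thesis using that[of b] by simp
  qed
  have small: "norm (integral {0..1} (\<lambda>w. D w * cnj (D w))) \<le> M * (2 * \<epsilon>)" if "\<epsilon> > 0" for \<epsilon>
  proof -
    have "\<exists>p. real_polynomial_function p \<and> (\<forall>w\<in>{0..1}. \<bar>g (D w) - p (cis (2 * pi * w))\<bar> < \<epsilon>)"
      if g: "continuous_on UNIV g" for g
    proof -
      obtain p where p: "real_polynomial_function p"
          "\<And>z. z \<in> sphere 0 1 \<Longrightarrow> \<bar>g (D (Arg2pi z / (2 * pi))) - p z\<bar> < \<epsilon>"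
        by (rule Stone_Weierstrass_real_polynomial_function[OF compact_sphere circ[OF g] \<open>\<epsilon> > 0\<close>]) blast
      have "\<bar>g (D w) - p (cis (2 * pi * w))\<bar> < \<epsilon>" if "w \<in> {0..1}" for w
        using p(2)[of "cis (2 * pi * w)"] Dcis[OF that] by simp
      with p(1) show ?thesis by blast
    qed
    note ex = this
    have ReIm: "continuous_on UNIV Re" "continuous_on UNIV Im" by (intro continuous_intros)+
    obtain p where p: "real_polynomial_function p" "\<forall>w\<in>{0..1}. \<bar>Re (D w) - p (cis (2 * pi * w))\<bar> < \<epsilon>"
      using ex[OF ReIm(1)] by blast
    obtain q where q: "real_polynomial_function q" "\<forall>w\<in>{0..1}. \<bar>Im (D w) - q (cis (2 * pi * w))\<bar> < \<epsilon>"
      using ex[OF ReIm(2)] by blast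
    define \<psi> where "\<psi> w = of_real (p (cis (2 * pi * w))) + (- \<i>) * of_real (q (cis (2 * pi * w)))" for w
    have og\<psi>: "og \<psi>" unfolding \<psi>_def by (intro og_add og_scale poly1 p q)
    then have i0: "integral {0..1} (\<lambda>w. D w * \<psi> w) = 0" and \<psi>c: "continuous_on {0..1} \<psi>"
      by (auto simp: og_def e_def dest: spec[of _ 0])
    have b: "norm (cnj (D w) - \<psi> w) \<le> 2 * \<epsilon>" if "w \<in> {0..1}" for w
    proof -
      have "cnj (D w) - \<psi> w = of_real (Re (D w) - p (cis (2 * pi * w))) - \<i> * of_real (Im (D w) - q (cis (2 * pi * w)))"
        by (simp add: \<psi>_def complex_eq_iff)
      then have "norm (cnj (D w) - \<psi> w) \<le> \<bar>Re (D w) - p (cis (2 * pi * w))\<bar> + \<bar>Im (D w) - q (cis (2 * pi * w))\<bar>"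
        by (metis norm_ii norm_mult norm_of_real norm_triangle_ineq4 mult_1)
      also have "\<dots> \<le> \<epsilon> + \<epsilon>"
        using p(2) q(2) that by (intro add_mono less_imp_le) auto
      finally show ?thesis by simp
    qed
    have "integral {0..1} (\<lambda>w. D w * cnj (D w)) = integral {0..1} (\<lambda>w. D w * (cnj (D w) - \<psi> w)) + integral {0..1} (\<lambda>w. D w * \<psi> w)"
      by (subst integral_add[symmetric])
        (auto intro!: integrable_continuous_interval continuous_intros cont \<psi>c simp: algebra_simps)
    also have "norm \<dots> \<le> integral {0..1::real} (\<lambda>w. M * (2 * \<epsilon>))"
      unfolding i0 add_0_right
    proof (rule integral_norm_bound_integral)
      fix w :: real assume "w \<in> {0..1}"
      then show "norm (D w * (cnj (D w) - \<psi> w)) \<le> M * (2 * \<epsilon>)"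
        unfolding norm_mult using M b by (intro mult_mono) (auto intro: order_trans[OF norm_ge_zero])
    qed (auto intro!: integrable_continuous_interval continuous_intros cont \<psi>c)
    finally show ?thesis by simp
  qed
  have "norm (integral {0..1} (\<lambda>w. D w * cnj (D w))) = 0"
  proof (rule ccontr)
    assume nz: "\<not> ?thesis"
    define N where "N = norm (integral {0..1} (\<lambda>w. D w * cnj (D w)))"
    have N: "N > 0" using nz by (simp add: N_def)
    have M0: "M \<ge> 0" using M[of 0] order_trans[OF norm_ge_zero] by auto
    \<comment> \<open>This choice of \<epsilon> makes the bound at most N / 2, contradicting N > 0;
      the 1 guards against M = 0.\<close>
    have "N \<le> M * (2 * (N / (4 * (M + 1))))"
      unfolding N_def by (rule small) (use N M0 in \<open>auto simp: N_def[symmetric]\<close>)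
    also have "\<dots> = N / 2 * (M / (M + 1))" using M0 by (simp add: field_simps)
    also have "\<dots> \<le> N / 2 * 1" using M0 N by (intro mult_left_mono) auto
    finally show False using N by simp
  qed
  moreover have "(\<lambda>w. D w * cnj (D w)) = (\<lambda>w. complex_of_real ((norm (D w))\<^sup>2))"
    by (simp only: complex_norm_square)
  moreover have "((\<lambda>w. (norm (D w))\<^sup>2) has_integral integral {0..1} (\<lambda>w. (norm (D w))\<^sup>2)) {0..1}"
    by (intro integrable_integral integrable_continuous_interval continuous_intros cont)
  then have "((\<lambda>w. complex_of_real ((norm (D w))\<^sup>2)) has_integral complex_of_real (integral {0..1} (\<lambda>w. (norm (D w))\<^sup>2))) {0..1}"
    by (rule has_integral_of_real)
  ultimately have "integral {0..1} (\<lambda>w. (norm (D w))\<^sup>2) = 0"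
    by (simp add: integral_unique)
  then have "\<forall>w\<in>{0..1}. (norm (D w))\<^sup>2 = 0"
    by (subst (asm) integral_eq_0_iff) (auto intro!: continuous_intros cont)
  then show ?thesis using w by auto
qed


text \<open>A Gaussian of parameter s modulated by the frequency r. The frequency is present because
  the phase of the theta kernel depends on the isotropic coordinate as soon as c and Re \<tau> are
  nonzero.\<close>

definition gauss_term :: "real \<Rightarrow> real \<Rightarrow> real \<Rightarrow> complex" where
  "gauss_term s r t = exp (of_real (- pi * s * t\<^sup>2) + 2 * pi * \<i> * of_real (r * t))"

lemma norm_gauss_term: "norm (gauss_term s r t) = exp (- (pi * s) * t\<^sup>2)"
  by (simp add: gauss_term_def)

lemma continuous_on_gauss_term [continuous_intros]:
  "continuous_on A g \<Longrightarrow> continuous_on A (\<lambda>x. gauss_term s r (g x))"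
  unfolding gauss_term_def by (intro continuous_intros)

lemma gauss_term_integral:
  assumes "s > 0"
  shows "integrable lborel (gauss_term s r)"
    "(\<integral>t. gauss_term s r t \<partial>lborel) = of_real (exp (- pi * r\<^sup>2 / s) / sqrt s)"
  using gauss_fourier(2,3)[OF assms, of r] unfolding gauss_term_def by auto

lemma gauss_term_modulate: "gauss_term s r t * exp (2 * pi * \<i> * of_real (x * t)) = gauss_term s (r + x) t"
  by (simp add: gauss_term_def exp_add[symmetric] algebra_simps)

lemma gauss_term_summable:
  assumes "s > 0"
  shows "(\<lambda>n::int. norm (gauss_term s r (w + n))) summable_on UNIV"
  unfolding norm_gauss_term
  by (rule summable_on_comparison_test[OF summable_on_gauss_bound gauss_shift_le]) (use assms in auto)

lemma gauss_term_infsum_continuous: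
  assumes "s > 0"
  shows "continuous_on A (\<lambda>w. \<Sum>\<^sub>\<infinity>n::int. gauss_term s r (w + of_int n))"
proof -
  \<comment> \<open>The parameter in \<open>dominated\<close> is complex, so the real variable w
    enters as Re \<tau>.\<close>
  have "dominated (count_space UNIV) UNIV (\<lambda>\<tau> n::int. gauss_term s r (Re \<tau> + of_int n))"
    unfolding dominated_def
  proof (intro conjI ballI)
    fix \<tau>0 :: complex
    show "\<exists>\<epsilon>>0. \<exists>g. integrable (count_space UNIV) g \<and>
        (\<forall>\<tau>\<in>ball \<tau>0 \<epsilon> \<inter> UNIV. \<forall>n\<in>space (count_space UNIV). norm (gauss_term s r (Re \<tau> + of_int n)) \<le> g n)"
    proof (intro exI[of _ 1] exI[of _ "\<lambda>n. exp (pi * s * (2 * (\<bar>Re \<tau>0\<bar> + 1) + 1)) * exp (- 2 * (pi * s)) ^ nat \<bar>n\<bar>"] conjI ballI)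
      show "integrable (count_space UNIV) (\<lambda>n::int. exp (pi * s * (2 * (\<bar>Re \<tau>0\<bar> + 1) + 1)) * exp (- 2 * (pi * s)) ^ nat \<bar>n\<bar>)"
        using summable_on_gauss_bound[of "pi * s"] assms by (intro integrable_count_space_nonneg) auto
      fix \<tau> :: complex and n :: int assume \<tau>: "\<tau> \<in> ball \<tau>0 1 \<inter> UNIV"
      have "\<bar>Re \<tau>\<bar> \<le> \<bar>Re \<tau>0\<bar> + 1"
        using \<tau> abs_Re_le_cmod[of "\<tau>0 - \<tau>"] by (simp add: dist_norm)
      then have "exp (pi * s * (2 * \<bar>Re \<tau>\<bar> + 1)) \<le> exp (pi * s * (2 * (\<bar>Re \<tau>0\<bar> + 1) + 1))"
        using assms by simp
      then have "exp (pi * s * (2 * \<bar>Re \<tau>\<bar> + 1)) * exp (- 2 * (pi * s)) ^ nat \<bar>n\<bar> \<le> exp (pi * s * (2 * (\<bar>Re \<tau>0\<bar> + 1) + 1)) * exp (- 2 * (pi * s)) ^ nat \<bar>n\<bar>"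
        by (rule mult_right_mono) simp
      then show "norm (gauss_term s r (Re \<tau> + of_int n)) \<le> exp (pi * s * (2 * (\<bar>Re \<tau>0\<bar> + 1) + 1)) * exp (- 2 * (pi * s)) ^ nat \<bar>n\<bar>"
        unfolding norm_gauss_term using gauss_shift_le[of "pi * s" "Re \<tau>" n] assms by (auto intro: order_trans)
    qed auto
  qed (auto intro!: continuous_intros)
  from dominated_continuous[OF this]
  have "continuous_on UNIV (\<lambda>\<tau>. \<Sum>\<^sub>\<infinity>n::int. gauss_term s r (Re \<tau> + of_int n))"
    using integral_count_space_eq_infsum[OF gauss_term_summable[OF assms]] by simp
  then have "continuous_on A (\<lambda>w. \<Sum>\<^sub>\<infinity>n::int. gauss_term s r (Re (complex_of_real w) + of_int n))"
    by (rule continuous_on_compose2) (auto intro!: continuous_intros)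
  then show ?thesis by simp
qed

text \<open>Unfolding: to integrate the periodisation over one period is to integrate the Gaussian
  over the line. The geometric majorant \<open>B\<close> justifies the interchange of sum and
  integral over the unit interval and over the line alike.\<close>

lemma integral_infsum_gauss_term:
  assumes "s > 0"
  shows "integral {0..1} (\<lambda>w. \<Sum>\<^sub>\<infinity>n::int. gauss_term s r (w + of_int n)) = of_real (exp (- pi * r\<^sup>2 / s) / sqrt s)"
proof -
  let ?G = "\<lambda>w. \<Sum>\<^sub>\<infinity>n::int. gauss_term s r (w + of_int n)"
  have si: "set_integrable lborel {0..1::real} g" if "continuous_on {0..1} g" for g :: "real \<Rightarrow> complex"
    using that by (rule borel_integrable_atLeastAtMost')
  define f1 where "f1 n w = indicator {0..1} w *\<^sub>R gauss_term s r (w + of_int n)" for n :: int and w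
  \<comment> \<open>The pieces are half-open so that each t lies in exactly one of them; after the
    shift they differ from the closed pieces \<open>f1\<close> only at the point 1.\<close>
  define f2 where "f2 n t = indicator {of_int n..<of_int n + 1} t *\<^sub>R gauss_term s r t" for n :: int and t
  define B where "B n = exp (pi * s * 3) * exp (- 2 * (pi * s)) ^ nat \<bar>n\<bar>" for n :: int
  have B: "B summable_on UNIV" unfolding B_def using assms by (intro summable_on_gauss_bound) simp
  have f1B: "norm (f1 n w) \<le> indicator {0..1} w * B n" for n w
  proof (cases "w \<in> {0..1}")
    case True
    have "norm (f1 n w) \<le> exp (pi * s * (2 * \<bar>w\<bar> + 1)) * exp (- 2 * (pi * s)) ^ nat \<bar>n\<bar>"
      using gauss_shift_le[of "pi * s" w n] True assms by (simp add: f1_def norm_gauss_term)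
    also have "\<dots> \<le> B n"
      unfolding B_def using True assms by (intro mult_right_mono) auto
    finally show ?thesis using True by simp
  qed (simp add: f1_def)
  have f1i: "integrable lborel (f1 n)" for n
  proof -
    have "continuous_on {0..1} (\<lambda>w. gauss_term s r (w + of_int n))" by (intro continuous_intros)
    from si[OF this] show ?thesis by (simp add: f1_def[abs_def] set_integrable_def)
  qed
  have f2i: "integrable lborel (f2 n)" for n
    unfolding f2_def by (intro integrable_mult_indicator gauss_term_integral assms) auto
  have shift: "integral\<^sup>L lborel (\<lambda>t. g (f2 n t)) = integral\<^sup>L lborel (\<lambda>w. g (f1 n w))"
    if "g 0 = 0" for n and g :: "complex \<Rightarrow> 'a::{banach,second_countable_topology}"
  proof -
    have "integral\<^sup>L lborel (\<lambda>t. g (f2 n t)) = integral\<^sup>L lborel (\<lambda>w. g (f2 n (of_int n + 1 * w)))"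
      by (subst lborel_integral_real_affine[where c=1 and t="of_int n"]) auto
    also have "\<dots> = integral\<^sup>L lborel (\<lambda>w. g (f1 n w))"
    proof (rule integral_discrete_difference[of "{1}"])
      fix w :: real assume "w \<notin> {1}"
      then show "g (f2 n (of_int n + 1 * w)) = g (f1 n w)"
        by (auto simp: f1_def f2_def indicator_def algebra_simps)
    qed auto
    finally show ?thesis .
  qed
  have "integral {0..1} ?G = (LINT w:{0..1}|lborel. ?G w)"
    by (rule set_borel_integral_eq_integral(2)[symmetric]) (intro si gauss_term_infsum_continuous assms)
  also have "\<dots> = (\<integral>w. (\<Sum>\<^sub>\<infinity>n. f1 n w) \<partial>lborel)"
    unfolding set_lebesgue_integral_def f1_def by (simp add: infsum_scaleR_right)
  also have "\<dots> = (\<Sum>\<^sub>\<infinity>n. \<integral>w. f1 n w \<partial>lborel)"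
  proof (rule integral_infsum_int[OF f1i])
    show "(\<lambda>n. norm (f1 n x)) summable_on UNIV" for x
      by (rule summable_on_comparison_test[OF summable_on_cmult_right[OF B] f1B]) auto
    show "(\<lambda>n. \<integral>x. norm (f1 n x) \<partial>lborel) summable_on UNIV"
    proof (rule summable_on_comparison_test[OF B])
      fix n
      have "(\<integral>x. norm (f1 n x) \<partial>lborel) \<le> (\<integral>x. indicator {0..1::real} x * B n \<partial>lborel)"
        by (rule integral_mono[OF integrable_norm[OF f1i]]) (auto simp: f1B)
      then show "(\<integral>x. norm (f1 n x) \<partial>lborel) \<le> B n" by simp
    qed auto
  qed
  also have "\<dots> = (\<Sum>\<^sub>\<infinity>n. \<integral>t. f2 n t \<partial>lborel)"
    using shift[of "\<lambda>x. x"] by simp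
  also have "\<dots> = (\<integral>t. (\<Sum>\<^sub>\<infinity>n. f2 n t) \<partial>lborel)"
  proof (rule integral_infsum_int[OF f2i, symmetric])
    show "(\<lambda>n. norm (f2 n t)) summable_on UNIV" for t
    proof -
      have "(\<lambda>n. norm (f2 n t)) summable_on {\<lfloor>t\<rfloor>}" by simp
      moreover have "norm (f2 n t) = 0" if "n \<noteq> \<lfloor>t\<rfloor>" for n
        using that by (auto simp: f2_def indicator_def) linarith
      ultimately show ?thesis by (subst summable_on_cong_neutral[of "{\<lfloor>t\<rfloor>}"]) auto
    qed
    have "(\<integral>x. norm (f2 n x) \<partial>lborel) \<le> B n" for n
    proof -
      have "(\<integral>x. norm (f2 n x) \<partial>lborel) = (\<integral>x. norm (f1 n x) \<partial>lborel)" by (rule shift) simp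
      also have "\<dots> \<le> (\<integral>x. indicator {0..1::real} x * B n \<partial>lborel)"
        by (rule integral_mono[OF integrable_norm[OF f1i]]) (auto simp: f1B)
      finally show ?thesis by simp
    qed
    then show "(\<lambda>n. \<integral>x. norm (f2 n x) \<partial>lborel) summable_on UNIV"
      by (rule summable_on_comparison_test[OF B]) auto
  qed
  also have "\<dots> = (\<integral>t. gauss_term s r t \<partial>lborel)"
  proof (rule Bochner_Integration.integral_cong[OF refl])
    fix t :: real
    have "f2 n t = 0" if "n \<noteq> \<lfloor>t\<rfloor>" for n
      using that by (auto simp: f2_def indicator_def) linarith
    then have "(\<Sum>\<^sub>\<infinity>n. f2 n t) = (\<Sum>\<^sub>\<infinity>n\<in>{\<lfloor>t\<rfloor>}. f2 n t)"
      by (intro infsum_cong_neutral) auto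
    also have "\<dots> = gauss_term s r t" by (auto simp: f2_def indicator_def)
    finally show "(\<Sum>\<^sub>\<infinity>n. f2 n t) = gauss_term s r t" .
  qed
  also have "\<dots> = of_real (exp (- pi * r\<^sup>2 / s) / sqrt s)" by (rule gauss_term_integral[OF assms])
  finally show ?thesis .
qed

lemma integral_exp_int:
  "integral {0..1} (\<lambda>w. exp (2 * pi * \<i> * of_real (of_int k * w))) = (if k = 0 then 1 else 0)"
proof (cases "k = 0")
  case False
  let ?c = "2 * pi * \<i> * of_int k :: complex"
  have "((\<lambda>w. exp (?c * of_real w)) has_integral (exp (?c * of_real 1) / ?c - exp (?c * of_real 0) / ?c)) {0..1}"
  proof (rule fundamental_theorem_of_calculus)
    fix w :: real
    have "((\<lambda>z. exp (?c * z) / ?c) has_field_derivative exp (?c * of_real w)) (at (of_real w))"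
      using False by (auto intro!: derivative_eq_intros)
    from has_vector_derivative_real_field[OF this]
    show "((\<lambda>w. exp (?c * of_real w) / ?c) has_vector_derivative exp (?c * of_real w)) (at w within {0..1})"
      by (rule has_vector_derivative_at_within)
  qed auto
  moreover have "exp ?c = 1"
    using exp_integer_2pi[of "of_int k"] by (simp add: algebra_simps)
  ultimately have "((\<lambda>w. exp (?c * of_real w)) has_integral 0) {0..1}" by simp
  then show ?thesis using False by (simp add: integral_unique mult.assoc)
qed simp

text \<open>Both sides are continuous of period 1, and both integrate against exp(2 \<pi> i k w) to
  exp(- \<pi> (k + r)^2 / s) / sqrt s. Uniqueness of Fourier coefficients gives equality on [0, 1],
  and the reduction to \<open>frac w\<close> extends it to the line.\<close>

theorem poisson_gauss:
  fixes s r w :: real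
  assumes "s > 0"
  shows "(\<Sum>\<^sub>\<infinity>n::int. gauss_term s r (w + of_int n)) =
     of_real (1 / sqrt s) * (\<Sum>\<^sub>\<infinity>k::int. of_real (exp (- pi * (of_int k - r)\<^sup>2 / s)) * exp (2 * pi * \<i> * of_real (of_int k * w)))"
proof -
  let ?G = "\<lambda>w. \<Sum>\<^sub>\<infinity>n::int. gauss_term s r (w + of_int n)"
  define ek where "ek k w = exp (2 * pi * \<i> * of_real (of_int k * w))" for k :: int and w :: real
  define c where "c k = exp (- pi * (of_int k - r)\<^sup>2 / s)" for k :: int
  let ?H = "\<lambda>w. of_real (1 / sqrt s) * (\<Sum>\<^sub>\<infinity>k. of_real (c k) * ek k w)"
  have ek1: "norm (ek k w) = 1" for k w by (simp add: ek_def)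
  have ekc: "continuous_on A (ek k)" for A k unfolding ek_def by (intro continuous_intros)
  have ekp: "ek k (w + of_int m) = ek k w" for k m w
  proof -
    have "exp (2 * of_int (k * m) * pi * \<i>) = (1::complex)"
      by (rule exp_integer_2pi) simp
    then show ?thesis unfolding ek_def by (simp add: ring_distribs exp_add mult.assoc mult.left_commute mult.commute)
  qed
  have c: "c summable_on UNIV"
  proof -
    have "c k = norm (gauss_term (1 / s) 0 (- r + of_int k))" for k
      by (simp add: norm_gauss_term c_def)
    then have "c = (\<lambda>k. norm (gauss_term (1 / s) 0 (- r + of_int k)))" by blast
    then show ?thesis using gauss_term_summable[of "1 / s" 0 "- r"] assms by (simp only:) simp
  qed
  have cs: "(\<lambda>k. norm (of_real (c k) * ek k w)) summable_on UNIV" for w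
  proof -
    have "(\<lambda>k. norm (of_real (c k) * ek k w)) = c" by (auto simp: norm_mult ek1 c_def)
    with c show ?thesis by (simp only:)
  qed
  have Hc: "continuous_on {0..1} ?H"
  proof -
    have "dominated (count_space UNIV) UNIV (\<lambda>\<tau> k. of_real (c k) * ek k (Re \<tau>))"
      unfolding dominated_def
    proof (intro conjI ballI)
      fix \<tau>0 :: complex
      have "integrable (count_space UNIV) c"
        using c by (rule integrable_count_space_nonneg) (simp add: c_def)
      then show "\<exists>\<epsilon>>0. \<exists>g. integrable (count_space UNIV) g \<and>
        (\<forall>\<tau>\<in>ball \<tau>0 \<epsilon> \<inter> UNIV. \<forall>k\<in>space (count_space UNIV). norm (of_real (c k) * ek k (Re \<tau>)) \<le> g k)"
        by (intro exI[of _ 1] exI[of _ c]) (auto simp: norm_mult ek1 c_def)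
    qed (auto intro!: continuous_intros continuous_on_compose2[OF ekc])
    from dominated_continuous[OF this]
    have "continuous_on UNIV (\<lambda>\<tau>. \<Sum>\<^sub>\<infinity>k. of_real (c k) * ek k (Re \<tau>))"
      using integral_count_space_eq_infsum[OF cs] by simp
    then have "continuous_on {0..1} (\<lambda>w. \<Sum>\<^sub>\<infinity>k. of_real (c k) * ek k (Re (complex_of_real w)))"
      by (rule continuous_on_compose2) (auto intro!: continuous_intros)
    then show ?thesis by (intro continuous_intros) simp
  qed
  have Gp: "?G (w + of_int m) = ?G w" for w m
  proof -
    have "bij (\<lambda>n::int. m + n)" by (rule bij_plus)
    from infsum_reindex_bij_betw[OF this, of "\<lambda>n. gauss_term s r (w + of_int n)"]
    show ?thesis by (simp add: add.assoc)
  qed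
  have eq01: "?G w = ?H w" if "w \<in> {0..1}" for w
  proof -
    have "?G w - ?H w = 0"
    proof (rule fourier_unique[OF _ _ _ that])
      show "continuous_on {0..1} (\<lambda>w. ?G w - ?H w)"
        by (intro continuous_on_diff gauss_term_infsum_continuous assms Hc)
      show "?G 0 - ?H 0 = ?G 1 - ?H 1"
        using Gp[of 0 1] ekp[of _ 0 1] by simp
      fix k :: int
      \<comment> \<open>A character of period 1 takes the same value at w and at w + n, so it can be
        absorbed into each term, where it raises the frequency by k.\<close>
      have Gk: "?G w * ek k w = (\<Sum>\<^sub>\<infinity>n::int. gauss_term s (r + of_int k) (w + of_int n))" for w
      proof -
        have "?G w * ek k w = (\<Sum>\<^sub>\<infinity>n::int. gauss_term s r (w + of_int n) * ek k w)"
          by (rule infsum_cmult_left[symmetric]) (rule abs_summable_summable[OF gauss_term_summable[OF assms]])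
        also have "\<dots> = (\<Sum>\<^sub>\<infinity>n::int. gauss_term s r (w + of_int n) * ek k (w + of_int n))"
          by (simp add: ekp)
        finally show ?thesis by (simp only: ek_def gauss_term_modulate)
      qed
      have Hk: "?H w * ek k w = of_real (1 / sqrt s) * (\<Sum>\<^sub>\<infinity>j. of_real (c j) * ek (j + k) w)" for w
      proof -
        have "(\<Sum>\<^sub>\<infinity>j. of_real (c j) * ek j w) * ek k w = (\<Sum>\<^sub>\<infinity>j. of_real (c j) * ek j w * ek k w)"
          by (rule infsum_cmult_left[symmetric]) (rule abs_summable_summable[OF cs])
        also have "\<dots> = (\<Sum>\<^sub>\<infinity>j. of_real (c j) * ek (j + k) w)"
          by (rule infsum_cong) (simp add: ek_def exp_add[symmetric] algebra_simps)
        finally show ?thesis by (simp add: mult.assoc)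
      qed
      have 1: "integral {0..1} (\<lambda>w. ?G w * ek k w) = of_real (c (- k) / sqrt s)"
        unfolding Gk integral_infsum_gauss_term[OF assms] c_def by (simp add: power2_eq_square algebra_simps)
      have 2: "integral {0..1} (\<lambda>w. ?H w * ek k w) = of_real (c (- k) / sqrt s)"
      proof -
        define f where "f j w = indicator {0..1::real} w *\<^sub>R (of_real (c j) * ek (j + k) w)" for j w
        have si: "set_integrable lborel {0..1::real} g" if "continuous_on {0..1} g" for g :: "real \<Rightarrow> complex"
          using that by (rule borel_integrable_atLeastAtMost')
        have fi: "integrable lborel (f j)" for j
        proof -
          have "continuous_on {0..1} (\<lambda>w. of_real (c j) * ek (j + k) w)" by (intro continuous_intros ekc)
          from si[OF this] show ?thesis by (simp add: f_def[abs_def] set_integrable_def)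
        qed
        have fB: "norm (f j w) = indicator {0..1} w * c j" for j w
          by (simp add: f_def norm_mult ek1 c_def)
        have "continuous_on {0..1} (\<lambda>w. ?H w * ek k w)" by (intro continuous_intros Hc ekc)
        then have "integral {0..1} (\<lambda>w. ?H w * ek k w) = (LINT w:{0..1}|lborel. ?H w * ek k w)"
          by (intro set_borel_integral_eq_integral(2)[symmetric] si)
        also have "\<dots> = (\<integral>w. of_real (1 / sqrt s) * (\<Sum>\<^sub>\<infinity>j. f j w) \<partial>lborel)"
          unfolding set_lebesgue_integral_def f_def Hk by (simp add: infsum_scaleR_right)
        also have "\<dots> = of_real (1 / sqrt s) * (\<integral>w. (\<Sum>\<^sub>\<infinity>j. f j w) \<partial>lborel)"
          by simp
        also have "(\<integral>w. (\<Sum>\<^sub>\<infinity>j. f j w) \<partial>lborel) = (\<Sum>\<^sub>\<infinity>j. \<integral>w. f j w \<partial>lborel)"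
        proof (rule integral_infsum_int[OF fi])
          show "(\<lambda>j. norm (f j w)) summable_on UNIV" for w
            unfolding fB by (rule summable_on_cmult_right[OF c])
          show "(\<lambda>j. \<integral>w. norm (f j w) \<partial>lborel) summable_on UNIV"
            unfolding fB using c by simp
        qed
        also have "\<dots> = (\<Sum>\<^sub>\<infinity>j\<in>{- k}. of_real (c j))"
        proof (rule infsum_cong_neutral)
          fix j
          have "(\<integral>w. f j w \<partial>lborel) = (LINT w:{0..1}|lborel. of_real (c j) * ek (j + k) w)"
            by (simp only: f_def set_lebesgue_integral_def)
          also have "\<dots> = integral {0..1} (\<lambda>w. of_real (c j) * ek (j + k) w)"
            by (rule set_borel_integral_eq_integral(2), rule si) (intro continuous_intros ekc)
          also have "\<dots> = of_real (c j) * (if j + k = 0 then 1 else 0)"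
            unfolding integral_mult_right ek_def integral_exp_int ..
          finally have *: "(\<integral>w. f j w \<partial>lborel) = (if j = - k then of_real (c j) else 0)" by (auto simp: eq_neg_iff_add_eq_0)
          show "j \<in> {- k} - UNIV \<Longrightarrow> complex_of_real (c j) = 0" by simp
          show "j \<in> UNIV - {- k} \<Longrightarrow> (\<integral>w. f j w \<partial>lborel) = 0" using * by simp
          show "j \<in> UNIV \<inter> {- k} \<Longrightarrow> (\<integral>w. f j w \<partial>lborel) = complex_of_real (c j)" using * by simp
        qed
        finally show ?thesis by simp
      qed
      have "integral {0..1} (\<lambda>w. ?G w * ek k w - ?H w * ek k w) = 0"
      proof -
        have "(\<lambda>w. ?G w * ek k w) integrable_on {0..1}" "(\<lambda>w. ?H w * ek k w) integrable_on {0..1}"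
          by (intro integrable_continuous_interval continuous_on_mult gauss_term_infsum_continuous assms Hc ekc)+
        from integral_diff[OF this] show ?thesis by (simp only: 1 2 diff_self)
      qed
      then show "integral {0..1} (\<lambda>w. (?G w - ?H w) * exp (2 * pi * \<i> * of_real (of_int k * w))) = 0"
        by (simp add: ek_def left_diff_distrib)
    qed
    then show ?thesis by simp
  qed
  have "?G w = ?G (frac w)"
    using Gp[of "frac w" "\<lfloor>w\<rfloor>"] by (simp add: frac_def)
  also have "\<dots> = ?H (frac w)"
    by (rule eq01) (simp add: frac_lt_1 less_imp_le)
  also have "\<dots> = ?H w"
    using ekp[of _ "frac w" "\<lfloor>w\<rfloor>"] by (simp add: frac_def)
  finally show ?thesis by (simp add: c_def ek_def)
qed

section \<open>Partial Fourier transforms of the Siegel theta kernel\<close>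

text \<open>Names for a transformed term and its derivatives in \<tau> = u + i v and z = x + i y.
  With the derivative as an argument, one bound and one domination lemma serve all of them. The
  mixed derivative \<open>Puv\<close> belongs to the C^2 regularity in \<tau>.\<close>

datatype part = P0 | Pu | Pv | Puu | Puv | Pvv | Px | Pxx | Py | Pyy

text \<open>An index (m, n, k) stands for a = m / D, c = n / D and the dual variable k / \<beta>: D
  is a common denominator of the coset, and \<beta> is its period in the isotropic
  direction.\<close>

locale theta_param =
  fixes N D \<beta> :: real
  assumes N: "N > 0" and D: "D > 0" and \<beta>: "\<beta> > 0"
begin

abbreviation ca :: "int \<times> int \<times> int \<Rightarrow> real" where "ca i \<equiv> of_int (fst i) / D"
abbreviation cc :: "int \<times> int \<times> int \<Rightarrow> real" where "cc i \<equiv> of_int (fst (snd i)) / D"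
abbreviation ck :: "int \<times> int \<times> int \<Rightarrow> real" where "ck i \<equiv> of_int (snd (snd i)) / \<beta>"

abbreviation cpi :: complex where "cpi \<equiv> complex_of_real pi"
abbreviation cN :: complex where "cN \<equiv> complex_of_real N"
abbreviation nI :: complex where "nI \<equiv> complex_of_real (inverse N)"

text \<open>The exponent produced by Poisson summation in the isotropic coordinate; on real
  arguments the bracket in the last term is |k - N c \<tau>|^2. All variables are complex and the
  square is expanded, so that each partial derivative is an ordinary complex derivative in one
  slot.\<close>

definition aE :: "complex \<Rightarrow> complex \<Rightarrow> complex \<Rightarrow> complex \<Rightarrow> complex \<Rightarrow> complex \<Rightarrow> complex \<Rightarrow> complex" where
  "aE a c k u v x y = 2 * cpi * \<i> * cN * (a - c * x)\<^sup>2 * (u + \<i> * v) + 2 * cpi * \<i> * k * (2 * a * x - c * x\<^sup>2)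
     - cpi * y\<^sup>2 * nI * inverse v * ((k - cN * c * u)\<^sup>2 + cN\<^sup>2 * c\<^sup>2 * v\<^sup>2)"

definition aEu :: "complex \<Rightarrow> complex \<Rightarrow> complex \<Rightarrow> complex \<Rightarrow> complex \<Rightarrow> complex \<Rightarrow> complex \<Rightarrow> complex" where
  "aEu a c k u v x y = 2 * cpi * \<i> * cN * (a - c * x)\<^sup>2 + 2 * cpi * y\<^sup>2 * nI * inverse v * cN * c * (k - cN * c * u)"

definition aEv :: "complex \<Rightarrow> complex \<Rightarrow> complex \<Rightarrow> complex \<Rightarrow> complex \<Rightarrow> complex \<Rightarrow> complex \<Rightarrow> complex" where
  "aEv a c k u v x y = - 2 * cpi * cN * (a - c * x)\<^sup>2 + cpi * y\<^sup>2 * nI * (inverse v)\<^sup>2 * ((k - cN * c * u)\<^sup>2 + cN\<^sup>2 * c\<^sup>2 * v\<^sup>2)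
     - 2 * cpi * y\<^sup>2 * nI * inverse v * cN\<^sup>2 * c\<^sup>2 * v"

definition aEuu :: "complex \<Rightarrow> complex \<Rightarrow> complex \<Rightarrow> complex \<Rightarrow> complex \<Rightarrow> complex \<Rightarrow> complex \<Rightarrow> complex" where
  "aEuu a c k u v x y = - 2 * cpi * y\<^sup>2 * nI * inverse v * cN\<^sup>2 * c\<^sup>2"

definition aEuv :: "complex \<Rightarrow> complex \<Rightarrow> complex \<Rightarrow> complex \<Rightarrow> complex \<Rightarrow> complex \<Rightarrow> complex \<Rightarrow> complex" where
  "aEuv a c k u v x y = - 2 * cpi * y\<^sup>2 * nI * (inverse v)\<^sup>2 * cN * c * (k - cN * c * u)"

definition aEvv :: "complex \<Rightarrow> complex \<Rightarrow> complex \<Rightarrow> complex \<Rightarrow> complex \<Rightarrow> complex \<Rightarrow> complex \<Rightarrow> complex" where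
  "aEvv a c k u v x y = - 2 * cpi * y\<^sup>2 * nI * (inverse v)^3 * ((k - cN * c * u)\<^sup>2 + cN\<^sup>2 * c\<^sup>2 * v\<^sup>2)
     + 4 * cpi * y\<^sup>2 * nI * (inverse v)\<^sup>2 * cN\<^sup>2 * c\<^sup>2 * v - 2 * cpi * y\<^sup>2 * nI * inverse v * cN\<^sup>2 * c\<^sup>2"

definition aEx :: "complex \<Rightarrow> complex \<Rightarrow> complex \<Rightarrow> complex \<Rightarrow> complex \<Rightarrow> complex \<Rightarrow> complex \<Rightarrow> complex" where
  "aEx a c k u v x y = 4 * cpi * \<i> * (a - c * x) * (k - cN * c * (u + \<i> * v))"

definition aExx :: "complex \<Rightarrow> complex \<Rightarrow> complex \<Rightarrow> complex \<Rightarrow> complex \<Rightarrow> complex \<Rightarrow> complex \<Rightarrow> complex" where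
  "aExx a c k u v x y = - 4 * cpi * \<i> * c * (k - cN * c * (u + \<i> * v))"

definition aEy :: "complex \<Rightarrow> complex \<Rightarrow> complex \<Rightarrow> complex \<Rightarrow> complex \<Rightarrow> complex \<Rightarrow> complex \<Rightarrow> complex" where
  "aEy a c k u v x y = - 2 * cpi * y * nI * inverse v * ((k - cN * c * u)\<^sup>2 + cN\<^sup>2 * c\<^sup>2 * v\<^sup>2)"

definition aEyy :: "complex \<Rightarrow> complex \<Rightarrow> complex \<Rightarrow> complex \<Rightarrow> complex \<Rightarrow> complex \<Rightarrow> complex \<Rightarrow> complex" where
  "aEyy a c k u v x y = - 2 * cpi * nI * inverse v * ((k - cN * c * u)\<^sup>2 + cN\<^sup>2 * c\<^sup>2 * v\<^sup>2)"

lemmas aE_defs = aEu_def aEv_def aEuu_def aEuv_def aEvv_def aEx_def aExx_def aEy_def aEyy_def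

text \<open>The factor in front of the exponential after differentiating y exp(E). The y comes from
  the Poisson factor and is responsible for the product-rule terms in \<open>Py\<close> and
  \<open>Pyy\<close>.\<close>

fun mult :: "part \<Rightarrow> complex \<Rightarrow> complex \<Rightarrow> complex \<Rightarrow> complex \<Rightarrow> complex \<Rightarrow> complex \<Rightarrow> complex \<Rightarrow> complex" where
  "mult P0 a c k u v x y = y"
| "mult Pu a c k u v x y = y * aEu a c k u v x y"
| "mult Pv a c k u v x y = y * aEv a c k u v x y"
| "mult Puu a c k u v x y = y * (aEuu a c k u v x y + (aEu a c k u v x y)\<^sup>2)"
| "mult Puv a c k u v x y = y * (aEuv a c k u v x y + aEu a c k u v x y * aEv a c k u v x y)"
| "mult Pvv a c k u v x y = y * (aEvv a c k u v x y + (aEv a c k u v x y)\<^sup>2)"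
| "mult Px a c k u v x y = y * aEx a c k u v x y"
| "mult Pxx a c k u v x y = y * (aExx a c k u v x y + (aEx a c k u v x y)\<^sup>2)"
| "mult Py a c k u v x y = 1 + y * aEy a c k u v x y"
| "mult Pyy a c k u v x y = 2 * aEy a c k u v x y + y * aEyy a c k u v x y + y * (aEy a c k u v x y)\<^sup>2"

definition aT :: "part \<Rightarrow> complex \<Rightarrow> complex \<Rightarrow> complex \<Rightarrow> complex \<Rightarrow> complex \<Rightarrow> complex \<Rightarrow> complex \<Rightarrow> complex" where
  "aT p a c k u v x y = mult p a c k u v x y * exp (aE a c k u v x y)"

definition tm :: "part \<Rightarrow> complex \<Rightarrow> complex \<Rightarrow> int \<times> int \<times> int \<Rightarrow> complex" where
  "tm p \<tau> z i = aT p (ca i) (cc i) (ck i) (Re \<tau>) (Im \<tau>) (Re z) (Im z)"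

lemma aE_deriv:
  assumes "v \<noteq> 0"
  shows "((\<lambda>w. aE a c k w v x y) has_field_derivative aEu a c k u v x y) (at u)"
    "((\<lambda>w. aE a c k u w x y) has_field_derivative aEv a c k u v x y) (at v)"
    "((\<lambda>w. aE a c k u v w y) has_field_derivative aEx a c k u v x y) (at x)"
    "((\<lambda>w. aE a c k u v x w) has_field_derivative aEy a c k u v x y) (at y)"
    "((\<lambda>w. aEu a c k w v x y) has_field_derivative aEuu a c k u v x y) (at u)"
    "((\<lambda>w. aEu a c k u w x y) has_field_derivative aEuv a c k u v x y) (at v)"
    "((\<lambda>w. aEv a c k w v x y) has_field_derivative aEuv a c k u v x y) (at u)"
    "((\<lambda>w. aEv a c k u w x y) has_field_derivative aEvv a c k u v x y) (at v)"
    "((\<lambda>w. aEx a c k u v w y) has_field_derivative aExx a c k u v x y) (at x)"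
    "((\<lambda>w. aEy a c k u v x w) has_field_derivative aEyy a c k u v x y) (at y)"
  using assms unfolding aE_def aE_defs
  by (auto intro!: derivative_eq_intros simp: algebra_simps power2_eq_square power3_eq_cube numeral_eq_Suc)

lemma aT_deriv:
  assumes "v \<noteq> 0"
  shows "((\<lambda>w. aT P0 a c k w v x y) has_field_derivative aT Pu a c k u v x y) (at u)"
    "((\<lambda>w. aT P0 a c k u w x y) has_field_derivative aT Pv a c k u v x y) (at v)"
    "((\<lambda>w. aT Pu a c k w v x y) has_field_derivative aT Puu a c k u v x y) (at u)"
    "((\<lambda>w. aT Pu a c k u w x y) has_field_derivative aT Puv a c k u v x y) (at v)"
    "((\<lambda>w. aT Pv a c k w v x y) has_field_derivative aT Puv a c k u v x y) (at u)"
    "((\<lambda>w. aT Pv a c k u w x y) has_field_derivative aT Pvv a c k u v x y) (at v)"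
    "((\<lambda>w. aT P0 a c k u v w y) has_field_derivative aT Px a c k u v x y) (at x)"
    "((\<lambda>w. aT P0 a c k u v x w) has_field_derivative aT Py a c k u v x y) (at y)"
    "((\<lambda>w. aT Px a c k u v w y) has_field_derivative aT Pxx a c k u v x y) (at x)"
    "((\<lambda>w. aT Py a c k u v x w) has_field_derivative aT Pyy a c k u v x y) (at y)"
  unfolding aT_def mult.simps
  by (auto intro!: derivative_eq_intros aE_deriv[OF assms] simp: algebra_simps power2_eq_square)

section \<open>Real partial derivatives of the terms and the heat equation\<close>

lemma has_dir_re_im:
  assumes "((\<lambda>w. G w (complex_of_real (Im z))) has_field_derivative d) (at (complex_of_real (Re z)))"
  shows "has_dir 1 (\<lambda>z. G (complex_of_real (Re z)) (complex_of_real (Im z))) d z"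
proof -
  have "((\<lambda>w. G (complex_of_real (Re z) + w) (complex_of_real (Im z))) has_field_derivative d) (at (complex_of_real 0))"
    using assms DERIV_shift[of "\<lambda>w. G w (complex_of_real (Im z))" d 0 "complex_of_real (Re z)"] by (simp add: add.commute)
  from has_vector_derivative_real_field[OF this] show ?thesis
    by (simp add: has_dir_def)
qed

lemma has_dir_re_im':
  assumes "((\<lambda>w. G (complex_of_real (Re z)) w) has_field_derivative d) (at (complex_of_real (Im z)))"
  shows "has_dir \<i> (\<lambda>z. G (complex_of_real (Re z)) (complex_of_real (Im z))) d z"
proof -
  have "((\<lambda>w. G (complex_of_real (Re z)) (complex_of_real (Im z) + w)) has_field_derivative d) (at (complex_of_real 0))"
    using assms DERIV_shift[of "\<lambda>w. G (complex_of_real (Re z)) w" d 0 "complex_of_real (Im z)"] by (simp add: add.commute)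
  from has_vector_derivative_real_field[OF this] show ?thesis
    by (simp add: has_dir_def)
qed

lemma tm_has_dir:
  assumes "Im \<tau> > 0"
  shows "has_dir 1 (\<lambda>\<tau>. tm P0 \<tau> z i) (tm Pu \<tau> z i) \<tau>" "has_dir \<i> (\<lambda>\<tau>. tm P0 \<tau> z i) (tm Pv \<tau> z i) \<tau>"
    "has_dir 1 (\<lambda>\<tau>. tm Pu \<tau> z i) (tm Puu \<tau> z i) \<tau>" "has_dir \<i> (\<lambda>\<tau>. tm Pu \<tau> z i) (tm Puv \<tau> z i) \<tau>"
    "has_dir 1 (\<lambda>\<tau>. tm Pv \<tau> z i) (tm Puv \<tau> z i) \<tau>" "has_dir \<i> (\<lambda>\<tau>. tm Pv \<tau> z i) (tm Pvv \<tau> z i) \<tau>"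
    "has_dir 1 (\<lambda>z. tm P0 \<tau> z i) (tm Px \<tau> z i) z" "has_dir \<i> (\<lambda>z. tm P0 \<tau> z i) (tm Py \<tau> z i) z"
    "has_dir 1 (\<lambda>z. tm Px \<tau> z i) (tm Pxx \<tau> z i) z" "has_dir \<i> (\<lambda>z. tm Py \<tau> z i) (tm Pyy \<tau> z i) z"
proof -
  have v: "complex_of_real (Im \<tau>) \<noteq> 0" using assms by simp
  show "has_dir 1 (\<lambda>\<tau>. tm P0 \<tau> z i) (tm Pu \<tau> z i) \<tau>" "has_dir 1 (\<lambda>\<tau>. tm Pu \<tau> z i) (tm Puu \<tau> z i) \<tau>"
       "has_dir 1 (\<lambda>\<tau>. tm Pv \<tau> z i) (tm Puv \<tau> z i) \<tau>"
    unfolding tm_def by (rule has_dir_re_im, rule aT_deriv[OF v])+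
  show "has_dir \<i> (\<lambda>\<tau>. tm P0 \<tau> z i) (tm Pv \<tau> z i) \<tau>" "has_dir \<i> (\<lambda>\<tau>. tm Pu \<tau> z i) (tm Puv \<tau> z i) \<tau>"
       "has_dir \<i> (\<lambda>\<tau>. tm Pv \<tau> z i) (tm Pvv \<tau> z i) \<tau>"
    unfolding tm_def by (rule has_dir_re_im', rule aT_deriv[OF v])+
  show "has_dir 1 (\<lambda>z. tm P0 \<tau> z i) (tm Px \<tau> z i) z" "has_dir 1 (\<lambda>z. tm Px \<tau> z i) (tm Pxx \<tau> z i) z"
    unfolding tm_def by (rule has_dir_re_im, rule aT_deriv[OF v])+
  show "has_dir \<i> (\<lambda>z. tm P0 \<tau> z i) (tm Py \<tau> z i) z" "has_dir \<i> (\<lambda>z. tm Py \<tau> z i) (tm Pyy \<tau> z i) z"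
    unfolding tm_def by (rule has_dir_re_im', rule aT_deriv[OF v])+
qed

text \<open>Put W = k - N c \<tau>, with W' its conjugate on real arguments. The derivative of the
  exponent in conjugate \<tau> is a multiple of W^2, its x-derivatives carry the factor W and its
  y-derivatives the factor W W'. Both sides then become polynomials that agree modulo v w = 1, cN nI
  = 1 and i^2 = -1.\<close>

lemma mult_heat:
  fixes a c k u v x y :: complex
  assumes "v \<noteq> 0"
  shows "4 * (- v\<^sup>2 * (mult Puu a c k u v x y + mult Pvv a c k u v x y) + \<i> / 2 * v * (mult Pu a c k u v x y + \<i> * mult Pv a c k u v x y))
     = - y\<^sup>2 * (mult Pxx a c k u v x y + mult Pyy a c k u v x y)"
proof -
  define w where "w = inverse v"
  define P A where "P = k - cN * c * u" and "A = a - c * x"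
  define W W' where "W = P - \<i> * cN * c * v" and "W' = P + \<i> * cN * c * v"
  have w: "v * w = 1" "cN * nI = 1" using assms N by (auto simp: w_def)
  have i: "\<i> * \<i> = (-1::complex)" by simp
  have WW: "P\<^sup>2 + cN\<^sup>2 * c\<^sup>2 * v\<^sup>2 = W * W'" unfolding W_def W'_def using i by algebra
  have F1: "aEu a c k u v x y + \<i> * aEv a c k u v x y = \<i> * cpi * y\<^sup>2 * nI * w\<^sup>2 * W\<^sup>2"
    unfolding aEu_def aEv_def w_def[symmetric] P_def[symmetric] A_def[symmetric] W_def using w(1) i by algebra
  have F2: "aEu a c k u v x y - \<i> * aEv a c k u v x y = 4 * cpi * \<i> * cN * A\<^sup>2 - \<i> * cpi * y\<^sup>2 * nI * w\<^sup>2 * W'\<^sup>2"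
    unfolding aEu_def aEv_def w_def[symmetric] P_def[symmetric] A_def[symmetric] W'_def using w(1) i by algebra
  have F3: "aEuu a c k u v x y + aEvv a c k u v x y = - 2 * cpi * y\<^sup>2 * nI * w^3 * (W * W')"
    unfolding aEuu_def aEvv_def w_def[symmetric] P_def[symmetric] A_def[symmetric] WW[symmetric] using w(1) by algebra
  have F4: "aEx a c k u v x y = 4 * cpi * \<i> * A * W" "aExx a c k u v x y = - 4 * cpi * \<i> * c * W"
    "aEy a c k u v x y = - 2 * cpi * y * nI * w * (W * W')" "aEyy a c k u v x y = - 2 * cpi * nI * w * (W * W')"
    unfolding aEx_def aExx_def aEy_def aEyy_def w_def[symmetric] P_def[symmetric] A_def[symmetric] WW
    by (simp_all add: W_def P_def algebra_simps)
  have W': "W' = W + 2 * \<i> * cN * c * v" by (simp add: W_def W'_def)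
  \<comment> \<open>The product X Z is the sum of the squares of the u- and v-derivatives of the
    exponent; in this form the square terms of \<open>Puu\<close> and \<open>Pvv\<close>
    factor.\<close>
  define X Z where "X = aEu a c k u v x y + \<i> * aEv a c k u v x y" and "Z = aEu a c k u v x y - \<i> * aEv a c k u v x y"
  have "4 * (- v\<^sup>2 * (mult Puu a c k u v x y + mult Pvv a c k u v x y) + \<i> / 2 * v * (mult Pu a c k u v x y + \<i> * mult Pv a c k u v x y))
     = y * (- 4 * v\<^sup>2 * ((aEuu a c k u v x y + aEvv a c k u v x y) + X * Z) + 2 * \<i> * v * X)"
    unfolding mult.simps X_def Z_def by (simp add: field_simps power2_eq_square)
  also have "\<dots> = y * (- 4 * v\<^sup>2 * (- 2 * cpi * y\<^sup>2 * nI * w^3 * (W * W') + (\<i> * cpi * y\<^sup>2 * nI * w\<^sup>2 * W\<^sup>2) * (4 * cpi * \<i> * cN * A\<^sup>2 - \<i> * cpi * y\<^sup>2 * nI * w\<^sup>2 * W'\<^sup>2)) + 2 * \<i> * v * (\<i> * cpi * y\<^sup>2 * nI * w\<^sup>2 * W\<^sup>2))"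
    unfolding X_def Z_def F1 F2 F3 ..
  also have "\<dots> = - y\<^sup>2 * (mult Pxx a c k u v x y + mult Pyy a c k u v x y)"
    unfolding mult.simps F4 W' using w i by algebra
  finally show ?thesis .
qed

lemma tm_heat:
  assumes "Im \<tau> > 0"
  shows "4 * (- (complex_of_real (Im \<tau>))\<^sup>2 * (tm Puu \<tau> z i + tm Pvv \<tau> z i) + \<i> / 2 * complex_of_real (Im \<tau>) * (tm Pu \<tau> z i + \<i> * tm Pv \<tau> z i))
    = - (complex_of_real (Im z))\<^sup>2 * (tm Pxx \<tau> z i + tm Pyy \<tau> z i)"
proof -
  have v: "complex_of_real (Im \<tau>) \<noteq> 0" using assms by simp
  have gen: "4 * (- V\<^sup>2 * (m1 * e + m2 * e) + \<i> / 2 * V * (m3 * e + \<i> * (m4 * e))) = - Y\<^sup>2 * (m5 * e + m6 * e)"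
    if eq: "4 * (- V\<^sup>2 * (m1 + m2) + \<i> / 2 * V * (m3 + \<i> * m4)) = - Y\<^sup>2 * (m5 + m6)" for V Y m1 m2 m3 m4 m5 m6 e :: complex
  proof -
    have "4 * (- V\<^sup>2 * (m1 * e + m2 * e) + \<i> / 2 * V * (m3 * e + \<i> * (m4 * e))) = (4 * (- V\<^sup>2 * (m1 + m2) + \<i> / 2 * V * (m3 + \<i> * m4))) * e"
      by (simp add: algebra_simps)
    also have "\<dots> = - Y\<^sup>2 * (m5 * e + m6 * e)" unfolding eq by (simp add: algebra_simps)
    finally show ?thesis .
  qed
  show ?thesis unfolding tm_def aT_def by (rule gen, rule mult_heat[OF v])
qed

lemma aT_continuous:
  assumes "\<And>\<tau>. \<tau> \<in> S \<Longrightarrow> Im \<tau> \<noteq> 0"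
  shows "continuous_on S (\<lambda>\<tau>. aT p a c k (complex_of_real (Re \<tau>)) (complex_of_real (Im \<tau>)) x y)"
    "continuous_on S' (\<lambda>z. aT p a c k u v (complex_of_real (Re z)) (complex_of_real (Im z)))"
proof -
  show "continuous_on S (\<lambda>\<tau>. aT p a c k (complex_of_real (Re \<tau>)) (complex_of_real (Im \<tau>)) x y)"
    using assms by (cases p) (auto simp: aT_def aE_def aE_defs intro!: continuous_intros)
  show "continuous_on S' (\<lambda>z. aT p a c k u v (complex_of_real (Re z)) (complex_of_real (Im z)))"
    by (cases p) (auto simp: aT_def aE_def aE_defs intro!: continuous_intros)
qed

lemma tm_continuous_tau:
  assumes "\<And>\<tau>. \<tau> \<in> S \<Longrightarrow> Im \<tau> > 0"
  shows "continuous_on S (\<lambda>\<tau>. tm p \<tau> z i)"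
  unfolding tm_def by (rule aT_continuous) (use assms in force)

lemma tm_continuous_z: "continuous_on S (\<lambda>z. tm p \<tau> z i)"
  unfolding tm_def by (rule aT_continuous(2)[of "{}"]) simp

section \<open>Uniform bounds for the terms and their derivatives\<close>

definition sq :: "int \<times> int \<times> int \<Rightarrow> real" where
  "sq i = (of_int (fst i))\<^sup>2 + (of_int (fst (snd i)))\<^sup>2 + (of_int (snd (snd i)))\<^sup>2"

text \<open>The indices with c = k = 0. They are the ones for which |k - N c \<tau>| vanishes, so
  their exponent does not decay in y.\<close>

definition lead :: "int \<times> int \<times> int \<Rightarrow> bool" where
  "lead i \<longleftrightarrow> fst (snd i) = 0 \<and> snd (snd i) = 0"

lemma sq_nonneg: "sq i \<ge> 0" by (simp add: sq_def)

text \<open>The weight \<epsilon> is free: a small value makes the loss \<epsilon> q^2 absorbable by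
  another positive term, at the price of a smaller share of p^2.\<close>

lemma quadratic_lower:
  fixes p q \<epsilon> :: real
  assumes "0 \<le> \<epsilon>" "\<epsilon> \<le> 1"
  shows "(p - q)\<^sup>2 \<ge> \<epsilon> * (p\<^sup>2 / 2 - q\<^sup>2)"
proof -
  have "0 \<le> (p / 2 - q)\<^sup>2 * 2" by simp
  then have "p\<^sup>2 / 2 - q\<^sup>2 \<le> (p - q)\<^sup>2" by (simp add: power2_eq_square field_simps)
  then have "\<epsilon> * (p\<^sup>2 / 2 - q\<^sup>2) \<le> \<epsilon> * (p - q)\<^sup>2" using assms(1) by (rule mult_left_mono)
  also have "\<dots> \<le> 1 * (p - q)\<^sup>2" by (rule mult_right_mono) (use assms in auto)
  finally show ?thesis by simp
qed

text \<open>The n-th power of 1 + t \<le> (n / \<eta>) exp(\<eta> (1 + t) / n).\<close>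

lemma power_le_exp:
  fixes \<eta> :: real
  assumes "\<eta> > 0" "n > 0"
  obtains C where "C > 0" "\<And>t. t \<ge> 0 \<Longrightarrow> (1 + t) ^ n \<le> C * exp (\<eta> * t)"
proof (rule that[of "(n / \<eta>) ^ n * exp \<eta>"])
  show "(n / \<eta>) ^ n * exp \<eta> > 0" using assms by simp
  fix t :: real assume t: "t \<ge> 0"
  have "\<eta> * (1 + t) / n \<le> exp (\<eta> * (1 + t) / n)" using exp_ge_add_one_self[of "\<eta> * (1 + t) / n"] by linarith
  then have "1 + t \<le> n / \<eta> * exp (\<eta> * (1 + t) / n)" using assms by (simp add: field_simps)
  then have "(1 + t) ^ n \<le> (n / \<eta> * exp (\<eta> * (1 + t) / n)) ^ n" using t by (intro power_mono) auto
  also have "\<dots> = (n / \<eta>) ^ n * exp (\<eta> * (1 + t) / n) ^ n" by (rule power_mult_distrib)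
  also have "exp (\<eta> * (1 + t) / n) ^ n = exp (\<eta> * (1 + t))"
    using assms by (simp add: exp_of_nat_mult[symmetric])
  finally show "(1 + t) ^ n \<le> (n / \<eta>) ^ n * exp \<eta> * exp (\<eta> * t)" by (simp add: distrib_left exp_add)
qed

text \<open>The real part of the exponent is - 2 \<pi> N v (a - c x)^2 - \<pi> y^2 |k - N c
  \<tau>|^2 / (N v), negative definite in (a, c, k). The cross terms with c x and c u are absorbed
  with weights that depend only on the box for \<tau> and the strip for z.\<close>

lemma exponent_bound:
  assumes "v0 > 0" "v0 \<le> V" "y0 > 0"
  obtains \<delta> where "\<delta> > 0"
    "\<And>u v x y i. \<bar>u\<bar> \<le> U \<Longrightarrow> v0 \<le> v \<Longrightarrow> v \<le> V \<Longrightarrow> \<bar>x\<bar> \<le> x0 \<Longrightarrow> y0 \<le> y \<Longrightarrow>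
      norm (exp (aE (ca i) (cc i) (ck i) (complex_of_real u) (complex_of_real v) (complex_of_real x) (complex_of_real y)))
        \<le> exp (- \<delta> * sq i - (if lead i then 0 else \<delta> * y\<^sup>2))"
proof -
  \<comment> \<open>Small enough that the loss \<epsilon>1 (N c u)^2 uses at most half of N^2 c^2
    v0^2.\<close>
  define \<epsilon>1 where "\<epsilon>1 = min 1 (v0\<^sup>2 / (2 * (U\<^sup>2 + 1)))"
  have Upos: "U\<^sup>2 + 1 > 0" "x0\<^sup>2 + 1 > 0" by (simp_all add: add_nonneg_pos)
  have \<epsilon>1: "0 < \<epsilon>1" "\<epsilon>1 \<le> 1" using assms Upos by (auto simp: \<epsilon>1_def)
  have \<epsilon>1': "\<epsilon>1 * U\<^sup>2 \<le> v0\<^sup>2 / 2"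
  proof -
    have "\<epsilon>1 * U\<^sup>2 \<le> \<epsilon>1 * (U\<^sup>2 + 1)" using \<epsilon>1 by (intro mult_left_mono) auto
    also have "\<dots> \<le> v0\<^sup>2 / (2 * (U\<^sup>2 + 1)) * (U\<^sup>2 + 1)" using Upos by (intro mult_right_mono) (auto simp: \<epsilon>1_def)
    also have "\<dots> = v0\<^sup>2 / 2" using Upos by (simp add: field_simps)
    finally show ?thesis .
  qed
  \<comment> \<open>The constant with |k - N c \<tau>|^2 \<ge> \<delta>1 (n^2 + k^2) in terms of the
    integer indices.\<close>
  define \<delta>1 where "\<delta>1 = min (\<epsilon>1 / (2 * \<beta>\<^sup>2)) (N\<^sup>2 * v0\<^sup>2 / (2 * D\<^sup>2))"
  have \<delta>1: "\<delta>1 > 0" using \<epsilon>1 \<beta> N D assms by (auto simp: \<delta>1_def)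
  define g where "g = pi * \<delta>1 / (N * V)"
  have g: "g > 0" using \<delta>1 N assms by (auto simp: g_def)
  \<comment> \<open>Small enough that the loss from c x costs at most g y0^2 n^2 / 4, a quarter of
    what the y-part of the exponent provides.\<close>
  define \<epsilon>2 where "\<epsilon>2 = min 1 (g * y0\<^sup>2 * D\<^sup>2 / (8 * pi * N * v0 * (x0\<^sup>2 + 1)))"
  have \<epsilon>2: "0 < \<epsilon>2" "\<epsilon>2 \<le> 1" using assms Upos g D N by (auto simp: \<epsilon>2_def)
  have \<epsilon>2': "2 * pi * N * v0 * \<epsilon>2 * x0\<^sup>2 / D\<^sup>2 \<le> g * y0\<^sup>2 / 4"
  proof -
    have "\<epsilon>2 * x0\<^sup>2 \<le> \<epsilon>2 * (x0\<^sup>2 + 1)" using \<epsilon>2 by (intro mult_left_mono) auto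
    also have "\<dots> \<le> g * y0\<^sup>2 * D\<^sup>2 / (8 * pi * N * v0 * (x0\<^sup>2 + 1)) * (x0\<^sup>2 + 1)"
      using Upos by (intro mult_right_mono) (auto simp: \<epsilon>2_def)
    also have "\<dots> = g * y0\<^sup>2 * D\<^sup>2 / (8 * pi * N * v0)" using Upos by simp
    finally have "(2 * pi * N * v0 / D\<^sup>2) * (\<epsilon>2 * x0\<^sup>2) \<le> (2 * pi * N * v0 / D\<^sup>2) * (g * y0\<^sup>2 * D\<^sup>2 / (8 * pi * N * v0))"
      using N assms by (intro mult_left_mono) auto
    also have "\<dots> = g * y0\<^sup>2 / 4" using N assms D by (simp add: field_simps)
    finally show ?thesis by (simp add: mult_ac)
  qed
  define \<delta> where "\<delta> = min (pi * N * v0 * \<epsilon>2 / D\<^sup>2) (g * min (y0\<^sup>2 / 4) (1 / 2))"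
  have \<delta>: "\<delta> > 0" using assms N D \<epsilon>2 g by (auto simp: \<delta>_def)
  have \<delta>_le: "\<delta> \<le> pi * N * v0 * \<epsilon>2 / D\<^sup>2" "\<delta> \<le> g * y0\<^sup>2 / 4" "\<delta> \<le> g / 2"
  proof -
    have "g * min (y0\<^sup>2 / 4) (1 / 2) \<le> g * (y0\<^sup>2 / 4)" "g * min (y0\<^sup>2 / 4) (1 / 2) \<le> g * (1 / 2)"
      using g by (intro mult_left_mono; simp)+
    then show "\<delta> \<le> pi * N * v0 * \<epsilon>2 / D\<^sup>2" "\<delta> \<le> g * y0\<^sup>2 / 4" "\<delta> \<le> g / 2"
      unfolding \<delta>_def by linarith+
  qed
  show ?thesis
  proof (rule that[OF \<delta>])
    fix u v x y :: real and i :: "int \<times> int \<times> int"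
    assume b: "\<bar>u\<bar> \<le> U" "v0 \<le> v" "v \<le> V" "\<bar>x\<bar> \<le> x0" "y0 \<le> y"
    obtain m n k where i: "i = (m, n, k)" by (cases i) auto
    define m' n' k' :: real where "m' = (of_int m)\<^sup>2" and "n' = (of_int n)\<^sup>2" and "k' = (of_int k)\<^sup>2"
    have pos: "m' \<ge> 0" "n' \<ge> 0" "k' \<ge> 0" by (simp_all add: m'_def n'_def k'_def)
    define a c \<kappa> :: real where "a = of_int m / D" and "c = of_int n / D" and "\<kappa> = of_int k / \<beta>"
    have sq2: "u\<^sup>2 \<le> U\<^sup>2" "x\<^sup>2 \<le> x0\<^sup>2" "v0\<^sup>2 \<le> v\<^sup>2" "y0\<^sup>2 \<le> y\<^sup>2"
      using b assms abs_le_square_iff[of u U] abs_le_square_iff[of x x0] abs_le_square_iff[of v0 v] abs_le_square_iff[of y0 y] by auto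
    have ac: "a\<^sup>2 = m' / D\<^sup>2" "c\<^sup>2 = n' / D\<^sup>2" "\<kappa>\<^sup>2 = k' / \<beta>\<^sup>2"
      by (simp_all add: a_def c_def \<kappa>_def m'_def n'_def k'_def power_divide)
    have v: "v > 0" using b assms by simp
    define W where "W = (\<kappa> - N * c * u)\<^sup>2 + N\<^sup>2 * c\<^sup>2 * v\<^sup>2"
    have W: "W \<ge> \<delta>1 * (n' + k')"
    proof -
      have "W \<ge> \<epsilon>1 * (\<kappa>\<^sup>2 / 2 - (N * c * u)\<^sup>2) + N\<^sup>2 * c\<^sup>2 * v0\<^sup>2"
        unfolding W_def using quadratic_lower[of \<epsilon>1 \<kappa> "N * c * u"] \<epsilon>1 sq2(3) by (intro add_mono mult_left_mono) auto
      moreover have "\<epsilon>1 * (N * c * u)\<^sup>2 \<le> N\<^sup>2 * c\<^sup>2 * (v0\<^sup>2 / 2)"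
      proof -
        have "\<epsilon>1 * u\<^sup>2 \<le> v0\<^sup>2 / 2" using mult_left_mono[OF sq2(1), of \<epsilon>1] \<epsilon>1 \<epsilon>1' by linarith
        from mult_left_mono[OF this, of "N\<^sup>2 * c\<^sup>2"] show ?thesis by (simp add: power_mult_distrib mult_ac)
      qed
      ultimately have "W \<ge> \<epsilon>1 / 2 * \<kappa>\<^sup>2 + N\<^sup>2 * v0\<^sup>2 / 2 * c\<^sup>2" by (simp add: algebra_simps)
      moreover have "\<epsilon>1 / 2 * \<kappa>\<^sup>2 = (\<epsilon>1 / (2 * \<beta>\<^sup>2)) * k'" "N\<^sup>2 * v0\<^sup>2 / 2 * c\<^sup>2 = (N\<^sup>2 * v0\<^sup>2 / (2 * D\<^sup>2)) * n'"
        by (simp_all add: ac)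
      moreover have "(\<epsilon>1 / (2 * \<beta>\<^sup>2)) * k' \<ge> \<delta>1 * k'" "(N\<^sup>2 * v0\<^sup>2 / (2 * D\<^sup>2)) * n' \<ge> \<delta>1 * n'"
        unfolding \<delta>1_def by (rule mult_right_mono[OF min.cobounded1 pos(3)], rule mult_right_mono[OF min.cobounded2 pos(2)])
      ultimately show ?thesis by (simp only: distrib_left)
    qed
    have A: "2 * pi * N * v * (a - c * x)\<^sup>2 \<ge> pi * N * v0 * \<epsilon>2 / D\<^sup>2 * m' - g * y0\<^sup>2 / 4 * n'"
    proof -
      have "2 * pi * N * v * (a - c * x)\<^sup>2 \<ge> 2 * pi * N * v0 * (\<epsilon>2 * (a\<^sup>2 / 2 - (c * x)\<^sup>2))"
      proof -
        have "2 * pi * N * v0 * (\<epsilon>2 * (a\<^sup>2 / 2 - (c * x)\<^sup>2)) \<le> 2 * pi * N * v0 * (a - c * x)\<^sup>2"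
          using quadratic_lower[of \<epsilon>2 a "c * x"] \<epsilon>2 N assms by (intro mult_left_mono) auto
        also have "\<dots> \<le> 2 * pi * N * v * (a - c * x)\<^sup>2"
          using b N by (intro mult_right_mono mult_left_mono) auto
        finally show ?thesis .
      qed
      moreover have "2 * pi * N * v0 * \<epsilon>2 * (c * x)\<^sup>2 \<le> g * y0\<^sup>2 / 4 * n'"
      proof -
        have "2 * pi * N * v0 * \<epsilon>2 * (c * x)\<^sup>2 = (2 * pi * N * v0 * \<epsilon>2 / D\<^sup>2 * n') * x\<^sup>2"
          by (simp add: power_mult_distrib ac mult_ac)
        also have "\<dots> \<le> (2 * pi * N * v0 * \<epsilon>2 / D\<^sup>2 * n') * x0\<^sup>2"
          using sq2(2) N assms \<epsilon>2 pos by (intro mult_left_mono) auto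
        also have "\<dots> = (2 * pi * N * v0 * \<epsilon>2 * x0\<^sup>2 / D\<^sup>2) * n'" by simp
        also have "\<dots> \<le> g * y0\<^sup>2 / 4 * n'" by (intro mult_right_mono \<epsilon>2' pos)
        finally show ?thesis .
      qed
      moreover have "2 * pi * N * v0 * (\<epsilon>2 * (a\<^sup>2 / 2 - (c * x)\<^sup>2)) = pi * N * v0 * \<epsilon>2 / D\<^sup>2 * m' - 2 * pi * N * v0 * \<epsilon>2 * (c * x)\<^sup>2"
        by (simp add: ac algebra_simps)
      ultimately show ?thesis by linarith
    qed
    have Wy: "pi * y\<^sup>2 / (N * v) * W \<ge> g * y\<^sup>2 * (n' + k')"
    proof -
      have "g * y\<^sup>2 * (n' + k') = pi * y\<^sup>2 / (N * V) * (\<delta>1 * (n' + k'))" by (simp add: g_def)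
      also have "\<dots> \<le> pi * y\<^sup>2 / (N * v) * W"
        using W b N v pos \<delta>1 by (intro mult_mono divide_left_mono mult_left_mono) auto
      finally show ?thesis .
    qed
    \<comment> \<open>One half of the y-part is frozen at y0 and pays for the loss from c x and for
      the share of \<delta> \<open>sq i\<close> in n and k. The other half keeps its y^2, and a
      nonleading index has n^2 + k^2 \<ge> 1.\<close>
    have gy: "g * y\<^sup>2 * (n' + k') \<ge> g * y0\<^sup>2 / 2 * (n' + k') + g / 2 * y\<^sup>2 * (n' + k')"
    proof -
      have gen: "A \<le> B \<Longrightarrow> (A + B) / 2 \<le> B" for A B :: real by simp
      have le: "g * (n' + k') * y0\<^sup>2 \<le> g * (n' + k') * y\<^sup>2" using sq2(4) g pos by (intro mult_left_mono) auto
      have e1: "g * y0\<^sup>2 / 2 * (n' + k') + g / 2 * y\<^sup>2 * (n' + k') = (g * (n' + k') * y0\<^sup>2 + g * (n' + k') * y\<^sup>2) / 2"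
        by (simp add: field_simps)
      have e2: "g * y\<^sup>2 * (n' + k') = g * (n' + k') * y\<^sup>2" by simp
      show ?thesis unfolding e1 unfolding e2 by (rule gen[OF le])
    qed
    have nk: "(if lead i then 0 else \<delta> * y\<^sup>2) \<le> g / 2 * y\<^sup>2 * (n' + k')"
    proof (cases "lead i")
      case False
      then have "n \<noteq> 0 \<or> k \<noteq> 0" by (simp add: lead_def i)
      then have "n\<^sup>2 + k\<^sup>2 \<ge> 1" by (smt (verit) zero_less_power2 zero_le_power2)
      then have "n' + k' \<ge> 1" unfolding n'_def k'_def by (metis of_int_1_le_iff of_int_add of_int_power)
      then have "\<delta> * y\<^sup>2 * 1 \<le> g / 2 * y\<^sup>2 * (n' + k')"
        using g \<delta>_le(3) by (intro mult_mono mult_right_mono) auto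
      with False show ?thesis by simp
    qed (use g pos in auto)
    define G where "G = g * y0\<^sup>2 / 4"
    have f: "\<delta> * m' \<le> pi * N * v0 * \<epsilon>2 / D\<^sup>2 * m'" "\<delta> * n' \<le> G * n'" "\<delta> * k' \<le> G * k'" "G * k' \<ge> 0"
      using mult_right_mono[OF \<delta>_le(1) pos(1)] mult_right_mono[OF \<delta>_le(2) pos(2)] mult_right_mono[OF \<delta>_le(2) pos(3)] g pos
      unfolding G_def by (simp_all only:) simp
    have f5: "g * y0\<^sup>2 / 2 * (n' + k') = 2 * (G * n') + 2 * (G * k')" by (simp add: G_def field_simps)
    have f7: "\<delta> * sq i = \<delta> * m' + \<delta> * n' + \<delta> * k'"
      by (simp add: sq_def i m'_def n'_def k'_def distrib_left)
    have gen: "\<delta>m + \<delta>n + \<delta>k + ee \<le> Aa + Ww"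
      if "Km - Gn \<le> Aa" "T \<le> Ww" "2 * Gn + 2 * Gk + Rr \<le> T" "ee \<le> Rr" "\<delta>m \<le> Km" "\<delta>n \<le> Gn" "\<delta>k \<le> Gk" "0 \<le> Gk"
      for Aa Ww Km Gn T Gk Rr ee \<delta>m \<delta>n \<delta>k :: real
      using that by linarith
    have main: "\<delta> * sq i + (if lead i then 0 else \<delta> * y\<^sup>2) \<le> 2 * pi * N * v * (a - c * x)\<^sup>2 + pi * y\<^sup>2 / (N * v) * W"
      unfolding f7 by (rule gen[OF A[folded G_def] Wy gy[unfolded f5] nk f])
    have "aE (ca i) (cc i) (ck i) (complex_of_real u) (complex_of_real v) (complex_of_real x) (complex_of_real y)
      = of_real (- (2 * pi * N * v * (a - c * x)\<^sup>2 + pi * y\<^sup>2 / (N * v) * W))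
        + \<i> * of_real (2 * pi * N * (a - c * x)\<^sup>2 * u + 2 * pi * \<kappa> * (2 * a * x - c * x\<^sup>2))"
      by (simp add: aE_def i a_def c_def \<kappa>_def W_def divide_inverse algebra_simps)
    then have "norm (exp (aE (ca i) (cc i) (ck i) (complex_of_real u) (complex_of_real v) (complex_of_real x) (complex_of_real y)))
      = exp (- (2 * pi * N * v * (a - c * x)\<^sup>2 + pi * y\<^sup>2 / (N * v) * W))"
      by simp
    also have "\<dots> \<le> exp (- \<delta> * sq i - (if lead i then 0 else \<delta> * y\<^sup>2))"
      using main by simp
    finally show "norm (exp (aE (ca i) (cc i) (ck i) (complex_of_real u) (complex_of_real v) (complex_of_real x) (complex_of_real y)))
        \<le> exp (- \<delta> * sq i - (if lead i then 0 else \<delta> * y\<^sup>2))" .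
  qed
qed

text \<open>A deliberately crude polynomial bound, uniform in the kind of derivative. A mechanical
  calculus of exponents suffices, because an exponential absorbs the polynomial afterwards.\<close>

lemma mult_bound:
  assumes "v0 > 0" "v0 \<le> V"
  obtains B where "B > 0"
    "\<And>p u v x y i. \<bar>u\<bar> \<le> U \<Longrightarrow> v0 \<le> v \<Longrightarrow> v \<le> V \<Longrightarrow> \<bar>x\<bar> \<le> x0 \<Longrightarrow> 0 \<le> y \<Longrightarrow>
      norm (mult p (ca i) (cc i) (ck i) (complex_of_real u) (complex_of_real v) (complex_of_real x) (complex_of_real y))
        \<le> B * (1 + sq i) ^ 4 * (1 + y) ^ 5"
proof -
  define b where "b = 13 + 1 / D + 1 / \<beta> + V + inverse v0 + N + inverse N + \<bar>U\<bar> + \<bar>x0\<bar>"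
  have pos: "1 / D > 0" "1 / \<beta> > 0" "V > 0" "inverse v0 > 0" "N > 0" "inverse N > 0" "\<bar>U\<bar> \<ge> 0" "\<bar>x0\<bar> \<ge> 0"
    using N D \<beta> assms by auto
  have b: "b \<ge> 13" "1 / D \<le> b" "1 / \<beta> \<le> b" "V \<le> b" "inverse v0 \<le> b" "N \<le> b" "inverse N \<le> b" "\<bar>U\<bar> \<le> b" "\<bar>x0\<bar> \<le> b"
    unfolding b_def using pos by linarith+
  show ?thesis
  proof (rule that[of "b ^ 70"])
    show "b ^ 70 > 0" using b(1) by simp
    fix p :: part and u v x y :: real and i :: "int \<times> int \<times> int"
    assume h: "\<bar>u\<bar> \<le> U" "v0 \<le> v" "v \<le> V" "\<bar>x\<bar> \<le> x0" "0 \<le> y"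
    define \<rho> Y where "\<rho> = 1 + sq i" and "Y = 1 + y"
    have \<rho>Y: "\<rho> \<ge> 1" "Y \<ge> 1" using h sq_nonneg[of i] by (auto simp: \<rho>_def Y_def)
    \<comment> \<open>Three exponents are tracked: of the constants, of the index and of the height.
      Products add them; a sum takes the maxima at the cost of one more power of b, which exceeds
      2.\<close>
    define bd where "bd X j k l \<longleftrightarrow> norm X \<le> b ^ j * \<rho> ^ k * Y ^ l" for X :: complex and j k l :: nat
    have bd_mult: "bd (X * Z) (j + j') (k + k') (l + l')" if "bd X j k l" "bd Z j' k' l'" for X Z j k l j' k' l'
    proof -
      have "norm (X * Z) \<le> (b ^ j * \<rho> ^ k * Y ^ l) * (b ^ j' * \<rho> ^ k' * Y ^ l')"
        unfolding norm_mult using that b(1) \<rho>Y by (intro mult_mono) (auto simp: bd_def)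
      then show ?thesis by (simp add: bd_def power_add mult_ac)
    qed
    have bd_weak: "bd X j' k' l'" if "bd X j k l" "j \<le> j'" "k \<le> k'" "l \<le> l'" for X j k l j' k' l'
    proof -
      have "b ^ j * \<rho> ^ k * Y ^ l \<le> b ^ j' * \<rho> ^ k' * Y ^ l'"
        using that b(1) \<rho>Y by (intro mult_mono power_increasing) auto
      then show ?thesis using that(1) by (simp add: bd_def)
    qed
    have bd_add: "bd (X + Z) (max j j' + 1) (max k k') (max l l')" if "bd X j k l" "bd Z j' k' l'" for X Z j k l j' k' l'
    proof -
      have "norm (X + Z) \<le> 2 * (b ^ max j j' * \<rho> ^ max k k' * Y ^ max l l')"
        using bd_weak[OF that(1), of "max j j'" "max k k'" "max l l'"] bd_weak[OF that(2), of "max j j'" "max k k'" "max l l'"]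
          norm_triangle_ineq[of X Z] by (simp add: bd_def)
      also have "\<dots> \<le> b * (b ^ max j j' * \<rho> ^ max k k' * Y ^ max l l')"
        using b(1) \<rho>Y by (intro mult_right_mono) auto
      finally show ?thesis by (simp add: bd_def mult_ac)
    qed
    have bd_minus: "bd (- X) j k l" if "bd X j k l" for X j k l using that by (simp add: bd_def)
    have bd_diff: "bd (X - Z) (max j j' + 1) (max k k') (max l l')" if "bd X j k l" "bd Z j' k' l'" for X Z j k l j' k' l'
      using bd_add[OF that(1) bd_minus[OF that(2)]] by simp
    have bd_sq: "bd (X\<^sup>2) (j + j) (k + k) (l + l)" if "bd X j k l" for X j k l
      unfolding power2_eq_square by (rule bd_mult[OF that that])
    have bd_cube: "bd (X^3) (j + j + j) (k + k + k) (l + l + l)" if "bd X j k l" for X j k l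
      unfolding power3_eq_cube by (rule bd_mult[OF bd_mult[OF that that] that])
    have int_le: "\<bar>real_of_int m\<bar> \<le> 1 + (real_of_int m)\<^sup>2" for m :: int
    proof -
      have "0 \<le> (\<bar>real_of_int m\<bar> - 1)\<^sup>2" by simp
      then show ?thesis unfolding power2_diff by simp
    qed
    have abc: "bd (ca i) 1 1 0" "bd (cc i) 1 1 0" "bd (ck i) 1 1 0"
    proof -
      have s: "\<bar>of_int (fst i)\<bar> \<le> \<rho>" "\<bar>of_int (fst (snd i))\<bar> \<le> \<rho>" "\<bar>of_int (snd (snd i))\<bar> \<le> \<rho>"
        using int_le[of "fst i"] int_le[of "fst (snd i)"] int_le[of "snd (snd i)"]
          zero_le_power2[of "real_of_int (fst i)"] zero_le_power2[of "real_of_int (fst (snd i))"] zero_le_power2[of "real_of_int (snd (snd i))"]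
        unfolding \<rho>_def sq_def by linarith+
      have "\<bar>ca i\<bar> \<le> b * \<rho>" "\<bar>cc i\<bar> \<le> b * \<rho>" "\<bar>ck i\<bar> \<le> b * \<rho>"
        using mult_mono[OF b(2) s(1)] mult_mono[OF b(2) s(2)] mult_mono[OF b(3) s(3)] b(1) D \<beta> by (auto simp: abs_divide)
      then show "bd (ca i) 1 1 0" "bd (cc i) 1 1 0" "bd (ck i) 1 1 0" by (simp_all add: bd_def del: of_real_divide)
    qed
    have iv: "inverse v \<le> inverse v0" "v > 0" using h assms by (auto intro: le_imp_inverse_le)
    have base: "bd (complex_of_real u) 1 0 0" "bd (complex_of_real v) 1 0 0" "bd (complex_of_real x) 1 0 0" "bd (complex_of_real y) 0 0 1"
      "bd (inverse (complex_of_real v)) 1 0 0" "bd cN 1 0 0" "bd nI 1 0 0" "bd \<i> 0 0 0" "bd 1 0 0 0" "bd 2 1 0 0" "bd 4 1 0 0" "bd cpi 1 0 0"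
      using h b iv order_trans[OF iv(1) b(5)] N assms pi_less_4 pi_gt_zero
      by (auto simp: bd_def Y_def norm_inverse)
    define E where "E g = g (complex_of_real (ca i)) (complex_of_real (cc i)) (complex_of_real (ck i)) (complex_of_real u) (complex_of_real v) (complex_of_real x) (complex_of_real y)"
      for g :: "complex \<Rightarrow> complex \<Rightarrow> complex \<Rightarrow> complex \<Rightarrow> complex \<Rightarrow> complex \<Rightarrow> complex \<Rightarrow> complex"
    note rl = bd_mult bd_sq bd_cube bd_add bd_diff bd_minus base abc
    \<comment> \<open>The exponent 30 is a generous cap. What matters is degree 2 in \<rho> and in
      Y: squaring and the factor y in \<open>mult\<close> then lead to the degrees 4 and 5.\<close>
    have "bd (E aEu) 30 2 2" unfolding E_def aE_defs by (rule bd_weak, (rule rl)+) simp_all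
    moreover have "bd (E aEv) 30 2 2" unfolding E_def aE_defs by (rule bd_weak, (rule rl)+) simp_all
    moreover have "bd (E aEuu) 30 2 2" unfolding E_def aE_defs by (rule bd_weak, (rule rl)+) simp_all
    moreover have "bd (E aEuv) 30 2 2" unfolding E_def aE_defs by (rule bd_weak, (rule rl)+) simp_all
    moreover have "bd (E aEvv) 30 2 2" unfolding E_def aE_defs by (rule bd_weak, (rule rl)+) simp_all
    moreover have "bd (E aEx) 30 2 2" unfolding E_def aE_defs by (rule bd_weak, (rule rl)+) simp_all
    moreover have "bd (E aExx) 30 2 2" unfolding E_def aE_defs by (rule bd_weak, (rule rl)+) simp_all
    moreover have "bd (E aEy) 30 2 2" unfolding E_def aE_defs by (rule bd_weak, (rule rl)+) simp_all
    moreover have "bd (E aEyy) 30 2 2" unfolding E_def aE_defs by (rule bd_weak, (rule rl)+) simp_all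
    ultimately have Es: "bd (E aEu) 30 2 2" "bd (E aEv) 30 2 2" "bd (E aEuu) 30 2 2" "bd (E aEuv) 30 2 2" "bd (E aEvv) 30 2 2"
       "bd (E aEx) 30 2 2" "bd (E aExx) 30 2 2" "bd (E aEy) 30 2 2" "bd (E aEyy) 30 2 2" by blast+
    have "bd (E (mult p)) 70 4 5"
      by (cases p; simp only: E_def mult.simps; rule bd_weak, (rule bd_mult bd_sq bd_add base Es[unfolded E_def])+; simp)
    then show "norm (mult p (ca i) (cc i) (ck i) (complex_of_real u) (complex_of_real v) (complex_of_real x) (complex_of_real y))
        \<le> b ^ 70 * (1 + sq i) ^ 4 * (1 + y) ^ 5"
      by (simp add: bd_def E_def \<rho>_def Y_def)
  qed
qed

text \<open>Half of the Gaussian in the index pays for (1 + sq i)^4. Off the leading indices, half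
  of the Gaussian in y pays for (1 + y)^5; a leading index keeps this power, having no decay in y to
  spend.\<close>

lemma tm_bound:
  assumes "v0 > 0" "v0 \<le> V" "y0 > 0"
  obtains C \<delta> where "C > 0" "\<delta> > 0"
    "\<And>p \<tau> z i. \<bar>Re \<tau>\<bar> \<le> U \<Longrightarrow> v0 \<le> Im \<tau> \<Longrightarrow> Im \<tau> \<le> V \<Longrightarrow> \<bar>Re z\<bar> \<le> x0 \<Longrightarrow> y0 \<le> Im z \<Longrightarrow>
      norm (tm p \<tau> z i) \<le> C * exp (- \<delta> * sq i) * (if lead i then (1 + Im z) ^ 5 else exp (- \<delta> * (Im z)\<^sup>2))"
proof -
  obtain B where B: "B > 0"
    "\<And>p u v x y i. \<bar>u\<bar> \<le> U \<Longrightarrow> v0 \<le> v \<Longrightarrow> v \<le> V \<Longrightarrow> \<bar>x\<bar> \<le> x0 \<Longrightarrow> 0 \<le> y \<Longrightarrow>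
      norm (mult p (ca i) (cc i) (ck i) (complex_of_real u) (complex_of_real v) (complex_of_real x) (complex_of_real y))
        \<le> B * (1 + sq i) ^ 4 * (1 + y) ^ 5"
    by (rule mult_bound[OF assms(1,2), of U x0]) blast
  obtain \<delta> where \<delta>: "\<delta> > 0"
    "\<And>u v x y i. \<bar>u\<bar> \<le> U \<Longrightarrow> v0 \<le> v \<Longrightarrow> v \<le> V \<Longrightarrow> \<bar>x\<bar> \<le> x0 \<Longrightarrow> y0 \<le> y \<Longrightarrow>
      norm (exp (aE (ca i) (cc i) (ck i) (complex_of_real u) (complex_of_real v) (complex_of_real x) (complex_of_real y)))
        \<le> exp (- \<delta> * sq i - (if lead i then 0 else \<delta> * y\<^sup>2))"
    by (rule exponent_bound[OF assms, of U x0]) blast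
  obtain C1 where C1: "C1 > 0" "\<And>t. t \<ge> 0 \<Longrightarrow> (1 + t) ^ 4 \<le> C1 * exp (\<delta> / 2 * t)"
    using power_le_exp[of "\<delta> / 2" 4] \<delta>(1) by auto
  obtain C2 where C2: "C2 > 0" "\<And>t. t \<ge> 0 \<Longrightarrow> (1 + t) ^ 5 \<le> C2 * exp (\<delta> / 2 * t)"
    using power_le_exp[of "\<delta> / 2" 5] \<delta>(1) by auto
  define C3 where "C3 = max 1 (C2 * exp (\<delta> / 2))"
  show ?thesis
  proof (rule that[of "B * C1 * C3" "\<delta> / 2"])
    show "B * C1 * C3 > 0" using B C1 by (auto simp: C3_def)
    fix p \<tau> z i
    assume h: "\<bar>Re \<tau>\<bar> \<le> U" "v0 \<le> Im \<tau>" "Im \<tau> \<le> V" "\<bar>Re z\<bar> \<le> x0" "y0 \<le> Im z"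
    define y where "y = Im z"
    have y: "y > 0" using h assms by (simp add: y_def)
    define e where "e = (if lead i then 0 else \<delta> * y\<^sup>2)"
    have Y5: "(1 + y) ^ 5 * exp (- e) \<le> C3 * (if lead i then (1 + y) ^ 5 else exp (- (\<delta> / 2) * y\<^sup>2))"
    proof (cases "lead i")
      case True
      have "1 * (1 + y) ^ 5 \<le> C3 * (1 + y) ^ 5" using y by (intro mult_right_mono) (auto simp: C3_def)
      then show ?thesis using True by (simp add: e_def)
    next
      case False
      have "0 \<le> (y - 1)\<^sup>2" by simp
      then have "y \<le> 1 + y\<^sup>2" using y by (simp add: power2_diff)
      then have "\<delta> / 2 * y \<le> \<delta> / 2 * (1 + y\<^sup>2)" using \<delta> by (intro mult_left_mono) auto
      then have le: "exp (\<delta> / 2 * y) \<le> exp (\<delta> / 2) * exp (\<delta> / 2 * y\<^sup>2)"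
        by (simp add: exp_add[symmetric] distrib_left)
      have "(1 + y) ^ 5 \<le> C2 * exp (\<delta> / 2 * y)" using C2(2)[of y] y by simp
      also have "\<dots> \<le> C2 * (exp (\<delta> / 2) * exp (\<delta> / 2 * y\<^sup>2))" using le C2 by (intro mult_left_mono) auto
      also have "\<dots> \<le> C3 * exp (\<delta> / 2 * y\<^sup>2)" unfolding mult.assoc[symmetric] by (intro mult_right_mono) (auto simp: C3_def)
      finally have "(1 + y) ^ 5 * exp (- e) \<le> (C3 * exp (\<delta> / 2 * y\<^sup>2)) * exp (- e)" by (intro mult_right_mono) auto
      also have "\<dots> = C3 * exp (- (\<delta> / 2) * y\<^sup>2)" using False by (simp add: e_def exp_add[symmetric])
      finally show ?thesis using False by simp
    qed
    have S4: "(1 + sq i) ^ 4 * exp (- \<delta> * sq i) \<le> C1 * exp (- (\<delta> / 2) * sq i)"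
    proof -
      have "(1 + sq i) ^ 4 * exp (- \<delta> * sq i) \<le> (C1 * exp (\<delta> / 2 * sq i)) * exp (- \<delta> * sq i)"
        using C1(2)[OF sq_nonneg] by (intro mult_right_mono) auto
      also have "\<dots> = C1 * exp (- (\<delta> / 2) * sq i)"
        unfolding mult.assoc exp_add[symmetric] by (simp add: field_simps)
      finally show ?thesis .
    qed
    have "norm (tm p \<tau> z i) \<le> (B * (1 + sq i) ^ 4 * (1 + y) ^ 5) * exp (- \<delta> * sq i - e)"
      unfolding tm_def aT_def norm_mult e_def y_def
      using h assms y B(1) sq_nonneg[of i] by (intro mult_mono B(2) \<delta>(2)) (auto simp: y_def)
    also have "\<dots> = B * ((1 + sq i) ^ 4 * exp (- \<delta> * sq i)) * ((1 + y) ^ 5 * exp (- e))"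
      by (simp add: exp_diff exp_minus divide_inverse)
    also have "\<dots> \<le> B * (C1 * exp (- (\<delta> / 2) * sq i)) * (C3 * (if lead i then (1 + y) ^ 5 else exp (- (\<delta> / 2) * y\<^sup>2)))"
      by (rule mult_mono[OF mult_left_mono[OF S4] Y5]) (use B(1) C1(1) y sq_nonneg[of i] in auto)
    finally show "norm (tm p \<tau> z i) \<le> B * C1 * C3 * exp (- (\<delta> / 2) * sq i) * (if lead i then (1 + Im z) ^ 5 else exp (- (\<delta> / 2) * (Im z)\<^sup>2))"
      unfolding y_def by (simp only: mult_ac)
  qed (use \<delta> in auto)
qed

text \<open>The function is a product of three one-dimensional Gaussians.\<close>

lemma sq_summable:
  assumes "\<delta> > 0"
  shows "(\<lambda>i. exp (- \<delta> * sq i)) summable_on UNIV"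
proof -
  define f where "f n = exp (- \<delta> * (of_int n)\<^sup>2)" for n :: int
  have f: "f summable_on UNIV"
    using gauss_term_summable[of "\<delta> / pi" 0 0] assms unfolding f_def norm_gauss_term by simp
  have prod: "(\<lambda>(x, y). g x * h y) summable_on (UNIV \<times> UNIV)"
    if "g summable_on UNIV" "h summable_on UNIV" "\<And>x. g x \<ge> 0" "\<And>x. h x \<ge> 0"
    for g :: "int \<Rightarrow> real" and h :: "'b \<Rightarrow> real"
  proof (rule summable_on_SigmaI[where g="\<lambda>x. g x * infsum h UNIV"])
    show "((\<lambda>y. case (x, y) of (x, y) \<Rightarrow> g x * h y) has_sum g x * infsum h UNIV) UNIV" for x
      using that(2) by (auto intro!: has_sum_cmult_right)
  qed (use that in \<open>auto intro!: summable_on_cmult_left\<close>)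
  have "(\<lambda>(x, y). f x * (\<lambda>(x, y). f x * f y) y) summable_on (UNIV \<times> UNIV)"
    using prod[OF f f] by (intro prod[OF f]) (auto simp: f_def)
  moreover have "(\<lambda>(x, y). f x * (\<lambda>(x, y). f x * f y) y) = (\<lambda>i. exp (- \<delta> * sq i))"
    by (auto simp: f_def sq_def exp_add[symmetric] algebra_simps)
  ultimately show ?thesis by simp
qed

text \<open>The weight \<omega> will be a coset phase, possibly cut down to the leading or to the
  other indices, so that the full kernel and its two parts arise from one construction.\<close>

definition Th :: "(int \<times> int \<times> int \<Rightarrow> complex) \<Rightarrow> part \<Rightarrow> complex \<Rightarrow> complex \<Rightarrow> complex" where
  "Th \<omega> p \<tau> z = (\<Sum>\<^sub>\<infinity>i. \<omega> i * tm p \<tau> z i)"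

lemma half_box:
  assumes "Im \<tau> > 0"
  obtains v0 V U \<epsilon> where "v0 > 0" "v0 \<le> V" "\<epsilon> > 0" "\<epsilon> \<le> v0"
    "\<And>w. dist \<tau> w < \<epsilon> \<Longrightarrow> \<bar>Re w\<bar> \<le> U \<and> v0 \<le> Im w \<and> Im w \<le> V"
proof (rule that[of "Im \<tau> / 2" "Im \<tau> * 2" "Im \<tau> / 2" "\<bar>Re \<tau>\<bar> + Im \<tau>"])
  fix w assume d: "dist \<tau> w < Im \<tau> / 2"
  have "\<bar>Re \<tau> - Re w\<bar> < Im \<tau> / 2" "\<bar>Im \<tau> - Im w\<bar> < Im \<tau> / 2"
    using d abs_Re_le_cmod[of "\<tau> - w"] abs_Im_le_cmod[of "\<tau> - w"] by (auto simp: dist_norm)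
  then show "\<bar>Re w\<bar> \<le> \<bar>Re \<tau>\<bar> + Im \<tau> \<and> Im \<tau> / 2 \<le> Im w \<and> Im w \<le> Im \<tau> * 2" by linarith
qed (use assms in auto)

text \<open>On a ball the height is bounded, so the distinction between leading and other indices
  disappears and one summable majorant covers all terms and all derivatives.\<close>

lemma tm_local_bound:
  assumes "Im \<tau> > 0" "Im z > 0"
  obtains C \<delta> \<epsilon> where "C > 0" "\<delta> > 0" "\<epsilon> > 0"
    "\<And>p \<tau>' z' i. dist \<tau> \<tau>' < \<epsilon> \<Longrightarrow> dist z z' < \<epsilon> \<Longrightarrow> norm (tm p \<tau>' z' i) \<le> C * exp (- \<delta> * sq i)"
proof -
  obtain v0 V U \<epsilon>1 where 1: "v0 > 0" "v0 \<le> V" "\<epsilon>1 > 0"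
    "\<And>w. dist \<tau> w < \<epsilon>1 \<Longrightarrow> \<bar>Re w\<bar> \<le> U \<and> v0 \<le> Im w \<and> Im w \<le> V"
    using half_box[OF assms(1)] by metis
  obtain y0 Y x0 \<epsilon>2 where 2: "y0 > 0" "y0 \<le> Y" "\<epsilon>2 > 0"
    "\<And>w. dist z w < \<epsilon>2 \<Longrightarrow> \<bar>Re w\<bar> \<le> x0 \<and> y0 \<le> Im w \<and> Im w \<le> Y"
    using half_box[OF assms(2)] by metis
  obtain C \<delta> where C: "C > 0" "\<delta> > 0" 
    "\<And>p \<tau> z i. \<bar>Re \<tau>\<bar> \<le> U \<Longrightarrow> v0 \<le> Im \<tau> \<Longrightarrow> Im \<tau> \<le> V \<Longrightarrow> \<bar>Re z\<bar> \<le> x0 \<Longrightarrow> y0 \<le> Im z \<Longrightarrow>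
      norm (tm p \<tau> z i) \<le> C * exp (- \<delta> * sq i) * (if lead i then (1 + Im z) ^ 5 else exp (- \<delta> * (Im z)\<^sup>2))"
    by (rule tm_bound[OF 1(1,2) 2(1), of U x0]) blast
  show ?thesis
  proof (rule that[of "C * (1 + Y) ^ 5" \<delta> "min \<epsilon>1 \<epsilon>2"])
    fix p \<tau>' z' i assume d: "dist \<tau> \<tau>' < min \<epsilon>1 \<epsilon>2" "dist z z' < min \<epsilon>1 \<epsilon>2"
    have h: "\<bar>Re \<tau>'\<bar> \<le> U" "v0 \<le> Im \<tau>'" "Im \<tau>' \<le> V" "\<bar>Re z'\<bar> \<le> x0" "y0 \<le> Im z'" "Im z' \<le> Y"
      using 1(4)[of \<tau>'] 2(4)[of z'] d by auto
    have "exp (- \<delta> * (Im z')\<^sup>2) \<le> 1" using C(2) by simp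
    also have "1 \<le> (1 + Y) ^ 5" using 2 by (intro one_le_power) auto
    finally have "(if lead i then (1 + Im z') ^ 5 else exp (- \<delta> * (Im z')\<^sup>2)) \<le> (1 + Y) ^ 5"
      using h 2 by (auto intro!: power_mono)
    then have "C * exp (- \<delta> * sq i) * (if lead i then (1 + Im z') ^ 5 else exp (- \<delta> * (Im z')\<^sup>2)) \<le> C * exp (- \<delta> * sq i) * (1 + Y) ^ 5"
      using C by (intro mult_left_mono) auto
    with C(3)[OF h(1-5), of p i] show "norm (tm p \<tau>' z' i) \<le> C * (1 + Y) ^ 5 * exp (- \<delta> * sq i)"
      by (simp add: mult_ac)
  qed (use 1 2 C in auto)
qed

context
  fixes \<omega> :: "int \<times> int \<times> int \<Rightarrow> complex"
  assumes \<omega>: "\<And>i. norm (\<omega> i) \<le> 1"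
begin

lemma norm_\<omega>: "norm (\<omega> i * a) \<le> norm a"
  using mult_right_mono[OF \<omega>[of i], of "norm a"] by (simp add: norm_mult)

lemma tm_summable:
  assumes "Im \<tau> > 0" "Im z > 0"
  shows "(\<lambda>i. norm (\<omega> i * tm p \<tau> z i)) summable_on UNIV"
proof -
  obtain C \<delta> \<epsilon> where *: "C > 0" "\<delta> > 0" "\<epsilon> > 0"
    "\<And>p \<tau>' z' i. dist \<tau> \<tau>' < \<epsilon> \<Longrightarrow> dist z z' < \<epsilon> \<Longrightarrow> norm (tm p \<tau>' z' i) \<le> C * exp (- \<delta> * sq i)"
    by (rule tm_local_bound[OF assms]) blast
  show ?thesis
    by (rule summable_on_comparison_test[OF summable_on_cmult_right[OF sq_summable[OF *(2)], of C]])
      (use *(3) *(4)[of \<tau> z p] in \<open>auto intro!: order_trans[OF norm_\<omega>]\<close>)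
qed

lemma Th_eq_integral:
  assumes "Im \<tau> > 0" "Im z > 0"
  shows "Th \<omega> p \<tau> z = integral\<^sup>L (count_space UNIV) (\<lambda>i. \<omega> i * tm p \<tau> z i)"
  unfolding Th_def by (rule integral_count_space_eq_infsum[OF tm_summable[OF assms], symmetric])

lemma tm_dominated:
  assumes "Im w > 0"
  shows "dominated (count_space UNIV) upper_half (\<lambda>\<tau> i. \<omega> i * tm p \<tau> w i)"
    "dominated (count_space UNIV) upper_half (\<lambda>z i. \<omega> i * tm p w z i)"
  unfolding dominated_def
proof (safe, goal_cases)
  case (2 i)
  then show ?case by (intro continuous_intros tm_continuous_tau) (simp add: upper_half_def)
next
  case (3 \<tau>)
  then have "Im \<tau> > 0" by (simp add: upper_half_def)
  then obtain C \<delta> \<epsilon> where *: "C > 0" "\<delta> > 0" "\<epsilon> > 0"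
    "\<And>p \<tau>' z' i. dist \<tau> \<tau>' < \<epsilon> \<Longrightarrow> dist w z' < \<epsilon> \<Longrightarrow> norm (tm p \<tau>' z' i) \<le> C * exp (- \<delta> * sq i)"
    using tm_local_bound[OF _ assms] by metis
  show ?case
    by (intro exI[of _ \<epsilon>] exI[of _ "\<lambda>i. C * exp (- \<delta> * sq i)"] conjI ballI integrable_count_space_nonneg summable_on_cmult_right sq_summable)
      (use * in \<open>auto intro!: order_trans[OF norm_\<omega>]\<close>)
next
  case (5 i)
  then show ?case by (intro continuous_intros tm_continuous_z)
next
  case (6 z)
  then have "Im z > 0" by (simp add: upper_half_def)
  then obtain C \<delta> \<epsilon> where *: "C > 0" "\<delta> > 0" "\<epsilon> > 0"
    "\<And>p \<tau>' z' i. dist w \<tau>' < \<epsilon> \<Longrightarrow> dist z z' < \<epsilon> \<Longrightarrow> norm (tm p \<tau>' z' i) \<le> C * exp (- \<delta> * sq i)"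
    using tm_local_bound[OF assms] by metis
  show ?case
    by (intro exI[of _ \<epsilon>] exI[of _ "\<lambda>i. C * exp (- \<delta> * sq i)"] conjI ballI integrable_count_space_nonneg summable_on_cmult_right sq_summable)
      (use * in \<open>auto intro!: order_trans[OF norm_\<omega>]\<close>)
qed auto

lemma Th_continuous:
  assumes "Im w > 0"
  shows "continuous_on upper_half (\<lambda>\<tau>. Th \<omega> p \<tau> w)" "continuous_on upper_half (\<lambda>z. Th \<omega> p w z)"
  using dominated_continuous[OF tm_dominated(1)[OF assms, of p]] dominated_continuous[OF tm_dominated(2)[OF assms, of p]] assms
  by (auto simp: Th_eq_integral upper_half_def cong: continuous_on_cong_simp)

lemma Th_has_dir_aux:
  assumes "Im w > 0"
  shows "(\<And>\<tau> i. Im \<tau> > 0 \<Longrightarrow> has_dir e (\<lambda>\<tau>. tm p \<tau> w i) (tm p' \<tau> w i) \<tau>) \<Longrightarrow> Im \<tau> > 0 \<Longrightarrow> has_dir e (\<lambda>\<tau>. Th \<omega> p \<tau> w) (Th \<omega> p' \<tau> w) \<tau>"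
    "(\<And>z i. Im z > 0 \<Longrightarrow> has_dir e (\<lambda>z. tm p w z i) (tm p' w z i) z) \<Longrightarrow> Im z > 0 \<Longrightarrow> has_dir e (\<lambda>z. Th \<omega> p w z) (Th \<omega> p' w z) z"
proof -
  assume *: "\<And>\<tau> i. Im \<tau> > 0 \<Longrightarrow> has_dir e (\<lambda>\<tau>. tm p \<tau> w i) (tm p' \<tau> w i) \<tau>" "Im \<tau> > 0"
  have "has_dir e (\<lambda>\<tau>. integral\<^sup>L (count_space UNIV) (\<lambda>i. \<omega> i * tm p \<tau> w i)) (integral\<^sup>L (count_space UNIV) (\<lambda>i. \<omega> i * tm p' \<tau> w i)) \<tau>"
    by (rule dominated_has_dir[OF open_upper tm_dominated(1)[OF assms] tm_dominated(1)[OF assms]])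
      (auto simp: upper_half_def *(2) intro!: has_dir_cmult *(1))
  then show "has_dir e (\<lambda>\<tau>. Th \<omega> p \<tau> w) (Th \<omega> p' \<tau> w) \<tau>"
    using *(2) assms by (subst has_dir_cong[OF open_upper]) (auto simp: upper_half_def Th_eq_integral)
next
  assume *: "\<And>z i. Im z > 0 \<Longrightarrow> has_dir e (\<lambda>z. tm p w z i) (tm p' w z i) z" "Im z > 0"
  have "has_dir e (\<lambda>z. integral\<^sup>L (count_space UNIV) (\<lambda>i. \<omega> i * tm p w z i)) (integral\<^sup>L (count_space UNIV) (\<lambda>i. \<omega> i * tm p' w z i)) z"
    by (rule dominated_has_dir[OF open_upper tm_dominated(2)[OF assms] tm_dominated(2)[OF assms]])
      (auto simp: upper_half_def *(2) intro!: has_dir_cmult *(1))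
  then show "has_dir e (\<lambda>z. Th \<omega> p w z) (Th \<omega> p' w z) z"
    using *(2) assms by (subst has_dir_cong[OF open_upper]) (auto simp: upper_half_def Th_eq_integral)
qed

lemma Th_has_dir:
  assumes "Im \<tau> > 0" "Im z > 0"
  shows "has_dir 1 (\<lambda>\<tau>. Th \<omega> P0 \<tau> z) (Th \<omega> Pu \<tau> z) \<tau>" "has_dir \<i> (\<lambda>\<tau>. Th \<omega> P0 \<tau> z) (Th \<omega> Pv \<tau> z) \<tau>"
    "has_dir 1 (\<lambda>\<tau>. Th \<omega> Pu \<tau> z) (Th \<omega> Puu \<tau> z) \<tau>" "has_dir \<i> (\<lambda>\<tau>. Th \<omega> Pu \<tau> z) (Th \<omega> Puv \<tau> z) \<tau>"
    "has_dir 1 (\<lambda>\<tau>. Th \<omega> Pv \<tau> z) (Th \<omega> Puv \<tau> z) \<tau>" "has_dir \<i> (\<lambda>\<tau>. Th \<omega> Pv \<tau> z) (Th \<omega> Pvv \<tau> z) \<tau>"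
    "has_dir 1 (\<lambda>z. Th \<omega> P0 \<tau> z) (Th \<omega> Px \<tau> z) z" "has_dir \<i> (\<lambda>z. Th \<omega> P0 \<tau> z) (Th \<omega> Py \<tau> z) z"
    "has_dir 1 (\<lambda>z. Th \<omega> Px \<tau> z) (Th \<omega> Pxx \<tau> z) z" "has_dir \<i> (\<lambda>z. Th \<omega> Py \<tau> z) (Th \<omega> Pyy \<tau> z) z"
  by (rule Th_has_dir_aux(1)[OF assms(2)], rule tm_has_dir, assumption, rule assms(1))+
    (rule Th_has_dir_aux(2)[OF assms(1)], rule tm_has_dir, rule assms(1), rule assms(2))+

lemma Th_heat:
  assumes "Im \<tau> > 0" "Im z > 0"
  shows "4 * (- (complex_of_real (Im \<tau>))\<^sup>2 * (Th \<omega> Puu \<tau> z + Th \<omega> Pvv \<tau> z) + \<i> / 2 * complex_of_real (Im \<tau>) * (Th \<omega> Pu \<tau> z + \<i> * Th \<omega> Pv \<tau> z))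
    = - (complex_of_real (Im z))\<^sup>2 * (Th \<omega> Pxx \<tau> z + Th \<omega> Pyy \<tau> z)"
proof -
  define V Y where "V = complex_of_real (Im \<tau>)" and "Y = complex_of_real (Im z)"
  have s: "(\<lambda>i. \<omega> i * tm p \<tau> z i) summable_on UNIV" for p
    by (rule abs_summable_summable[OF tm_summable[OF assms]])
  have h: "((\<lambda>i. \<omega> i * tm p \<tau> z i) has_sum Th \<omega> p \<tau> z) UNIV" for p
    unfolding Th_def by (rule has_sum_infsum[OF s])
  have "((\<lambda>i. 4 * (- V\<^sup>2 * (\<omega> i * tm Puu \<tau> z i + \<omega> i * tm Pvv \<tau> z i) + \<i> / 2 * V * (\<omega> i * tm Pu \<tau> z i + \<i> * (\<omega> i * tm Pv \<tau> z i))))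
     has_sum (4 * (- V\<^sup>2 * (Th \<omega> Puu \<tau> z + Th \<omega> Pvv \<tau> z) + \<i> / 2 * V * (Th \<omega> Pu \<tau> z + \<i> * Th \<omega> Pv \<tau> z)))) UNIV"
    by (intro has_sum_cmult_right has_sum_add h)
  moreover have "((\<lambda>i. - Y\<^sup>2 * (\<omega> i * tm Pxx \<tau> z i + \<omega> i * tm Pyy \<tau> z i)) has_sum (- Y\<^sup>2 * (Th \<omega> Pxx \<tau> z + Th \<omega> Pyy \<tau> z))) UNIV"
    by (intro has_sum_cmult_right has_sum_add h)
  moreover have "4 * (- V\<^sup>2 * (\<omega> i * tm Puu \<tau> z i + \<omega> i * tm Pvv \<tau> z i) + \<i> / 2 * V * (\<omega> i * tm Pu \<tau> z i + \<i> * (\<omega> i * tm Pv \<tau> z i)))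
     = - Y\<^sup>2 * (\<omega> i * tm Pxx \<tau> z i + \<omega> i * tm Pyy \<tau> z i)" for i
  proof -
    have "4 * (- V\<^sup>2 * (\<omega> i * tm Puu \<tau> z i + \<omega> i * tm Pvv \<tau> z i) + \<i> / 2 * V * (\<omega> i * tm Pu \<tau> z i + \<i> * (\<omega> i * tm Pv \<tau> z i)))
      = \<omega> i * (4 * (- V\<^sup>2 * (tm Puu \<tau> z i + tm Pvv \<tau> z i) + \<i> / 2 * V * (tm Pu \<tau> z i + \<i> * tm Pv \<tau> z i)))"
      by (simp add: algebra_simps)
    also have "\<dots> = \<omega> i * (- Y\<^sup>2 * (tm Pxx \<tau> z i + tm Pyy \<tau> z i))"
      unfolding V_def Y_def tm_heat[OF assms(1)] ..
    finally show ?thesis by (simp add: algebra_simps)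
  qed
  ultimately show ?thesis unfolding V_def Y_def by (simp only: has_sum_unique)
qed

text \<open>With the leading indices switched off, every term carries exp(- \<delta> y^2) with the
  same \<delta>, and the sum over the indices only changes the constant. Uniformity over the strip
  and over a box in \<tau> is what later supplies integrable majorants.\<close>

lemma Th_decay:
  assumes "v0 > 0" "v0 \<le> V" "y0 > 0" and lead: "\<And>i. lead i \<Longrightarrow> \<omega> i = 0"
  obtains C \<delta> where "C > 0" "\<delta> > 0"
    "\<And>p \<tau> z. \<bar>Re \<tau>\<bar> \<le> U \<Longrightarrow> v0 \<le> Im \<tau> \<Longrightarrow> Im \<tau> \<le> V \<Longrightarrow> \<bar>Re z\<bar> \<le> x0 \<Longrightarrow> y0 \<le> Im z \<Longrightarrow>
      norm (Th \<omega> p \<tau> z) \<le> C * exp (- \<delta> * (Im z)\<^sup>2)"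
proof -
  obtain C \<delta> where C: "C > 0" "\<delta> > 0" 
    "\<And>p \<tau> z i. \<bar>Re \<tau>\<bar> \<le> U \<Longrightarrow> v0 \<le> Im \<tau> \<Longrightarrow> Im \<tau> \<le> V \<Longrightarrow> \<bar>Re z\<bar> \<le> x0 \<Longrightarrow> y0 \<le> Im z \<Longrightarrow>
      norm (tm p \<tau> z i) \<le> C * exp (- \<delta> * sq i) * (if lead i then (1 + Im z) ^ 5 else exp (- \<delta> * (Im z)\<^sup>2))"
    by (rule tm_bound[OF assms(1-3), of U x0]) blast
  define S where "S = (\<Sum>\<^sub>\<infinity>i. exp (- \<delta> * sq i))"
  have S: "S \<ge> 0" unfolding S_def by (rule infsum_nonneg) simp
  show ?thesis
  proof (rule that[of "C * (S + 1)" \<delta>])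
    fix p \<tau> z assume h: "\<bar>Re \<tau>\<bar> \<le> U" "v0 \<le> Im \<tau>" "Im \<tau> \<le> V" "\<bar>Re z\<bar> \<le> x0" "y0 \<le> Im z"
    have pos: "Im \<tau> > 0" "Im z > 0" using h assms by auto
    have s: "(\<lambda>i. C * exp (- \<delta> * (Im z)\<^sup>2) * exp (- \<delta> * sq i)) summable_on UNIV"
      by (intro summable_on_cmult_right sq_summable C)
    have "norm (Th \<omega> p \<tau> z) \<le> (\<Sum>\<^sub>\<infinity>i. norm (\<omega> i * tm p \<tau> z i))"
      unfolding Th_def by (rule norm_infsum_bound[OF tm_summable[OF pos]])
    also have "\<dots> \<le> (\<Sum>\<^sub>\<infinity>i. C * exp (- \<delta> * (Im z)\<^sup>2) * exp (- \<delta> * sq i))"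
    proof (rule infsum_mono[OF tm_summable[OF pos] s])
      fix i
      show "norm (\<omega> i * tm p \<tau> z i) \<le> C * exp (- \<delta> * (Im z)\<^sup>2) * exp (- \<delta> * sq i)"
      proof (cases "lead i")
        case False
        have "norm (\<omega> i * tm p \<tau> z i) \<le> norm (tm p \<tau> z i)" by (rule norm_\<omega>)
        also have "\<dots> \<le> C * exp (- \<delta> * sq i) * exp (- \<delta> * (Im z)\<^sup>2)" using C(3)[OF h, of p i] False by simp
        finally show ?thesis by (simp add: mult_ac)
      qed (use lead C in auto)
    qed
    also have "\<dots> = C * exp (- \<delta> * (Im z)\<^sup>2) * S" unfolding S_def by (rule infsum_cmult_right') 
    also have "\<dots> \<le> C * exp (- \<delta> * (Im z)\<^sup>2) * (S + 1)" using C by (intro mult_left_mono) auto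
    finally show "norm (Th \<omega> p \<tau> z) \<le> C * (S + 1) * exp (- \<delta> * (Im z)\<^sup>2)" by (simp add: mult_ac)
  qed (use C S in auto)
qed

end

end

no_notation fps_nth (infixl \<open>$\<close> 75)

section \<open>The action of \<open>SL\<^sub>2\<close> on the quadratic space\<close>

lemma mat2_nth [simp]:
  "mat2 a b c d $ 1 $ 1 = a" "mat2 a b c d $ 1 $ 2 = b" "mat2 a b c d $ 2 $ 1 = c" "mat2 a b c d $ 2 $ 2 = d"
  by (simp_all add: mat2_def)

lemma mat2_eqI:
  fixes X Y :: "real^2^2"
  assumes "X $ 1 $ 1 = Y $ 1 $ 1" "X $ 1 $ 2 = Y $ 1 $ 2" "X $ 2 $ 1 = Y $ 2 $ 1" "X $ 2 $ 2 = Y $ 2 $ 2"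
  shows "X = Y"
  using assms by (simp add: vec_eq_iff forall_2)

lemma mult_nth:
  fixes X Y :: "real^2^2"
  shows "(X ** Y) $ i $ j = X $ i $ 1 * Y $ 1 $ j + X $ i $ 2 * Y $ 2 $ j"
  by (simp add: matrix_matrix_mult_def sum_2)

lemma mat_1_nth: "(mat 1 :: real^2^2) $ i $ j = (if i = j then 1 else 0)"
  by (simp add: mat_def)

text \<open>The adjugate, which is the inverse for determinant 1. Unlike \<open>matrix_inv\<close>,
  which is defined by a choice, it is given by entries, so matrix identities become polynomial
  ones.\<close>

definition adj :: "real^2^2 \<Rightarrow> real^2^2" where
  "adj g = mat2 (g $ 2 $ 2) (- (g $ 1 $ 2)) (- (g $ 2 $ 1)) (g $ 1 $ 1)"

lemma adj_nth [simp]: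
  "adj g $ 1 $ 1 = g $ 2 $ 2" "adj g $ 1 $ 2 = - (g $ 1 $ 2)" "adj g $ 2 $ 1 = - (g $ 2 $ 1)" "adj g $ 2 $ 2 = g $ 1 $ 1"
  by (simp_all add: adj_def)

lemma adj_inverse:
  assumes "det g = 1"
  shows "g ** adj g = mat 1" "adj g ** g = mat 1"
  using assms by (auto intro!: mat2_eqI simp: mult_nth mat_1_nth det_2 algebra_simps)

lemma matrix_inv_eq_adj: "det g = 1 \<Longrightarrow> matrix_inv g = adj g"
  unfolding matrix_inv_def
proof (rule some_equality)
  fix A assume "det g = 1" "g ** A = mat 1 \<and> A ** g = mat 1"
  then have "A ** (g ** adj g) = adj g" by (simp add: matrix_mul_assoc)
  then show "A = adj g" using \<open>det g = 1\<close> by (simp add: adj_inverse)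
qed (simp add: adj_inverse)

lemma det_adj: "det (adj g) = det (g :: real^2^2)"
  by (simp add: det_2)

lemma adj_adj: "adj (adj g) = (g :: real^2^2)"
  by (rule mat2_eqI) simp_all

lemma act_eq: "det g = 1 \<Longrightarrow> act g X = g ** X ** adj g"
  by (simp add: act_def matrix_inv_eq_adj)

lemma act_add: "det g = 1 \<Longrightarrow> act g (X + Y) = act g X + act g Y"
  and act_diff: "det g = 1 \<Longrightarrow> act g (X - Y) = act g X - act g Y"
  and act_scaleR: "det g = 1 \<Longrightarrow> act g (r *\<^sub>R X) = r *\<^sub>R act g X"
  by (auto intro!: mat2_eqI simp: act_eq mult_nth algebra_simps)

lemma act_mult:
  assumes "det g = 1" "det h = 1"
  shows "act (g ** h) X = act g (act h X)"
proof -
  have "adj (g ** h) = adj h ** adj g"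
    by (rule mat2_eqI) (simp_all add: mult_nth)
  then show ?thesis using assms by (simp add: act_eq det_mul matrix_mul_assoc)
qed

lemma act_1: "act (mat 1) X = X"
  by (simp add: act_eq adj_def mat_1_nth) (auto intro!: mat2_eqI simp: mult_nth mat_1_nth)

lemma act_adj: 
  assumes "det g = 1"
  shows "act (adj g) (act g X) = X" "act g (act (adj g) X) = X"
  using assms act_mult[of "adj g" g X] act_mult[of g "adj g" X] by (simp_all add: det_adj adj_inverse act_1)

lemma act_minus: "det g = 1 \<Longrightarrow> act (- g) X = act g X"
proof -
  assume "det g = 1"
  moreover from this have "det (- g) = 1" by (simp add: det_2)
  ultimately show ?thesis by (simp add: act_eq) (auto intro!: mat2_eqI simp: mult_nth algebra_simps)
qed

lemma trace_act:
  assumes "det g = 1"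
  shows "trace (act g X ** act g Y) = trace (X ** Y)" "trace (act g X) = trace X"
proof -
  have "act g X ** act g Y = g ** X ** (adj g ** g) ** Y ** adj g"
    using assms by (simp add: act_eq matrix_mul_assoc)
  then have "trace (act g X ** act g Y) = trace ((g ** (X ** Y)) ** adj g)"
    using assms by (simp add: adj_inverse matrix_mul_assoc)
  also have "\<dots> = trace (adj g ** (g ** (X ** Y)))" by (rule trace_mul_sym)
  also have "\<dots> = trace (X ** Y)" using assms by (simp add: matrix_mul_assoc adj_inverse)
  finally show "trace (act g X ** act g Y) = trace (X ** Y)" .
  have "trace (act g X) = trace ((g ** X) ** adj g)" using assms by (simp add: act_eq)
  also have "\<dots> = trace (adj g ** (g ** X))" by (rule trace_mul_sym)
  also have "\<dots> = trace X" using assms by (simp add: matrix_mul_assoc adj_inverse)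
  finally show "trace (act g X) = trace X" .
qed

lemma bil_act: "det g = 1 \<Longrightarrow> bil N (act g X) (act g Y) = bil N X Y"
  by (simp add: bil_def trace_act)

lemma det_act: "det g = 1 \<Longrightarrow> det (act g X) = det X"
  by (simp add: act_eq det_mul det_adj)

lemma Q_act: "det g = 1 \<Longrightarrow> Q_form N (act g X) = Q_form N X"
  by (simp add: Q_form_def det_act)

text \<open>Coordinates on the trace-zero matrices: b is the coordinate along \<open>u_zero\<close>,
  and c = 0 describes the plane orthogonal to it.\<close>

definition tz :: "real \<Rightarrow> real \<Rightarrow> real \<Rightarrow> real^2^2" where
  "tz a b c = mat2 a b c (- a)"

lemma tz_nth [simp]: "tz a b c $ 1 $ 1 = a" "tz a b c $ 1 $ 2 = b" "tz a b c $ 2 $ 1 = c" "tz a b c $ 2 $ 2 = - a"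
  by (simp_all add: tz_def)

lemma tz_eq_iff [simp]: "tz a b c = tz a' b' c' \<longleftrightarrow> a = a' \<and> b = b' \<and> c = c'"
  by (metis tz_nth)

lemma trace_2: "trace (X :: real^2^2) = X $ 1 $ 1 + X $ 2 $ 2"
  by (simp add: trace_def sum_2)

lemma trace_zero_tz:
  fixes X :: "real^2^2"
  assumes "trace X = 0"
  shows "X = tz (X $ 1 $ 1) (X $ 1 $ 2) (X $ 2 $ 1)"
  using assms by (intro mat2_eqI) (auto simp: trace_2)

lemma tz_add: "tz a b c + tz a' b' c' = tz (a + a') (b + b') (c + c')"
  and tz_diff: "tz a b c - tz a' b' c' = tz (a - a') (b - b') (c - c')"
  and tz_scaleR: "r *\<^sub>R tz a b c = tz (r * a) (r * b) (r * c)"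
  by (auto intro!: mat2_eqI)

lemma u_zero_tz: "u_zero = tz 0 1 0"
  by (simp add: u_zero_def tz_def)

lemma SL2Z_det: "g \<in> SL2Z \<Longrightarrow> det g = 1" and SL2Z_Ints: "g \<in> SL2Z \<Longrightarrow> g $ i $ j \<in> \<int>"
  by (auto simp: SL2Z_def)

lemma SL2Z_mult: "g \<in> SL2Z \<Longrightarrow> h \<in> SL2Z \<Longrightarrow> g ** h \<in> SL2Z"
  by (auto simp: SL2Z_def det_mul mult_nth)

lemma SL2Z_adj: "g \<in> SL2Z \<Longrightarrow> adj g \<in> SL2Z"
  by (auto simp: SL2Z_def det_adj forall_2)

lemma SL2Z_minus: "g \<in> SL2Z \<Longrightarrow> - g \<in> SL2Z"
  by (auto simp: SL2Z_def det_2)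

lemma SL2Z_one: "mat 1 \<in> SL2Z"
  by (auto simp: SL2Z_def mat_1_nth)

lemma SL2Z_trans_mat: "trans_mat n \<in> SL2Z"
  by (auto simp: SL2Z_def trans_mat_def forall_2 det_2)

subsection \<open>Moebius transformations\<close>

text \<open>The automorphy factor: its squared modulus divides Im z under the action, and its
  inverse square is the derivative of the Moebius map.\<close>

definition aut :: "real^2^2 \<Rightarrow> complex \<Rightarrow> complex" where
  "aut g z = complex_of_real (g $ 2 $ 1) * z + complex_of_real (g $ 2 $ 2)"

lemma aut_nonzero:
  assumes "det g = 1" "Im z > 0"
  shows "aut g z \<noteq> 0"
proof
  assume *: "aut g z = 0"
  then have "Im (aut g z) = 0" by simp
  then have "g $ 2 $ 1 = 0" using assms(2) by (simp add: aut_def)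
  moreover from this * have "g $ 2 $ 2 = 0" by (simp add: aut_def)
  ultimately show False using assms(1) by (simp add: det_2)
qed

lemma moebius_act_mult:
  assumes "det g = 1" "det h = 1" "Im z > 0"
  shows "moebius_act (g ** h) z = moebius_act g (moebius_act h z)"
proof -
  have "aut h z \<noteq> 0" using assms aut_nonzero by blast
  then show ?thesis
    by (simp add: moebius_act_def mult_nth aut_def add_divide_distrib[symmetric] divide_simps) (simp add: algebra_simps)
qed

lemma moebius_act_coords:
  assumes "det g = 1" "Im z > 0"
  defines "J \<equiv> (cmod (aut g z))\<^sup>2"
  shows "J > 0" "Im (moebius_act g z) = Im z / J"
    "Re (moebius_act g z) = ((g $ 1 $ 1 * Re z + g $ 1 $ 2) * (g $ 2 $ 1 * Re z + g $ 2 $ 2) + g $ 1 $ 1 * g $ 2 $ 1 * (Im z)\<^sup>2) / J"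
    "(cmod (moebius_act g z))\<^sup>2 = ((g $ 1 $ 1 * Re z + g $ 1 $ 2)\<^sup>2 + (g $ 1 $ 1)\<^sup>2 * (Im z)\<^sup>2) / J"
    "J = (g $ 2 $ 1 * Re z + g $ 2 $ 2)\<^sup>2 + (g $ 2 $ 1)\<^sup>2 * (Im z)\<^sup>2"
proof -
  show J: "J = (g $ 2 $ 1 * Re z + g $ 2 $ 2)\<^sup>2 + (g $ 2 $ 1)\<^sup>2 * (Im z)\<^sup>2"
    by (simp add: J_def aut_def cmod_power2 power_mult_distrib)
  show J0: "J > 0" using aut_nonzero[OF assms(1,2)] by (simp add: J_def)
  have d: "g $ 1 $ 1 * g $ 2 $ 2 - g $ 1 $ 2 * g $ 2 $ 1 = 1" using assms by (simp add: det_2)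
  have "Im (moebius_act g z) = (g $ 1 $ 1 * g $ 2 $ 2 - g $ 1 $ 2 * g $ 2 $ 1) * Im z / J"
    by (simp add: moebius_act_def Im_divide J power2_eq_square algebra_simps)
  then show "Im (moebius_act g z) = Im z / J" by (simp add: d)
  show "Re (moebius_act g z) = ((g $ 1 $ 1 * Re z + g $ 1 $ 2) * (g $ 2 $ 1 * Re z + g $ 2 $ 2) + g $ 1 $ 1 * g $ 2 $ 1 * (Im z)\<^sup>2) / J"
    by (simp add: moebius_act_def Re_divide J power2_eq_square algebra_simps)
  have "(cmod (moebius_act g z))\<^sup>2 = (cmod (complex_of_real (g $ 1 $ 1) * z + complex_of_real (g $ 1 $ 2)))\<^sup>2 / J"
    by (simp add: moebius_act_def norm_divide power_divide J_def aut_def)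
  then show "(cmod (moebius_act g z))\<^sup>2 = ((g $ 1 $ 1 * Re z + g $ 1 $ 2)\<^sup>2 + (g $ 1 $ 1)\<^sup>2 * (Im z)\<^sup>2) / J"
    by (simp add: cmod_power2 power_mult_distrib)
qed

lemma moebius_act_upper:
  assumes "det g = 1" "Im z > 0"
  shows "Im (moebius_act g z) > 0"
  using moebius_act_coords[OF assms] assms(2) by simp

lemma moebius_act_minus: "moebius_act (- g) z = moebius_act g z"
proof -
  have "moebius_act (- g) z = (- (complex_of_real (g $ 1 $ 1) * z + complex_of_real (g $ 1 $ 2))) / (- (complex_of_real (g $ 2 $ 1) * z + complex_of_real (g $ 2 $ 2)))"
    by (simp add: moebius_act_def)
  then show ?thesis by (simp only: minus_divide_divide) (simp add: moebius_act_def)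
qed

text \<open>The factor |aut g z|^2 in the imaginary part of the image cancels the denominators,
  after which both sides are 1 / (sqrt N y) times the same quadratic expressions in the entries of
  g. Hence the kernel depends only on the relative position of X and z.\<close>

lemma X_pt_moebius:
  assumes "det g = 1" "Im z > 0"
  shows "X_pt N (moebius_act g z) = act g (X_pt N z)"
proof -
  note c = moebius_act_coords[OF assms]
  define J where "J = (cmod (aut g z))\<^sup>2"
  define x y where "x = Re z" and "y = Im z"
  define p q r s where "p = g $ 1 $ 1" and "q = g $ 1 $ 2" and "r = g $ 2 $ 1" and "s = g $ 2 $ 2"
  have J: "J = (r * x + s)\<^sup>2 + r\<^sup>2 * y\<^sup>2" "J > 0" using c by (simp_all add: J_def x_def y_def r_def s_def)
  have X: "X_pt N z = (1 / (sqrt (real N) * y)) *\<^sub>R tz (- x) (x\<^sup>2 + y\<^sup>2) (- 1)"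
    by (simp add: X_pt_def tz_def x_def y_def cmod_power2)
  have "X_pt N (moebius_act g z) = (1 / (sqrt (real N) * (y / J))) *\<^sub>R tz (- (((p * x + q) * (r * x + s) + p * r * y\<^sup>2) / J)) (((p * x + q)\<^sup>2 + p\<^sup>2 * y\<^sup>2) / J) (- 1)"
    using c(2-4) by (simp add: X_pt_def tz_def x_def y_def p_def q_def r_def s_def J_def)
  also have "\<dots> = (1 / (sqrt (real N) * y)) *\<^sub>R tz (- ((p * x + q) * (r * x + s) + p * r * y\<^sup>2)) ((p * x + q)\<^sup>2 + p\<^sup>2 * y\<^sup>2) (- J)"
  proof -
    have k: "1 / (sqrt (real N) * (y / J)) = (1 / (sqrt (real N) * y)) * J" by simp
    have "J *\<^sub>R tz (- (((p * x + q) * (r * x + s) + p * r * y\<^sup>2) / J)) (((p * x + q)\<^sup>2 + p\<^sup>2 * y\<^sup>2) / J) (- 1)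
      = tz (- ((p * x + q) * (r * x + s) + p * r * y\<^sup>2)) ((p * x + q)\<^sup>2 + p\<^sup>2 * y\<^sup>2) (- J)"
      using J(2) by (simp add: tz_scaleR)
    then show ?thesis unfolding k scaleR_scaleR[symmetric] by (simp only:)
  qed
  also have "tz (- ((p * x + q) * (r * x + s) + p * r * y\<^sup>2)) ((p * x + q)\<^sup>2 + p\<^sup>2 * y\<^sup>2) (- J) = act g (tz (- x) (x\<^sup>2 + y\<^sup>2) (- 1))"
    unfolding J(1) using assms(1)
    by (intro mat2_eqI) (simp_all add: act_eq mult_nth p_def q_def r_def s_def power2_eq_square algebra_simps)
  finally show ?thesis using assms by (simp add: X act_scaleR)
qed

lemma phi_zero_moebius:
  assumes "det g = 1" "Im z > 0"
  shows "phi_zero N (act g X) \<tau> (moebius_act g z) = phi_zero N X \<tau> z"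
  using assms by (simp add: phi_zero_def X_pt_moebius bil_act)

text \<open>Moves the transformation from the point to the coset, so that every cusp can be treated
  as the cusp at infinity of a rotated coset.\<close>

lemma Theta_L_moebius:
  assumes "det g = 1" "Im z > 0"
  shows "Theta_L N h \<tau> (moebius_act g z) = Theta_L N (act (adj g) ` h) \<tau> z"
proof -
  have inj: "inj_on (act (adj g)) h"
    by (rule inj_on_inverseI[where g="act g"]) (simp add: act_adj assms)
  have "Theta_L N (act (adj g) ` h) \<tau> z = (\<Sum>\<^sub>\<infinity>X\<in>h. phi_zero N (act (adj g) X) \<tau> z)"
    unfolding Theta_L_def using infsum_reindex[OF inj, of "\<lambda>X. phi_zero N X \<tau> z"] by (simp add: o_def)
  also have "\<dots> = Theta_L N h \<tau> (moebius_act g z)"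
    unfolding Theta_L_def
    by (rule infsum_cong) (use phi_zero_moebius[OF assms] act_adj(2)[OF assms(1)] in metis)
  finally show ?thesis by simp
qed

section \<open>Theta functions of lattice cosets\<close>

text \<open>With b' = b + 2 a x - c x^2, the term 2 N c b' in (X, X) cancels against the mixed term
  of (X, X(z))^2. Thus b enters the modulus only through b'^2 / y^2 and the phase only through N c u
  b', which is a modulated Gaussian ready for Poisson summation in b.\<close>

lemma phi_zero_tz:
  assumes "N \<ge> 1" "Im \<tau> > 0" "Im z > 0" "\<beta> > 0"
  defines "s \<equiv> Im \<tau> * real N * \<beta>\<^sup>2 / (Im z)\<^sup>2"
  shows "phi_zero N (tz a b c) \<tau> z =
    complex_of_real (sqrt (Im \<tau>)) * exp (2 * pi * \<i> * N * (of_real (a - c * Re z))\<^sup>2 * \<tau> - of_real (pi * Im \<tau> * N * c\<^sup>2 * (Im z)\<^sup>2)) *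
    gauss_term s (N * c * Re \<tau> * \<beta>) ((b + 2 * a * Re z - c * (Re z)\<^sup>2) / \<beta>)"
proof -
  define x y u v where "x = Re z" and "y = Im z" and "u = Re \<tau>" and "v = Im \<tau>"
  have pos: "y > 0" "v > 0" "real N > 0" using assms by (auto simp: y_def v_def)
  define b' where "b' = b + 2 * a * x - c * x\<^sup>2"
  have 1: "bil N (tz a b c) (tz a b c) = 2 * N * ((a - c * x)\<^sup>2 + c * b')"
    by (simp add: bil_def trace_2 mult_nth b'_def power2_eq_square algebra_simps)
  have "bil N (tz a b c) (X_pt N z) = N * (1 / (sqrt N * y)) * (c * (x\<^sup>2 + y\<^sup>2) - 2 * a * x - b)"
    by (simp add: bil_def trace_2 mult_nth X_pt_def cmod_power2 x_def y_def algebra_simps)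
  also have "N * (1 / (sqrt N * y)) = sqrt N / y" using pos by (simp add: field_simps)
  also have "c * (x\<^sup>2 + y\<^sup>2) - 2 * a * x - b = c * y\<^sup>2 - b'" by (simp add: b'_def algebra_simps)
  finally have "(bil N (tz a b c) (X_pt N z))\<^sup>2 = N * (c * y\<^sup>2 - b')\<^sup>2 / y\<^sup>2"
    by (simp add: power_mult_distrib power_divide)
  also have "\<dots> = N * (b'\<^sup>2 / y\<^sup>2 + c\<^sup>2 * y\<^sup>2 - 2 * c * b')"
    using pos by (simp add: power2_diff field_simps power2_eq_square)
  finally have 2: "bil N (tz a b c) (tz a b c) + (bil N (tz a b c) (X_pt N z))\<^sup>2 = 2 * N * (a - c * x)\<^sup>2 + N * (b'\<^sup>2 / y\<^sup>2 + c\<^sup>2 * y\<^sup>2)"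
    unfolding 1 by (simp add: algebra_simps)
  have sb: "s * (b' / \<beta>)\<^sup>2 = v * N * b'\<^sup>2 / y\<^sup>2"
    using assms(4) by (simp add: s_def v_def y_def power_divide)
  have rb: "(N * c * u * \<beta>) * (b' / \<beta>) = N * c * u * b'" using assms(4) by simp
  have \<tau>: "\<tau> = of_real u + \<i> * of_real v" by (simp add: u_def v_def complex_eq_iff)
  have "complex_of_real pi * \<i> * complex_of_real (bil N (tz a b c) (tz a b c) * Re \<tau>)
          - complex_of_real (pi * Im \<tau> * (bil N (tz a b c) (tz a b c) + (bil N (tz a b c) (X_pt N z))\<^sup>2))
     = (2 * pi * \<i> * N * (of_real (a - c * x))\<^sup>2 * \<tau> - of_real (pi * v * N * c\<^sup>2 * y\<^sup>2))
       + (of_real (- pi * (s * (b' / \<beta>)\<^sup>2)) + 2 * pi * \<i> * of_real ((N * c * u * \<beta>) * (b' / \<beta>)))"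
    unfolding 2 unfolding 1 sb rb \<tau> u_def[symmetric] v_def[symmetric]
    by (simp add: complex_eq_iff algebra_simps power2_eq_square)
  then show ?thesis
    unfolding phi_zero_def gauss_term_def x_def[symmetric] y_def[symmetric] b'_def[symmetric] u_def[symmetric] v_def[symmetric]
    by (simp only: exp_add mult.assoc)
qed

text \<open>The rows of a coset of a lattice in the direction of the isotropic line through \<open>u_zero\<close> are
  cosets of \<open>\<beta>\<int>\<close>, indexed by the integers \<open>m = D a\<close> and \<open>n = D c\<close>.\<close>

locale coset_rows =
  fixes N :: nat and D \<beta> :: real and S :: "(real^2^2) set"
  assumes N1: "N \<ge> 1" and D0: "D > 0" and \<beta>0: "\<beta> > 0"
    and S_tz: "\<And>X. X \<in> S \<Longrightarrow> \<exists>m n b. X = tz (of_int m / D) b (of_int n / D)"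
    and S_row: "\<And>a b c b'. tz a b c \<in> S \<Longrightarrow> tz a b' c \<in> S \<longleftrightarrow> (\<exists>j::int. b' = b + \<beta> * of_int j)"
begin

sublocale theta_param "real N" D \<beta>
  by unfold_locales (use N1 D0 \<beta>0 in auto)

definition rows :: "(int \<times> int) set" where
  "rows = {(m, n). \<exists>b. tz (of_int m / D) b (of_int n / D) \<in> S}"

definition b0 :: "int \<times> int \<Rightarrow> real" where
  "b0 p = (SOME b. tz (of_int (fst p) / D) b (of_int (snd p) / D) \<in> S)"

text \<open>The phase that the offset \<open>b0\<close> of a row leaves on the dual frequency; it is
  0 where the coset has no row, so that sums may run over all integer triples.\<close>

definition om :: "int \<times> int \<times> int \<Rightarrow> complex" where
  "om i = (if (fst i, fst (snd i)) \<in> rows then exp (2 * pi * \<i> * of_real (ck i * b0 (fst i, fst (snd i)))) else 0)"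

lemma b0: "p \<in> rows \<Longrightarrow> tz (of_int (fst p) / D) (b0 p) (of_int (snd p) / D) \<in> S"
  unfolding b0_def rows_def by (rule someI_ex) auto

lemma norm_om: "norm (om i) \<le> 1"
  by (simp add: om_def)

definition pt :: "(int \<times> int) \<times> int \<Rightarrow> real^2^2" where
  "pt q = tz (of_int (fst (fst q)) / D) (b0 (fst q) + \<beta> * of_int (snd q)) (of_int (snd (fst q)) / D)"

lemma pt_bij: "bij_betw pt (rows \<times> UNIV) S"
  unfolding bij_betw_def
proof
  show "inj_on pt (rows \<times> UNIV)"
    using D0 \<beta>0 by (auto simp: inj_on_def pt_def)
  show "pt ` (rows \<times> UNIV) = S"
  proof
    show "pt ` (rows \<times> UNIV) \<subseteq> S"
    proof (clarify)
      fix m n j assume "(m, n) \<in> rows"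
      from S_row[OF b0[OF this], of "b0 (m, n) + \<beta> * of_int j"] show "pt ((m, n), j) \<in> S"
        by (auto simp: pt_def)
    qed
    show "S \<subseteq> pt ` (rows \<times> UNIV)"
    proof
      fix X assume X: "X \<in> S"
      then obtain m n b where mn: "X = tz (of_int m / D) b (of_int n / D)" using S_tz by blast
      then have r: "(m, n) \<in> rows" using X by (auto simp: rows_def)
      from S_row[OF b0[OF this], of b] obtain j :: int where "b = b0 (m, n) + \<beta> * of_int j"
        using X mn by auto
      then have "X = pt ((m, n), j)" by (simp add: pt_def mn)
      with r show "X \<in> pt ` (rows \<times> UNIV)" by blast
    qed
  qed
qed

definition gs :: "complex \<Rightarrow> complex \<Rightarrow> real" where
  "gs \<tau> z = Im \<tau> * real N * \<beta>\<^sup>2 / (Im z)\<^sup>2"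

definition pre :: "complex \<Rightarrow> complex \<Rightarrow> int \<times> int \<Rightarrow> complex" where
  "pre \<tau> z p = complex_of_real (sqrt (Im \<tau>)) * exp (2 * pi * \<i> * N * (of_real (of_int (fst p) / D - of_int (snd p) / D * Re z))\<^sup>2 * \<tau>
      - of_real (pi * Im \<tau> * N * (of_int (snd p) / D)\<^sup>2 * (Im z)\<^sup>2))"

definition sh :: "complex \<Rightarrow> int \<times> int \<Rightarrow> real" where
  "sh z p = (b0 p + 2 * (of_int (fst p) / D) * Re z - of_int (snd p) / D * (Re z)\<^sup>2) / \<beta>"

lemma phi_zero_pt:
  assumes "Im \<tau> > 0" "Im z > 0"
  shows "phi_zero N (pt (p, j)) \<tau> z = pre \<tau> z p * gauss_term (gs \<tau> z) (N * (of_int (snd p) / D) * Re \<tau> * \<beta>) (sh z p + of_int j)"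
proof -
  have "(b0 p + \<beta> * of_int j + 2 * (of_int (fst p) / D) * Re z - of_int (snd p) / D * (Re z)\<^sup>2) / \<beta> = sh z p + of_int j"
    using \<beta>0 by (simp add: sh_def field_simps)
  then show ?thesis
    unfolding pt_def fst_conv snd_conv phi_zero_tz[OF N1 assms \<beta>0] pre_def gs_def by simp
qed

lemma gs_pos: "Im \<tau> > 0 \<Longrightarrow> Im z > 0 \<Longrightarrow> gs \<tau> z > 0"
  using N1 \<beta>0 by (simp add: gs_def)

text \<open>Poisson summation along one row. The offset of the row goes into \<open>om\<close>, and
  the remaining exponent of the dual term is \<open>aE\<close>.\<close>

lemma phi_zero_row:
  assumes "Im \<tau> > 0" "Im z > 0" "p \<in> rows"
  shows "(\<Sum>\<^sub>\<infinity>j. phi_zero N (pt (p, j)) \<tau> z) =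
     of_real (1 / (sqrt N * \<beta>)) * (\<Sum>\<^sub>\<infinity>k. om (fst p, snd p, k) * tm P0 \<tau> z (fst p, snd p, k))"
proof -
  define s r w a c where "s = gs \<tau> z" and "r = N * (of_int (snd p) / D) * Re \<tau> * \<beta>" and "w = sh z p"
    and "a = of_int (fst p) / D" and "c = of_int (snd p) / D"
  have s: "s > 0" using gs_pos assms by (simp add: s_def)
  \<comment> \<open>The factor sqrt v of the kernel cancels against the width of the Gaussian. What
    remains is the factor y of the transformed terms and the constant 1 / (sqrt N \<beta>).\<close>
  have sq: "sqrt (Im \<tau>) * (1 / sqrt s) = Im z / (sqrt N * \<beta>)"
    using assms N1 \<beta>0 by (simp add: s_def gs_def real_sqrt_mult real_sqrt_divide)
  have "(\<Sum>\<^sub>\<infinity>j. phi_zero N (pt (p, j)) \<tau> z) = pre \<tau> z p * (\<Sum>\<^sub>\<infinity>j::int. gauss_term s r (w + of_int j))"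
    unfolding phi_zero_pt[OF assms(1,2)] s_def r_def w_def by (rule infsum_cmult_right')
  also have "\<dots> = pre \<tau> z p * (of_real (1 / sqrt s) * (\<Sum>\<^sub>\<infinity>k::int. of_real (exp (- pi * (of_int k - r)\<^sup>2 / s)) * exp (2 * pi * \<i> * of_real (of_int k * w))))"
    unfolding poisson_gauss[OF s] ..
  also have "\<dots> = (\<Sum>\<^sub>\<infinity>k::int. pre \<tau> z p * (of_real (1 / sqrt s) * (of_real (exp (- pi * (of_int k - r)\<^sup>2 / s)) * exp (2 * pi * \<i> * of_real (of_int k * w)))))"
    by (simp only: infsum_cmult_right')
  also have "\<dots> = (\<Sum>\<^sub>\<infinity>k. of_real (1 / (sqrt N * \<beta>)) * (om (fst p, snd p, k) * tm P0 \<tau> z (fst p, snd p, k)))"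
  proof (rule infsum_cong)
    fix k :: int
    define \<kappa> where "\<kappa> = of_int k / \<beta>"
    have e1: "(of_int k - r)\<^sup>2 / s = (Im z)\<^sup>2 / (N * Im \<tau>) * (\<kappa> - N * c * Re \<tau>)\<^sup>2"
    proof -
      have kr: "of_int k - r = \<beta> * (\<kappa> - N * c * Re \<tau>)" using \<beta>0 by (simp add: \<kappa>_def r_def c_def field_simps)
      show ?thesis unfolding kr power_mult_distrib s_def gs_def using \<beta>0 N1 assms by (simp add: field_simps)
    qed
    have e2: "of_int k * w = \<kappa> * b0 p + \<kappa> * (2 * a * Re z - c * (Re z)\<^sup>2)"
      by (simp add: w_def sh_def \<kappa>_def a_def c_def algebra_simps add_divide_distrib diff_divide_distrib)
    have \<tau>: "complex_of_real (Re \<tau>) + \<i> * complex_of_real (Im \<tau>) = \<tau>" by (simp add: complex_eq_iff)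
    have e3: "(2 * pi * \<i> * N * (of_real (a - c * Re z))\<^sup>2 * \<tau> - of_real (pi * Im \<tau> * N * c\<^sup>2 * (Im z)\<^sup>2))
        + (of_real (- pi * ((of_int k - r)\<^sup>2 / s)) + 2 * pi * \<i> * of_real (of_int k * w))
      = 2 * pi * \<i> * of_real (\<kappa> * b0 p) + aE a c \<kappa> (Re \<tau>) (Im \<tau>) (Re z) (Im z)"
    proof -
      have k1: "cpi * (of_real (Im z))\<^sup>2 * nI * inverse (of_real (Im \<tau>)) * (cN\<^sup>2 * (of_real c)\<^sup>2 * (of_real (Im \<tau>))\<^sup>2) = of_real (pi * Im \<tau> * N * c\<^sup>2 * (Im z)\<^sup>2)"
        using N1 assms by (simp add: field_simps power2_eq_square)
      have k2: "cpi * (of_real (Im z))\<^sup>2 * nI * inverse (of_real (Im \<tau>)) * (of_real \<kappa> - cN * of_real c * of_real (Re \<tau>))\<^sup>2 = of_real (pi * ((Im z)\<^sup>2 / (N * Im \<tau>) * (\<kappa> - N * c * Re \<tau>)\<^sup>2))"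
        by (simp add: divide_inverse)
      show ?thesis
        unfolding e1 e2 aE_def \<tau> distrib_left[of "cpi * (of_real (Im z))\<^sup>2 * nI * inverse (of_real (Im \<tau>))"] k1 k2
        by (simp add: algebra_simps)
    qed
    have o: "om (fst p, snd p, k) = exp (2 * pi * \<i> * of_real (\<kappa> * b0 p))"
      using assms(3) by (simp add: om_def \<kappa>_def)
    have t: "tm P0 \<tau> z (fst p, snd p, k) = of_real (Im z) * exp (aE a c \<kappa> (Re \<tau>) (Im \<tau>) (Re z) (Im z))"
      by (simp add: tm_def aT_def a_def c_def \<kappa>_def)
    have gen: "of_real x * exp E1 * (of_real q * (of_real (exp X) * exp E2)) = of_real (x * q) * exp (E1 + (of_real X + E2))"
      for x q X :: real and E1 E2 :: complex
      by (simp add: exp_add exp_of_real)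
    have d: "- pi * (of_int k - r)\<^sup>2 / s = - pi * ((of_int k - r)\<^sup>2 / s)" by simp
    have "pre \<tau> z p * (of_real (1 / sqrt s) * (of_real (exp (- pi * (of_int k - r)\<^sup>2 / s)) * exp (2 * pi * \<i> * of_real (of_int k * w))))
      = of_real (sqrt (Im \<tau>) * (1 / sqrt s)) * exp ((2 * pi * \<i> * N * (of_real (a - c * Re z))\<^sup>2 * \<tau> - of_real (pi * Im \<tau> * N * c\<^sup>2 * (Im z)\<^sup>2))
        + (of_real (- pi * ((of_int k - r)\<^sup>2 / s)) + 2 * pi * \<i> * of_real (of_int k * w)))"
      unfolding pre_def a_def[symmetric] c_def[symmetric] d by (rule gen)
    also have "\<dots> = of_real (1 / (sqrt N * \<beta>)) * (om (fst p, snd p, k) * tm P0 \<tau> z (fst p, snd p, k))"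
      unfolding sq e3 o t exp_add by simp
    finally show "pre \<tau> z p * (of_real (1 / sqrt s) * (of_real (exp (- pi * (of_int k - r)\<^sup>2 / s)) * exp (2 * pi * \<i> * of_real (of_int k * w))))
      = of_real (1 / (sqrt N * \<beta>)) * (om (fst p, snd p, k) * tm P0 \<tau> z (fst p, snd p, k))" .
  qed
  also have "\<dots> = of_real (1 / (sqrt N * \<beta>)) * (\<Sum>\<^sub>\<infinity>k. om (fst p, snd p, k) * tm P0 \<tau> z (fst p, snd p, k))"
    by (rule infsum_cmult_right')
  finally show ?thesis .
qed

text \<open>The sum along a row is bounded by one constant \<open>K\<close> whatever the offset,
  because the offset can be reduced modulo 1 by reindexing. There remains the sum of the prefactors
  over all pairs (m, n).\<close>

lemma phi_zero_summable:
  assumes "Im \<tau> > 0" "Im z > 0"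
  shows "(\<lambda>q. norm (phi_zero N (pt q) \<tau> z)) summable_on (rows \<times> UNIV)"
proof -
  define s where "s = gs \<tau> z"
  have s: "s > 0" using gs_pos assms by (simp add: s_def)
  define K where "K = (\<Sum>\<^sub>\<infinity>n::int. exp (pi * s * 3) * exp (- 2 * (pi * s)) ^ nat \<bar>n\<bar>)"
  have nrm: "norm (phi_zero N (pt (p, j)) \<tau> z) = norm (pre \<tau> z p) * exp (- (pi * s) * (sh z p + of_int j)\<^sup>2)" for p j
    unfolding phi_zero_pt[OF assms] norm_mult norm_gauss_term s_def ..
  have Ks: "(\<lambda>n::int. exp (pi * s * 3) * exp (- 2 * (pi * s)) ^ nat \<bar>n\<bar>) summable_on UNIV"
    by (rule summable_on_gauss_bound) (use s in simp)
  have gsum: "(\<lambda>j::int. exp (- (pi * s) * (w + of_int j)\<^sup>2)) summable_on UNIV" for w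
    using gauss_term_summable[OF s, of 0 w] by (simp add: norm_gauss_term)
  have gK: "(\<Sum>\<^sub>\<infinity>j::int. exp (- (pi * s) * (w + of_int j)\<^sup>2)) \<le> K" for w
  proof -
    have "bij (\<lambda>j::int. \<lfloor>w\<rfloor> + j)" by (rule bij_plus)
    from infsum_reindex_bij_betw[OF this, of "\<lambda>j. exp (- (pi * s) * (frac w + of_int j)\<^sup>2)"]
    have "(\<Sum>\<^sub>\<infinity>j::int. exp (- (pi * s) * (w + of_int j)\<^sup>2)) = (\<Sum>\<^sub>\<infinity>j::int. exp (- (pi * s) * (frac w + of_int j)\<^sup>2))"
      by (simp add: frac_def algebra_simps)
    also have "\<dots> \<le> K"
      unfolding K_def
    proof (rule infsum_mono[OF gsum Ks])
      fix j :: int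
      have "exp (- (pi * s) * (frac w + of_int j)\<^sup>2) \<le> exp (pi * s * (2 * \<bar>frac w\<bar> + 1)) * exp (- 2 * (pi * s)) ^ nat \<bar>j\<bar>"
        by (rule gauss_shift_le) (use s in simp)
      also have "\<dots> \<le> exp (pi * s * 3) * exp (- 2 * (pi * s)) ^ nat \<bar>j\<bar>"
        using frac_lt_1[of w] s by (intro mult_right_mono) auto
      finally show "exp (- (pi * s) * (frac w + of_int j)\<^sup>2) \<le> exp (pi * s * 3) * exp (- 2 * (pi * s)) ^ nat \<bar>j\<bar>" .
    qed
    finally show ?thesis .
  qed
  have pre_s: "(\<lambda>p. norm (pre \<tau> z p)) summable_on UNIV"
  proof -
    \<comment> \<open>At \<tau>' = i v and k = 0 the transformed exponent is real and equals that of
      the modulus of \<open>pre\<close>, so the summability of the transformed series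
      applies.\<close>
    define \<tau>' where "\<tau>' = Complex 0 (Im \<tau>)"
    have "(\<lambda>i. norm (tm P0 \<tau>' z i)) summable_on UNIV"
      using tm_summable[of "\<lambda>_. 1" \<tau>' z P0] assms by (simp add: \<tau>'_def)
    then have "(\<lambda>i. norm (tm P0 \<tau>' z i)) summable_on range (\<lambda>p. (fst p, snd p, 0))"
      by (rule summable_on_subset_banach) simp
    then have "(\<lambda>p. norm (tm P0 \<tau>' z (fst p, snd p, 0))) summable_on UNIV"
      by (subst (asm) summable_on_reindex) (auto simp: o_def inj_on_def prod_eq_iff)
    moreover have "norm (pre \<tau> z p) = sqrt (Im \<tau>) / Im z * norm (tm P0 \<tau>' z (fst p, snd p, 0))" for p
    proof -
      define a c where "a = of_int (fst p) / D" and "c = of_int (snd p) / D"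
      have "norm (pre \<tau> z p) = sqrt (Im \<tau>) * exp (- (2 * pi * N * (a - c * Re z)\<^sup>2 * Im \<tau> + pi * Im \<tau> * N * c\<^sup>2 * (Im z)\<^sup>2))"
        using assms by (simp add: pre_def norm_mult a_def c_def of_real_diff[symmetric] of_real_power[symmetric] of_real_mult[symmetric] of_real_divide[symmetric] mult.assoc del: of_real_diff of_real_power of_real_mult of_real_divide of_int_mult)
      moreover have "norm (tm P0 \<tau>' z (fst p, snd p, 0)) = Im z * exp (- (2 * pi * N * (a - c * Re z)\<^sup>2 * Im \<tau> + pi * Im \<tau> * N * c\<^sup>2 * (Im z)\<^sup>2))"
      proof -
        have "aE a c 0 (complex_of_real (Re \<tau>')) (complex_of_real (Im \<tau>')) (complex_of_real (Re z)) (complex_of_real (Im z))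
          = of_real (- (2 * pi * N * (a - c * Re z)\<^sup>2 * Im \<tau> + pi * Im \<tau> * N * c\<^sup>2 * (Im z)\<^sup>2))"
          using assms N1 by (simp add: aE_def \<tau>'_def field_simps power2_eq_square)
        then show ?thesis using assms by (simp add: tm_def aT_def norm_mult a_def c_def)
      qed
      ultimately show ?thesis using assms by simp
    qed
    ultimately show ?thesis by (simp only:) (rule summable_on_cmult_right)
  qed
  show ?thesis
  proof (rule Infinite_Sum.abs_summable_on_Sigma_iff[THEN iffD2], intro conjI ballI)
    fix p assume "p \<in> rows"
    show "(\<lambda>j. norm (phi_zero N (pt (p, j)) \<tau> z)) summable_on UNIV"
      unfolding nrm by (rule summable_on_cmult_right[OF gsum])
  next
    have "(\<lambda>p. norm (pre \<tau> z p) * K) summable_on rows"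
      by (rule summable_on_cmult_left[OF summable_on_subset_banach[OF pre_s]]) simp
    then show "(\<lambda>p. norm (\<Sum>\<^sub>\<infinity>j. norm (phi_zero N (pt (p, j)) \<tau> z))) summable_on rows"
    proof (rule summable_on_comparison_test)
      fix p
      have "(\<Sum>\<^sub>\<infinity>j. norm (phi_zero N (pt (p, j)) \<tau> z)) = norm (pre \<tau> z p) * (\<Sum>\<^sub>\<infinity>j::int. exp (- (pi * s) * (sh z p + of_int j)\<^sup>2))"
        unfolding nrm by (rule infsum_cmult_right')
      also have "\<dots> \<le> norm (pre \<tau> z p) * K" by (intro mult_left_mono gK) simp
      finally show "norm (\<Sum>\<^sub>\<infinity>j. norm (phi_zero N (pt (p, j)) \<tau> z)) \<le> norm (pre \<tau> z p) * K"
        by (simp add: infsum_nonneg)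
    qed simp
  qed
qed

text \<open>Absolute convergence before and after the Poisson step licenses the regrouping: the
  coset splits into rows, the rows are extended by weight 0 to all pairs (m, n), and the pairs
  combine with the dual variable into triples.\<close>

lemma Theta_eq_Th:
  assumes "Im \<tau> > 0" "Im z > 0"
  shows "Theta_L N S \<tau> z = of_real (1 / (sqrt N * \<beta>)) * Th om P0 \<tau> z"
proof -
  have sm: "(\<lambda>q. phi_zero N (pt q) \<tau> z) summable_on (rows \<times> UNIV)"
    by (rule abs_summable_summable[OF phi_zero_summable[OF assms]])
  have sT: "(\<lambda>i. om i * tm P0 \<tau> z i) summable_on UNIV"
    by (rule abs_summable_summable[OF tm_summable[OF norm_om assms]])
  have "Theta_L N S \<tau> z = (\<Sum>\<^sub>\<infinity>q\<in>rows \<times> UNIV. phi_zero N (pt q) \<tau> z)"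
    unfolding Theta_L_def by (rule infsum_reindex_bij_betw[OF pt_bij, symmetric])
  also have "\<dots> = (\<Sum>\<^sub>\<infinity>p\<in>rows. \<Sum>\<^sub>\<infinity>j. phi_zero N (pt (p, j)) \<tau> z)"
    using infsum_Sigma_banach[OF sm] by simp
  also have "\<dots> = (\<Sum>\<^sub>\<infinity>p\<in>rows. of_real (1 / (sqrt N * \<beta>)) * (\<Sum>\<^sub>\<infinity>k. om (fst p, snd p, k) * tm P0 \<tau> z (fst p, snd p, k)))"
    by (rule infsum_cong) (rule phi_zero_row[OF assms])
  also have "\<dots> = of_real (1 / (sqrt N * \<beta>)) * (\<Sum>\<^sub>\<infinity>p\<in>rows. (\<Sum>\<^sub>\<infinity>k. om (fst p, snd p, k) * tm P0 \<tau> z (fst p, snd p, k)))"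
    by (rule infsum_cmult_right')
  also have "(\<Sum>\<^sub>\<infinity>p\<in>rows. (\<Sum>\<^sub>\<infinity>k. om (fst p, snd p, k) * tm P0 \<tau> z (fst p, snd p, k)))
     = (\<Sum>\<^sub>\<infinity>p\<in>UNIV. (\<Sum>\<^sub>\<infinity>k. om (fst p, snd p, k) * tm P0 \<tau> z (fst p, snd p, k)))"
    by (rule infsum_cong_neutral) (auto simp: om_def)
  also have "\<dots> = (\<Sum>\<^sub>\<infinity>q\<in>UNIV \<times> UNIV. om (fst (fst q), snd (fst q), snd q) * tm P0 \<tau> z (fst (fst q), snd (fst q), snd q))"
  proof -
    have bij: "bij_betw (\<lambda>q. (fst (fst q), snd (fst q), snd q)) (UNIV \<times> UNIV) (UNIV :: (int \<times> int \<times> int) set)"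
      by (rule bij_betwI[where g="\<lambda>i. ((fst i, fst (snd i)), snd (snd i))"]) auto
    have "(\<lambda>q. om (fst (fst q), snd (fst q), snd q) * tm P0 \<tau> z (fst (fst q), snd (fst q), snd q)) summable_on (UNIV \<times> UNIV)"
      using summable_on_reindex_bij_betw[OF bij, of "\<lambda>i. om i * tm P0 \<tau> z i"] sT by simp
    from infsum_Sigma_banach[OF this] show ?thesis by simp
  qed
  also have "\<dots> = Th om P0 \<tau> z"
  proof -
    have bij: "bij_betw (\<lambda>q. (fst (fst q), snd (fst q), snd q)) (UNIV \<times> UNIV) (UNIV :: (int \<times> int \<times> int) set)"
      by (rule bij_betwI[where g="\<lambda>i. ((fst i, fst (snd i)), snd (snd i))"]) auto
    show ?thesis
      unfolding Th_def using infsum_reindex_bij_betw[OF bij, of "\<lambda>i. om i * tm P0 \<tau> z i"] by simp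
  qed
  finally show ?thesis .
qed

definition om_lead :: "int \<times> int \<times> int \<Rightarrow> complex" where
  "om_lead i = (if lead i then om i else 0)"

definition om_rem :: "int \<times> int \<times> int \<Rightarrow> complex" where
  "om_rem i = (if lead i then 0 else om i)"

lemma norm_om_lead: "norm (om_lead i) \<le> 1" and norm_om_rem: "norm (om_rem i) \<le> 1"
  using norm_om[of i] by (auto simp: om_lead_def om_rem_def)

lemma Th_split:
  assumes "Im \<tau> > 0" "Im z > 0"
  shows "Th om p \<tau> z = Th om_lead p \<tau> z + Th om_rem p \<tau> z"
proof -
  have "Th om p \<tau> z = (\<Sum>\<^sub>\<infinity>i. om_lead i * tm p \<tau> z i + om_rem i * tm p \<tau> z i)"
    unfolding Th_def by (rule infsum_cong) (auto simp: om_lead_def om_rem_def)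
  also have "\<dots> = Th om_lead p \<tau> z + Th om_rem p \<tau> z"
    unfolding Th_def
    by (rule infsum_add) (rule abs_summable_summable, rule tm_summable, rule norm_om_lead norm_om_rem, fact, fact)+
  finally show ?thesis .
qed

text \<open>The theta series of the rows with c = 0, that is, of the vectors orthogonal to the
  isotropic line. At a cusp it becomes \<open>theta_K_tilde\<close>.\<close>

definition theta0 :: "complex \<Rightarrow> complex" where
  "theta0 \<tau> = (\<Sum>\<^sub>\<infinity>m\<in>{m. (m, 0) \<in> rows}. exp (2 * pi * \<i> * of_real (N * (of_int m / D)\<^sup>2) * \<tau>))"

text \<open>For c = k = 0 the exponent is 2 \<pi> i N a^2 \<tau>, free of z, and the phase
  \<open>om\<close> is 1; only the factor y of the terms remembers z.\<close>

lemma Th_lead: "Th om_lead P0 \<tau> z = of_real (Im z) * theta0 \<tau>"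
proof -
  have bij: "bij_betw (\<lambda>m::int. (m, 0::int, 0::int)) {m. (m, 0) \<in> rows} {(m, n, k). (m, 0) \<in> rows \<and> n = 0 \<and> k = 0}"
    by (rule bij_betwI[where g=fst]) auto
  have "Th om_lead P0 \<tau> z = (\<Sum>\<^sub>\<infinity>i\<in>{(m, n, k). (m, 0) \<in> rows \<and> n = 0 \<and> k = 0}. om_lead i * tm P0 \<tau> z i)"
    unfolding Th_def by (rule infsum_cong_neutral) (auto simp: om_lead_def om_def lead_def)
  also have "\<dots> = (\<Sum>\<^sub>\<infinity>m\<in>{m. (m, 0) \<in> rows}. om_lead (m, 0, 0) * tm P0 \<tau> z (m, 0, 0))"
    by (rule infsum_reindex_bij_betw[OF bij, symmetric])
  also have "\<dots> = (\<Sum>\<^sub>\<infinity>m\<in>{m. (m, 0) \<in> rows}. of_real (Im z) * exp (2 * pi * \<i> * of_real (N * (of_int m / D)\<^sup>2) * \<tau>))"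
  proof (rule infsum_cong)
    fix m :: int assume "m \<in> {m. (m, 0) \<in> rows}"
    then have "om_lead (m, 0, 0) = 1" by (simp add: om_lead_def om_def lead_def)
    moreover have "complex_of_real (Re \<tau>) + \<i> * complex_of_real (Im \<tau>) = \<tau>" by (simp add: complex_eq_iff)
    ultimately show "om_lead (m, 0, 0) * tm P0 \<tau> z (m, 0, 0) = of_real (Im z) * exp (2 * pi * \<i> * of_real (N * (of_int m / D)\<^sup>2) * \<tau>)"
      by (simp add: tm_def aT_def aE_def mult.assoc)
  qed
  also have "\<dots> = of_real (Im z) * theta0 \<tau>" unfolding theta0_def by (rule infsum_cmult_right')
  finally show ?thesis .
qed

end


section \<open>Lattice cosets at a cusp\<close>

lemma common_denominator:
  fixes S :: "real set"
  assumes "finite S" "S \<subseteq> \<rat>"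
  shows "\<exists>d::nat. d > 0 \<and> (\<forall>q\<in>S. real d * q \<in> \<int>)"
  using assms
proof (induction S)
  case empty
  show ?case by (intro exI[of _ 1]) simp
next
  case (insert q S)
  then obtain d where d: "d > 0" "\<forall>q\<in>S. real d * q \<in> \<int>" by auto
  from insert obtain a b :: int where ab: "b > 0" "q = of_int a / of_int b"
    using Rats_cases' by (metis insert_subset)
  have "real (d * nat b) * q = of_int (int d * a)" using ab by simp
  then have "real (d * nat b) * q \<in> \<int>" by (metis Ints_of_int)
  moreover have "real (d * nat b) * r \<in> \<int>" if "r \<in> S" for r
  proof -
    have "real (d * nat b) * r = of_int b * (real d * r)" using ab by simp
    then show ?thesis using d(2) that by (metis Ints_mult Ints_of_int)
  qed
  ultimately show ?case using d(1) ab(1) 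
    by (intro exI[of _ "d * nat b"] conjI ballI) (simp, blast)
qed

text \<open>The least positive element of a nonzero subgroup of the multiples of 1 / d generates it,
  by division with remainder on the numerators.\<close>

lemma discrete_subgroup_cyclic:
  fixes B :: "real set" and d :: nat
  assumes "d > 0" and d: "\<And>b. b \<in> B \<Longrightarrow> real d * b \<in> \<int>"
    and diff: "\<And>b c. b \<in> B \<Longrightarrow> c \<in> B \<Longrightarrow> b - c \<in> B"
    and nz: "b1 \<in> B" "b1 \<noteq> 0"
  obtains \<beta> where "\<beta> > 0" "real d * \<beta> \<in> \<int>" "B = range (\<lambda>j::int. \<beta> * of_int j)"
proof -
  have z: "0 \<in> B" using diff[OF nz(1) nz(1)] by simp
  have neg: "- b \<in> B" if "b \<in> B" for b using diff[OF z that] by simp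
  have add: "b + c \<in> B" if "b \<in> B" "c \<in> B" for b c using diff[OF that(1) neg[OF that(2)]] by simp
  have nmult: "real n * b \<in> B" if "b \<in> B" for n b
    by (induction n) (use z add[OF that] in \<open>auto simp: distrib_right\<close>)
  have imult: "of_int j * b \<in> B" if "b \<in> B" for j b
    using nmult[OF that, of "nat j"] neg[OF nmult[OF that, of "nat (- j)"]] by (cases "j \<ge> 0") auto
  define A where "A = {n::nat. n > 0 \<and> real n / real d \<in> B}"
  have "\<exists>n. n \<in> A"
  proof -
    obtain m where m: "real d * b1 = of_int m" using d[OF nz(1)] by (auto elim: Ints_cases)
    then have b1: "b1 = of_int m / real d" using assms(1) by (simp add: field_simps)
    show ?thesis
    proof (cases "m > 0")
      case True
      then show ?thesis using nz b1 by (intro exI[of _ "nat m"]) (simp add: A_def)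
    next
      case False
      then have "m < 0" using nz(2) b1 by (cases "m = 0") auto
      then show ?thesis using neg[OF nz(1)] b1 by (intro exI[of _ "nat (- m)"]) (simp add: A_def)
    qed
  qed
  define n0 where "n0 = (LEAST n. n \<in> A)"
  have n0: "n0 \<in> A" unfolding n0_def using \<open>\<exists>n. n \<in> A\<close> by (auto intro: LeastI)
  have least: "n \<in> A \<Longrightarrow> n0 \<le> n" for n unfolding n0_def by (rule Least_le)
  define \<beta> where "\<beta> = real n0 / real d"
  have \<beta>: "\<beta> > 0" "\<beta> \<in> B" using n0 assms(1) by (auto simp: \<beta>_def A_def)
  show ?thesis
  proof (rule that[of \<beta>])
    show "real d * \<beta> \<in> \<int>" using assms(1) by (simp add: \<beta>_def)
    show "B = range (\<lambda>j::int. \<beta> * of_int j)"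
    proof (intro set_eqI iffI)
      fix b assume b: "b \<in> B"
      obtain m where m: "real d * b = of_int m" using d[OF b] by (auto elim: Ints_cases)
      define q r where "q = m div int n0" and "r = m mod int n0"
      have r: "0 \<le> r" "r < int n0" using n0 by (auto simp: r_def A_def)
      have mqr: "m = q * int n0 + r" by (simp add: q_def r_def)
      have "b - of_int q * \<beta> = of_int r / real d"
        using m assms(1) by (simp add: \<beta>_def field_simps mqr)
      moreover have "b - of_int q * \<beta> \<in> B" by (intro diff b imult \<beta>)
      ultimately have rB: "of_int r / real d \<in> B" by simp
      have "r = 0"
      proof (rule ccontr)
        assume "r \<noteq> 0"
        then have "nat r \<in> A" using r rB by (simp add: A_def)
        then show False using least r by fastforce
      qed
      then have "b = \<beta> * of_int q" using \<open>b - of_int q * \<beta> = of_int r / real d\<close> by simp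
      then show "b \<in> range (\<lambda>j::int. \<beta> * of_int j)" by blast
    next
      fix b assume "b \<in> range (\<lambda>j::int. \<beta> * of_int j)"
      then show "b \<in> B" using imult[OF \<beta>(2)] by (auto simp: mult.commute)
    qed
  qed (rule \<beta>)
qed

lemma full_lattice_diff:
  assumes "full_lattice L" "X \<in> L" "Y \<in> L"
  shows "X - Y \<in> L"
proof -
  obtain B where L: "L = {\<Sum>b\<in>B. of_int (c b) *\<^sub>R b | c :: real^2^2 \<Rightarrow> int. True}"
    using assms(1) unfolding full_lattice_def by blast
  from assms(2,3) obtain c c' :: "real^2^2 \<Rightarrow> int"
    where c: "X = (\<Sum>b\<in>B. of_int (c b) *\<^sub>R b)" "Y = (\<Sum>b\<in>B. of_int (c' b) *\<^sub>R b)"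
    unfolding L by blast
  have "X - Y = (\<Sum>b\<in>B. of_int (c b - c' b) *\<^sub>R b)"
    by (simp add: c sum_subtractf scaleR_left_diff_distrib)
  then show ?thesis unfolding L by (intro CollectI exI[of _ "\<lambda>b. c b - c' b"]) simp
qed

lemma full_lattice_zero: "full_lattice L \<Longrightarrow> 0 \<in> L"
  unfolding full_lattice_def by (auto intro!: exI[of _ "\<lambda>_. 0"])

lemma full_lattice_add:
  assumes "full_lattice L" "X \<in> L" "Y \<in> L"
  shows "X + Y \<in> L"
proof -
  have "0 - Y \<in> L" by (intro full_lattice_diff assms full_lattice_zero)
  from full_lattice_diff[OF assms(1,2) this] show ?thesis by simp
qed

lemma V_space_diff: "X \<in> V_space \<Longrightarrow> Y \<in> V_space \<Longrightarrow> X - Y \<in> V_space"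
  and V_space_add: "X \<in> V_space \<Longrightarrow> Y \<in> V_space \<Longrightarrow> X + Y \<in> V_space"
  by (auto simp: V_space_def trace_add trace_sub)

lemma lattice_denominator:
  assumes "full_lattice L"
  obtains d :: nat where "d > 0" "\<And>X i j. X \<in> L \<Longrightarrow> real d * X $ i $ j \<in> \<int>" "L \<subseteq> V_space"
proof -
  obtain B where B: "B \<subseteq> V_space" "card B = 3"
    and L: "L = {\<Sum>b\<in>B. of_int (c b) *\<^sub>R b | c :: real^2^2 \<Rightarrow> int. True}"
    using assms unfolding full_lattice_def by blast
  have fin: "finite B" using B(2) by (metis card.infinite zero_neq_numeral)
  define E where "E = (\<lambda>(X, i, j). X $ i $ j) ` (B \<times> (UNIV :: 2 set) \<times> (UNIV :: 2 set))"
  have "finite E" "E \<subseteq> \<rat>" using fin B(1) by (auto simp: E_def V_space_def)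
  from common_denominator[OF this] obtain d :: nat where d: "d > 0" "\<forall>q\<in>E. real d * q \<in> \<int>" by blast
  show ?thesis
  proof (rule that[OF d(1)])
    fix X i j assume "X \<in> L"
    then obtain c where X: "X = (\<Sum>b\<in>B. of_int (c b) *\<^sub>R b)" unfolding L by blast
    have "real d * X $ i $ j = (\<Sum>b\<in>B. of_int (c b) * (real d * b $ i $ j))"
      by (simp add: X sum_component sum_distrib_left mult.left_commute)
    also have "\<dots> \<in> \<int>"
    proof (rule Ints_sum)
      fix b assume "b \<in> B"
      then have "b $ i $ j \<in> E" unfolding E_def by (intro image_eqI[of _ _ "(b, i, j)"]) auto
      then show "of_int (c b) * (real d * b $ i $ j) \<in> \<int>" 
        using Ints_mult[OF Ints_of_int bspec[OF d(2)]] by blast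
    qed
    finally show "real d * X $ i $ j \<in> \<int>" .
  next
    show "L \<subseteq> V_space"
    proof
      fix X assume "X \<in> L"
      then obtain c where X: "X = (\<Sum>b\<in>B. of_int (c b) *\<^sub>R b)" unfolding L by blast
      have "trace X = 0"
        unfolding X trace_2 sum_component sum.distrib[symmetric]
        by (rule sum.neutral) (use B(1) in \<open>auto simp: V_space_def trace_2 distrib_left[symmetric] simp del: distrib_left\<close>)
      moreover have "X $ i $ j \<in> \<rat>" for i j
        unfolding X sum_component by (rule Rats_sum) (use B(1) in \<open>auto simp: V_space_def intro!: Rats_mult\<close>)
      ultimately show "X \<in> V_space" by (simp add: V_space_def)
    qed
  qed
qed

text \<open>Three independent vectors cannot all lie in the plane c = 0, which two vectors
  span.\<close>

lemma lattice_not_perp: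
  assumes "full_lattice L" "det g = 1"
  obtains X where "X \<in> L" "act (adj g) X $ 2 $ 1 \<noteq> 0"
proof -
  obtain B where B: "B \<subseteq> V_space" "card B = 3" "independent B"
    and L: "L = {\<Sum>b\<in>B. of_int (c b) *\<^sub>R b | c :: real^2^2 \<Rightarrow> int. True}"
    using assms(1) unfolding full_lattice_def by blast
  have fin: "finite B" using B(2) by (metis card.infinite zero_neq_numeral)
  have BL: "b \<in> L" if "b \<in> B" for b
  proof -
    have "b = (\<Sum>b'\<in>B. of_int (if b' = b then 1 else 0) *\<^sub>R b')"
      using that fin by (simp add: if_distrib[of "\<lambda>x. x *\<^sub>R _"] if_distrib[of of_int] cong: if_cong)
    then show ?thesis unfolding L by (intro CollectI exI[of _ "\<lambda>b'. if b' = b then 1 else 0"]) simp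
  qed
  have "\<exists>X\<in>B. act (adj g) X $ 2 $ 1 \<noteq> 0"
  proof (rule ccontr)
    assume n: "\<not> ?thesis"
    define E where "E = {act g (tz 1 0 0), act g (tz 0 1 0)}"
    have "B \<subseteq> span E"
    proof
      fix X assume X: "X \<in> B"
      define Y where "Y = act (adj g) X"
      have "trace X = 0" using X B(1) by (auto simp: V_space_def)
      then have "trace Y = 0" using trace_act(2)[of "adj g" X] assms(2) by (simp add: Y_def det_adj)
      then have "Y = tz (Y $ 1 $ 1) (Y $ 1 $ 2) (Y $ 2 $ 1)" by (rule trace_zero_tz)
      also have "\<dots> = Y $ 1 $ 1 *\<^sub>R tz 1 0 0 + Y $ 1 $ 2 *\<^sub>R tz 0 1 0"
        using n X by (simp add: tz_scaleR tz_add Y_def)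
      finally have "act g Y = Y $ 1 $ 1 *\<^sub>R act g (tz 1 0 0) + Y $ 1 $ 2 *\<^sub>R act g (tz 0 1 0)"
        by (metis act_add act_scaleR assms(2))
      moreover have "act g Y = X" by (simp add: Y_def act_adj assms)
      moreover have "act g (tz 1 0 0) \<in> span E" "act g (tz 0 1 0) \<in> span E"
        by (simp_all add: E_def span_base)
      ultimately show "X \<in> span E" by (metis span_add span_scale)
    qed
    then have "card B \<le> card E" using independent_span_bound[OF _ B(3)] by (simp add: E_def)
    also have "card E \<le> 2" unfolding E_def by (metis card_2_iff card.insert_remove finite.emptyI card_insert_le_m1 One_nat_def Suc_1 card.empty diff_Suc_1 lessI less_imp_le_nat card_insert_if order.refl finite_insert card_1_singleton_iff le_SucI insert_absorb)
    finally show False using B(2) by simp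
  qed
  then show ?thesis using that BL by blast
qed

lemma act_trans_mat:
  "act (trans_mat n) (tz a b c) = tz (a + real n * c) (b - 2 * real n * a - (real n)\<^sup>2 * c) c"
proof -
  have "det (trans_mat n) = 1" by (simp add: trans_mat_def det_2)
  then show ?thesis
    by (intro mat2_eqI) (simp_all add: act_eq mult_nth trans_mat_def power2_eq_square algebra_simps)
qed

text \<open>The difference g T^M g^-1 - 1 is M times an integral matrix. This puts a translation
  into every congruence subgroup at every cusp, which makes the cusp width finite and produces
  isotropic lattice vectors.\<close>

lemma principal_conjugate:
  assumes "g \<in> SL2Z" "M \<ge> 1"
  shows "g ** trans_mat M ** adj g \<in> principal_congruence M"
proof -
  have d: "det g = 1" by (rule SL2Z_det[OF assms(1)])
  have "(g ** trans_mat M ** adj g) $ i $ j - (mat 1 :: real^2^2) $ i $ j = real M * (g $ i $ 1 * adj g $ 2 $ j)" for i j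
  proof -
    have "(g ** adj g) $ i $ j = (mat 1 :: real^2^2) $ i $ j" using adj_inverse[OF d] by simp
    then show ?thesis by (simp add: mult_nth trans_mat_def algebra_simps)
  qed
  then have "((g ** trans_mat M ** adj g) $ i $ j - (mat 1 :: real^2^2) $ i $ j) / real M \<in> \<int>" for i j
    using assms(2) SL2Z_Ints[OF assms(1)] SL2Z_Ints[OF SL2Z_adj[OF assms(1)]] by (simp add: Ints_mult)
  moreover have "g ** trans_mat M ** adj g \<in> SL2Z"
    by (intro SL2Z_mult SL2Z_adj SL2Z_trans_mat assms)
  ultimately show ?thesis by (simp add: principal_congruence_def)
qed

lemma act_Ints:
  assumes "g \<in> SL2Z" "\<And>i j. r * X $ i $ j \<in> \<int>"
  shows "r * act g X $ i $ j \<in> \<int>"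
proof -
  have "r * act g X $ i $ j = (g $ i $ 1 * (r * X $ 1 $ 1) + g $ i $ 2 * (r * X $ 2 $ 1)) * adj g $ 1 $ j
     + (g $ i $ 1 * (r * X $ 1 $ 2) + g $ i $ 2 * (r * X $ 2 $ 2)) * adj g $ 2 $ j"
    by (simp add: act_eq SL2Z_det[OF assms(1)] mult_nth algebra_simps)
  also have "\<dots> \<in> \<int>"
    by (intro Ints_add Ints_mult assms(2) SL2Z_Ints[OF assms(1)] SL2Z_Ints[OF SL2Z_adj[OF assms(1)]])
  finally show ?thesis .
qed

text \<open>Rotating by the inverse of g sends the cusp to infinity. The rotated lattice meets the
  line of \<open>u_zero\<close> in a cyclic group generated by \<beta>, which gives the row
  structure and identifies \<open>beta_cusp\<close>; the rows with c = 0 correspond to the elements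
  of \<open>hbar\<close>, which identifies the theta series.\<close>

lemma coset_at_cusp:
  assumes N: "N \<ge> 1" and L: "even_lattice N L" and \<Gamma>: "congruence_subgroup \<Gamma>" "compatible_group N L \<Gamma>"
    and h: "h \<in> disc_group N L" and g: "g \<in> SL2Z" and \<l>: "act g ` line_zero = \<l>"
  obtains D where "coset_rows N D (beta_cusp L \<l> g) (act (adj g) ` h)"
    "\<And>\<tau>. coset_rows.theta0 N D (act (adj g) ` h) \<tau> = theta_K_tilde N \<l> h \<tau>"
proof -
  have dg: "det g = 1" by (rule SL2Z_det[OF g])
  have dag: "det (adj g) = 1" by (simp add: det_adj dg)
  have fl: "full_lattice L" using L by (simp add: even_lattice_def)
  obtain d1 :: nat where d1: "d1 > 0" "\<And>X i j. X \<in> L \<Longrightarrow> real d1 * X $ i $ j \<in> \<int>" and LV: "L \<subseteq> V_space"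
    using lattice_denominator[OF fl] by blast
  obtain X0 where X0: "X0 \<in> dual_lattice N L" and hX: "h = (+) X0 ` L" using h by (auto simp: disc_group_def)
  have X0V: "X0 \<in> V_space" using X0 by (simp add: dual_lattice_def)
  have "finite (range (\<lambda>(i, j). X0 $ i $ j))" "range (\<lambda>(i, j). X0 $ i $ j) \<subseteq> \<rat>"
    using X0V by (auto simp: V_space_def)
  from common_denominator[OF this] obtain d2 :: nat where d2: "d2 > 0" "\<And>i j. real d2 * X0 $ i $ j \<in> \<int>" by auto
  define d where "d = d1 * d2"
  have d0: "d > 0" using d1 d2 by (simp add: d_def)
  have dL: "real d * X $ i $ j \<in> \<int>" if "X \<in> L" for X i j
  proof -
    have "real d * X $ i $ j = of_nat d2 * (real d1 * X $ i $ j)" by (simp add: d_def)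
    then show ?thesis using d1(2)[OF that] by (metis Ints_mult Ints_of_nat)
  qed
  have dX0: "real d * X0 $ i $ j \<in> \<int>" for i j
  proof -
    have "real d * X0 $ i $ j = of_nat d1 * (real d2 * X0 $ i $ j)" by (simp add: d_def)
    then show ?thesis using d2(2) by (metis Ints_mult Ints_of_nat)
  qed
  have hV: "X \<in> V_space" "real d * X $ i $ j \<in> \<int>" if "X \<in> h" for X i j
    using that hX X0V LV dL dX0 by (auto intro: V_space_add simp: distrib_left)
  have hdiff: "X - Y \<in> L" if "X \<in> h" "Y \<in> h" for X Y
  proof -
    from that hX obtain A C where "X = X0 + A" "Y = X0 + C" "A \<in> L" "C \<in> L" by blast
    then show ?thesis using full_lattice_diff[OF fl, of A C] by simp
  qed
  have hadd: "X + Y \<in> h" if "X \<in> h" "Y \<in> L" for X Y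
  proof -
    from that hX obtain A where A: "X = X0 + A" "A \<in> L" by blast
    then have "X + Y = X0 + (A + Y)" "A + Y \<in> L" using full_lattice_add[OF fl A(2) that(2)] by (simp_all add: add.assoc)
    then show ?thesis using hX by blast
  qed
  define S L2 where "S = act (adj g) ` h" and "L2 = act (adj g) ` L"
  have S_iff: "Y \<in> S \<longleftrightarrow> act g Y \<in> h" and L2_iff: "Y \<in> L2 \<longleftrightarrow> act g Y \<in> L" for Y
    unfolding S_def L2_def by (auto simp: act_adj[OF dg] intro!: image_eqI[of _ _ "act g Y"])
  have tr: "trace (act (adj g) X) = 0" if "X \<in> V_space" for X
    using that trace_act(2)[OF dag] by (simp add: V_space_def)
  have S_entries: "trace Y = 0" "real d * Y $ i $ j \<in> \<int>" if "Y \<in> S" for Y i j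
    using that tr hV act_Ints[OF SL2Z_adj[OF g]] by (auto simp: S_def)
  have L2_entries: "trace Y = 0" "real d * Y $ i $ j \<in> \<int>" if "Y \<in> L2" for Y i j
    using that tr LV dL act_Ints[OF SL2Z_adj[OF g]] by (auto simp: L2_def)
  have L2_diff: "X - Y \<in> L2" if "X \<in> L2" "Y \<in> L2" for X Y
    using that full_lattice_diff[OF fl] by (simp add: L2_iff act_diff dg)
  define B where "B = {b. tz 0 b 0 \<in> L2}"
  obtain M where M: "M \<ge> 1" "principal_congruence M \<subseteq> \<Gamma>" using \<Gamma>(1) by (auto simp: congruence_subgroup_def)
  have T: "act (trans_mat M) Y \<in> L2" if "Y \<in> L2" for Y
  proof -
    define t where "t = g ** trans_mat M ** adj g"
    have t: "t \<in> \<Gamma>" using principal_conjugate[OF g M(1)] M(2) by (auto simp: t_def)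
    have dt: "det (trans_mat M) = 1" by (rule SL2Z_det[OF SL2Z_trans_mat])
    have "act t (act g Y) \<in> L"
      using t \<Gamma>(2) that unfolding compatible_group_def L2_iff by blast
    moreover have "act t (act g Y) = act g (act (trans_mat M) Y)"
      by (simp add: t_def act_mult det_mul dg dt dag act_adj)
    ultimately show ?thesis by (simp add: L2_iff)
  qed
  \<comment> \<open>Applying T^M - 1 twice to a vector with c \<noteq> 0 leaves - 2 M^2 c times
    \<open>u_zero\<close>, so the lattice contains a nonzero vector of the line.\<close>
  obtain b1 where b1: "b1 \<in> B" "b1 \<noteq> 0"
  proof -
    obtain X where X: "X \<in> L" "act (adj g) X $ 2 $ 1 \<noteq> 0" using lattice_not_perp[OF fl dg] by blast
    define a b c where "a = act (adj g) X $ 1 $ 1" and "b = act (adj g) X $ 1 $ 2" and "c = act (adj g) X $ 2 $ 1"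
    have "act (adj g) X \<in> L2" using X by (simp add: L2_def)
    moreover have "act (adj g) X = tz a b c" unfolding a_def b_def c_def
      by (rule trace_zero_tz) (use X LV tr in blast)
    ultimately have Y: "tz a b c \<in> L2" by simp
    have Y1: "act (trans_mat M) (tz a b c) - tz a b c \<in> L2" by (intro L2_diff T Y)
    have "act (trans_mat M) (act (trans_mat M) (tz a b c) - tz a b c) - (act (trans_mat M) (tz a b c) - tz a b c) \<in> L2"
      by (rule L2_diff[OF T[OF Y1] Y1])
    then have "tz 0 (- 2 * (real M)\<^sup>2 * c) 0 \<in> L2"
      by (simp add: act_trans_mat tz_diff algebra_simps power2_eq_square)
    then show ?thesis using that[of "- 2 * (real M)\<^sup>2 * c"] X(2) M(1) by (simp add: B_def c_def)
  qed
  have B_diff: "b - c \<in> B" if "b \<in> B" "c \<in> B" for b c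
    using L2_diff[of "tz 0 b 0" "tz 0 c 0"] that by (simp add: B_def tz_diff)
  have dB: "real d * b \<in> \<int>" if "b \<in> B" for b
    using L2_entries(2)[of "tz 0 b 0" 1 2] that by (simp add: B_def)
  obtain \<beta> where \<beta>: "\<beta> > 0" "real d * \<beta> \<in> \<int>" "B = range (\<lambda>j::int. \<beta> * of_int j)"
    by (rule discrete_subgroup_cyclic[OF d0 dB B_diff b1])
  have rat: "x \<in> \<rat>" if "real d * x \<in> \<int>" for x :: real
  proof -
    have "x = (real d * x) / real d" using d0 by simp
    then show ?thesis using that Ints_subset_Rats by (metis Rats_divide Rats_of_nat subsetD)
  qed
  have u: "act g (r *\<^sub>R u_zero) = r *\<^sub>R act g u_zero" for r by (rule act_scaleR[OF dg])
  have u_tz: "r *\<^sub>R u_zero = tz 0 r 0" for r by (simp add: u_zero_tz tz_scaleR)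
  have \<l>_iff: "Z \<in> \<l> \<longleftrightarrow> (\<exists>q\<in>\<rat>. Z = act g (tz 0 q 0))" for Z
    unfolding \<l>[symmetric] line_zero_def rat_line_def by (auto simp: u_tz)
  have u_inj: "r = r'" if "r *\<^sub>R act g u_zero = r' *\<^sub>R act g u_zero" for r r'
  proof -
    have "act (adj g) (act g (r *\<^sub>R u_zero)) = act (adj g) (act g (r' *\<^sub>R u_zero))" using that by (simp only: u)
    then show ?thesis by (simp add: act_adj dg u_tz)
  qed
  have lL: "\<l> \<inter> L = {of_int k *\<^sub>R (\<beta> *\<^sub>R act g u_zero) | k. True}"
  proof (intro set_eqI iffI)
    fix Z assume "Z \<in> \<l> \<inter> L"
    then obtain q where q: "Z = act g (tz 0 q 0)" "Z \<in> L" by (auto simp: \<l>_iff)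
    then have "q \<in> B" by (simp add: B_def L2_iff)
    then obtain j :: int where "q = \<beta> * of_int j" using \<beta>(3) by blast
    then have "Z = of_int j *\<^sub>R (\<beta> *\<^sub>R act g u_zero)" by (simp add: q u_tz[symmetric] u mult.commute)
    then show "Z \<in> {of_int k *\<^sub>R (\<beta> *\<^sub>R act g u_zero) | k. True}" by blast
  next
    fix Z assume "Z \<in> {of_int k *\<^sub>R (\<beta> *\<^sub>R act g u_zero) | k. True}"
    then obtain j :: int where "Z = of_int j *\<^sub>R (\<beta> *\<^sub>R act g u_zero)" by blast
    then have Z: "Z = act g (tz 0 (\<beta> * of_int j) 0)" by (simp add: u_tz[symmetric] u mult.commute)
    have "\<beta> * of_int j \<in> B" using \<beta>(3) by blast
    then have "Z \<in> L" "\<beta> * of_int j \<in> \<rat>" using Z dB rat by (auto simp: B_def L2_iff)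
    then show "Z \<in> \<l> \<inter> L" using Z by (auto simp: \<l>_iff)
  qed
  have beta: "beta_cusp L \<l> g = \<beta>"
    unfolding beta_cusp_def
  proof (rule the_equality)
    show "\<beta> \<in> \<rat> \<and> \<beta> > 0 \<and> \<l> \<inter> L = {of_int k *\<^sub>R (\<beta> *\<^sub>R act g u_zero) | k. True}"
      using \<beta> rat lL by blast
    \<comment> \<open>Two positive generators are positive integer multiples of each other, so both
      multipliers are 1.\<close>
    fix b assume b: "b \<in> \<rat> \<and> b > 0 \<and> \<l> \<inter> L = {of_int k *\<^sub>R (b *\<^sub>R act g u_zero) | k. True}"
    have "1 *\<^sub>R (b *\<^sub>R act g u_zero) \<in> \<l> \<inter> L" using b by (metis (mono_tags, lifting) CollectI of_int_1)
    then obtain j :: int where "b *\<^sub>R act g u_zero = of_int j *\<^sub>R (\<beta> *\<^sub>R act g u_zero)" using lL by auto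
    then have j: "b = of_int j * \<beta>" using u_inj[of b "of_int j * \<beta>"] by simp
    have "1 *\<^sub>R (\<beta> *\<^sub>R act g u_zero) \<in> \<l> \<inter> L" using lL by (metis (mono_tags, lifting) CollectI of_int_1)
    then obtain k :: int where "\<beta> *\<^sub>R act g u_zero = of_int k *\<^sub>R (b *\<^sub>R act g u_zero)" using b by auto
    then have k: "\<beta> = of_int k * b" using u_inj[of \<beta> "of_int k * b"] by simp
    have "j > 0" using b j \<beta>(1) by (simp add: zero_less_mult_iff)
    moreover have "k > 0" using b k \<beta>(1) by (simp add: zero_less_mult_iff)
    moreover have "of_int (j * k) * b = 1 * b" using j k by simp
    then have "j * k = 1" using b by (metis mult_right_cancel of_int_eq_1_iff less_irrefl)
    ultimately have "j = 1" using zmult_eq_1_iff[of j k] by auto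
    then show "b = \<beta>" using j by simp
  qed
  have Int_div: "\<exists>m::int. x = of_int m / real d" if "real d * x \<in> \<int>" for x
    using that d0 by (auto elim!: Ints_cases simp: field_simps)
  interpret cr: coset_rows N "real d" \<beta> S
  proof unfold_locales
    fix X assume X: "X \<in> S"
    obtain m n :: int where "X $ 1 $ 1 = of_int m / real d" "X $ 2 $ 1 = of_int n / real d"
      using Int_div[OF S_entries(2)[OF X]] by metis
    then show "\<exists>m n b. X = tz (of_int m / real d) b (of_int n / real d)"
      using trace_zero_tz[OF S_entries(1)[OF X]] by metis
  next
    fix a b c b' assume X: "tz a b c \<in> S"
    have "tz a b' c \<in> S \<longleftrightarrow> tz 0 (b' - b) 0 \<in> L2"
    proof
      assume "tz a b' c \<in> S"
      then have "act g (tz a b' c) - act g (tz a b c) \<in> L" using X hdiff by (simp add: S_iff)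
      then show "tz 0 (b' - b) 0 \<in> L2" by (simp add: L2_iff act_diff[OF dg, symmetric] tz_diff)
    next
      assume "tz 0 (b' - b) 0 \<in> L2"
      then have "act g (tz a b c) + act g (tz 0 (b' - b) 0) \<in> h" using X hadd by (simp add: S_iff L2_iff)
      then show "tz a b' c \<in> S" by (simp add: S_iff act_add[OF dg, symmetric] tz_add)
    qed
    also have "\<dots> \<longleftrightarrow> b' - b \<in> B" by (simp add: B_def)
    also have "\<dots> \<longleftrightarrow> (\<exists>j::int. b' = b + \<beta> * of_int j)" unfolding \<beta>(3) by (auto simp: algebra_simps)
    finally show "tz a b' c \<in> S \<longleftrightarrow> (\<exists>j::int. b' = b + \<beta> * of_int j)" .
  qed (use N d0 \<beta> in auto)
  define M0 where "M0 = {m. (m, 0) \<in> cr.rows}"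
  \<comment> \<open>The class modulo the line of a vector in the row m with c = 0. Vectors of one
    row differ along the line, and different rows have different a, whence the bijection with
    \<open>hbar\<close>.\<close>
  define \<kappa> where "\<kappa> m = line_coset \<l> (act g (tz (of_int m / real d) (cr.b0 (m, 0)) 0))" for m :: int
  have perp_iff: "X \<in> perp N \<l> \<longleftrightarrow> act (adj g) X $ 2 $ 1 = 0" if "X \<in> V_space" for X
  proof -
    define Y where "Y = act (adj g) X"
    have X: "X = act g Y" by (simp add: Y_def act_adj dg)
    have "bil N X (act g (tz 0 q 0)) = real N * q * Y $ 2 $ 1" for q :: real
      unfolding X bil_act[OF dg] by (simp add: bil_def trace_2 mult_nth)
    note eq = this
    have "Y $ 2 $ 1 = 0" if "X \<in> perp N \<l>"
    proof -
      have "act g (tz 0 1 0) \<in> \<l>" unfolding \<l>_iff by (intro bexI[of _ 1]) auto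
      then have "bil N X (act g (tz 0 1 0)) = 0" using that by (simp add: perp_def)
      then show ?thesis using eq[of 1] N by simp
    qed
    moreover have "X \<in> perp N \<l>" if "Y $ 2 $ 1 = 0"
      using \<open>X \<in> V_space\<close> that by (auto simp: perp_def \<l>_iff eq)
    ultimately show ?thesis by (auto simp: Y_def)
  qed
  have M0_in: "tz (of_int m / real d) (cr.b0 (m, 0)) 0 \<in> S" if "m \<in> M0" for m
    using cr.b0[of "(m, 0)"] that by (simp add: M0_def)
  have \<l>_zero: "0 \<in> \<l>" unfolding \<l>_iff
    by (intro bexI[of _ 0]) (use act_scaleR[OF dg, of 0 "tz 0 0 0"] in \<open>simp_all add: tz_scaleR\<close>)
  have \<l>_diff: "X - Y \<in> \<l>" if "X \<in> \<l>" "Y \<in> \<l>" for X Y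
  proof -
    from that obtain q r where "q \<in> \<rat>" "r \<in> \<rat>" "X = act g (tz 0 q 0)" "Y = act g (tz 0 r 0)" by (auto simp: \<l>_iff)
    then have "X - Y = act g (tz 0 (q - r) 0)" "q - r \<in> \<rat>" by (simp_all add: act_diff[OF dg, symmetric] tz_diff)
    then show ?thesis by (auto simp: \<l>_iff)
  qed
  have lc_eq: "line_coset \<l> X = line_coset \<l> Y \<longleftrightarrow> X - Y \<in> \<l>" for X Y
  proof
    assume "line_coset \<l> X = line_coset \<l> Y"
    moreover have "X \<in> line_coset \<l> X" unfolding line_coset_def using \<l>_zero by (auto intro!: image_eqI[of _ _ 0])
    ultimately show "X - Y \<in> \<l>" by (auto simp: line_coset_def)
  next
    assume a: "X - Y \<in> \<l>"
    have b: "Y - X \<in> \<l>" using \<l>_diff[OF \<l>_zero a] by simp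
    have sub: "line_coset \<l> P \<subseteq> line_coset \<l> Q" if "P - Q \<in> \<l>" "Q - P \<in> \<l>" for P Q
    proof
      fix Z assume "Z \<in> line_coset \<l> P"
      then obtain W where "W \<in> \<l>" "Z = P + W" by (auto simp: line_coset_def)
      then have "Z = Q + (W - (Q - P))" "W - (Q - P) \<in> \<l>" using \<l>_diff[OF _ that(2)] by simp_all
      then show "Z \<in> line_coset \<l> Q" unfolding line_coset_def by blast
    qed
    show "line_coset \<l> X = line_coset \<l> Y" using sub[OF a b] sub[OF b a] by blast
  qed
  have bij: "bij_betw \<kappa> M0 (hbar N \<l> h)"
    unfolding bij_betw_def
  proof
    show "inj_on \<kappa> M0"
    proof (rule inj_onI)
      fix m m' assume "\<kappa> m = \<kappa> m'"
      then obtain q where "act g (tz (of_int m / real d - of_int m' / real d) (cr.b0 (m, 0) - cr.b0 (m', 0)) 0) = act g (tz 0 q 0)"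
        unfolding \<kappa>_def lc_eq \<l>_iff by (auto simp: act_diff[OF dg, symmetric] tz_diff)
      then have "tz (of_int m / real d - of_int m' / real d) (cr.b0 (m, 0) - cr.b0 (m', 0)) 0 = tz 0 q 0"
        using act_adj(1)[OF dg] by metis
      then show "m = m'" using d0 by simp
    qed
    show "\<kappa> ` M0 = hbar N \<l> h"
    proof
      show "\<kappa> ` M0 \<subseteq> hbar N \<l> h"
      proof
        fix K assume "K \<in> \<kappa> ` M0"
        then obtain m where m: "m \<in> M0" "K = \<kappa> m" by blast
        have "act g (tz (of_int m / real d) (cr.b0 (m, 0)) 0) \<in> h" using M0_in[OF m(1)] by (simp add: S_iff)
        moreover from this have "act g (tz (of_int m / real d) (cr.b0 (m, 0)) 0) \<in> perp N \<l>"
          using hV(1) perp_iff by (simp add: act_adj dg)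
        ultimately show "K \<in> hbar N \<l> h" unfolding hbar_def m(2) \<kappa>_def by blast
      qed
      show "hbar N \<l> h \<subseteq> \<kappa> ` M0"
      proof
        fix K assume "K \<in> hbar N \<l> h"
        then obtain X where X: "X \<in> h" "X \<in> perp N \<l>" "K = line_coset \<l> X" by (auto simp: hbar_def)
        define Y where "Y = act (adj g) X"
        have YS: "Y \<in> S" using X by (simp add: S_def Y_def)
        have Y0: "Y $ 2 $ 1 = 0" using X perp_iff hV(1) by (simp add: Y_def)
        obtain m :: int where m: "Y $ 1 $ 1 = of_int m / real d" using Int_div[OF S_entries(2)[OF YS]] by blast
        have Yt: "Y = tz (of_int m / real d) (Y $ 1 $ 2) 0" using trace_zero_tz[OF S_entries(1)[OF YS]] Y0 m by simp
        then have "\<exists>b. tz (of_int m / real d) b (of_int 0 / real d) \<in> S" using YS by (metis div_0 of_int_0)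
        then have mM: "m \<in> M0" by (simp add: M0_def cr.rows_def)
        from cr.S_row[OF M0_in[OF this], of "Y $ 1 $ 2"] obtain j :: int where j: "Y $ 1 $ 2 = cr.b0 (m, 0) + \<beta> * of_int j"
          using YS Yt by auto
        have "X - act g (tz (of_int m / real d) (cr.b0 (m, 0)) 0) = act g (Y - tz (of_int m / real d) (cr.b0 (m, 0)) 0)"
          by (simp add: act_diff dg Y_def act_adj)
        also have "Y - tz (of_int m / real d) (cr.b0 (m, 0)) 0 = tz 0 (\<beta> * of_int j) 0"
          by (subst Yt) (simp add: tz_diff j)
        finally have "X - act g (tz (of_int m / real d) (cr.b0 (m, 0)) 0) \<in> \<l>"
          unfolding \<l>_iff using rat[OF \<beta>(2)] by (auto intro!: bexI[of _ "\<beta> * of_int j"])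
        then have "K = \<kappa> m" unfolding X(3) \<kappa>_def lc_eq .
        with mM show "K \<in> \<kappa> ` M0" by blast
      qed
    qed
  qed
  have Qk: "Q_quot N (\<kappa> m) = N * (of_int m / real d)\<^sup>2" for m
  proof -
    have "Q_form N ` \<kappa> m = {N * (of_int m / real d)\<^sup>2}"
    proof -
      have "Q_form N (act g (tz a b 0) + Z) = real N * a\<^sup>2" if "Z \<in> \<l>" for a b :: real and Z
      proof -
        from that obtain q where "Z = act g (tz 0 q 0)" by (auto simp: \<l>_iff)
        then have "act g (tz a b 0) + Z = act g (tz a (b + q) 0)" by (simp add: act_add[OF dg, symmetric] tz_add)
        then show ?thesis by (simp add: Q_act dg) (simp add: Q_form_def det_2 power2_eq_square)
      qed
      then show ?thesis unfolding \<kappa>_def line_coset_def image_image using \<l>_zero by (auto intro!: image_eqI[of _ _ 0])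
    qed
    then show ?thesis by (simp add: Q_quot_def)
  qed
  have th: "cr.theta0 \<tau> = theta_K_tilde N \<l> h \<tau>" for \<tau>
  proof -
    have "theta_K N \<l> h \<tau> = (\<Sum>\<^sub>\<infinity>m\<in>M0. exp (2 * complex_of_real pi * \<i> * complex_of_real (Q_quot N (\<kappa> m)) * \<tau>))"
      unfolding theta_K_def by (rule infsum_reindex_bij_betw[OF bij, symmetric])
    also have "\<dots> = cr.theta0 \<tau>" by (simp add: cr.theta0_def M0_def Qk)
    finally have eq: "theta_K N \<l> h \<tau> = cr.theta0 \<tau>" .
    show ?thesis
    proof (cases "h \<inter> perp N \<l> = {}")
      case True
      then have "hbar N \<l> h = {}" by (simp add: hbar_def)
      then have "theta_K N \<l> h \<tau> = 0" by (simp add: theta_K_def)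
      then show ?thesis using True eq by (simp add: theta_K_tilde_def)
    qed (simp add: theta_K_tilde_def eq)
  qed
  have "coset_rows N (real d) (beta_cusp L \<l> g) (act (adj g) ` h)"
    unfolding beta S_def[symmetric] by (rule cr.coset_rows_axioms)
  moreover have "coset_rows.theta0 N (real d) (act (adj g) ` h) \<tau> = theta_K_tilde N \<l> h \<tau>" for \<tau>
    unfolding S_def[symmetric] by (rule th)
  ultimately show ?thesis by (rule that)
qed

section \<open>Integration over the fundamental domain\<close>

text \<open>Both measures agree on boxes, and that characterises Lebesgue measure. Integrals over
  the half plane thereby become iterated integrals in x and y.\<close>

lemma complex_lborel: "(lborel :: complex measure) = distr (lborel \<Otimes>\<^sub>M lborel) borel (\<lambda>p. Complex (fst p) (snd p))"
proof (rule lborel_eqI)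
  fix l u :: complex assume lu: "\<And>b. b \<in> Basis \<Longrightarrow> l \<bullet> b \<le> u \<bullet> b"
  have le: "Re l \<le> Re u" "Im l \<le> Im u"
    using lu[of 1] lu[of \<i>] by (auto simp: Basis_complex_def inner_complex_def)
  have m: "(\<lambda>p. Complex (fst p) (snd p)) \<in> borel_measurable (lborel \<Otimes>\<^sub>M lborel)"
    by (simp add: borel_measurable_complex_iff)
  have "(\<lambda>p. Complex (fst p) (snd p)) -` box l u \<inter> space (lborel \<Otimes>\<^sub>M lborel) = {Re l<..<Re u} \<times> {Im l<..<Im u}"
    by (auto simp: box_def Basis_complex_def inner_complex_def space_pair_measure)
  then have "emeasure (distr (lborel \<Otimes>\<^sub>M lborel) borel (\<lambda>p. Complex (fst p) (snd p))) (box l u)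
      = emeasure (lborel \<Otimes>\<^sub>M lborel) ({Re l<..<Re u} \<times> {Im l<..<Im u})"
    using m by (subst emeasure_distr) auto
  also have "\<dots> = ennreal (Re u - Re l) * ennreal (Im u - Im l)"
    using le by (subst lborel.emeasure_pair_measure_Times) auto
  also have "\<dots> = (\<Prod>b\<in>Basis. (u - l) \<bullet> b)"
    using le by (simp add: Basis_complex_def inner_complex_def ennreal_mult)
  finally show "emeasure (distr (lborel \<Otimes>\<^sub>M lborel) borel (\<lambda>p. Complex (fst p) (snd p))) (box l u) = (\<Prod>b\<in>Basis. (u - l) \<bullet> b)" .
qed simp

lemma complex_integrable_pair:
  fixes g :: "complex \<Rightarrow> 'a::{banach, second_countable_topology}"
  assumes "g \<in> borel_measurable borel"
  shows "integrable lborel g \<longleftrightarrow> integrable (lborel \<Otimes>\<^sub>M lborel) (\<lambda>p. g (Complex (fst p) (snd p)))"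
proof -
  have m: "(\<lambda>p. Complex (fst p) (snd p)) \<in> borel_measurable (lborel \<Otimes>\<^sub>M lborel)"
    by (simp add: borel_measurable_complex_iff)
  show ?thesis
    by (subst complex_lborel) (rule integrable_distr_eq[OF m assms])
qed

lemma fubini_complex:
  fixes g :: "complex \<Rightarrow> 'a::{banach, second_countable_topology}"
  assumes "integrable lborel g"
  shows "integral\<^sup>L lborel g = (\<integral>x. (\<integral>y. g (Complex x y) \<partial>lborel) \<partial>lborel)"
    "integral\<^sup>L lborel g = (\<integral>y. (\<integral>x. g (Complex x y) \<partial>lborel) \<partial>lborel)"
proof -
  have m: "(\<lambda>p. Complex (fst p) (snd p)) \<in> borel_measurable (lborel \<Otimes>\<^sub>M lborel)"
    by (simp add: borel_measurable_complex_iff)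
  have gm: "g \<in> borel_measurable borel" using assms by auto
  have i: "integrable (lborel \<Otimes>\<^sub>M lborel) (\<lambda>p. g (Complex (fst p) (snd p)))"
    using assms complex_integrable_pair[OF gm] by simp
  have "integral\<^sup>L lborel g = integral\<^sup>L (lborel \<Otimes>\<^sub>M lborel) (\<lambda>p. g (Complex (fst p) (snd p)))"
    by (subst complex_lborel) (rule integral_distr[OF m gm])
  with lborel_pair.integral_fst'[OF i] lborel_pair.integral_snd[of "\<lambda>x y. g (Complex x y)"] i
  show "integral\<^sup>L lborel g = (\<integral>x. (\<integral>y. g (Complex x y) \<partial>lborel) \<partial>lborel)"
    "integral\<^sup>L lborel g = (\<integral>y. (\<integral>x. g (Complex x y) \<partial>lborel) \<partial>lborel)"
    by (simp_all add: case_prod_unfold)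
qed

lemma integral_indicator_Icc:
  fixes k :: "real \<Rightarrow> complex"
  assumes "continuous_on {a..b} k"
  shows "(\<integral>x. indicator {a..b} x *\<^sub>R k x \<partial>lborel) = integral {a..b} k"
  using set_borel_integral_eq_integral(2)[OF borel_integrable_atLeastAtMost'[OF assms]]
  by (simp add: set_lebesgue_integral_def)

text \<open>Vertical and horizontal lines are null sets, which disposes of the overlaps between
  adjacent pieces of the domain.\<close>

lemma AE_Re_Im_neq: "AE z in lborel. Re z \<noteq> c" "AE z in lborel. Im z \<noteq> c"
proof -
  have "negligible {z::complex. 1 \<bullet> z = c}" "negligible {z. \<i> \<bullet> z = c}"
    by (rule negligible_hyperplane, simp)+
  then have n: "negligible {z. Re z = c}" "negligible {z. Im z = c}"
    by (simp_all add: inner_complex_def)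
  have "closed {z. Re z = c}" "closed {z. Im z = c}"
    by (intro closed_Collect_eq continuous_intros)+
  then have "{z. Re z = c} \<in> null_sets lborel" "{z. Im z = c} \<in> null_sets lborel"
    using n unfolding negligible_iff_null_sets by (auto simp: null_sets_completion_iff)
  then show "AE z in lborel. Re z \<noteq> c" "AE z in lborel. Im z \<noteq> c"
    by (auto dest: AE_not_in)
qed

lemma has_dir_line:
  "has_dir 1 P d (Complex x y) \<Longrightarrow> ((\<lambda>x. P (Complex x y)) has_vector_derivative d) (at x)"
  "has_dir \<i> P d (Complex x y) \<Longrightarrow> ((\<lambda>y. P (Complex x y)) has_vector_derivative d) (at y)"
proof -
  have e: "Complex 0 y + 1 * complex_of_real x = Complex x y" "Complex x 0 + \<i> * complex_of_real y = Complex x y" for x y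
    by (simp_all add: complex_eq_iff)
  show "has_dir 1 P d (Complex x y) \<Longrightarrow> ((\<lambda>x. P (Complex x y)) has_vector_derivative d) (at x)"
    using has_dir_at[of 1 P d "Complex 0 y" x] by (simp only: e)
  show "has_dir \<i> P d (Complex x y) \<Longrightarrow> ((\<lambda>y. P (Complex x y)) has_vector_derivative d) (at y)"
    using has_dir_at[of \<i> P d "Complex x 0" y] by (simp only: e)
qed

lemma continuous_on_Complex [continuous_intros]:
  fixes f g :: "'a::topological_space \<Rightarrow> real"
  assumes "continuous_on S f" "continuous_on S g"
  shows "continuous_on S (\<lambda>x. Complex (f x) (g x))"
  unfolding Complex_eq by (intro continuous_intros assms)

lemma continuous_on_upper_compose:
  assumes "continuous_on upper_half g" "continuous_on S k" "\<And>x. x \<in> S \<Longrightarrow> Im (k x) > 0"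
  shows "continuous_on S (\<lambda>x. g (k x))"
  by (rule continuous_on_compose2[OF assms(1,2)]) (use assms(3) in \<open>auto simp: upper_half_def\<close>)

section \<open>The truncated fundamental domain and Green's formula on it\<close>

definition FT :: "real \<Rightarrow> complex set" where
  "FT T = {z \<in> fund_dom. Im z \<le> T}"

text \<open>The open condition Im z > 0 becomes the closed one 0 \<le> Im z, since no real point has
  |Re z| \<le> 1/2 and |z| \<ge> 1. The set is therefore closed, and compactness follows.\<close>

lemma FT_iff: "z \<in> FT T \<longleftrightarrow> \<bar>Re z\<bar> \<le> 1 / 2 \<and> 1 \<le> cmod z \<and> 0 \<le> Im z \<and> Im z \<le> T"
proof -
  have False if "Im z = 0" "\<bar>Re z\<bar> \<le> 1 / 2" "1 \<le> cmod z"
  proof -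
    have "cmod z = \<bar>Re z\<bar>" using that(1) by (simp add: cmod_def)
    then show False using that by simp
  qed
  then show ?thesis by (auto simp: FT_def fund_dom_def upper_half_def order_less_le)
qed

lemma FT_compact: "compact (FT T)"
proof -
  have "closed {z. \<bar>Re z\<bar> \<le> 1 / 2 \<and> 1 \<le> cmod z \<and> 0 \<le> Im z \<and> Im z \<le> T}"
    by (intro closed_Collect_conj closed_Collect_le continuous_intros)
  moreover have "FT T = {z. \<bar>Re z\<bar> \<le> 1 / 2 \<and> 1 \<le> cmod z \<and> 0 \<le> Im z \<and> Im z \<le> T}" using FT_iff by blast
  moreover have "bounded (FT T)"
  proof (rule boundedI)
    fix z assume "z \<in> FT T"
    then show "cmod z \<le> 1 / 2 + T" using cmod_le[of z] by (auto simp: FT_iff)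
  qed
  ultimately show ?thesis by (simp add: compact_eq_bounded_closed)
qed

lemma FT_upper: "z \<in> FT T \<Longrightarrow> Im z > 0"
  by (simp add: FT_def fund_dom_def upper_half_def)

lemma FT_Im_ge:
  assumes "z \<in> FT T"
  shows "Im z \<ge> sqrt 3 / 2" "Im z \<ge> 1 / 2"
proof -
  have "1 \<le> (cmod z)\<^sup>2" using assms by (simp add: FT_iff)
  moreover have "(Re z)\<^sup>2 \<le> (1 / 2)\<^sup>2" using assms by (subst abs_le_square_iff[symmetric]) (simp add: FT_iff)
  ultimately have "(sqrt 3 / 2)\<^sup>2 \<le> (Im z)\<^sup>2" by (simp add: cmod_power2 power_divide)
  then show a: "Im z \<ge> sqrt 3 / 2" using FT_upper[OF assms] by (simp add: power2_le_iff_abs_le)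
  have "sqrt 3 \<ge> 1" by simp
  then show "Im z \<ge> 1 / 2" using a by linarith
qed

lemma compact_set_integrable:
  fixes g :: "complex \<Rightarrow> complex"
  assumes "compact S" "continuous_on S g"
  shows "set_integrable lborel S g"
  unfolding set_integrable_def by (rule borel_integrable_compact[OF assms])

definition arc :: "real \<Rightarrow> real" where "arc x = sqrt (1 - x\<^sup>2)"

lemma arc_bounds:
  assumes "\<bar>x\<bar> \<le> 1 / 2"
  shows "arc x > 0" "arc x \<le> 1" "x\<^sup>2 + (arc x)\<^sup>2 = 1" "sqrt 3 / 2 \<le> arc x"
proof -
  have "x\<^sup>2 \<le> (1 / 2)\<^sup>2" using assms by (subst abs_le_square_iff[symmetric]) simp
  then have x: "x\<^sup>2 \<le> 1 / 4" by (simp add: power_divide)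
  then show "arc x > 0" "arc x \<le> 1" "x\<^sup>2 + (arc x)\<^sup>2 = 1" by (simp_all add: arc_def)
  have "sqrt (3 / 4) \<le> arc x" unfolding arc_def using x by (intro real_sqrt_le_mono) simp
  then show "sqrt 3 / 2 \<le> arc x" by (simp add: real_sqrt_divide)
qed

lemma FT_slice_y:
  assumes "T \<ge> 1"
  shows "Complex x y \<in> FT T \<longleftrightarrow> \<bar>x\<bar> \<le> 1 / 2 \<and> y \<in> {arc x..T}"
proof (cases "\<bar>x\<bar> \<le> 1 / 2")
  case True
  note a = arc_bounds[OF True]
  have "1 \<le> cmod (Complex x y) \<longleftrightarrow> (arc x)\<^sup>2 \<le> y\<^sup>2"
    using a(3) by (simp add: complex_norm) linarith
  also have "\<dots> \<longleftrightarrow> arc x \<le> \<bar>y\<bar>" using a(1) by (simp add: power2_le_iff_abs_le abs_le_square_iff[symmetric])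
  finally show ?thesis using True a(1) by (auto simp: FT_iff)
qed (simp add: FT_iff)

text \<open>A horizontal slice is the interval [-1/2, 1/2] minus an open gap cut out by the unit
  circle; the maximum makes the gap empty for y \<ge> 1.\<close>

lemma FT_slice_x:
  assumes "T \<ge> 1"
  defines "r \<equiv> \<lambda>y::real. sqrt (max 0 (1 - y\<^sup>2))"
  shows "Complex x y \<in> FT T \<longleftrightarrow> y \<in> {sqrt 3 / 2..T} \<and> x \<in> {-1/2..1/2} \<and> x \<notin> {- r y<..<r y}"
proof (cases "y \<in> {sqrt 3 / 2..T} \<and> \<bar>x\<bar> \<le> 1 / 2")
  case True
  have y: "y > 0" using True by (smt (verit) atLeastAtMost_iff divide_pos_pos real_sqrt_gt_zero)
  have "1 \<le> cmod (Complex x y) \<longleftrightarrow> 1 - y\<^sup>2 \<le> x\<^sup>2" by (simp add: complex_norm) linarith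
  also have "\<dots> \<longleftrightarrow> max 0 (1 - y\<^sup>2) \<le> x\<^sup>2" by simp
  also have "\<dots> \<longleftrightarrow> r y \<le> \<bar>x\<bar>" unfolding r_def by (metis real_sqrt_abs real_sqrt_le_iff)
  finally show ?thesis using True y by (auto simp: FT_iff abs_if split: if_splits)
next
  case False
  then show ?thesis using FT_Im_ge(1)[of "Complex x y" T] by (auto simp: FT_iff abs_le_iff)
qed

text \<open>The fundamental theorem on each slice gives the values on the two sides minus those at
  the ends of the gap, collected in \<open>K\<close>. The substitution y = \<open>arc x\<close>
  expresses the latter in the variable x, the one in which \<open>green_y\<close> leaves the
  arc.\<close>

lemma green_x:
  assumes "T \<ge> 1" "continuous_on upper_half P" "continuous_on upper_half P'"
    and der: "\<And>z. Im z > 0 \<Longrightarrow> has_dir 1 P (P' z) z"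
  shows "(LINT z:FT T|lborel. P' z) = integral {sqrt 3 / 2..T} (\<lambda>y. P (Complex (1/2) y) - P (Complex (-1/2) y))
     - integral {0..1/2} (\<lambda>x. (x / arc x) *\<^sub>R (P (Complex x (arc x)) - P (Complex (- x) (arc x))))"
proof -
  define r where "r y = sqrt (max 0 (1 - y\<^sup>2))" for y :: real
  have s3: "sqrt 3 / 2 > 0" "sqrt 3 / 2 \<le> 1" using arc_bounds[of 0] by (simp_all add: arc_def)
  have ypos: "y > 0" if "y \<in> {sqrt 3 / 2..T}" for y using that s3 by (meson atLeastAtMost_iff less_le_trans)
  have rc: "continuous_on A r" for A unfolding r_def by (intro continuous_intros)
  have r0: "r y \<ge> 0" for y by (simp add: r_def)
  have r_half: "r y \<le> 1 / 2" if "y \<in> {sqrt 3 / 2..T}" for y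
  proof -
    have "(sqrt 3 / 2)\<^sup>2 \<le> y\<^sup>2" using that s3 by (intro power_mono) auto
    then have "r y \<le> sqrt ((1 / 2)\<^sup>2)" unfolding r_def by (intro real_sqrt_le_mono) (simp add: power_divide max_def)
    then show ?thesis by simp
  qed
  define K where "K y = P (Complex (r y) y) - P (Complex (- r y) y)" for y
  have Kc: "continuous_on {sqrt 3 / 2..T} K"
    unfolding K_def by (intro continuous_on_diff continuous_on_upper_compose[OF assms(2)] continuous_intros rc) (simp_all only: complex.sel ypos)
  have Wc: "continuous_on {sqrt 3 / 2..T} (\<lambda>y. P (Complex (1/2) y) - P (Complex (-1/2) y))"
    by (intro continuous_on_diff continuous_on_upper_compose[OF assms(2)] continuous_intros) (simp_all only: complex.sel ypos)
  have P'c: "continuous_on A (\<lambda>x. P' (Complex x y))" if "y > 0" for y A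
    by (intro continuous_on_upper_compose[OF assms(3)] continuous_intros) (use that in auto)
  have ftc: "integral {a..b} (\<lambda>x. P' (Complex x y)) = P (Complex b y) - P (Complex a y)" if "y > 0" "a \<le> b" for a b y
    by (rule integral_unique, rule fundamental_theorem_of_calculus[OF that(2)])
      (auto intro!: has_vector_derivative_at_within has_dir_line der simp: that)
  have si: "set_integrable lborel (FT T) P'"
    by (rule compact_set_integrable[OF FT_compact]) (rule continuous_on_subset[OF assms(3)], auto simp: upper_half_def dest: FT_upper)
  have inner: "(\<integral>x. indicator (FT T) (Complex x y) *\<^sub>R P' (Complex x y) \<partial>lborel)
     = indicator {sqrt 3 / 2..T} y *\<^sub>R ((P (Complex (1/2) y) - P (Complex (-1/2) y)) - K y)" for y
  proof (cases "y \<in> {sqrt 3 / 2..T}")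
    case True
    note yp = ypos[OF True]
    have "(\<integral>x. indicator (FT T) (Complex x y) *\<^sub>R P' (Complex x y) \<partial>lborel)
      = (\<integral>x. indicator {-1/2..1/2} x *\<^sub>R P' (Complex x y) - indicator {- r y<..<r y} x *\<^sub>R P' (Complex x y) \<partial>lborel)"
    proof (rule Bochner_Integration.integral_cong[OF refl])
      fix x
      show "indicator (FT T) (Complex x y) *\<^sub>R P' (Complex x y) = indicator {-1/2..1/2} x *\<^sub>R P' (Complex x y) - indicator {- r y<..<r y} x *\<^sub>R P' (Complex x y)"
        using True r_half[OF True] FT_slice_x[OF assms(1), of x y] by (auto simp: indicator_def r_def[symmetric])
    qed
    also have "\<dots> = (\<integral>x. indicator {-1/2..1/2} x *\<^sub>R P' (Complex x y) \<partial>lborel) - (\<integral>x. indicator {- r y<..<r y} x *\<^sub>R P' (Complex x y) \<partial>lborel)"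
    proof (rule Bochner_Integration.integral_diff)
      show "integrable lborel (\<lambda>x. indicator {-1/2..1/2} x *\<^sub>R P' (Complex x y))"
        using borel_integrable_atLeastAtMost'[OF P'c[OF yp]] by (simp add: set_integrable_def)
      have "set_integrable lborel {- r y<..<r y} (\<lambda>x. P' (Complex x y))"
        by (rule set_integrable_subset[OF borel_integrable_atLeastAtMost'[OF P'c[OF yp], of "- r y" "r y"]]) auto
      then show "integrable lborel (\<lambda>x. indicator {- r y<..<r y} x *\<^sub>R P' (Complex x y))" by (simp add: set_integrable_def)
    qed
    also have "(\<integral>x. indicator {- r y<..<r y} x *\<^sub>R P' (Complex x y) \<partial>lborel) = (\<integral>x. indicator {- r y..r y} x *\<^sub>R P' (Complex x y) \<partial>lborel)"
      by (rule integral_discrete_difference[of "{- r y, r y}"]) (auto simp: indicator_def)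
    also have "\<dots> = integral {- r y..r y} (\<lambda>x. P' (Complex x y))" by (rule integral_indicator_Icc[OF P'c[OF yp]])
    also have "(\<integral>x. indicator {-1/2..1/2} x *\<^sub>R P' (Complex x y) \<partial>lborel) = integral {-1/2..1/2} (\<lambda>x. P' (Complex x y))"
      by (rule integral_indicator_Icc[OF P'c[OF yp]])
    finally show ?thesis using True r0[of y] by (simp add: ftc[OF yp] K_def)
  next
    case False
    then have "Complex x y \<notin> FT T" for x using FT_slice_x[OF assms(1), of x y] by blast
    moreover have "indicator {sqrt 3 / 2..T} y = (0::real)" using False by (simp only: indicator_def of_bool_def if_False)
    ultimately show ?thesis by simp
  qed
  have "(LINT z:FT T|lborel. P' z) = (\<integral>y. indicator {sqrt 3 / 2..T} y *\<^sub>R ((P (Complex (1/2) y) - P (Complex (-1/2) y)) - K y) \<partial>lborel)"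
    unfolding set_lebesgue_integral_def by (subst fubini_complex(2)) (use si in \<open>simp_all add: set_integrable_def inner\<close>)
  also have "\<dots> = integral {sqrt 3 / 2..T} (\<lambda>y. (P (Complex (1/2) y) - P (Complex (-1/2) y)) - K y)"
    by (intro integral_indicator_Icc continuous_on_diff[OF Wc Kc])
  also have "\<dots> = integral {sqrt 3 / 2..T} (\<lambda>y. P (Complex (1/2) y) - P (Complex (-1/2) y)) - integral {sqrt 3 / 2..T} K"
    by (intro Henstock_Kurzweil_Integration.integral_diff integrable_continuous_interval Wc Kc)
  also have "integral {sqrt 3 / 2..T} K = integral {sqrt 3 / 2..1} K + integral {1..T} K"
    by (rule Henstock_Kurzweil_Integration.integral_combine[symmetric]) (use s3 assms(1) in \<open>auto intro!: integrable_continuous_interval Kc\<close>)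
  also have "integral {1..T} K = integral {1..T} (\<lambda>_. 0)"
  proof (rule Henstock_Kurzweil_Integration.integral_cong)
    fix y assume "y \<in> {1..T}"
    then have "1 - y\<^sup>2 \<le> 0" by simp
    then show "K y = 0" by (simp add: K_def r_def max_absorb1)
  qed
  also have "integral {sqrt 3 / 2..1} K = integral {0..1/2} (\<lambda>x. (x / arc x) *\<^sub>R K (arc x))"
  proof -
    \<comment> \<open>The function \<open>arc\<close> decreases from 1 to sqrt 3 / 2, so the
      reversed orientation compensates the sign of its derivative - x /
      \<open>arc x\<close>.\<close>
    have "((\<lambda>x. (- x / arc x) *\<^sub>R K (arc x)) has_integral (integral {arc 0..arc (1/2)} K - integral {arc (1/2)..arc 0} K)) {0..1/2}"
    proof (rule has_integral_substitution_general[where s="{}" and c="sqrt 3 / 2" and d=1])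
      show "arc ` {0..1/2} \<subseteq> {sqrt 3 / 2..1}" using arc_bounds by auto
      show "continuous_on {sqrt 3 / 2..1} K" by (rule continuous_on_subset[OF Kc]) (use assms(1) in auto)
      show "continuous_on {0..1/2} arc" unfolding arc_def by (intro continuous_intros)
      fix x :: real assume "x \<in> {0..1/2} - {}"
      then have "arc x > 0" by (intro arc_bounds(1)) auto
      then show "(arc has_field_derivative - x / arc x) (at x within {0..1/2})"
        unfolding arc_def by (auto intro!: derivative_eq_intros simp: field_simps)
    qed auto
    moreover have a: "arc 0 = 1" "arc (1/2) = sqrt 3 / 2" by (simp_all add: arc_def power_divide real_sqrt_divide)
    moreover have "integral {1..sqrt 3 / 2} K = 0"
      using s3(2) by (cases "sqrt 3 / 2 = 1") auto
    ultimately have "((\<lambda>x. (- x / arc x) *\<^sub>R K (arc x)) has_integral - integral {sqrt 3 / 2..1} K) {0..1/2}" by simp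
    from has_integral_neg[OF this] show ?thesis by (simp add: integral_unique)
  qed
  also have "\<dots> = integral {0..1/2} (\<lambda>x. (x / arc x) *\<^sub>R (P (Complex x (arc x)) - P (Complex (- x) (arc x))))"
  proof (rule Henstock_Kurzweil_Integration.integral_cong)
    fix x :: real assume x: "x \<in> {0..1/2}"
    then have "1 - (arc x)\<^sup>2 = x\<^sup>2" using arc_bounds(3)[of x] by auto
    then have "r (arc x) = x" using x by (simp add: r_def)
    then show "(x / arc x) *\<^sub>R K (arc x) = (x / arc x) *\<^sub>R (P (Complex x (arc x)) - P (Complex (- x) (arc x)))"
      by (simp add: K_def)
  qed
  finally show ?thesis by simp
qed

text \<open>The left half of the arc is reflected onto [0, 1/2], so that each x pairs the two points
  of the arc which z -> - 1 / z interchanges.\<close>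

lemma green_y:
  assumes "T \<ge> 1" "continuous_on upper_half Q" "continuous_on upper_half Q'"
    and der: "\<And>z. Im z > 0 \<Longrightarrow> has_dir \<i> Q (Q' z) z"
  shows "(LINT z:FT T|lborel. Q' z) = integral {-1/2..1/2} (\<lambda>x. Q (Complex x T))
     - integral {0..1/2} (\<lambda>x. Q (Complex x (arc x)) + Q (Complex (- x) (arc x)))"
proof -
  have arcc: "continuous_on A arc" for A unfolding arc_def by (intro continuous_intros)
  have Qac: "continuous_on A (\<lambda>x. Q (Complex x (arc x)))" if "A \<subseteq> {-1/2..1/2}" for A
  proof -
    have "arc x > 0" if "x \<in> A" for x
    proof -
      have "x \<in> {-1/2..1/2}" using that \<open>A \<subseteq> {-1/2..1/2}\<close> by blast
      then have "\<bar>x\<bar> \<le> 1 / 2" unfolding atLeastAtMost_iff abs_le_iff by linarith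
      then show ?thesis by (rule arc_bounds(1))
    qed
    then show ?thesis by (intro continuous_on_upper_compose[OF assms(2)] continuous_intros arcc) auto
  qed
  have QTc: "continuous_on A (\<lambda>x. Q (Complex x T))" for A
    by (intro continuous_on_upper_compose[OF assms(2)] continuous_intros) (use assms(1) in auto)
  have si: "set_integrable lborel (FT T) Q'"
    by (rule compact_set_integrable[OF FT_compact]) (rule continuous_on_subset[OF assms(3)], auto simp: upper_half_def dest: FT_upper)
  have inner: "(\<integral>y. indicator (FT T) (Complex x y) *\<^sub>R Q' (Complex x y) \<partial>lborel)
     = indicator {-1/2..1/2} x *\<^sub>R (Q (Complex x T) - Q (Complex x (arc x)))" for x
  proof (cases "\<bar>x\<bar> \<le> 1 / 2")
    case True
    note a = arc_bounds[OF True]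
    have "(\<integral>y. indicator (FT T) (Complex x y) *\<^sub>R Q' (Complex x y) \<partial>lborel) = (\<integral>y. indicator {arc x..T} y *\<^sub>R Q' (Complex x y) \<partial>lborel)"
      by (rule Bochner_Integration.integral_cong[OF refl]) (use True FT_slice_y[OF assms(1)] in \<open>simp add: indicator_def\<close>)
    also have "\<dots> = integral {arc x..T} (\<lambda>y. Q' (Complex x y))"
      by (intro integral_indicator_Icc continuous_on_upper_compose[OF assms(3)] continuous_intros) (use a in auto)
    also have "\<dots> = Q (Complex x T) - Q (Complex x (arc x))"
      by (rule integral_unique, rule fundamental_theorem_of_calculus)
        (use a assms(1) in \<open>auto intro!: has_vector_derivative_at_within has_dir_line der\<close>)
    also have "indicator {-1/2..1/2} x = (1::real)" using True by (simp add: indicator_def) linarith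
    then have "Q (Complex x T) - Q (Complex x (arc x)) = indicator {-1/2..1/2} x *\<^sub>R (Q (Complex x T) - Q (Complex x (arc x)))" by simp
    finally show ?thesis .
  next
    case False
    then have "Complex x y \<notin> FT T" for y using FT_slice_y[OF assms(1), of x y] by blast
    moreover have "x \<notin> {-1/2..1/2}" using False unfolding atLeastAtMost_iff abs_le_iff by linarith
    then have "indicator {-1/2..1/2} x = (0::real)" by (rule indicator_simps(2))
    ultimately show ?thesis by simp
  qed
  have "(LINT z:FT T|lborel. Q' z) = (\<integral>x. indicator {-1/2..1/2} x *\<^sub>R (Q (Complex x T) - Q (Complex x (arc x))) \<partial>lborel)"
    unfolding set_lebesgue_integral_def by (subst fubini_complex(1)) (use si in \<open>simp_all add: set_integrable_def inner\<close>)
  also have "\<dots> = integral {-1/2..1/2} (\<lambda>x. Q (Complex x T) - Q (Complex x (arc x)))"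
    by (intro integral_indicator_Icc continuous_on_diff QTc Qac) simp
  also have "\<dots> = integral {-1/2..1/2} (\<lambda>x. Q (Complex x T)) - integral {-1/2..1/2} (\<lambda>x. Q (Complex x (arc x)))"
    by (intro Henstock_Kurzweil_Integration.integral_diff integrable_continuous_interval QTc Qac) simp
  also have "integral {-1/2..1/2} (\<lambda>x. Q (Complex x (arc x))) = integral {-1/2..0} (\<lambda>x. Q (Complex x (arc x))) + integral {0..1/2} (\<lambda>x. Q (Complex x (arc x)))"
    by (rule Henstock_Kurzweil_Integration.integral_combine[symmetric]) (auto intro!: integrable_continuous_interval Qac)
  also have "integral {-1/2..0} (\<lambda>x. Q (Complex x (arc x))) = integral {0..1/2} (\<lambda>x. Q (Complex (- x) (arc x)))"
    using Henstock_Kurzweil_Integration.integral_reflect_real[of "1/2" 0 "\<lambda>x. Q (Complex (- x) (arc x))"] by (simp add: arc_def)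
  also have "integral {0..1/2} (\<lambda>x. Q (Complex (- x) (arc x))) + integral {0..1/2} (\<lambda>x. Q (Complex x (arc x)))
     = integral {0..1/2} (\<lambda>x. Q (Complex x (arc x)) + Q (Complex (- x) (arc x)))"
  proof (subst add.commute, rule Henstock_Kurzweil_Integration.integral_add[symmetric])
    have "continuous_on {0..1/2} (\<lambda>x. Q (Complex (- x) (arc x)))"
      by (intro continuous_on_upper_compose[OF assms(2)] continuous_intros arcc) (use arc_bounds(1) in auto)
    then show "(\<lambda>x. Q (Complex (- x) (arc x))) integrable_on {0..1/2}" by (rule integrable_continuous_interval)
  qed (auto intro!: integrable_continuous_interval Qac)
  finally show ?thesis .
qed

section \<open>Unions of translates and the strip above height 1\<close>

definition bigF :: "nat \<Rightarrow> complex set" where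
  "bigF a = (\<Union>j<a. moebius_act (trans_mat j) ` fund_dom)"

lemma moebius_trans: "moebius_act (trans_mat j) z = z + of_nat j"
  by (simp add: moebius_act_def trans_mat_def)

lemma bigF_iff: "z \<in> bigF a \<longleftrightarrow> (\<exists>j<a. z - of_nat j \<in> fund_dom)"
proof
  assume "\<exists>j<a. z - of_nat j \<in> fund_dom"
  then obtain j where "j < a" "z - of_nat j \<in> fund_dom" by blast
  then show "z \<in> bigF a"
    unfolding bigF_def moebius_trans by (intro UN_I[of j] image_eqI[of _ _ "z - of_nat j"]) auto
qed (auto simp: bigF_def moebius_trans)

lemma fund_dom_trunc_eq: "fund_dom_trunc a T = {z \<in> bigF a. Im z \<le> T}"
  by (simp add: fund_dom_trunc_def bigF_def)

lemma bigF_strip: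
  assumes "z \<in> bigF a"
  shows "Im z \<ge> 1 / 2" "-1/2 \<le> Re z" "Re z \<le> real a - 1/2"
proof -
  obtain j where j: "j < a" "z - of_nat j \<in> fund_dom" using assms by (auto simp: bigF_iff)
  then have F: "z - of_nat j \<in> FT (Im z)" by (simp add: FT_def)
  then show "Im z \<ge> 1 / 2" using FT_Im_ge(2) by fastforce
  have "\<bar>Re z - real j\<bar> \<le> 1 / 2" using F by (simp add: FT_iff)
  moreover have "real j \<le> real a - 1" using j(1) by linarith
  ultimately show "-1/2 \<le> Re z" "Re z \<le> real a - 1/2" by linarith+
qed

lemma bigF_above:
  assumes "a > 0" "Im z > 1" "-1/2 \<le> Re z" "Re z \<le> real a - 1/2"
  shows "z \<in> bigF a"
proof -
  \<comment> \<open>The cap a - 1 matters only on the right edge Re z = a - 1/2, where the floor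
    alone would give a.\<close>
  define j where "j = min (nat \<lfloor>Re z + 1/2\<rfloor>) (a - 1)"
  have j: "j < a" using assms(1) by (simp add: j_def)
  have fl: "real (nat \<lfloor>Re z + 1/2\<rfloor>) \<le> Re z + 1/2" "Re z + 1/2 < real (nat \<lfloor>Re z + 1/2\<rfloor>) + 1"
    using assms(3) by linarith+
  have "\<bar>Re z - real j\<bar> \<le> 1 / 2"
  proof (cases "nat \<lfloor>Re z + 1/2\<rfloor> \<le> a - 1")
    case True
    then have "real j = real (nat \<lfloor>Re z + 1/2\<rfloor>)" by (simp only: j_def min_absorb1)
    then show ?thesis using fl by linarith
  next
    case False
    then have "real j = real a - 1" "real (nat \<lfloor>Re z + 1/2\<rfloor>) \<ge> real a" using assms(1) by (auto simp: j_def of_nat_diff)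
    then show ?thesis using fl assms(4) by (simp add: abs_le_iff)
  qed
  moreover have "1 \<le> cmod (z - of_nat j)"
    using abs_Im_le_cmod[of "z - of_nat j"] assms(2) by simp
  ultimately have "z - of_nat j \<in> fund_dom" using assms(2) by (simp add: fund_dom_def upper_half_def)
  with j show ?thesis by (auto simp: bigF_iff)
qed

lemma fund_dom_trunc_FT: "fund_dom_trunc a T = (\<Union>j<a. (\<lambda>z. z + of_nat j) ` FT T)"
proof (intro set_eqI iffI)
  fix z assume "z \<in> fund_dom_trunc a T"
  then obtain j where j: "j < a" "z - of_nat j \<in> fund_dom" "Im z \<le> T" by (auto simp: fund_dom_trunc_eq bigF_iff)
  then have "z - of_nat j \<in> FT T" by (simp add: FT_def)
  moreover have "z = (z - of_nat j) + of_nat j" by simp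
  ultimately show "z \<in> (\<Union>j<a. (\<lambda>z. z + of_nat j) ` FT T)" using j(1) by blast
next
  fix z assume "z \<in> (\<Union>j<a. (\<lambda>z. z + of_nat j) ` FT T)"
  then obtain j w where "j < a" "w \<in> FT T" "z = w + of_nat j" by blast
  then show "z \<in> fund_dom_trunc a T" unfolding fund_dom_trunc_eq bigF_iff FT_def by (auto intro!: exI[of _ j])
qed

lemma fund_dom_trunc_compact: "compact (fund_dom_trunc a T)"
  unfolding fund_dom_trunc_FT
  by (intro compact_UN compact_continuous_image FT_compact continuous_intros) auto

lemma bigF_borel: "bigF a \<in> sets borel"
proof -
  have "bigF a = (\<Union>n. fund_dom_trunc a (real n))"
    by (auto simp: fund_dom_trunc_eq) (meson real_arch_simple)
  moreover have "fund_dom_trunc a (real n) \<in> sets borel" for n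
    by (intro borel_closed compact_imp_closed fund_dom_trunc_compact)
  ultimately show ?thesis by auto
qed

lemma fund_dom_trunc_upper: "z \<in> fund_dom_trunc a T \<Longrightarrow> Im z > 0"
  using bigF_strip(1)[of z a] by (force simp: fund_dom_trunc_eq)

lemma fund_dom_trunc_integrable:
  assumes "continuous_on upper_half g"
  shows "set_integrable lborel (fund_dom_trunc a T) (g :: complex \<Rightarrow> complex)"
  by (rule compact_set_integrable[OF fund_dom_trunc_compact continuous_on_subset[OF assms]])
    (auto simp: upper_half_def dest: fund_dom_trunc_upper)

lemma set_integral_shift:
  fixes g :: "complex \<Rightarrow> complex"
  assumes "compact S" "continuous_on ((\<lambda>z. z + c) ` S) g"
  shows "(LINT z:(\<lambda>z. z + c) ` S|lborel. g z) = (LINT z:S|lborel. g (z + c))"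
proof -
  have cl: "closed ((\<lambda>z. z + c) ` S)"
    by (intro compact_imp_closed compact_continuous_image assms(1) continuous_intros)
  have m: "(\<lambda>z. indicator ((\<lambda>z. z + c) ` S) z *\<^sub>R g z) \<in> borel_measurable borel"
    by (rule borel_measurable_continuous_on_indicator[OF _ assms(2)]) (use cl in auto)
  have "(LINT z:(\<lambda>z. z + c) ` S|lborel. g z) = integral\<^sup>L (distr lborel borel ((+) c)) (\<lambda>z. indicator ((\<lambda>z. z + c) ` S) z *\<^sub>R g z)"
    unfolding set_lebesgue_integral_def lborel_distr_plus ..
  also have "\<dots> = integral\<^sup>L lborel (\<lambda>z. indicator ((\<lambda>z. z + c) ` S) (c + z) *\<^sub>R g (c + z))"
    by (rule integral_distr[OF _ m]) simp
  also have "\<dots> = (LINT z:S|lborel. g (z + c))"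
    unfolding set_lebesgue_integral_def by (rule Bochner_Integration.integral_cong) (auto simp: indicator_def add.commute)
  finally show ?thesis .
qed

text \<open>Distinct translates meet only in lines Re z = k + 1/2, and countably many such lines
  form a null set.\<close>

lemma fund_dom_trunc_integral:
  fixes g :: "complex \<Rightarrow> complex"
  assumes "continuous_on upper_half g"
  shows "(LINT z:fund_dom_trunc a T|lborel. g z) = (\<Sum>j<a. LINT z:FT T|lborel. g (z + of_nat j))"
proof -
  have sub: "(\<lambda>z. z + of_nat j) ` FT T \<subseteq> upper_half" for j by (auto simp: upper_half_def dest: FT_upper)
  have comp: "compact ((\<lambda>z. z + of_nat j) ` FT T)" for j
    by (intro compact_continuous_image FT_compact continuous_intros)
  have "(LINT z:fund_dom_trunc a T|lborel. g z) = (\<Sum>j<a. LINT z:(\<lambda>z. z + of_nat j) ` FT T|lborel. g z)"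
    unfolding fund_dom_trunc_FT
  proof (rule set_integral_finite_UN_AE)
    fix i j :: nat
    have "AE z in lborel. \<forall>k::nat. Re z \<noteq> real k + 1 / 2"
      unfolding AE_all_countable using AE_Re_Im_neq(1) by blast
    then show "AE z in lborel. z \<in> (\<lambda>z. z + of_nat i) ` FT T \<and> z \<in> (\<lambda>z. z + of_nat j) ` FT T \<longrightarrow> i = j"
    proof eventually_elim
      case (elim z)
      show ?case
      proof
        assume a: "z \<in> (\<lambda>z. z + of_nat i) ` FT T \<and> z \<in> (\<lambda>z. z + of_nat j) ` FT T"
        have "\<bar>Re z - real k\<bar> \<le> 1 / 2" if "z \<in> (\<lambda>z. z + of_nat k) ` FT T" for k
          using that by (auto simp: FT_iff)
        with a have "\<bar>Re z - real i\<bar> \<le> 1 / 2" "\<bar>Re z - real j\<bar> \<le> 1 / 2" by blast+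
        moreover have "Re z \<noteq> real i + 1 / 2" "Re z \<noteq> real j + 1 / 2" using elim by auto
        ultimately have "\<bar>real i - real j\<bar> < 1" by linarith
        then show "i = j" by linarith
      qed
    qed
  next
    show "(\<lambda>z. z + of_nat j) ` FT T \<in> sets lborel" for j using compact_imp_closed[OF comp] by auto
    show "set_integrable lborel ((\<lambda>z. z + of_nat j) ` FT T) g" for j
      by (rule compact_set_integrable[OF comp continuous_on_subset[OF assms sub]])
  qed simp
  also have "\<dots> = (\<Sum>j<a. LINT z:FT T|lborel. g (z + of_nat j))"
    by (intro sum.cong refl set_integral_shift FT_compact continuous_on_subset[OF assms sub])
  finally show ?thesis .
qed

text \<open>Above height 1 the arcs are out of sight and the translates fill a rectangle whose width
  is a full period, so this part depends on the integrals over x alone. The part below is a fixed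
  compact set.\<close>

lemma fund_dom_trunc_strip:
  fixes g :: "complex \<Rightarrow> complex"
  assumes g: "continuous_on upper_half g" and "a > 0" "T \<ge> 1"
  shows "(LINT z:fund_dom_trunc a T|lborel. g z) = (LINT z:fund_dom_trunc a 1|lborel. g z)
     + integral {1..T} (\<lambda>y. integral {-1/2..real a - 1/2} (\<lambda>x. g (Complex x y)))"
proof -
  define b where "b = real a - 1/2"
  define Sp where "Sp = {z. -1/2 \<le> Re z \<and> Re z \<le> b \<and> 1 \<le> Im z \<and> Im z \<le> T}"
  have Sp_eq: "Sp = cbox (Complex (-1/2) 1) (Complex b T)"
    by (auto simp: Sp_def cbox_def Basis_complex_def inner_complex_def)
  have comp: "compact Sp" unfolding Sp_eq by (rule compact_cbox)
  have sub: "Sp \<subseteq> upper_half" by (auto simp: Sp_def upper_half_def)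
  have si: "set_integrable lborel Sp g" by (rule compact_set_integrable[OF comp continuous_on_subset[OF g sub]])
  have ae: "AE z in lborel. \<not> (z \<in> fund_dom_trunc a 1 \<and> z \<in> Sp)"
    using AE_Re_Im_neq(2)[of 1] by eventually_elim (auto simp: fund_dom_trunc_eq Sp_def)
  have "(LINT z:fund_dom_trunc a T|lborel. g z) = (LINT z:fund_dom_trunc a 1 \<union> Sp|lborel. g z)"
  proof (rule set_integral_cong_set[symmetric])
    show "set_borel_measurable lborel (fund_dom_trunc a T) g" "set_borel_measurable lborel (fund_dom_trunc a 1 \<union> Sp) g"
    proof -
      have "set_integrable lborel (fund_dom_trunc a 1 \<union> Sp) g"
        by (rule set_integrable_Un[OF fund_dom_trunc_integrable[OF g] si]) (auto intro!: borel_closed compact_imp_closed fund_dom_trunc_compact comp)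
      with fund_dom_trunc_integrable[OF g, of a T]
      show "set_borel_measurable lborel (fund_dom_trunc a T) g" "set_borel_measurable lborel (fund_dom_trunc a 1 \<union> Sp) g"
        unfolding set_integrable_def set_borel_measurable_def by (blast intro: borel_measurable_integrable)+
    qed
    show "AE z in lborel. z \<in> fund_dom_trunc a T \<longleftrightarrow> z \<in> fund_dom_trunc a 1 \<union> Sp"
      using AE_Re_Im_neq(2)[of 1]
    proof eventually_elim
      case (elim z)
      show ?case
        using elim assms(3) bigF_strip[of z a] bigF_above[OF assms(2), of z]
        by (auto simp: fund_dom_trunc_eq Sp_def b_def)
    qed
  qed
  also have "\<dots> = (LINT z:fund_dom_trunc a 1|lborel. g z) + (LINT z:Sp|lborel. g z)"
    by (rule set_integral_Un_AE[OF ae _ _ fund_dom_trunc_integrable[OF g] si])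
      (auto intro!: borel_closed compact_imp_closed fund_dom_trunc_compact comp)
  also have "(LINT z:Sp|lborel. g z) = (\<integral>y. indicator {1..T} y *\<^sub>R integral {-1/2..b} (\<lambda>x. g (Complex x y)) \<partial>lborel)"
  proof -
    have "(\<integral>x. indicator Sp (Complex x y) *\<^sub>R g (Complex x y) \<partial>lborel) = indicator {1..T} y *\<^sub>R integral {-1/2..b} (\<lambda>x. g (Complex x y))" for y
    proof (cases "y \<in> {1..T}")
      case True
      have "(\<integral>x. indicator Sp (Complex x y) *\<^sub>R g (Complex x y) \<partial>lborel) = (\<integral>x. indicator {-1/2..b} x *\<^sub>R g (Complex x y) \<partial>lborel)"
        by (rule Bochner_Integration.integral_cong[OF refl]) (use True in \<open>simp add: indicator_def Sp_def\<close>)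
      also have "\<dots> = integral {-1/2..b} (\<lambda>x. g (Complex x y))"
        by (intro integral_indicator_Icc continuous_on_upper_compose[OF g] continuous_intros) (use True in auto)
      finally show ?thesis using True by simp
    qed (auto simp: Sp_def indicator_def)
    then show ?thesis
      unfolding set_lebesgue_integral_def by (subst fubini_complex(2)) (use si in \<open>simp_all add: set_integrable_def\<close>)
  qed
  also have "\<dots> = integral {1..T} (\<lambda>y. integral {-1/2..b} (\<lambda>x. g (Complex x y)))"
  proof (rule integral_indicator_Icc)
    have "continuous_on ({1..T} \<times> cbox (-1/2) b) (\<lambda>(y, x). g (Complex x y))"
      unfolding case_prod_unfold by (intro continuous_on_upper_compose[OF g] continuous_intros) auto
    from integral_continuous_on_param[OF this] show "continuous_on {1..T} (\<lambda>y. integral {-1/2..b} (\<lambda>x. g (Complex x y)))"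
      by simp
  qed
  finally show ?thesis by (simp add: b_def)
qed

lemma strip_exp_integrable:
  "integrable lborel (\<lambda>z. indicator {z. a \<le> Re z \<and> Re z \<le> b \<and> 0 < Im z} z * exp (- Im z) :: real)"
proof -
  define g where "g z = indicator {z. a \<le> Re z \<and> Re z \<le> b \<and> 0 < Im z} z * exp (- Im z)" for z
  have S: "{z. a \<le> Re z \<and> Re z \<le> b \<and> 0 < Im z} \<in> sets borel" by measurable
  have m: "g \<in> borel_measurable borel" unfolding g_def by (rule borel_measurable_times) (use S in auto)
  have "integrable (lborel \<Otimes>\<^sub>M lborel) (\<lambda>p. g (Complex (fst p) (snd p)))"
  proof (rule lborel_pair.Fubini_integrable)
    show "(\<lambda>p. g (Complex (fst p) (snd p))) \<in> borel_measurable (lborel \<Otimes>\<^sub>M lborel)"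
      by (rule measurable_compose[OF _ m]) (simp add: borel_measurable_complex_iff)
    have e: "g (Complex x y) = indicator {a..b} x * (indicator {0<..} y *\<^sub>R exp (- (y * 1)))" for x y
      by (simp add: g_def indicator_def)
    have i: "integrable lborel (\<lambda>y::real. indicator {0<..} y *\<^sub>R exp (- (y * 1)))"
      using integrable_I0i_exp_mscale[of 1] by (simp add: set_integrable_def)
    show "AE x in lborel. integrable lborel (\<lambda>y. g (Complex (fst (x, y)) (snd (x, y))))"
      unfolding fst_conv snd_conv e by (intro AE_I2 integrable_mult_right i)
    have "(\<lambda>x. \<integral>y. norm (g (Complex (fst (x, y)) (snd (x, y)))) \<partial>lborel) = (\<lambda>x. indicator {a..b} x * (\<integral>y. (indicator {0<..} y *\<^sub>R exp (- (y * 1))) \<partial>lborel))"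
      unfolding fst_conv snd_conv e by (rule ext) (simp add: abs_mult)
    then show "integrable lborel (\<lambda>x. \<integral>y. norm (g (Complex (fst (x, y)) (snd (x, y)))) \<partial>lborel)"
      by (simp add: emeasure_lborel_Icc_eq)
  qed
  then show ?thesis using complex_integrable_pair[OF m] by (simp add: g_def[abs_def])
qed

section \<open>The regularized integral at one cusp\<close>

lemma has_vector_derivative_strip_integral:
  fixes u u' :: "complex \<Rightarrow> complex"
  assumes "continuous_on upper_half u" "continuous_on upper_half u'"
    and der: "\<And>z. Im z > 0 \<Longrightarrow> has_dir \<i> u (u' z) z" and "y > 0"
  shows "((\<lambda>y. integral {c..d} (\<lambda>x. u (Complex x y))) has_vector_derivative integral {c..d} (\<lambda>x. u' (Complex x y))) (at y)"
proof -
  have "((\<lambda>y. integral (cbox c d) (\<lambda>x. u (Complex x y))) has_vector_derivative integral (cbox c d) (\<lambda>x. u' (Complex x y))) (at y within {0<..})"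
  proof (rule leibniz_rule_vector_derivative)
    show "((\<lambda>y. u (Complex x y)) has_vector_derivative u' (Complex x y)) (at y within {0<..})" if "y \<in> {0<..}" for x y
      by (rule has_vector_derivative_at_within, rule has_dir_line(2), rule der) (use that in simp)
    show "(\<lambda>x. u (Complex x y)) integrable_on cbox c d" if "y \<in> {0<..}" for y
      by (intro integrable_continuous continuous_on_upper_compose[OF assms(1)] continuous_intros) (use that in auto)
    show "continuous_on ({0<..} \<times> cbox c d) (\<lambda>(y, x). u' (Complex x y))"
      unfolding case_prod_unfold by (intro continuous_on_upper_compose[OF assms(2)] continuous_intros) auto
  qed (use assms(4) in auto)
  then show ?thesis using assms(4) by (simp add: at_within_open[of y "{0<..}"])
qed

text \<open>The increment of g over [y, y + 1] tends to 0, while the mean value inequality keeps it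
  close to L; with e = |L| / 2 the two estimates contradict each other unless L = 0.\<close>

lemma tendsto_derivative_zero:
  fixes g g' :: "real \<Rightarrow> complex"
  assumes "\<And>y. y > Y \<Longrightarrow> (g has_vector_derivative g' y) (at y)"
    and "(g \<longlongrightarrow> 0) at_top" "(g' \<longlongrightarrow> L) at_top"
  shows "L = 0"
proof (rule ccontr)
  assume "L \<noteq> 0"
  define e where "e = norm L / 2"
  have e: "e > 0" using \<open>L \<noteq> 0\<close> by (simp add: e_def)
  have "eventually (\<lambda>y. dist (g' y) L < e) at_top" using assms(3) e by (rule tendstoD)
  moreover have "eventually (\<lambda>y. dist (g y) 0 < e / 2) at_top" using tendstoD[OF assms(2), of "e / 2"] e by simp
  moreover have "eventually (\<lambda>y. y > Y) at_top" by (rule eventually_gt_at_top)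
  ultimately have "eventually (\<lambda>y. dist (g' y) L < e \<and> dist (g y) 0 < e / 2 \<and> y > Y) at_top" by eventually_elim simp
  then obtain y0 where y0: "\<And>y. y \<ge> y0 \<Longrightarrow> dist (g' y) L < e \<and> dist (g y) 0 < e / 2 \<and> y > Y"
    unfolding eventually_at_top_linorder by blast
  have "norm ((g (y0 + 1) - of_real (y0 + 1) * L) - (g y0 - of_real y0 * L)) \<le> e * norm ((y0 + 1) - y0)"
  proof (rule differentiable_bound[where S="{y0..y0+1}"])
    fix y assume y: "y \<in> {y0..y0+1}"
    show "((\<lambda>y. g y - of_real y * L) has_derivative (\<lambda>h. h *\<^sub>R (g' y - L))) (at y within {y0..y0+1})"
      unfolding has_vector_derivative_def[symmetric]
      by (rule has_vector_derivative_at_within)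
        (use y0[of y] y in \<open>auto intro!: derivative_eq_intros assms(1) has_vector_derivative_real_field\<close>)
    show "onorm (\<lambda>h. h *\<^sub>R (g' y - L)) \<le> e"
      by (rule onorm_scaleR_bound) (use y0[of y] y in \<open>simp add: dist_norm less_imp_le\<close>)
  qed auto
  then have "norm (g (y0 + 1) - g y0 - L) \<le> e" by (simp add: algebra_simps)
  moreover have "norm (g (y0 + 1)) < e / 2" "norm (g y0) < e / 2" using y0[of y0] y0[of "y0 + 1"] by auto
  moreover have "norm L \<le> norm (g (y0 + 1) - g y0 - L) + norm (g (y0 + 1)) + norm (g y0)"
  proof -
    have "norm (- L) = norm ((g (y0 + 1) - g y0 - L) + (g y0 - g (y0 + 1)))" by simp
    also have "\<dots> \<le> norm (g (y0 + 1) - g y0 - L) + norm (g y0 - g (y0 + 1))" by (rule norm_triangle_ineq)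
    also have "norm (g y0 - g (y0 + 1)) \<le> norm (g y0) + norm (g (y0 + 1))" by (rule norm_triangle_ineq4)
    finally show ?thesis by simp
  qed
  ultimately have "norm L < 2 * e" by linarith
  then show False by (simp add: e_def)
qed

section \<open>Mellin transforms of rapidly decaying functions\<close>

lemma abs_ln_le:
  fixes y :: real
  assumes "y \<ge> 1 / 2"
  shows "\<bar>ln y\<bar> \<le> y + 1"
proof -
  have "ln y \<le> y - 1" using assms by (intro ln_le_minus_one) simp
  moreover have "ln (1 / y) \<le> 1 / y - 1" using assms by (intro ln_le_minus_one) simp
  moreover have "1 / y \<le> 2" using assms by (simp add: field_simps)
  moreover have "ln (1 / y) = - ln y" using assms by (simp add: ln_div)
  ultimately show ?thesis using assms by linarith
qed

lemma norm_powr_le: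
  fixes y :: real and s :: complex
  assumes "y \<ge> 1 / 2" "\<bar>Re s\<bar> \<le> k"
  shows "norm (complex_of_real y powr (- s)) \<le> exp k * exp (k * y)"
proof -
  have "norm (complex_of_real y powr (- s)) = exp (- Re s * ln y)"
    using assms(1) by (simp add: norm_powr_real_powr powr_def)
  also have "- Re s * ln y \<le> \<bar>Re s\<bar> * \<bar>ln y\<bar>" by (metis abs_ge_self abs_minus_cancel abs_mult)
  also have "\<dots> \<le> k * (y + 1)" using assms abs_ln_le[OF assms(1)] by (intro mult_mono) auto
  finally show ?thesis by (simp add: exp_add[symmetric] distrib_left add.commute)
qed

lemma bigF_exp_integrable: "set_integrable lborel (bigF a) (\<lambda>z. K * exp (- Im z) :: real)"
proof -
  have "set_integrable lborel {z. -1/2 \<le> Re z \<and> Re z \<le> real a - 1/2 \<and> 0 < Im z} (\<lambda>z. exp (- Im z) :: real)"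
    using strip_exp_integrable[of "-1/2" "real a - 1/2"] by (simp add: set_integrable_def)
  then have "set_integrable lborel (bigF a) (\<lambda>z. exp (- Im z) :: real)"
    by (rule set_integrable_subset) (use bigF_borel bigF_strip in force)+
  then show ?thesis by (intro set_integrable_mult_right) 
qed

lemma indicator_measurable_upper:
  fixes w :: "complex \<Rightarrow> complex"
  assumes "S0 \<in> sets borel" "S0 \<subseteq> bigF a" "continuous_on upper_half w"
  shows "(\<lambda>z. indicator S0 z *\<^sub>R w z) \<in> borel_measurable lborel"
proof -
  have "S0 \<subseteq> upper_half"
  proof
    fix z assume "z \<in> S0"
    then have "Im z \<ge> 1 / 2" using assms(2) bigF_strip(1) by blast
    then show "z \<in> upper_half" by (simp add: upper_half_def)
  qed
  then have "continuous_on S0 w" using assms(3) continuous_on_subset by blast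
  from borel_measurable_continuous_on_indicator[OF assms(1) this] show ?thesis by simp
qed

text \<open>Decay beyond every exponential in Im z, with a spare exp(- Im z) that is integrable over
  the strip. The quantifier over all k is what makes the Mellin transform entire.\<close>

definition fast_decay :: "complex set \<Rightarrow> (complex \<Rightarrow> complex) \<Rightarrow> bool" where
  "fast_decay S0 w \<longleftrightarrow> (\<forall>k. \<exists>K. \<forall>z\<in>S0. norm (w z) * exp (k * Im z) \<le> K * exp (- Im z))"

lemma fast_decay_integrable:
  fixes w :: "complex \<Rightarrow> complex"
  assumes "S0 \<in> sets borel" "S0 \<subseteq> bigF a" "continuous_on upper_half w" "fast_decay S0 w"
  shows "set_integrable lborel S0 w"
proof -
  obtain K where K: "\<And>z. z \<in> S0 \<Longrightarrow> norm (w z) * exp (0 * Im z) \<le> K * exp (- Im z)"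
    using assms(4) unfolding fast_decay_def by blast
  have "integrable lborel (\<lambda>z. indicator S0 z *\<^sub>R w z)"
  proof (rule Bochner_Integration.integrable_bound)
    show "integrable lborel (\<lambda>z. indicator S0 z *\<^sub>R (K * exp (- Im z)) :: real)"
      using set_integrable_subset[OF bigF_exp_integrable[of a K] _ assms(2)] assms(1) by (simp add: set_integrable_def)
    show "AE z in lborel. norm (indicator S0 z *\<^sub>R w z) \<le> norm (indicator S0 z *\<^sub>R (K * exp (- Im z)) :: real)"
      using K by (intro AE_I2) (force simp: indicator_def intro: order_trans[OF _ abs_ge_self])
  qed (rule indicator_measurable_upper[OF assms(1-3)])
  then show ?thesis by (simp add: set_integrable_def)
qed

text \<open>Differentiation in s under the integral: for s in a ball the power of y grows at most
  exponentially in y, and so does its derivative, which brings in ln y. Both are swallowed by the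
  decay of \<open>w\<close>.\<close>

lemma mellin_entire:
  fixes w :: "complex \<Rightarrow> complex"
  assumes S0: "S0 \<in> sets borel" "S0 \<subseteq> bigF a" and w: "continuous_on upper_half w" and fd: "fast_decay S0 w"
  shows "(\<lambda>s. LINT z:S0|lborel. w z * complex_of_real (Im z) powr (- s)) holomorphic_on UNIV"
    "\<And>s. set_integrable lborel S0 (\<lambda>z. w z * complex_of_real (Im z) powr (- s))"
proof -
  have half: "Im z \<ge> 1 / 2" if "z \<in> S0" for z using that S0(2) bigF_strip(1) by blast
  have pc: "continuous_on upper_half (\<lambda>z. complex_of_real (Im z) powr (- s))" for s
    by (intro continuous_intros) (auto simp: upper_half_def complex_nonpos_Reals_iff)
  have lc: "continuous_on upper_half (\<lambda>z. complex_of_real (ln (Im z)))"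
    by (intro continuous_intros) (auto simp: upper_half_def)
  define \<phi> where "\<phi> s z = indicator S0 z *\<^sub>R (w z * complex_of_real (Im z) powr (- s))" for s z
  define \<phi>' where "\<phi>' s z = indicator S0 z *\<^sub>R (w z * (complex_of_real (Im z) powr (- s) * - complex_of_real (ln (Im z))))" for s z
  have bnd: "\<exists>K. \<forall>s\<in>ball s0 1. \<forall>z. norm (\<phi> s z) \<le> indicator S0 z *\<^sub>R (K * exp (- Im z)) \<and> norm (\<phi>' s z) \<le> indicator S0 z *\<^sub>R (K * exp (- Im z))" for s0
  proof -
    define k where "k = \<bar>Re s0\<bar> + 1"
    \<comment> \<open>The 1 added to k pays for the factor |ln y|, which is at most exp 1 exp y on
      the domain.\<close>
    obtain K where K: "\<And>z. z \<in> S0 \<Longrightarrow> norm (w z) * exp ((k + 1) * Im z) \<le> K * exp (- Im z)"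
      using fd unfolding fast_decay_def by blast
    show ?thesis
    proof (intro exI[of _ "exp k * exp 1 * K"] ballI allI conjI)
      fix s z assume s: "s \<in> ball s0 1"
      have "\<bar>Re s\<bar> \<le> k" using s abs_Re_le_cmod[of "s0 - s"] by (auto simp: k_def dist_norm)
      have main: "norm (w z) * (norm (complex_of_real (Im z) powr (- s)) * c) \<le> exp k * exp 1 * K * exp (- Im z)"
        if z: "z \<in> S0" and c: "0 \<le> c" "c \<le> exp 1 * exp (Im z)" for c
      proof -
        have "norm (w z) * (norm (complex_of_real (Im z) powr (- s)) * c) \<le> norm (w z) * ((exp k * exp (k * Im z)) * (exp 1 * exp (Im z)))"
          using norm_powr_le[OF half[OF z] \<open>\<bar>Re s\<bar> \<le> k\<close>] c by (intro mult_left_mono mult_mono) auto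
        also have "\<dots> = exp k * exp 1 * (norm (w z) * exp ((k + 1) * Im z))" by (simp add: distrib_right exp_add)
        also have "\<dots> \<le> exp k * exp 1 * (K * exp (- Im z))" by (intro mult_left_mono K z) auto
        finally show ?thesis by (simp add: mult.assoc)
      qed
      have c1: "1 \<le> exp 1 * exp (Im z)" if "z \<in> S0"
        using half[OF that] by (simp add: exp_add[symmetric])
      have c2: "\<bar>ln (Im z)\<bar> \<le> exp 1 * exp (Im z)" if "z \<in> S0"
        using abs_ln_le[OF half[OF that]] exp_ge_add_one_self[of "1 + Im z"] by (simp add: exp_add[symmetric])
      show "norm (\<phi> s z) \<le> indicator S0 z *\<^sub>R (exp k * exp 1 * K * exp (- Im z))"
        using main[of 1] c1 by (cases "z \<in> S0") (auto simp: \<phi>_def norm_mult)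
      show "norm (\<phi>' s z) \<le> indicator S0 z *\<^sub>R (exp k * exp 1 * K * exp (- Im z))"
        using main[of "\<bar>ln (Im z)\<bar>"] c2 by (cases "z \<in> S0") (auto simp: \<phi>'_def norm_mult)
    qed
  qed
  have dom: "dominated lborel UNIV \<phi>" "dominated lborel UNIV \<phi>'"
    unfolding dominated_def
  proof (safe, goal_cases)
    case (1 s)
    then show ?case unfolding \<phi>_def by (intro indicator_measurable_upper[OF S0] continuous_intros w pc)
  next
    case (2 z)
    then show ?case
    proof (cases "z \<in> S0")
      case True
      then show ?thesis unfolding \<phi>_def using half[OF True] by (intro continuous_intros) (auto simp: complex_nonpos_Reals_iff)
    qed (simp add: \<phi>_def)
  next
    case (3 s0)
    obtain K where "\<forall>s\<in>ball s0 1. \<forall>z. norm (\<phi> s z) \<le> indicator S0 z *\<^sub>R (K * exp (- Im z))" using bnd by blast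
    moreover have "integrable lborel (\<lambda>z. indicator S0 z *\<^sub>R (K * exp (- Im z)) :: real)"
      using set_integrable_subset[OF bigF_exp_integrable[of a K] _ S0(2)] S0(1) by (simp add: set_integrable_def)
    ultimately show ?case by (intro exI[of _ 1] conjI exI[of _ "\<lambda>z. indicator S0 z *\<^sub>R (K * exp (- Im z))"]) auto
  next
    case (4 s)
    then show ?case unfolding \<phi>'_def by (intro indicator_measurable_upper[OF S0] continuous_intros w pc lc)
  next
    case (5 z)
    then show ?case
    proof (cases "z \<in> S0")
      case True
      then show ?thesis unfolding \<phi>'_def using half[OF True] by (intro continuous_intros) (auto simp: complex_nonpos_Reals_iff)
    qed (simp add: \<phi>'_def)
  next
    case (6 s0)
    obtain K where "\<forall>s\<in>ball s0 1. \<forall>z. norm (\<phi>' s z) \<le> indicator S0 z *\<^sub>R (K * exp (- Im z))" using bnd by blast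
    moreover have "integrable lborel (\<lambda>z. indicator S0 z *\<^sub>R (K * exp (- Im z)) :: real)"
      using set_integrable_subset[OF bigF_exp_integrable[of a K] _ S0(2)] S0(1) by (simp add: set_integrable_def)
    ultimately show ?case by (intro exI[of _ 1] conjI exI[of _ "\<lambda>z. indicator S0 z *\<^sub>R (K * exp (- Im z))"]) auto
  qed
  have "(\<lambda>s. integral\<^sup>L lborel (\<phi> s)) holomorphic_on UNIV"
  proof (rule dominated_holomorphic[OF open_UNIV dom])
    fix s z
    show "((\<lambda>s. \<phi> s z) has_field_derivative \<phi>' s z) (at s)"
    proof (cases "z \<in> S0")
      case True
      have y: "Im z > 0" using half[OF True] by simp
      have "((\<lambda>s. complex_of_real (Im z) powr (- s)) has_field_derivative (complex_of_real (Im z) powr (- s) * - complex_of_real (ln (Im z)))) (at s)"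
        using y by (auto intro!: derivative_eq_intros simp: powr_def Ln_of_real)
      from DERIV_cmult[OF this, of "w z"] show ?thesis using True by (simp add: \<phi>_def \<phi>'_def)
    qed (simp add: \<phi>_def \<phi>'_def)
  qed
  then show "(\<lambda>s. LINT z:S0|lborel. w z * complex_of_real (Im z) powr (- s)) holomorphic_on UNIV"
    by (simp add: \<phi>_def[abs_def] set_lebesgue_integral_def)
  show "set_integrable lborel S0 (\<lambda>z. w z * complex_of_real (Im z) powr (- s))" for s
    using dominated_integrable[OF dom(1), of s] by (simp add: \<phi>_def[abs_def] set_integrable_def)
qed

lemma bigF_exhaustion:
  assumes "set_integrable lborel (bigF a) (w :: complex \<Rightarrow> complex)"
  shows "((\<lambda>T. LINT z:fund_dom_trunc a T|lborel. w z) \<longlongrightarrow> (LINT z:bigF a|lborel. w z)) at_top"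
  unfolding set_lebesgue_integral_def
proof (rule integral_dominated_convergence_at_top)
  show "integrable lborel (\<lambda>z. norm (indicator (bigF a) z *\<^sub>R w z))"
    using assms unfolding set_integrable_def by (rule integrable_norm)
  show "(\<lambda>z. indicator (bigF a) z *\<^sub>R w z) \<in> borel_measurable lborel"
    using assms by (auto simp: set_integrable_def)
  show "(\<lambda>z. indicator (fund_dom_trunc a T) z *\<^sub>R w z) \<in> borel_measurable lborel" for T
  proof -
    have "set_integrable lborel (fund_dom_trunc a T) w"
      by (rule set_integrable_subset[OF assms]) (auto simp: fund_dom_trunc_eq intro!: borel_closed compact_imp_closed fund_dom_trunc_compact[unfolded fund_dom_trunc_eq])
    then show ?thesis by (auto simp: set_integrable_def)
  qed
  show "\<forall>\<^sub>F T in at_top. AE z in lborel. norm (indicator (fund_dom_trunc a T) z *\<^sub>R w z) \<le> norm (indicator (bigF a) z *\<^sub>R w z)"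
    by (intro always_eventually allI AE_I2) (auto simp: fund_dom_trunc_eq indicator_def)
  show "AE z in lborel. ((\<lambda>T. indicator (fund_dom_trunc a T) z *\<^sub>R w z) \<longlongrightarrow> indicator (bigF a) z *\<^sub>R w z) at_top"
  proof (rule AE_I2)
    fix z
    have "\<forall>\<^sub>F T in at_top. indicator (fund_dom_trunc a T) z *\<^sub>R w z = indicator (bigF a) z *\<^sub>R w z"
      using eventually_ge_at_top[of "Im z"] by eventually_elim (simp add: fund_dom_trunc_eq indicator_def)
    then show "((\<lambda>T. indicator (fund_dom_trunc a T) z *\<^sub>R w z) \<longlongrightarrow> indicator (bigF a) z *\<^sub>R w z) at_top"
      by (rule tendsto_eventually)
  qed
qed

lemma powr_has_vector_derivative:
  assumes "y > 0"
  shows "((\<lambda>y. complex_of_real y powr w) has_vector_derivative (w * complex_of_real y powr (w - 1))) (at y within S)"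
proof -
  have "((\<lambda>z. z powr w) has_field_derivative (w * complex_of_real y powr (w - 1))) (at (complex_of_real y))"
    by (rule has_field_derivative_powr) (use assms in \<open>simp add: complex_nonpos_Reals_iff\<close>)
  from has_vector_derivative_real_field[OF this] show ?thesis by (rule has_vector_derivative_at_within)
qed

lemma powr_continuous:
  assumes "\<And>y. y \<in> S \<Longrightarrow> y > 0"
  shows "continuous_on S (\<lambda>y. complex_of_real y powr w)"
  by (intro continuous_intros) (auto dest!: assms)

lemma integral_powr:
  assumes "T \<ge> 1" "w \<noteq> 0"
  shows "integral {1..T} (\<lambda>y. complex_of_real y powr (w - 1)) = (complex_of_real T powr w - 1) / w"
proof -
  have "((\<lambda>y. complex_of_real y powr (w - 1)) has_integral (complex_of_real T powr w / w - complex_of_real 1 powr w / w)) {1..T}"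
  proof (rule fundamental_theorem_of_calculus[OF assms(1)])
    fix y assume "y \<in> {1..T}"
    then have "((\<lambda>y. complex_of_real y powr w * (1 / w)) has_vector_derivative (w * complex_of_real y powr (w - 1)) * (1 / w)) (at y within {1..T})"
      by (intro has_vector_derivative_mult_left powr_has_vector_derivative) auto
    then show "((\<lambda>y. complex_of_real y powr w / w) has_vector_derivative complex_of_real y powr (w - 1)) (at y within {1..T})"
      using assms(2) by simp
  qed
  then show ?thesis by (simp add: integral_unique diff_divide_distrib)
qed

lemma powr_tendsto_0:
  assumes "Re w < 0"
  shows "((\<lambda>T. complex_of_real T powr w) \<longlongrightarrow> 0) at_top"
proof (rule tendsto_norm_zero_cancel)
  have "((\<lambda>T. T powr Re w) \<longlongrightarrow> 0) at_top" by (rule tendsto_neg_powr[OF assms filterlim_ident])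
  moreover have "\<forall>\<^sub>F T in at_top. norm (complex_of_real T powr w) = T powr Re w"
    using eventually_gt_at_top[of 0] by eventually_elim (simp add: norm_powr_real_powr)
  ultimately show "((\<lambda>T. norm (complex_of_real T powr w)) \<longlongrightarrow> 0) at_top"
    by (simp add: tendsto_cong)
qed

text \<open>One cusp moved to infinity: p stands for f after \<sigma>_\<l> and \<open>a\<close> for
  the cusp width. The constant term is taken over [-1/2, a - 1/2], the base of the rectangle formed
  by the translates.\<close>

locale cusp = coset_rows +
  fixes a :: nat and p :: "complex \<Rightarrow> complex" and s' A B :: complex
  assumes a: "a > 0" and p: "continuous_on upper_half p"
    and growth: "\<exists>c C Y. \<forall>z. Im z \<ge> Y \<longrightarrow> norm (p z) \<le> c * exp (C * Im z)"
    and const: "\<And>y. y > 0 \<Longrightarrow> integral {-1/2..real a - 1/2} (\<lambda>x. p (Complex x y))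
        = of_nat a * (A * complex_of_real y powr s' + B * complex_of_real y powr (1 - s'))"
begin

definition ct :: "real \<Rightarrow> complex" where
  "ct y = A * complex_of_real y powr s' + B * complex_of_real y powr (1 - s')"

definition \<kappa> :: complex where "\<kappa> = of_real (1 / (sqrt N * \<beta>))"

abbreviation R :: "part \<Rightarrow> complex \<Rightarrow> complex \<Rightarrow> complex" where "R \<equiv> Th om_rem"

lemma R_continuous: "Im \<tau> > 0 \<Longrightarrow> continuous_on upper_half (R q \<tau>)"
  by (rule Th_continuous(2)[OF norm_om_rem])

text \<open>Growth is assumed only above some height; below it a compact rectangle bounds p.\<close>

lemma p_bound:
  obtains c C where "c > 0" "C > 0" "\<And>z. Im z \<ge> 1/2 \<Longrightarrow> -1/2 \<le> Re z \<Longrightarrow> Re z \<le> real a - 1/2 \<Longrightarrow> norm (p z) \<le> c * exp (C * Im z)"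
proof -
  obtain c C Y where g: "\<And>z. Im z \<ge> Y \<Longrightarrow> norm (p z) \<le> c * exp (C * Im z)" using growth by blast
  define K where "K = cbox (Complex (-1/2) (1/2)) (Complex (real a - 1/2) Y)"
  have K: "K \<subseteq> upper_half" by (auto simp: K_def upper_half_def cbox_def Basis_complex_def inner_complex_def)
  have "bounded (p ` K)"
    by (intro compact_imp_bounded compact_continuous_image continuous_on_subset[OF p K]) (simp add: K_def)
  then obtain b where b: "\<And>z. z \<in> K \<Longrightarrow> norm (p z) \<le> b" by (auto simp: bounded_iff)
  show ?thesis
  proof (rule that[of "max 1 (max \<bar>c\<bar> b)" "max 1 \<bar>C\<bar>"])
    fix z assume z: "Im z \<ge> 1/2" "-1/2 \<le> Re z" "Re z \<le> real a - 1/2"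
    have e1: "exp (C * Im z) \<le> exp (max 1 \<bar>C\<bar> * Im z)" using z by (auto intro!: mult_right_mono)
    show "norm (p z) \<le> max 1 (max \<bar>c\<bar> b) * exp (max 1 \<bar>C\<bar> * Im z)"
    proof (cases "Im z \<ge> Y")
      case True
      have "norm (p z) \<le> c * exp (C * Im z)" by (rule g[OF True])
      also have "\<dots> \<le> max 1 (max \<bar>c\<bar> b) * exp (max 1 \<bar>C\<bar> * Im z)" using e1 by (intro mult_mono) auto
      finally show ?thesis .
    next
      case False
      then have "norm (p z) \<le> b" using z by (intro b) (auto simp: K_def cbox_def Basis_complex_def inner_complex_def)
      also have "\<dots> \<le> max 1 (max \<bar>c\<bar> b) * 1" by simp
      also have "\<dots> \<le> max 1 (max \<bar>c\<bar> b) * exp (max 1 \<bar>C\<bar> * Im z)" using z by (intro mult_left_mono) auto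
      finally show ?thesis .
    qed
  qed auto
qed

text \<open>The Gaussian decay of the remainder against the exponential growth of p: completing the
  square gives m y - \<delta> y^2 \<le> m^2 / (4 \<delta>).\<close>

lemma key_bound:
  assumes "Im \<tau>0 > 0"
  obtains \<epsilon> K where "\<epsilon> > 0"
    "\<And>\<tau> z q. dist \<tau>0 \<tau> < \<epsilon> \<Longrightarrow> Im z \<ge> 1/2 \<Longrightarrow> -1/2 \<le> Re z \<Longrightarrow> Re z \<le> real a - 1/2 \<Longrightarrow>
       norm (p z * R q \<tau> z) * exp (k * Im z) \<le> K * exp (- Im z)"
proof -
  obtain c C where p: "c > 0" "C > 0" "\<And>z. Im z \<ge> 1/2 \<Longrightarrow> -1/2 \<le> Re z \<Longrightarrow> Re z \<le> real a - 1/2 \<Longrightarrow> norm (p z) \<le> c * exp (C * Im z)"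
    using p_bound by blast
  obtain v0 V U \<epsilon> where b: "v0 > 0" "v0 \<le> V" "\<epsilon> > 0"
    "\<And>w. dist \<tau>0 w < \<epsilon> \<Longrightarrow> \<bar>Re w\<bar> \<le> U \<and> v0 \<le> Im w \<and> Im w \<le> V"
    using half_box[OF assms] by metis
  obtain C1 \<delta> where C1: "C1 > 0" "\<delta> > 0"
    "\<And>q \<tau> z. \<bar>Re \<tau>\<bar> \<le> U \<Longrightarrow> v0 \<le> Im \<tau> \<Longrightarrow> Im \<tau> \<le> V \<Longrightarrow> \<bar>Re z\<bar> \<le> real a + 1 \<Longrightarrow> 1/2 \<le> Im z \<Longrightarrow>
      norm (R q \<tau> z) \<le> C1 * exp (- \<delta> * (Im z)\<^sup>2)"
    by (rule Th_decay[of om_rem, OF norm_om_rem b(1,2), of "1/2" U "real a + 1"]) (auto simp: om_rem_def)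
  \<comment> \<open>C is the growth rate of p, k the prescribed weight, and 1 buys the factor exp(-
    y) of the conclusion.\<close>
  define m where "m = C + k + 1"
  show ?thesis
  proof (rule that[OF b(3), of "c * C1 * exp (m\<^sup>2 / (4 * \<delta>))"])
    fix \<tau> z q assume d: "dist \<tau>0 \<tau> < \<epsilon>" and z: "Im z \<ge> 1/2" "-1/2 \<le> Re z" "Re z \<le> real a - 1/2"
    define y where "y = Im z"
    have "\<bar>Re z\<bar> \<le> real a + 1" using z by linarith
    then have "norm (p z * R q \<tau> z) \<le> (c * exp (C * y)) * (C1 * exp (- \<delta> * y\<^sup>2))"
      unfolding norm_mult y_def using b(4)[OF d] z C1(1) p(1) by (intro mult_mono p(3) C1(3)) auto
    then have "norm (p z * R q \<tau> z) * exp (k * y) \<le> (c * exp (C * y)) * (C1 * exp (- \<delta> * y\<^sup>2)) * exp (k * y)"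
      by (rule mult_right_mono) simp
    also have "\<dots> = c * C1 * exp (m * y - \<delta> * y\<^sup>2) * exp (- y)"
      by (simp add: m_def exp_add[symmetric] algebra_simps)
    also have "m * y - \<delta> * y\<^sup>2 \<le> m\<^sup>2 / (4 * \<delta>)"
    proof -
      have "0 \<le> (m - 2 * \<delta> * y)\<^sup>2 / (4 * \<delta>)" using C1(2) by simp
      also have "\<dots> = m\<^sup>2 / (4 * \<delta>) - m * y + \<delta> * y\<^sup>2"
        using C1(2) by (simp add: power2_diff field_simps power2_eq_square)
      finally show ?thesis by simp
    qed
    finally show "norm (p z * R q \<tau> z) * exp (k * Im z) \<le> c * C1 * exp (m\<^sup>2 / (4 * \<delta>)) * exp (- Im z)"
      using p(1) C1(1) by (simp add: y_def)
  qed
qed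

lemma y_sq_bound:
  assumes "Im z \<ge> 1 / 2"
  shows "norm (w / (complex_of_real (Im z))\<^sup>2) \<le> 4 * norm w"
proof -
  have "(1 / 2)\<^sup>2 \<le> (Im z)\<^sup>2" using assms by (intro power_mono) auto
  then have "norm w / (Im z)\<^sup>2 \<le> norm w / (1 / 4)" by (intro divide_left_mono) (auto simp: power_divide)
  then show ?thesis by (simp add: norm_divide norm_power)
qed

lemma rem_fast_decay:
  assumes "Im \<tau> > 0"
  shows "fast_decay (bigF a) (\<lambda>z. p z * R q \<tau> z)" "fast_decay (bigF a) (\<lambda>z. p z * R q \<tau> z / (complex_of_real (Im z))\<^sup>2)"
proof -
  have *: "\<exists>K. \<forall>z\<in>bigF a. norm (p z * R q \<tau> z) * exp (k * Im z) \<le> K * exp (- Im z)" for k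
  proof -
    obtain \<epsilon> K where "\<epsilon> > 0" "\<And>\<tau>' z q. dist \<tau> \<tau>' < \<epsilon> \<Longrightarrow> Im z \<ge> 1/2 \<Longrightarrow> -1/2 \<le> Re z \<Longrightarrow> Re z \<le> real a - 1/2 \<Longrightarrow>
       norm (p z * R q \<tau>' z) * exp (k * Im z) \<le> K * exp (- Im z)" using key_bound[OF assms] by blast
    then show ?thesis using bigF_strip by (intro exI[of _ K] ballI) auto
  qed
  then show "fast_decay (bigF a) (\<lambda>z. p z * R q \<tau> z)" by (simp add: fast_decay_def)
  show "fast_decay (bigF a) (\<lambda>z. p z * R q \<tau> z / (complex_of_real (Im z))\<^sup>2)"
    unfolding fast_decay_def
  proof
    fix k
    obtain K where K: "\<forall>z\<in>bigF a. norm (p z * R q \<tau> z) * exp (k * Im z) \<le> K * exp (- Im z)" using * by blast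
    show "\<exists>K. \<forall>z\<in>bigF a. norm (p z * R q \<tau> z / (complex_of_real (Im z))\<^sup>2) * exp (k * Im z) \<le> K * exp (- Im z)"
    proof (intro exI[of _ "4 * K"] ballI)
      fix z assume z: "z \<in> bigF a"
      have "norm (p z * R q \<tau> z / (complex_of_real (Im z))\<^sup>2) * exp (k * Im z) \<le> 4 * norm (p z * R q \<tau> z) * exp (k * Im z)"
        by (intro mult_right_mono y_sq_bound bigF_strip[OF z]) simp
      also have "\<dots> \<le> 4 * (K * exp (- Im z))" using K z by (simp add: mult.assoc)
      finally show "norm (p z * R q \<tau> z / (complex_of_real (Im z))\<^sup>2) * exp (k * Im z) \<le> 4 * K * exp (- Im z)" by simp
    qed
  qed
qed

lemma y_inverse_continuous:
  fixes w :: "complex \<Rightarrow> complex"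
  assumes "continuous_on upper_half w"
  shows "continuous_on upper_half (\<lambda>z. w z / (complex_of_real (Im z))\<^sup>2)" "continuous_on upper_half (\<lambda>z. w z / complex_of_real (Im z))"
  by (intro continuous_intros assms; auto simp: upper_half_def)+

lemma trunc1_fast_decay:
  fixes w :: "complex \<Rightarrow> complex"
  assumes "continuous_on upper_half w"
  shows "fast_decay (fund_dom_trunc a 1) w"
  unfolding fast_decay_def
proof
  fix k
  have sub: "fund_dom_trunc a 1 \<subseteq> upper_half" by (auto simp: upper_half_def dest: fund_dom_trunc_upper)
  have "continuous_on (fund_dom_trunc a 1) (\<lambda>z. norm (w z) * exp (k * Im z) * exp (Im z))"
    by (intro continuous_intros continuous_on_subset[OF assms sub])
  then have "bounded ((\<lambda>z. norm (w z) * exp (k * Im z) * exp (Im z)) ` fund_dom_trunc a 1)"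
    by (intro compact_imp_bounded compact_continuous_image fund_dom_trunc_compact)
  then obtain K where K: "\<And>z. z \<in> fund_dom_trunc a 1 \<Longrightarrow> norm (norm (w z) * exp (k * Im z) * exp (Im z)) \<le> K"
    by (auto simp: bounded_iff)
  show "\<exists>K. \<forall>z\<in>fund_dom_trunc a 1. norm (w z) * exp (k * Im z) \<le> K * exp (- Im z)"
  proof (intro exI[of _ K] ballI)
    fix z assume "z \<in> fund_dom_trunc a 1"
    from K[OF this] have "norm (w z) * exp (k * Im z) * exp (Im z) \<le> K" by simp
    then have "norm (w z) * exp (k * Im z) * exp (Im z) * exp (- Im z) \<le> K * exp (- Im z)" by (rule mult_right_mono) simp
    then show "norm (w z) * exp (k * Im z) \<le> K * exp (- Im z)" by (simp add: mult.assoc exp_add[symmetric])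
  qed
qed

lemma trunc_borel: "fund_dom_trunc a T \<in> sets borel"
  by (intro borel_closed compact_imp_closed fund_dom_trunc_compact)

lemma trunc_subset: "fund_dom_trunc a T \<subseteq> bigF a"
  by (auto simp: fund_dom_trunc_eq)

text \<open>\<open>Hs\<close> is the remainder over the whole domain, while \<open>hs\<close> below
  is the leading part under height 1; up to \<kappa> and the theta series these are the
  contributions that are entire in s.\<close>

definition Hs :: "complex \<Rightarrow> complex \<Rightarrow> complex" where
  "Hs \<tau> s = (LINT z:bigF a|lborel. (p z * R P0 \<tau> z / (complex_of_real (Im z))\<^sup>2) * complex_of_real (Im z) powr (- s))"

definition hs :: "complex \<Rightarrow> complex" where
  "hs s = (LINT z:fund_dom_trunc a 1|lborel. (p z / complex_of_real (Im z)) * complex_of_real (Im z) powr (- s))"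

lemma Hs_entire: "Im \<tau> > 0 \<Longrightarrow> Hs \<tau> holomorphic_on UNIV"
  unfolding Hs_def
  by (rule mellin_entire(1)[OF bigF_borel order_refl _ rem_fast_decay(2)])
    (intro y_inverse_continuous continuous_intros p R_continuous)

lemma hs_entire: "hs holomorphic_on UNIV"
  unfolding hs_def
  by (rule mellin_entire(1)[OF trunc_borel trunc_subset _ trunc1_fast_decay]; intro y_inverse_continuous p)

lemma Theta_decomp:
  assumes "Im \<tau> > 0" "Im z > 0"
  shows "Theta_L N S \<tau> z = \<kappa> * (of_real (Im z) * theta0 \<tau> + R P0 \<tau> z)"
  using Theta_eq_Th[OF assms] Th_split[OF assms, of P0] by (simp add: \<kappa>_def Th_lead)

text \<open>Above height 1 the leading part integrates over x to the constant term, so apart from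
  the remainder the dependence on T is a one-dimensional integral of powers of y.\<close>

lemma trunc_decomp:
  assumes "Im \<tau> > 0" "T \<ge> 1"
  shows "(LINT z:fund_dom_trunc a T|lborel. p z * Theta_L N S \<tau> z * complex_of_real (Im z) powr (- s) / (complex_of_real (Im z))\<^sup>2)
    = \<kappa> * (LINT z:fund_dom_trunc a T|lborel. (p z * R P0 \<tau> z / (complex_of_real (Im z))\<^sup>2) * complex_of_real (Im z) powr (- s))
      + \<kappa> * theta0 \<tau> * (hs s + of_nat a * integral {1..T} (\<lambda>y. ct y * complex_of_real y powr (- s) / complex_of_real y))"
proof -
  have pc: "continuous_on upper_half (\<lambda>z. complex_of_real (Im z) powr (- s))"
    by (intro continuous_intros) (auto simp: upper_half_def complex_nonpos_Reals_iff)
  define w1 where "w1 z = (p z * R P0 \<tau> z / (complex_of_real (Im z))\<^sup>2) * complex_of_real (Im z) powr (- s)" for z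
  define w2 where "w2 z = (p z / complex_of_real (Im z)) * complex_of_real (Im z) powr (- s)" for z
  have w1: "continuous_on upper_half w1" unfolding w1_def by (intro continuous_on_mult y_inverse_continuous p R_continuous assms pc)
  have w2: "continuous_on upper_half w2" unfolding w2_def by (intro continuous_on_mult y_inverse_continuous p pc)
  have i: "set_integrable lborel (fund_dom_trunc a T) w1" "set_integrable lborel (fund_dom_trunc a T) w2"
    by (intro fund_dom_trunc_integrable w1 w2)+
  have "(LINT z:fund_dom_trunc a T|lborel. p z * Theta_L N S \<tau> z * complex_of_real (Im z) powr (- s) / (complex_of_real (Im z))\<^sup>2)
    = (LINT z:fund_dom_trunc a T|lborel. \<kappa> * w1 z + (\<kappa> * theta0 \<tau>) * w2 z)"
  proof (rule set_lebesgue_integral_cong)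
    show "\<forall>z. z \<in> fund_dom_trunc a T \<longrightarrow> p z * Theta_L N S \<tau> z * complex_of_real (Im z) powr (- s) / (complex_of_real (Im z))\<^sup>2 = \<kappa> * w1 z + (\<kappa> * theta0 \<tau>) * w2 z"
    proof (intro allI impI)
      fix z assume "z \<in> fund_dom_trunc a T"
      then have "Im z > 0" by (rule fund_dom_trunc_upper)
      then show "p z * Theta_L N S \<tau> z * complex_of_real (Im z) powr (- s) / (complex_of_real (Im z))\<^sup>2 = \<kappa> * w1 z + (\<kappa> * theta0 \<tau>) * w2 z"
        unfolding w1_def w2_def Theta_decomp[OF assms(1) \<open>Im z > 0\<close>] by (simp add: field_simps power2_eq_square)
    qed
  qed (use trunc_borel in simp)
  also have "\<dots> = \<kappa> * (LINT z:fund_dom_trunc a T|lborel. w1 z) + (\<kappa> * theta0 \<tau>) * (LINT z:fund_dom_trunc a T|lborel. w2 z)"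
    by (subst set_integral_add(2)) (use i in \<open>auto intro!: set_integrable_mult_right\<close>)
  also have "(LINT z:fund_dom_trunc a T|lborel. w2 z) = hs s + integral {1..T} (\<lambda>y. integral {-1/2..real a - 1/2} (\<lambda>x. w2 (Complex x y)))"
    unfolding hs_def w2_def[symmetric] by (rule fund_dom_trunc_strip[OF w2 a assms(2)])
  also have "integral {1..T} (\<lambda>y. integral {-1/2..real a - 1/2} (\<lambda>x. w2 (Complex x y)))
     = integral {1..T} (\<lambda>y. of_nat a * (ct y * complex_of_real y powr (- s) / complex_of_real y))"
  proof (rule Henstock_Kurzweil_Integration.integral_cong)
    fix y assume "y \<in> {1..T}"
    then have y: "y > 0" by auto
    have "integral {-1/2..real a - 1/2} (\<lambda>x. w2 (Complex x y)) = integral {-1/2..real a - 1/2} (\<lambda>x. p (Complex x y) * (complex_of_real y powr (- s) / complex_of_real y))"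
      by (simp add: w2_def)
    also have "\<dots> = integral {-1/2..real a - 1/2} (\<lambda>x. p (Complex x y)) * (complex_of_real y powr (- s) / complex_of_real y)"
      by (rule integral_mult_left)
    finally show "integral {-1/2..real a - 1/2} (\<lambda>x. w2 (Complex x y)) = of_nat a * (ct y * complex_of_real y powr (- s) / complex_of_real y)"
      unfolding const[OF y, folded ct_def] by (simp only: mult.assoc times_divide_eq_right)
  qed
  also have "\<dots> = of_nat a * integral {1..T} (\<lambda>y. ct y * complex_of_real y powr (- s) / complex_of_real y)"
    by (rule integral_mult_right)
  finally show ?thesis unfolding w1_def .
qed

text \<open>The two conditions on s are those under which T powr (s' - s) and T powr (1 - s' - s)
  tend to 0. The lower limits of integration leave two simple fractions, which are meromorphic on
  the whole plane.\<close>

lemma reg_limit: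
  assumes "Im \<tau> > 0" "Re s > Re s'" "Re s > 1 - Re s'"
  shows "((\<lambda>T. LINT z:fund_dom_trunc a T|lborel. p z * Theta_L N S \<tau> z * complex_of_real (Im z) powr (- s) / (complex_of_real (Im z))\<^sup>2)
    \<longlongrightarrow> \<kappa> * Hs \<tau> s + \<kappa> * theta0 \<tau> * (hs s + of_nat a * (A / (s - s') + B / (s - (1 - s'))))) at_top"
proof -
  have ne: "s' - s \<noteq> 0" "1 - s' - s \<noteq> 0" using assms(2,3) by (auto simp: complex_eq_iff)
  have lim1: "((\<lambda>T. LINT z:fund_dom_trunc a T|lborel. (p z * R P0 \<tau> z / (complex_of_real (Im z))\<^sup>2) * complex_of_real (Im z) powr (- s)) \<longlongrightarrow> Hs \<tau> s) at_top"
    unfolding Hs_def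
    by (rule bigF_exhaustion, rule mellin_entire(2)[OF bigF_borel order_refl _ rem_fast_decay(2)[OF assms(1)]])
      (intro y_inverse_continuous continuous_intros p R_continuous assms)
  have int: "integral {1..T} (\<lambda>y. ct y * complex_of_real y powr (- s) / complex_of_real y)
      = A * ((complex_of_real T powr (s' - s) - 1) / (s' - s)) + B * ((complex_of_real T powr (1 - s' - s) - 1) / (1 - s' - s))" if T: "T \<ge> 1" for T
  proof -
    have c: "continuous_on {1..T} (\<lambda>y. complex_of_real y powr w)" for w by (rule powr_continuous) auto
    have "integral {1..T} (\<lambda>y. ct y * complex_of_real y powr (- s) / complex_of_real y)
      = integral {1..T} (\<lambda>y. A * complex_of_real y powr (s' - s - 1) + B * complex_of_real y powr (1 - s' - s - 1))"
    proof (rule Henstock_Kurzweil_Integration.integral_cong)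
      fix y assume "y \<in> {1..T}"
      then have y: "complex_of_real y \<noteq> 0" by auto
      have "complex_of_real y powr w * complex_of_real y powr (- s) / complex_of_real y = complex_of_real y powr (w - s - 1)" for w
        using y by (simp add: powr_diff powr_minus divide_inverse)
      then show "ct y * complex_of_real y powr (- s) / complex_of_real y = A * complex_of_real y powr (s' - s - 1) + B * complex_of_real y powr (1 - s' - s - 1)"
        by (simp only: ct_def distrib_right add_divide_distrib mult.assoc times_divide_eq_right[symmetric])
    qed
    also have "\<dots> = A * integral {1..T} (\<lambda>y. complex_of_real y powr (s' - s - 1)) + B * integral {1..T} (\<lambda>y. complex_of_real y powr (1 - s' - s - 1))"
      by (subst Henstock_Kurzweil_Integration.integral_add) (auto intro!: integrable_continuous_interval continuous_intros c)
    finally show ?thesis unfolding integral_powr[OF T ne(1)] integral_powr[OF T ne(2)] .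
  qed
  have "((\<lambda>T. A * ((complex_of_real T powr (s' - s) - 1) / (s' - s)) + B * ((complex_of_real T powr (1 - s' - s) - 1) / (1 - s' - s)))
      \<longlongrightarrow> A * ((0 - 1) / (s' - s)) + B * ((0 - 1) / (1 - s' - s))) at_top"
    by (intro tendsto_intros powr_tendsto_0) (use ne assms in auto)
  moreover have "A * ((0 - 1) / (s' - s)) + B * ((0 - 1) / (1 - s' - s)) = A / (s - s') + B / (s - (1 - s'))"
  proof -
    have "(0 - 1) / (s' - s) = 1 / (s - s')" "(0 - 1) / (1 - s' - s) = 1 / (s - (1 - s'))"
      using ne by (simp_all add: divide_simps)
    then show ?thesis by (simp only:) simp
  qed
  ultimately have "((\<lambda>T. A * ((complex_of_real T powr (s' - s) - 1) / (s' - s)) + B * ((complex_of_real T powr (1 - s' - s) - 1) / (1 - s' - s)))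
      \<longlongrightarrow> A / (s - s') + B / (s - (1 - s'))) at_top" by simp
  with lim1 have "((\<lambda>T. \<kappa> * (LINT z:fund_dom_trunc a T|lborel. (p z * R P0 \<tau> z / (complex_of_real (Im z))\<^sup>2) * complex_of_real (Im z) powr (- s))
      + \<kappa> * theta0 \<tau> * (hs s + of_nat a * (A * ((complex_of_real T powr (s' - s) - 1) / (s' - s)) + B * ((complex_of_real T powr (1 - s' - s) - 1) / (1 - s' - s)))))
    \<longlongrightarrow> \<kappa> * Hs \<tau> s + \<kappa> * theta0 \<tau> * (hs s + of_nat a * (A / (s - s') + B / (s - (1 - s'))))) at_top"
    by - (rule tendsto_add[OF tendsto_mult_left tendsto_mult_left[OF tendsto_add[OF tendsto_const tendsto_mult_left]]])
  then show ?thesis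
  proof (rule Lim_transform_eventually)
    show "\<forall>\<^sub>F T in at_top. \<kappa> * (LINT z:fund_dom_trunc a T|lborel. (p z * R P0 \<tau> z / (complex_of_real (Im z))\<^sup>2) * complex_of_real (Im z) powr (- s))
      + \<kappa> * theta0 \<tau> * (hs s + of_nat a * (A * ((complex_of_real T powr (s' - s) - 1) / (s' - s)) + B * ((complex_of_real T powr (1 - s' - s) - 1) / (1 - s' - s))))
      = (LINT z:fund_dom_trunc a T|lborel. p z * Theta_L N S \<tau> z * complex_of_real (Im z) powr (- s) / (complex_of_real (Im z))\<^sup>2)"
      using eventually_ge_at_top[of 1] by eventually_elim (simp only: trunc_decomp[OF assms(1)] int)
  qed
qed

text \<open>The value at s = 0 of A / (s - s') + B / (s - (1 - s')), each fraction being dropped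
  when its pole lies at s = 0.\<close>

definition c0 :: complex where
  "c0 = (if s' = 0 then 0 else - A / s') + (if s' = 1 then 0 else B / (s' - 1))"

definition J :: "part \<Rightarrow> complex \<Rightarrow> complex" where
  "J q \<tau> = (LINT z:bigF a|lborel. p z * R q \<tau> z / (complex_of_real (Im z))\<^sup>2)"

text \<open>For \<open>P0\<close> this is the contribution of the cusp to the constant term at s =
  0. Evaluating the leading series at z = \<i>, where Im z = 1, represents
  \<open>theta0 \<tau>\<close> within the family \<open>Th\<close>, so that its derivatives in
  \<tau> are available under the same names.\<close>

definition Ir :: "part \<Rightarrow> complex \<Rightarrow> complex" where
  "Ir q \<tau> = \<kappa> * (J q \<tau> + (hs 0 + of_nat a * c0) * Th om_lead q \<tau> \<i>)"

section \<open>Differentiating the constant term in \<tau>\<close>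

lemma J_dominated: "dominated lborel upper_half (\<lambda>\<tau> z. indicator (bigF a) z *\<^sub>R (p z * R q \<tau> z / (complex_of_real (Im z))\<^sup>2))"
  unfolding dominated_def
proof (intro conjI ballI)
  fix \<tau> assume "\<tau> \<in> upper_half"
  then show "(\<lambda>z. indicator (bigF a) z *\<^sub>R (p z * R q \<tau> z / (complex_of_real (Im z))\<^sup>2)) \<in> borel_measurable lborel"
    by (intro indicator_measurable_upper[OF bigF_borel order_refl] y_inverse_continuous continuous_intros p R_continuous) (simp add: upper_half_def)
next
  fix z :: complex assume "z \<in> space lborel"
  show "continuous_on upper_half (\<lambda>\<tau>. indicator (bigF a) z *\<^sub>R (p z * R q \<tau> z / (complex_of_real (Im z))\<^sup>2))"
  proof (cases "z \<in> bigF a")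
    case True
    then have "Im z > 0" using bigF_strip(1) by force
    then show ?thesis by (intro continuous_intros Th_continuous(1)[OF norm_om_rem]) auto
  qed simp
next
  fix \<tau>0 assume "\<tau>0 \<in> upper_half"
  then have "Im \<tau>0 > 0" by (simp add: upper_half_def)
  from key_bound[OF this, of 0] obtain \<epsilon> K where K: "\<epsilon> > 0" "\<And>\<tau> z q. dist \<tau>0 \<tau> < \<epsilon> \<Longrightarrow> Im z \<ge> 1/2 \<Longrightarrow> -1/2 \<le> Re z \<Longrightarrow> Re z \<le> real a - 1/2 \<Longrightarrow>
       norm (p z * R q \<tau> z) * exp (0 * Im z) \<le> K * exp (- Im z)" by blast
  show "\<exists>\<epsilon>>0. \<exists>g. integrable lborel g \<and> (\<forall>\<tau>\<in>ball \<tau>0 \<epsilon> \<inter> upper_half. \<forall>z\<in>space lborel.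
      norm (indicator (bigF a) z *\<^sub>R (p z * R q \<tau> z / (complex_of_real (Im z))\<^sup>2)) \<le> g z)"
  proof (intro exI[of _ \<epsilon>] exI[of _ "\<lambda>z. indicator (bigF a) z *\<^sub>R (4 * K * exp (- Im z))"] conjI ballI K(1))
    show "integrable lborel (\<lambda>z. indicator (bigF a) z *\<^sub>R (4 * K * exp (- Im z)) :: real)"
      using bigF_exp_integrable[of a "4 * K"] by (simp add: set_integrable_def)
    fix \<tau> z assume \<tau>: "\<tau> \<in> ball \<tau>0 \<epsilon> \<inter> upper_half"
    show "norm (indicator (bigF a) z *\<^sub>R (p z * R q \<tau> z / (complex_of_real (Im z))\<^sup>2)) \<le> indicator (bigF a) z *\<^sub>R (4 * K * exp (- Im z))"
    proof (cases "z \<in> bigF a")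
      case True
      note b = bigF_strip[OF True]
      have "norm (p z * R q \<tau> z / (complex_of_real (Im z))\<^sup>2) \<le> 4 * norm (p z * R q \<tau> z)" by (rule y_sq_bound[OF b(1)])
      also have "\<dots> \<le> 4 * (K * exp (- Im z))" using K(2)[of \<tau> z q] \<tau> b by simp
      finally show ?thesis using True by simp
    qed simp
  qed
qed

lemma J_continuous: "continuous_on upper_half (J q)"
  using dominated_continuous[OF J_dominated[of q]] by (simp add: J_def[abs_def] set_lebesgue_integral_def)

lemma J_has_dir_aux:
  assumes "\<tau> \<in> upper_half" and "\<And>\<tau> z. Im \<tau> > 0 \<Longrightarrow> Im z > 0 \<Longrightarrow> has_dir e (\<lambda>\<tau>. R q \<tau> z) (R q' \<tau> z) \<tau>"
  shows "has_dir e (J q) (J q' \<tau>) \<tau>"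
proof -
  have "has_dir e (\<lambda>\<tau>. integral\<^sup>L lborel (\<lambda>z. indicator (bigF a) z *\<^sub>R (p z * R q \<tau> z / (complex_of_real (Im z))\<^sup>2)))
     (integral\<^sup>L lborel (\<lambda>z. indicator (bigF a) z *\<^sub>R (p z * R q' \<tau> z / (complex_of_real (Im z))\<^sup>2))) \<tau>"
  proof (rule dominated_has_dir[OF open_upper J_dominated J_dominated assms(1)])
    fix \<tau> z assume \<tau>: "\<tau> \<in> upper_half"
    show "has_dir e (\<lambda>\<tau>. indicator (bigF a) z *\<^sub>R (p z * R q \<tau> z / (complex_of_real (Im z))\<^sup>2)) (indicator (bigF a) z *\<^sub>R (p z * R q' \<tau> z / (complex_of_real (Im z))\<^sup>2)) \<tau>"
    proof (cases "z \<in> bigF a")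
      case True
      then have "Im z > 0" using bigF_strip(1) by force
      then have "has_dir e (\<lambda>\<tau>. R q \<tau> z) (R q' \<tau> z) \<tau>" using \<tau> assms(2) by (simp add: upper_half_def)
      from has_dir_cmult[OF this, of "p z / (complex_of_real (Im z))\<^sup>2"] show ?thesis using True by simp
    qed (simp add: has_dir_const)
  qed
  then show ?thesis by (simp add: J_def[abs_def] set_lebesgue_integral_def)
qed

lemma Ir_has_dir:
  assumes "\<tau> \<in> upper_half"
  shows "has_dir 1 (Ir P0) (Ir Pu \<tau>) \<tau>" "has_dir \<i> (Ir P0) (Ir Pv \<tau>) \<tau>" "has_dir 1 (Ir Pu) (Ir Puu \<tau>) \<tau>" "has_dir \<i> (Ir Pu) (Ir Puv \<tau>) \<tau>"
    "has_dir 1 (Ir Pv) (Ir Puv \<tau>) \<tau>" "has_dir \<i> (Ir Pv) (Ir Pvv \<tau>) \<tau>"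
proof -
  have \<tau>: "Im \<tau> > 0" using assms by (simp add: upper_half_def)
  have *: "has_dir e (Ir q) (Ir q' \<tau>) \<tau>"
    if "\<And>\<omega> \<tau> z. (\<And>i. norm (\<omega> i) \<le> 1) \<Longrightarrow> Im \<tau> > 0 \<Longrightarrow> Im z > 0 \<Longrightarrow> has_dir e (\<lambda>\<tau>. Th \<omega> q \<tau> z) (Th \<omega> q' \<tau> z) \<tau>" for e q q'
    unfolding Ir_def[abs_def]
    by (intro has_dir_cmult has_dir_add J_has_dir_aux[OF assms] that norm_om_rem norm_om_lead) (use \<tau> in auto)
  show "has_dir 1 (Ir P0) (Ir Pu \<tau>) \<tau>" by (rule *) (rule Th_has_dir(1))
  show "has_dir \<i> (Ir P0) (Ir Pv \<tau>) \<tau>" by (rule *) (rule Th_has_dir(2))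
  show "has_dir 1 (Ir Pu) (Ir Puu \<tau>) \<tau>" by (rule *) (rule Th_has_dir(3))
  show "has_dir \<i> (Ir Pu) (Ir Puv \<tau>) \<tau>" by (rule *) (rule Th_has_dir(4))
  show "has_dir 1 (Ir Pv) (Ir Puv \<tau>) \<tau>" by (rule *) (rule Th_has_dir(5))
  show "has_dir \<i> (Ir Pv) (Ir Pvv \<tau>) \<tau>" by (rule *) (rule Th_has_dir(6))
qed

lemma Ir_continuous: "continuous_on upper_half (Ir q)"
  unfolding Ir_def[abs_def] by (intro continuous_intros J_continuous Th_continuous(1)[OF norm_om_lead]) simp

lemma Ir_P0:
  assumes "Im \<tau> > 0"
  shows "Ir P0 \<tau> = \<kappa> * Hs \<tau> 0 + \<kappa> * theta0 \<tau> * (hs 0 + of_nat a * c0)"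
proof -
  have "Hs \<tau> 0 = J P0 \<tau>"
    unfolding Hs_def J_def
    by (rule set_lebesgue_integral_cong) (use bigF_borel bigF_strip(1) in \<open>fastforce\<close>)+
  then show ?thesis by (simp add: Ir_def Th_lead algebra_simps)
qed

text \<open>The derivative series must agree with the derivatives of the closed form y
  \<open>theta0 \<tau>\<close>, by uniqueness of derivatives.\<close>

lemma lead_derivs:
  assumes "Im \<tau> > 0" "Im z > 0"
  shows "Th om_lead Px \<tau> z = 0" "Th om_lead Pxx \<tau> z = 0" "Th om_lead Py \<tau> z = theta0 \<tau>" "Th om_lead Pyy \<tau> z = 0"
proof -
  have l: "Th om_lead P0 \<tau> = (\<lambda>z. of_real (Im z) * theta0 \<tau>)" by (rule ext) (rule Th_lead)
  have im: "has_dir 1 (\<lambda>z. of_real (Im z) * theta0 \<tau>) 0 z" "has_dir \<i> (\<lambda>z. of_real (Im z) * theta0 \<tau>) (theta0 \<tau>) z" for z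
    by (auto simp: has_dir_def intro!: derivative_eq_intros has_vector_derivative_real_field)
  have x: "Th om_lead Px \<tau> z = 0" if "Im z > 0" for z
    using has_dir_unique[OF Th_has_dir(7)[OF norm_om_lead assms(1) that]] im(1) by (simp add: l)
  have y: "Th om_lead Py \<tau> z = theta0 \<tau>" if "Im z > 0" for z
    using has_dir_unique[OF Th_has_dir(8)[OF norm_om_lead assms(1) that]] im(2) by (simp add: l)
  show "Th om_lead Px \<tau> z = 0" "Th om_lead Py \<tau> z = theta0 \<tau>" using x y assms by auto
  have "has_dir 1 (Th om_lead Px \<tau>) 0 z"
    by (subst has_dir_cong[OF open_upper, of _ _ "\<lambda>_. 0"]) (use assms x in \<open>auto simp: upper_half_def has_dir_const\<close>)
  then show "Th om_lead Pxx \<tau> z = 0" by (rule has_dir_unique[OF Th_has_dir(9)[OF norm_om_lead assms]])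
  have "has_dir \<i> (Th om_lead Py \<tau>) 0 z"
    by (subst has_dir_cong[OF open_upper, of _ _ "\<lambda>_. theta0 \<tau>"]) (use assms y in \<open>auto simp: upper_half_def has_dir_const\<close>)
  then show "Th om_lead Pyy \<tau> z = 0" by (rule has_dir_unique[OF Th_has_dir(10)[OF norm_om_lead assms]])
qed

definition LapInt :: "complex \<Rightarrow> complex" where
  "LapInt \<tau> = (LINT z:bigF a|lborel. p z * (R Pxx \<tau> z + R Pyy \<tau> z))"

text \<open>On the remainder the heat equation produces the Laplacian in z, whose factor y^2 cancels
  the density of d\<mu>. The leading part drops out: it is harmonic in z, so its heat equation says
  that the operator in \<tau> annihilates it.\<close>

lemma Ir_heat:
  assumes "Im \<tau> > 0"
  shows "4 * (- (complex_of_real (Im \<tau>))\<^sup>2 * (Ir Puu \<tau> + Ir Pvv \<tau>) + \<i> / 2 * complex_of_real (Im \<tau>) * (Ir Pu \<tau> + \<i> * Ir Pv \<tau>)) = - \<kappa> * LapInt \<tau>"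
proof -
  define V where "V = complex_of_real (Im \<tau>)"
  define L where "L f = 4 * (- V\<^sup>2 * (f Puu + f Pvv) + \<i> / 2 * V * (f Pu + \<i> * f Pv))" for f :: "part \<Rightarrow> complex"
  have lead: "L (\<lambda>q. Th om_lead q \<tau> \<i>) = 0"
    using Th_heat[OF norm_om_lead assms, of \<i>] lead_derivs[OF assms, of \<i>] by (simp add: L_def V_def)
  define w where "w q z = indicator (bigF a) z *\<^sub>R (p z * R q \<tau> z / (complex_of_real (Im z))\<^sup>2)" for q z
  have wi: "integrable lborel (w q)" for q
    using dominated_integrable[OF J_dominated[of q], of \<tau>] assms by (simp add: w_def[abs_def] upper_half_def)
  have Jw: "J q \<tau> = integral\<^sup>L lborel (w q)" for q by (simp add: J_def w_def[abs_def] set_lebesgue_integral_def)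
  have "L (\<lambda>q. J q \<tau>) = integral\<^sup>L lborel (\<lambda>z. L (\<lambda>q. w q z))"
    unfolding L_def Jw using wi by simp
  also have "\<dots> = integral\<^sup>L lborel (\<lambda>z. indicator (bigF a) z *\<^sub>R (- (p z * (R Pxx \<tau> z + R Pyy \<tau> z))))"
  proof (rule Bochner_Integration.integral_cong[OF refl])
    fix z
    show "L (\<lambda>q. w q z) = indicator (bigF a) z *\<^sub>R (- (p z * (R Pxx \<tau> z + R Pyy \<tau> z)))"
    proof (cases "z \<in> bigF a")
      case True
      then have z: "Im z > 0" using bigF_strip(1) by force
      have "L (\<lambda>q. w q z) = (p z / (complex_of_real (Im z))\<^sup>2) * L (\<lambda>q. R q \<tau> z)"
        using True by (simp add: w_def L_def algebra_simps)
      also have "L (\<lambda>q. R q \<tau> z) = - (complex_of_real (Im z))\<^sup>2 * (R Pxx \<tau> z + R Pyy \<tau> z)"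
        unfolding L_def V_def by (rule Th_heat[OF norm_om_rem assms z])
      finally show ?thesis using True z by simp
    qed (simp add: w_def L_def)
  qed
  also have "\<dots> = - LapInt \<tau>" by (simp add: LapInt_def set_lebesgue_integral_def)
  finally have J: "L (\<lambda>q. J q \<tau>) = - LapInt \<tau>" .
  have "L (\<lambda>q. Ir q \<tau>) = \<kappa> * (L (\<lambda>q. J q \<tau>) + (hs 0 + of_nat a * c0) * L (\<lambda>q. Th om_lead q \<tau> \<i>))"
    by (simp add: L_def Ir_def algebra_simps)
  then show ?thesis by (simp add: J lead L_def V_def)
qed

end

section \<open>Green's identity and the eigenvalue equation\<close>

text \<open>The data that Green's identity for the Laplacian consumes, all continuous and kept as
  named functions, so that they can be carried along shifts and Moebius maps.\<close>

definition second_partials where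
  "second_partials g g1 g2 g11 g22 \<longleftrightarrow>
     (\<forall>h\<in>{g, g1, g2, g11, g22}. continuous_on upper_half h) \<and>
     (\<forall>z. Im z > 0 \<longrightarrow> has_dir 1 g (g1 z) z \<and> has_dir \<i> g (g2 z) z \<and> has_dir 1 g1 (g11 z) z \<and> has_dir \<i> g2 (g22 z) z)"

lemma second_partialsD:
  assumes "second_partials g g1 g2 g11 g22"
  shows "continuous_on upper_half g" "continuous_on upper_half g1" "continuous_on upper_half g2"
    "continuous_on upper_half g11" "continuous_on upper_half g22"
    "Im z > 0 \<Longrightarrow> has_dir 1 g (g1 z) z" "Im z > 0 \<Longrightarrow> has_dir \<i> g (g2 z) z"
    "Im z > 0 \<Longrightarrow> has_dir 1 g1 (g11 z) z" "Im z > 0 \<Longrightarrow> has_dir \<i> g2 (g22 z) z"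
  using assms unfolding second_partials_def by auto

lemma second_partials_shift:
  assumes "second_partials g g1 g2 g11 g22"
  shows "second_partials (\<lambda>z. g (z + of_nat j)) (\<lambda>z. g1 (z + of_nat j)) (\<lambda>z. g2 (z + of_nat j)) (\<lambda>z. g11 (z + of_nat j)) (\<lambda>z. g22 (z + of_nat j))"
proof -
  have c: "continuous_on upper_half (\<lambda>z. h (z + of_nat j))" if "continuous_on upper_half h" for h :: "complex \<Rightarrow> complex"
    by (rule continuous_on_upper_compose[OF that]) (auto intro!: continuous_intros simp: upper_half_def)
  show ?thesis
    unfolding second_partials_def using second_partialsD[OF assms]
    by (auto intro!: c has_dir_shift)
qed

text \<open>The chain rule for g after \<gamma> is compared with the known partial derivatives of h.
  By the Cauchy-Riemann equations \<gamma>' acts on the gradient as a rotation with scaling.\<close>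

lemma first_partials_compose:
  assumes g: "second_partials g g1 g2 g11 g22" and h: "second_partials h h1 h2 h11 h22"
    and eq: "\<And>w. Im w > 0 \<Longrightarrow> g (\<gamma> w) = h w" and z: "Im z > 0" "Im (\<gamma> z) > 0"
    and der: "(\<gamma> has_field_derivative \<gamma>') (at z)"
  shows "h1 z = of_real (Re \<gamma>') * g1 (\<gamma> z) + of_real (Im \<gamma>') * g2 (\<gamma> z)"
    "h2 z = of_real (- Im \<gamma>') * g1 (\<gamma> z) + of_real (Re \<gamma>') * g2 (\<gamma> z)"
proof -
  have *: "has_dir e h (of_real (Re (\<gamma>' * e)) * g1 (\<gamma> z) + of_real (Im (\<gamma>' * e)) * g2 (\<gamma> z)) z" for e
  proof -
    have "has_dir e (\<lambda>z. g (\<gamma> z)) (of_real (Re (\<gamma>' * e)) * g1 (\<gamma> z) + of_real (Im (\<gamma>' * e)) * g2 (\<gamma> z)) z"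
      by (rule has_dir_compose[OF open_upper _ _ _ second_partialsD(2,3)[OF g] der])
        (use second_partialsD(6,7)[OF g] z in \<open>auto simp: upper_half_def\<close>)
    then show ?thesis
      using has_dir_cong[OF open_upper, of z "\<lambda>z. g (\<gamma> z)" h] eq z by (simp add: upper_half_def)
  qed
  show "h1 z = of_real (Re \<gamma>') * g1 (\<gamma> z) + of_real (Im \<gamma>') * g2 (\<gamma> z)"
    using has_dir_unique[OF second_partialsD(6)[OF h z(1)] *[of 1]] by simp
  show "h2 z = of_real (- Im \<gamma>') * g1 (\<gamma> z) + of_real (Re \<gamma>') * g2 (\<gamma> z)"
    using has_dir_unique[OF second_partialsD(7)[OF h z(1)] *[of \<i>]] by simp
qed

lemma FT_integrable:
  assumes "continuous_on upper_half g"
  shows "set_integrable lborel (FT T) (g :: complex \<Rightarrow> complex)"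
  by (rule compact_set_integrable[OF FT_compact continuous_on_subset[OF assms]])
    (auto simp: upper_half_def dest: FT_upper)

lemma FT_integral_sum:
  assumes "\<And>i. i \<in> I \<Longrightarrow> continuous_on upper_half (g i)"
  shows "(LINT z:FT T|lborel. (\<Sum>i\<in>I. g i z :: complex)) = (\<Sum>i\<in>I. LINT z:FT T|lborel. g i z)"
  unfolding set_lebesgue_integral_def scaleR_sum_right
  by (rule Bochner_Integration.integral_sum) (use FT_integrable[OF assms] in \<open>simp add: set_integrable_def\<close>)

text \<open>The two boundary arcs and the two vertical sides cancel because the generators of the
  modular group permute the summands.\<close>

lemma green_permutation:
  fixes p q p1 p2 q1 q2 p11 p22 q11 q22 :: "'i \<Rightarrow> complex \<Rightarrow> complex"
  assumes fin: "finite I" and T: "T \<ge> 1"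
    and sp: "\<And>i. i \<in> I \<Longrightarrow> second_partials (p i) (p1 i) (p2 i) (p11 i) (p22 i)"
    and sq: "\<And>i. i \<in> I \<Longrightarrow> second_partials (q i) (q1 i) (q2 i) (q11 i) (q22 i)"
    and \<pi>: "bij_betw \<pi> I I" "\<And>i z. i \<in> I \<Longrightarrow> Im z > 0 \<Longrightarrow> p i (z + 1) = p (\<pi> i) z \<and> q i (z + 1) = q (\<pi> i) z"
    and \<rho>: "bij_betw \<rho> I I" "\<And>i z. i \<in> I \<Longrightarrow> Im z > 0 \<Longrightarrow> p i (- 1 / z) = p (\<rho> i) z \<and> q i (- 1 / z) = q (\<rho> i) z"
  shows "(\<Sum>i\<in>I. LINT z:FT T|lborel. p i z * (q11 i z + q22 i z) - q i z * (p11 i z + p22 i z))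
    = (\<Sum>i\<in>I. integral {-1/2..1/2} (\<lambda>x. p i (Complex x T) * q2 i (Complex x T) - q i (Complex x T) * p2 i (Complex x T)))"
proof -
  note spD = second_partialsD[OF sp] and sqD = second_partialsD[OF sq]
  \<comment> \<open>(P, Q) is the field p grad q - q grad p summed over i. Its divergence P' + Q' is
    the integrand, because the products of first derivatives cancel.\<close>
  define P where "P z = (\<Sum>i\<in>I. p i z * q1 i z - q i z * p1 i z)" for z
  define Q where "Q z = (\<Sum>i\<in>I. p i z * q2 i z - q i z * p2 i z)" for z
  define P' where "P' z = (\<Sum>i\<in>I. p i z * q11 i z - q i z * p11 i z)" for z
  define Q' where "Q' z = (\<Sum>i\<in>I. p i z * q22 i z - q i z * p22 i z)" for z
  have cont: "continuous_on upper_half P" "continuous_on upper_half Q" "continuous_on upper_half P'" "continuous_on upper_half Q'"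
    unfolding P_def Q_def P'_def Q'_def
    by (rule continuous_on_sum, rule continuous_on_diff; rule continuous_on_mult, erule spD sqD, erule spD sqD)+
  have dP: "has_dir 1 P (P' z) z" if z: "Im z > 0" for z
    unfolding P_def P'_def
  proof (rule has_dir_sum)
    fix i assume i: "i \<in> I"
    show "has_dir 1 (\<lambda>z. p i z * q1 i z - q i z * p1 i z) (p i z * q11 i z - q i z * p11 i z) z"
      using has_dir_diff[OF has_dir_mult[OF spD(6)[OF i z] sqD(8)[OF i z]] has_dir_mult[OF sqD(6)[OF i z] spD(8)[OF i z]]]
      by (simp add: algebra_simps)
  qed
  have dQ: "has_dir \<i> Q (Q' z) z" if z: "Im z > 0" for z
    unfolding Q_def Q'_def
  proof (rule has_dir_sum)
    fix i assume i: "i \<in> I"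
    show "has_dir \<i> (\<lambda>z. p i z * q2 i z - q i z * p2 i z) (p i z * q22 i z - q i z * p22 i z) z"
      using has_dir_diff[OF has_dir_mult[OF spD(7)[OF i z] sqD(9)[OF i z]] has_dir_mult[OF sqD(7)[OF i z] spD(9)[OF i z]]]
      by (simp add: algebra_simps)
  qed
  have side: "P (z + 1) = P z" if z: "Im z > 0" for z
  proof -
    have z': "Im (z + 1) > 0" using z by simp
    have d: "((\<lambda>z. z + 1) has_field_derivative 1) (at z)" by (auto intro!: derivative_eq_intros)
    have "P (z + 1) = (\<Sum>i\<in>I. p (\<pi> i) z * q1 (\<pi> i) z - q (\<pi> i) z * p1 (\<pi> i) z)"
      unfolding P_def
    proof (rule sum.cong[OF refl])
      fix i assume i: "i \<in> I"
      then have \<pi>i: "\<pi> i \<in> I" using \<pi>(1) by (auto simp: bij_betw_def)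
      have "p1 (\<pi> i) z = p1 i (z + 1)"
        using first_partials_compose(1)[OF sp[OF i] sp[OF \<pi>i] _ z z' d] \<pi>(2)[OF i] by simp
      moreover have "q1 (\<pi> i) z = q1 i (z + 1)"
        using first_partials_compose(1)[OF sq[OF i] sq[OF \<pi>i] _ z z' d] \<pi>(2)[OF i] by simp
      ultimately show "p i (z + 1) * q1 i (z + 1) - q i (z + 1) * p1 i (z + 1) = p (\<pi> i) z * q1 (\<pi> i) z - q (\<pi> i) z * p1 (\<pi> i) z"
        using \<pi>(2)[OF i z] by simp
    qed
    also have "\<dots> = P z" unfolding P_def by (rule sum.reindex_bij_betw[OF \<pi>(1)])
    finally show ?thesis .
  qed
  \<comment> \<open>On the unit circle z' = - 1 / z is the mirror image of z, and the derivative
    z'^2 of the inversion at z rotates the field from z' to z. With x^2 + y^2 = 1 the fluxes through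
    the two halves of the arc then cancel.\<close>
  have arc: "(x / arc x) *\<^sub>R (P (Complex x (arc x)) - P (Complex (- x) (arc x))) = - (Q (Complex x (arc x)) + Q (Complex (- x) (arc x)))"
    if "x \<in> {0..1/2}" for x
  proof -
    have x: "\<bar>x\<bar> \<le> 1 / 2" using that unfolding atLeastAtMost_iff by linarith
    define y where "y = arc x"
    have y: "y > 0" "x\<^sup>2 + y\<^sup>2 = 1" using arc_bounds[OF x] by (simp_all add: y_def)
    define z z' where "z = Complex x y" and "z' = Complex (- x) y"
    have z: "Im z > 0" "z \<noteq> 0" using y by (auto simp: z_def complex_eq_iff)
    have "z * z' = - 1" using y(2) by (simp add: z_def z'_def complex_eq_iff power2_eq_square)
    then have zz1: "- 1 / z = z'" using z(2) by (simp add: field_simps)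
    have zz2: "Im (- 1 / z) > 0" unfolding zz1 using y(1) by (simp add: z'_def)
    note zz = zz1 zz2
    have d0: "((\<lambda>z. - 1 / z) has_field_derivative 1 / z\<^sup>2) (at z)"
      using z(2) by (auto intro!: derivative_eq_intros simp: power2_eq_square)
    have "1 / z\<^sup>2 = z'\<^sup>2" unfolding zz(1)[symmetric] by (simp add: power_divide)
    then have d: "((\<lambda>z. - 1 / z) has_field_derivative z'\<^sup>2) (at z)" using d0 by simp
    have re: "Re (z'\<^sup>2) = x\<^sup>2 - y\<^sup>2" "Im (z'\<^sup>2) = - (2 * x * y)" by (simp_all add: z'_def power2_eq_square)
    define c s where "c = complex_of_real (x\<^sup>2 - y\<^sup>2)" and "s = complex_of_real (2 * x * y)"
    have tr: "p1 (\<rho> i) z = c * p1 i z' - s * p2 i z'" "p2 (\<rho> i) z = s * p1 i z' + c * p2 i z'"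
        "q1 (\<rho> i) z = c * q1 i z' - s * q2 i z'" "q2 (\<rho> i) z = s * q1 i z' + c * q2 i z'"
        "p (\<rho> i) z = p i z'" "q (\<rho> i) z = q i z'" if i: "i \<in> I" for i
    proof -
      have \<rho>i: "\<rho> i \<in> I" using \<rho>(1) i by (auto simp: bij_betw_def)
      note a = first_partials_compose[OF sp[OF i] sp[OF \<rho>i] _ z(1) zz(2) d]
      note b = first_partials_compose[OF sq[OF i] sq[OF \<rho>i] _ z(1) zz(2) d]
      show "p1 (\<rho> i) z = c * p1 i z' - s * p2 i z'" "p2 (\<rho> i) z = s * p1 i z' + c * p2 i z'"
        using a \<rho>(2)[OF i] unfolding re zz(1) c_def s_def by simp_all
      show "q1 (\<rho> i) z = c * q1 i z' - s * q2 i z'" "q2 (\<rho> i) z = s * q1 i z' + c * q2 i z'"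
        using b \<rho>(2)[OF i] unfolding re zz(1) c_def s_def by simp_all
      show "p (\<rho> i) z = p i z'" "q (\<rho> i) z = q i z'" using \<rho>(2)[OF i z(1)] unfolding zz(1) by simp_all
    qed
    have PS: "P z = c * P z' - s * Q z'"
    proof -
      have "P z = (\<Sum>i\<in>I. p (\<rho> i) z * q1 (\<rho> i) z - q (\<rho> i) z * p1 (\<rho> i) z)"
        unfolding P_def by (rule sum.reindex_bij_betw[OF \<rho>(1), symmetric])
      also have "\<dots> = (\<Sum>i\<in>I. c * (p i z' * q1 i z' - q i z' * p1 i z') - s * (p i z' * q2 i z' - q i z' * p2 i z'))"
        by (rule sum.cong[OF refl]) (simp add: tr algebra_simps)
      finally show ?thesis by (simp only: P_def Q_def sum_subtractf sum_distrib_left right_diff_distrib)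
    qed
    have QS: "Q z = s * P z' + c * Q z'"
    proof -
      have "Q z = (\<Sum>i\<in>I. p (\<rho> i) z * q2 (\<rho> i) z - q (\<rho> i) z * p2 (\<rho> i) z)"
        unfolding Q_def by (rule sum.reindex_bij_betw[OF \<rho>(1), symmetric])
      also have "\<dots> = (\<Sum>i\<in>I. s * (p i z' * q1 i z' - q i z' * p1 i z') + c * (p i z' * q2 i z' - q i z' * p2 i z'))"
        by (rule sum.cong[OF refl]) (simp add: tr algebra_simps)
      finally show ?thesis by (simp add: P_def Q_def sum.distrib sum_distrib_left)
    qed
    have c: "c - 1 = complex_of_real (- 2 * y\<^sup>2)" "c + 1 = complex_of_real (2 * x\<^sup>2)"
    proof -
      have r: "x\<^sup>2 - y\<^sup>2 - 1 = - 2 * y\<^sup>2" "x\<^sup>2 - y\<^sup>2 + 1 = 2 * x\<^sup>2" using y(2) by linarith+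
      show "c - 1 = complex_of_real (- 2 * y\<^sup>2)" "c + 1 = complex_of_real (2 * x\<^sup>2)"
        unfolding c_def r[symmetric] by simp_all
    qed
    have "P z - P z' = (c - 1) * P z' - s * Q z'" by (simp add: PS algebra_simps)
    also have "(x / y) *\<^sub>R \<dots> = - s * P z' - complex_of_real (2 * x\<^sup>2) * Q z'"
    proof -
      have "complex_of_real y \<noteq> 0" using y(1) by simp
      then have "complex_of_real (x / y) * complex_of_real (- 2 * y\<^sup>2) = - s" "complex_of_real (x / y) * s = complex_of_real (2 * x\<^sup>2)"
        unfolding s_def of_real_mult[symmetric] of_real_minus[symmetric] of_real_eq_iff by (simp_all add: power2_eq_square)
      then show ?thesis
        unfolding c scaleR_conv_of_real right_diff_distrib mult.assoc[symmetric] by (simp only:)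
    qed
    also have "\<dots> = - (Q z + Q z')" unfolding QS c(2)[symmetric] by (simp add: algebra_simps)
    finally show ?thesis by (simp add: y_def[symmetric] z_def z'_def)
  qed
  have "(\<Sum>i\<in>I. LINT z:FT T|lborel. p i z * (q11 i z + q22 i z) - q i z * (p11 i z + p22 i z))
    = (LINT z:FT T|lborel. (\<Sum>i\<in>I. p i z * (q11 i z + q22 i z) - q i z * (p11 i z + p22 i z)))"
    by (rule FT_integral_sum[symmetric], rule continuous_on_diff; rule continuous_on_mult, erule spD sqD, rule continuous_on_add; erule spD sqD)
  also have "\<dots> = (LINT z:FT T|lborel. P' z + Q' z)"
    unfolding P'_def Q'_def sum.distrib[symmetric] by (simp add: algebra_simps)
  also have "\<dots> = (LINT z:FT T|lborel. P' z) + (LINT z:FT T|lborel. Q' z)"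
    by (intro set_integral_add(2) FT_integrable cont)
  also have "(LINT z:FT T|lborel. P' z) = integral {sqrt 3 / 2..T} (\<lambda>y. P (Complex (1/2) y) - P (Complex (-1/2) y))
     - integral {0..1/2} (\<lambda>x. (x / arc x) *\<^sub>R (P (Complex x (arc x)) - P (Complex (- x) (arc x))))"
    by (rule green_x[OF T cont(1,3) dP])
  also have "integral {sqrt 3 / 2..T} (\<lambda>y. P (Complex (1/2) y) - P (Complex (-1/2) y)) = integral {sqrt 3 / 2..T} (\<lambda>y. 0)"
  proof (rule Henstock_Kurzweil_Integration.integral_cong)
    fix y assume "y \<in> {sqrt 3 / 2..T}"
    then have "y > 0" using less_le_trans[of 0 "sqrt 3 / 2" y] by simp
    moreover have "Complex (-1/2) y + 1 = Complex (1/2) y" by (simp add: complex_eq_iff)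
    ultimately show "P (Complex (1/2) y) - P (Complex (-1/2) y) = 0" using side[of "Complex (-1/2) y"] by simp
  qed
  also have "integral {0..1/2} (\<lambda>x. (x / arc x) *\<^sub>R (P (Complex x (arc x)) - P (Complex (- x) (arc x))))
     = integral {0..1/2} (\<lambda>x. - (Q (Complex x (arc x)) + Q (Complex (- x) (arc x))))"
    by (rule Henstock_Kurzweil_Integration.integral_cong) (rule arc)
  also have "\<dots> = - integral {0..1/2} (\<lambda>x. Q (Complex x (arc x)) + Q (Complex (- x) (arc x)))"
    by (rule integral_neg)
  also have "(LINT z:FT T|lborel. Q' z) = integral {-1/2..1/2} (\<lambda>x. Q (Complex x T))
     - integral {0..1/2} (\<lambda>x. Q (Complex x (arc x)) + Q (Complex (- x) (arc x)))"
    by (rule green_y[OF T cont(2,4) dQ])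
  also have "integral {-1/2..1/2} (\<lambda>x. Q (Complex x T)) = (\<Sum>i\<in>I. integral {-1/2..1/2} (\<lambda>x. p i (Complex x T) * q2 i (Complex x T) - q i (Complex x T) * p2 i (Complex x T)))"
    unfolding Q_def
  proof (rule integral_sum[OF fin])
    fix i assume i: "i \<in> I"
    have "continuous_on upper_half (\<lambda>z. p i z * q2 i z - q i z * p2 i z)"
      by (intro continuous_on_diff continuous_on_mult spD sqD i)
    then have "continuous_on {-1/2..1/2} (\<lambda>x. p i (Complex x T) * q2 i (Complex x T) - q i (Complex x T) * p2 i (Complex x T))"
      by (rule continuous_on_upper_compose) (use T in \<open>auto intro!: continuous_intros\<close>)
    then show "(\<lambda>x. p i (Complex x T) * q2 i (Complex x T) - q i (Complex x T) * p2 i (Complex x T)) integrable_on {-1/2..1/2}"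
      by (rule integrable_continuous_interval)
  qed
  finally show ?thesis by simp
qed

lemma integral_split_unit:
  fixes k :: "real \<Rightarrow> complex"
  assumes "continuous_on {-1/2..real a - 1/2} k"
  shows "integral {-1/2..real a - 1/2} k = (\<Sum>j<a. integral {-1/2..1/2} (\<lambda>x. k (x + real j)))"
  using assms
proof (induction a)
  case (Suc a)
  have c: "continuous_on {-1/2..real a - 1/2} k" "continuous_on {real a - 1/2..real (Suc a) - 1/2} k"
    by (rule continuous_on_subset[OF Suc.prems]; auto)+
  have "integral {-1/2..real a - 1/2} k + integral {real a - 1/2..real (Suc a) - 1/2} k = integral {-1/2..real (Suc a) - 1/2} k"
    by (rule Henstock_Kurzweil_Integration.integral_combine)
      (use Suc.prems in \<open>auto intro!: integrable_continuous_interval\<close>)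
  moreover have "integral {-1/2..1/2} (k \<circ> (\<lambda>x. x + real a)) = integral {-1/2 + real a..1/2 + real a} k"
    by (rule integral_shift) (use c(2) in \<open>simp add: algebra_simps\<close>)
  moreover have "{-1/2 + real a..1/2 + real a} = {real a - 1/2..real (Suc a) - 1/2}" by auto
  ultimately show ?case using Suc.IH[OF c(1)] by (simp add: o_def)
qed simp

text \<open>The eigenvalue equation is put in Euclidean form, with the partial derivatives of p as
  parameters.\<close>

locale cusp_eigen = cusp +
  fixes p1 p2 p11 p22 :: "complex \<Rightarrow> complex"
  assumes sp: "second_partials p p1 p2 p11 p22"
    and eigen: "\<And>z. Im z > 0 \<Longrightarrow> p11 z + p22 z = - (s' * (1 - s')) * p z / (complex_of_real (Im z))\<^sup>2"
begin

abbreviation lam :: complex where "lam \<equiv> s' * (1 - s')"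

definition ct' :: "real \<Rightarrow> complex" where
  "ct' y = A * (s' * complex_of_real y powr (s' - 1)) + B * ((1 - s') * complex_of_real y powr (1 - s' - 1))"

text \<open>The value at y = 1 of ct - y ct', the flux of the constant term against the leading
  function y.\<close>

definition d0 :: complex where "d0 = A * (1 - s') + B * s'"

lemma theta_partials:
  assumes "Im \<tau> > 0"
  shows "second_partials (\<lambda>z. \<kappa> * Th om P0 \<tau> z) (\<lambda>z. \<kappa> * Th om Px \<tau> z) (\<lambda>z. \<kappa> * Th om Py \<tau> z) (\<lambda>z. \<kappa> * Th om Pxx \<tau> z) (\<lambda>z. \<kappa> * Th om Pyy \<tau> z)"
proof -
  have "continuous_on upper_half (\<lambda>z. \<kappa> * Th om q \<tau> z)" for q
    by (intro continuous_on_mult continuous_on_const Th_continuous(2)[OF norm_om assms])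
  moreover note Th_has_dir(7-10)[of om \<tau>, OF norm_om assms, THEN has_dir_cmult]
  ultimately show ?thesis unfolding second_partials_def by blast
qed

lemma strip_continuous:
  assumes "continuous_on upper_half u" "y > 0"
  shows "continuous_on {c..d} (\<lambda>x. u (Complex x y))"
  by (rule continuous_on_upper_compose[OF assms(1)]) (use assms(2) in \<open>auto intro!: continuous_intros\<close>)

text \<open>The constant term may be differentiated under the integral, so the average of the normal
  derivative of p is known exactly from the assumed shape of the constant term.\<close>

lemma strip_normal_derivative:
  assumes "y > 0"
  shows "integral {-1/2..real a - 1/2} (\<lambda>x. p2 (Complex x y)) = of_nat a * ct' y"
proof -
  have d1: "((\<lambda>y. integral {-1/2..real a - 1/2} (\<lambda>x. p (Complex x y))) has_vector_derivative integral {-1/2..real a - 1/2} (\<lambda>x. p2 (Complex x y))) (at y)"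
    by (rule has_vector_derivative_strip_integral[OF second_partialsD(1,3)[OF sp] second_partialsD(7)[OF sp] assms])
  have "((\<lambda>y. of_nat a * (A * complex_of_real y powr s' + B * complex_of_real y powr (1 - s'))) has_vector_derivative of_nat a * ct' y) (at y)"
    unfolding ct'_def
    by (intro has_vector_derivative_mult_right has_vector_derivative_add powr_has_vector_derivative assms)
  then have "((\<lambda>y. integral {-1/2..real a - 1/2} (\<lambda>x. p (Complex x y))) has_vector_derivative of_nat a * ct' y) (at y)"
    by (rule has_vector_derivative_transform_within_open[where S="{0<..}"]) (use assms const in auto)
  then show ?thesis using vector_derivative_unique_at[OF d1] by blast
qed

text \<open>The function ct - y ct' has derivative \<lambda> ct / y. Integration from 1 to T writes
  the boundary term at height T as d0 plus \<lambda> times the very integral that the truncated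
  leading part produces.\<close>

lemma ct_identity:
  assumes "T \<ge> 1"
  shows "ct T - complex_of_real T * ct' T = d0 + lam * integral {1..T} (\<lambda>y. ct y / complex_of_real y)"
proof -
  define h where "h y = A * (1 - s') * complex_of_real y powr s' + B * s' * complex_of_real y powr (1 - s')" for y
  have pw: "complex_of_real y * complex_of_real y powr (w - 1) = complex_of_real y powr w" if "y > 0" for y w
    using that by (simp add: powr_diff)
  have hy: "ct y - complex_of_real y * ct' y = h y" if "y > 0" for y
  proof -
    have "complex_of_real y * ct' y = A * s' * (complex_of_real y * complex_of_real y powr (s' - 1)) + B * (1 - s') * (complex_of_real y * complex_of_real y powr (1 - s' - 1))"
      by (simp add: ct'_def algebra_simps)
    also have "\<dots> = A * s' * complex_of_real y powr s' + B * (1 - s') * complex_of_real y powr (1 - s')"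
      unfolding pw[OF that] ..
    finally show ?thesis by (simp add: h_def ct_def algebra_simps)
  qed
  have "((\<lambda>y. lam * (ct y / complex_of_real y)) has_integral (h T - h 1)) {1..T}"
  proof (rule fundamental_theorem_of_calculus[OF assms])
    fix y assume "y \<in> {1..T}"
    then have y: "y > 0" by auto
    have "(h has_vector_derivative A * (1 - s') * (s' * complex_of_real y powr (s' - 1)) + B * s' * ((1 - s') * complex_of_real y powr (1 - s' - 1))) (at y within {1..T})"
      unfolding h_def
      by (intro has_vector_derivative_mult_right has_vector_derivative_add powr_has_vector_derivative y)
    moreover have "complex_of_real y powr (w - 1) = complex_of_real y powr w / complex_of_real y" for w
      using y by (simp add: powr_diff)
    then have "A * (1 - s') * (s' * complex_of_real y powr (s' - 1)) + B * s' * ((1 - s') * complex_of_real y powr (1 - s' - 1)) = lam * (ct y / complex_of_real y)"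
      using y by (simp only: ct_def) (simp add: field_simps)
    ultimately show "(h has_vector_derivative lam * (ct y / complex_of_real y)) (at y within {1..T})"
      by simp
  qed
  then have "h T - h 1 = integral {1..T} (\<lambda>y. lam * (ct y / complex_of_real y))" by (simp add: integral_unique)
  also have "\<dots> = lam * integral {1..T} (\<lambda>y. ct y / complex_of_real y)" by (rule integral_mult_right)
  finally have "h T = h 1 + lam * integral {1..T} (\<lambda>y. ct y / complex_of_real y)" by (metis add.commute diff_eq_eq)
  moreover have "h 1 = d0" by (simp add: h_def d0_def)
  ultimately show ?thesis using hy[of T] assms by (metis less_le_trans zero_less_one)
qed

lemma trunc_strip_p:
  assumes "T \<ge> 1"
  shows "(LINT z:fund_dom_trunc a T|lborel. p z / complex_of_real (Im z))
    = hs 0 + of_nat a * integral {1..T} (\<lambda>y. ct y / complex_of_real y)"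
proof -
  have "(LINT z:fund_dom_trunc a T|lborel. p z / complex_of_real (Im z)) = (LINT z:fund_dom_trunc a 1|lborel. p z / complex_of_real (Im z))
     + integral {1..T} (\<lambda>y. integral {-1/2..real a - 1/2} (\<lambda>x. p (Complex x y) / complex_of_real (Im (Complex x y))))"
    by (rule fund_dom_trunc_strip[OF y_inverse_continuous(2)[OF p] a assms])
  also have "(LINT z:fund_dom_trunc a 1|lborel. p z / complex_of_real (Im z)) = hs 0"
    unfolding hs_def
    by (rule set_lebesgue_integral_cong) (use trunc_borel in \<open>auto dest: fund_dom_trunc_upper\<close>)
  also have "integral {1..T} (\<lambda>y. integral {-1/2..real a - 1/2} (\<lambda>x. p (Complex x y) / complex_of_real (Im (Complex x y))))
     = integral {1..T} (\<lambda>y. of_nat a * (ct y / complex_of_real y))"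
  proof (rule Henstock_Kurzweil_Integration.integral_cong)
    fix y assume "y \<in> {1..T}"
    then have y: "y > 0" by auto
    have "integral {-1/2..real a - 1/2} (\<lambda>x. p (Complex x y) / complex_of_real (Im (Complex x y))) = integral {-1/2..real a - 1/2} (\<lambda>x. p (Complex x y)) / complex_of_real y"
      unfolding complex.sel by (rule integral_divide)
    then show "integral {-1/2..real a - 1/2} (\<lambda>x. p (Complex x y) / complex_of_real (Im (Complex x y))) = of_nat a * (ct y / complex_of_real y)"
      unfolding const[OF y, folded ct_def] by (simp only: times_divide_eq_right)
  qed
  also have "\<dots> = of_nat a * integral {1..T} (\<lambda>y. ct y / complex_of_real y)" by (rule integral_mult_right)
  finally show ?thesis .
qed

text \<open>Bulk integral minus upper boundary term in Green's identity for p and the theta kernel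
  at one cusp. It measures the flux through the lower arcs and the sides, which need not vanish for
  a single cusp.\<close>

definition defect :: "complex \<Rightarrow> real \<Rightarrow> complex" where
  "defect \<tau> T = (LINT z:fund_dom_trunc a T|lborel. p z * (\<kappa> * Th om Pxx \<tau> z + \<kappa> * Th om Pyy \<tau> z) - \<kappa> * Th om P0 \<tau> z * (p11 z + p22 z))
     - integral {-1/2..real a - 1/2} (\<lambda>x. p (Complex x T) * (\<kappa> * Th om Py \<tau> (Complex x T)) - \<kappa> * Th om P0 \<tau> (Complex x T) * p2 (Complex x T))"

lemma defect_sum:
  assumes "Im \<tau> > 0" "T \<ge> 1"
  shows "defect \<tau> T = (\<Sum>j<a. (LINT z:FT T|lborel. p (z + of_nat j) * (\<kappa> * Th om Pxx \<tau> (z + of_nat j) + \<kappa> * Th om Pyy \<tau> (z + of_nat j))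
        - \<kappa> * Th om P0 \<tau> (z + of_nat j) * (p11 (z + of_nat j) + p22 (z + of_nat j)))
     - integral {-1/2..1/2} (\<lambda>x. p (Complex x T + of_nat j) * (\<kappa> * Th om Py \<tau> (Complex x T + of_nat j)) - \<kappa> * Th om P0 \<tau> (Complex x T + of_nat j) * p2 (Complex x T + of_nat j)))"
proof -
  note t = second_partialsD[OF theta_partials[OF assms(1)]] and s = second_partialsD[OF sp]
  have c: "Complex x T + of_nat j = Complex (x + real j) T" for x j by (simp add: complex_eq_iff)
  have T: "T > 0" using assms(2) by simp
  have "continuous_on upper_half (\<lambda>z. p z * (\<kappa> * Th om Pxx \<tau> z + \<kappa> * Th om Pyy \<tau> z) - \<kappa> * Th om P0 \<tau> z * (p11 z + p22 z))"
    by (intro continuous_on_diff continuous_on_mult[of _ p] continuous_on_mult[of _ "\<lambda>z. \<kappa> * Th om P0 \<tau> z"] continuous_on_add t s)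
  note i1 = fund_dom_trunc_integral[OF this]
  have "continuous_on upper_half (\<lambda>z. p z * (\<kappa> * Th om Py \<tau> z) - \<kappa> * Th om P0 \<tau> z * p2 z)"
    by (intro continuous_on_diff continuous_on_mult[of _ p] continuous_on_mult[of _ "\<lambda>z. \<kappa> * Th om P0 \<tau> z"] t s)
  note i2 = integral_split_unit[OF strip_continuous[OF this T]]
  show ?thesis unfolding defect_def i1 i2 c sum_subtractf ..
qed

text \<open>The integrals of ct / y in the bulk and in the boundary term cancel, leaving d0. For the
  remainder, p R_y - p_y R is rewritten as 2 p R_y - (p R)_y: the first part decays, and p_y occurs
  only inside an exact derivative.\<close>

lemma defect_eq:
  assumes "Im \<tau> > 0" "T \<ge> 1"
  shows "defect \<tau> T = \<kappa> * ((LINT z:fund_dom_trunc a T|lborel. p z * (R Pxx \<tau> z + R Pyy \<tau> z))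
      + lam * (LINT z:fund_dom_trunc a T|lborel. p z * R P0 \<tau> z / (complex_of_real (Im z))\<^sup>2)
      + lam * theta0 \<tau> * hs 0 - theta0 \<tau> * of_nat a * d0
      - 2 * integral {-1/2..real a - 1/2} (\<lambda>x. p (Complex x T) * R Py \<tau> (Complex x T))
      + integral {-1/2..real a - 1/2} (\<lambda>x. p (Complex x T) * R Py \<tau> (Complex x T) + p2 (Complex x T) * R P0 \<tau> (Complex x T)))"
proof -
  have T: "T > 0" using assms(2) by simp
  note Rc = R_continuous[OF assms(1)]
  define w1 w2 w3 where "w1 z = p z * (R Pxx \<tau> z + R Pyy \<tau> z)" and "w2 z = p z * R P0 \<tau> z / (complex_of_real (Im z))\<^sup>2"
    and "w3 z = p z / complex_of_real (Im z)" for z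
  have c1: "continuous_on upper_half w1" unfolding w1_def by (intro continuous_on_mult p continuous_on_add Rc)
  have c2: "continuous_on upper_half w2" unfolding w2_def by (intro y_inverse_continuous continuous_on_mult p Rc)
  have c3: "continuous_on upper_half w3" unfolding w3_def by (intro y_inverse_continuous p)
  note i = c1[THEN fund_dom_trunc_integrable, of a T] c2[THEN fund_dom_trunc_integrable, of a T] c3[THEN fund_dom_trunc_integrable, of a T]
  have split: "Th om Pxx \<tau> z = R Pxx \<tau> z" "Th om Pyy \<tau> z = R Pyy \<tau> z" "Th om Py \<tau> z = theta0 \<tau> + R Py \<tau> z"
      "Th om P0 \<tau> z = of_real (Im z) * theta0 \<tau> + R P0 \<tau> z" if "Im z > 0" for z
    using Th_split[OF assms(1) that] lead_derivs[OF assms(1) that] by (simp_all add: Th_lead)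
  have "(LINT z:fund_dom_trunc a T|lborel. p z * (\<kappa> * Th om Pxx \<tau> z + \<kappa> * Th om Pyy \<tau> z) - \<kappa> * Th om P0 \<tau> z * (p11 z + p22 z))
      = (LINT z:fund_dom_trunc a T|lborel. \<kappa> * w1 z + (\<kappa> * lam * w2 z + \<kappa> * lam * theta0 \<tau> * w3 z))"
  proof (rule set_lebesgue_integral_cong)
    show "\<forall>z. z \<in> fund_dom_trunc a T \<longrightarrow> p z * (\<kappa> * Th om Pxx \<tau> z + \<kappa> * Th om Pyy \<tau> z) - \<kappa> * Th om P0 \<tau> z * (p11 z + p22 z) = \<kappa> * w1 z + (\<kappa> * lam * w2 z + \<kappa> * lam * theta0 \<tau> * w3 z)"
    proof (intro allI impI)
      fix z assume "z \<in> fund_dom_trunc a T"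
      then have z: "Im z > 0" by (rule fund_dom_trunc_upper)
      define y where "y = complex_of_real (Im z)"
      have "y \<noteq> 0" using z by (simp add: y_def)
      then show "p z * (\<kappa> * Th om Pxx \<tau> z + \<kappa> * Th om Pyy \<tau> z) - \<kappa> * Th om P0 \<tau> z * (p11 z + p22 z) = \<kappa> * w1 z + (\<kappa> * lam * w2 z + \<kappa> * lam * theta0 \<tau> * w3 z)"
        unfolding split[OF z] eigen[OF z] w1_def w2_def w3_def y_def[symmetric]
        by (simp add: field_simps power2_eq_square)
    qed
  qed (use trunc_borel in simp)
  also have "\<dots> = \<kappa> * (LINT z:fund_dom_trunc a T|lborel. w1 z) + (\<kappa> * lam * (LINT z:fund_dom_trunc a T|lborel. w2 z) + \<kappa> * lam * theta0 \<tau> * (LINT z:fund_dom_trunc a T|lborel. w3 z))"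
    by (subst set_integral_add(2); (subst set_integral_add(2))?) (use i in \<open>auto intro!: set_integrable_mult_right set_integral_add(1)\<close>)
  also have "(LINT z:fund_dom_trunc a T|lborel. w3 z) = hs 0 + of_nat a * integral {1..T} (\<lambda>y. ct y / complex_of_real y)"
    unfolding w3_def by (rule trunc_strip_p[OF assms(2)])
  finally have 1: "(LINT z:fund_dom_trunc a T|lborel. p z * (\<kappa> * Th om Pxx \<tau> z + \<kappa> * Th om Pyy \<tau> z) - \<kappa> * Th om P0 \<tau> z * (p11 z + p22 z))
     = \<kappa> * (LINT z:fund_dom_trunc a T|lborel. w1 z) + (\<kappa> * lam * (LINT z:fund_dom_trunc a T|lborel. w2 z) + \<kappa> * lam * theta0 \<tau> * (hs 0 + of_nat a * integral {1..T} (\<lambda>y. ct y / complex_of_real y)))" .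
  define I where "I u = integral {-1/2..real a - 1/2} (\<lambda>x. u (Complex x T))" for u :: "complex \<Rightarrow> complex"
  have Iadd: "I (\<lambda>z. u z + v z) = I u + I v" if "continuous_on upper_half u" "continuous_on upper_half v" for u v
    unfolding I_def by (intro Henstock_Kurzweil_Integration.integral_add integrable_continuous_interval strip_continuous that T)
  have Imul: "I (\<lambda>z. k * u z) = k * I u" for k u unfolding I_def by (rule integral_mult_right)
  note c = p second_partialsD(3)[OF sp] Rc[of Py] Rc[of P0]
  have cc: "continuous_on upper_half (\<lambda>z. p z * R Py \<tau> z)" "continuous_on upper_half (\<lambda>z. p2 z * R P0 \<tau> z)"
    by (intro continuous_on_mult c)+
  have "I (\<lambda>z. p z * (\<kappa> * Th om Py \<tau> z) - \<kappa> * Th om P0 \<tau> z * p2 z)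
     = I (\<lambda>z. (\<kappa> * theta0 \<tau>) * p z + ((- \<kappa> * theta0 \<tau> * of_real T) * p2 z + (\<kappa> * (p z * R Py \<tau> z) + (- \<kappa>) * (p2 z * R P0 \<tau> z))))"
    unfolding I_def using T by (intro Henstock_Kurzweil_Integration.integral_cong) (simp add: split algebra_simps)
  also have "\<dots> = (\<kappa> * theta0 \<tau>) * I p + ((- \<kappa> * theta0 \<tau> * of_real T) * I p2 + (\<kappa> * I (\<lambda>z. p z * R Py \<tau> z) + (- \<kappa>) * I (\<lambda>z. p2 z * R P0 \<tau> z)))"
    by (subst Iadd Imul; (intro continuous_on_add continuous_on_mult continuous_on_const c)?)+ rule
  also have "I p = of_nat a * ct T" unfolding I_def ct_def by (rule const[OF T])
  also have "I p2 = of_nat a * ct' T" unfolding I_def by (rule strip_normal_derivative[OF T])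
  finally have 2: "I (\<lambda>z. p z * (\<kappa> * Th om Py \<tau> z) - \<kappa> * Th om P0 \<tau> z * p2 z)
    = \<kappa> * theta0 \<tau> * of_nat a * (ct T - of_real T * ct' T) + \<kappa> * I (\<lambda>z. p z * R Py \<tau> z) - \<kappa> * I (\<lambda>z. p2 z * R P0 \<tau> z)"
    by (simp add: algebra_simps)
  have 3: "I (\<lambda>z. p z * R Py \<tau> z + p2 z * R P0 \<tau> z) = I (\<lambda>z. p z * R Py \<tau> z) + I (\<lambda>z. p2 z * R P0 \<tau> z)"
    by (rule Iadd[OF cc])
  have "defect \<tau> T = \<kappa> * ((LINT z:fund_dom_trunc a T|lborel. w1 z) + lam * (LINT z:fund_dom_trunc a T|lborel. w2 z)
      + lam * theta0 \<tau> * hs 0 - theta0 \<tau> * of_nat a * d0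
      - 2 * I (\<lambda>z. p z * R Py \<tau> z) + I (\<lambda>z. p z * R Py \<tau> z + p2 z * R P0 \<tau> z))"
    unfolding 3 defect_def 1 2[unfolded I_def] ct_identity[OF assms(2)] by (simp add: I_def algebra_simps)
  then show ?thesis unfolding w1_def w2_def I_def .
qed

lemma strip_decay:
  assumes "Im \<tau> > 0"
  shows "((\<lambda>T. integral {-1/2..real a - 1/2} (\<lambda>x. p (Complex x T) * R q \<tau> (Complex x T))) \<longlongrightarrow> 0) at_top"
proof -
  obtain \<epsilon> K where K: "\<epsilon> > 0" "\<And>\<tau>' z q. dist \<tau> \<tau>' < \<epsilon> \<Longrightarrow> Im z \<ge> 1/2 \<Longrightarrow> -1/2 \<le> Re z \<Longrightarrow> Re z \<le> real a - 1/2 \<Longrightarrow>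
       norm (p z * R q \<tau>' z) * exp (0 * Im z) \<le> K * exp (- Im z)" using key_bound[OF assms] by blast
  have "((\<lambda>T::real. exp (- T)) \<longlongrightarrow> 0) at_top"
    by (rule filterlim_compose[OF exp_at_bot filterlim_uminus_at_bot_at_top])
  then have lim: "((\<lambda>T. K * exp (- T) * (real a - 1/2 - -1/2)) \<longlongrightarrow> 0) at_top"
    by (intro tendsto_mult_left_zero tendsto_mult_right_zero)
  show ?thesis
  proof (rule Lim_null_comparison[OF _ lim])
    show "\<forall>\<^sub>F T in at_top. norm (integral {-1/2..real a - 1/2} (\<lambda>x. p (Complex x T) * R q \<tau> (Complex x T))) \<le> K * exp (- T) * (real a - 1/2 - -1/2)"
      using eventually_ge_at_top[of 1]
    proof eventually_elim
      case (elim T)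
      have le: "-1/2 \<le> real a - 1/2" by simp
      have "continuous_on upper_half (\<lambda>z. p z * R q \<tau> z)" by (intro continuous_on_mult p R_continuous assms)
      then have c: "continuous_on {-1/2..real a - 1/2} (\<lambda>x. p (Complex x T) * R q \<tau> (Complex x T))"
        by (rule strip_continuous) (use elim in simp)
      show ?case
      proof (rule integral_bound[OF le c])
        fix x assume "x \<in> {-1/2..real a - 1/2}"
        then show "norm (p (Complex x T) * R q \<tau> (Complex x T)) \<le> K * exp (- T)"
          using K(2)[of \<tau> "Complex x T" q] K(1) elim by simp
      qed
    qed
  qed
qed

text \<open>The limit of the defect after the exact derivative has been removed. That the sum of
  these limits over the cusps is zero is the content of the eigenvalue equation.\<close>

definition Lam :: "complex \<Rightarrow> complex" where
  "Lam \<tau> = \<kappa> * (LapInt \<tau> + lam * J P0 \<tau> + lam * theta0 \<tau> * hs 0 - theta0 \<tau> * of_nat a * d0)"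

text \<open>G is \<kappa> times the integral over x of p R at height T, which decays; its derivative
  absorbs everything in the defect whose limit is not known directly.\<close>

lemma defect_limit:
  assumes "Im \<tau> > 0"
  shows "\<exists>G G'. (\<forall>y>1. (G has_vector_derivative G' y) (at y)) \<and> (G \<longlongrightarrow> 0) at_top \<and> ((\<lambda>T. defect \<tau> T - G' T) \<longlongrightarrow> Lam \<tau>) at_top"
proof -
  define g where "g T = integral {-1/2..real a - 1/2} (\<lambda>x. p (Complex x T) * R P0 \<tau> (Complex x T))" for T
  define g' where "g' T = integral {-1/2..real a - 1/2} (\<lambda>x. p (Complex x T) * R Py \<tau> (Complex x T) + p2 (Complex x T) * R P0 \<tau> (Complex x T))" for T
  note Rc = R_continuous[OF assms]
  have d: "(g has_vector_derivative g' T) (at T)" if "T > 1" for T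
    unfolding g_def g'_def
  proof (rule has_vector_derivative_strip_integral)
    show "continuous_on upper_half (\<lambda>z. p z * R P0 \<tau> z)" "continuous_on upper_half (\<lambda>z. p z * R Py \<tau> z + p2 z * R P0 \<tau> z)"
      by (intro continuous_on_add continuous_on_mult p Rc second_partialsD(3)[OF sp])+
    show "has_dir \<i> (\<lambda>z. p z * R P0 \<tau> z) (p z * R Py \<tau> z + p2 z * R P0 \<tau> z) z" if "Im z > 0" for z
      by (rule has_dir_mult[OF second_partialsD(7)[OF sp that] Th_has_dir(8)[OF norm_om_rem assms that]])
  qed (use that in simp)
  have i: "set_integrable lborel (bigF a) (\<lambda>z. p z * R q \<tau> z)" "set_integrable lborel (bigF a) (\<lambda>z. p z * R q \<tau> z / (complex_of_real (Im z))\<^sup>2)" for q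
    by (rule fast_decay_integrable[OF bigF_borel order_refl _ rem_fast_decay(1)[OF assms]], intro continuous_on_mult p Rc)
      (rule fast_decay_integrable[OF bigF_borel order_refl _ rem_fast_decay(2)[OF assms]], intro y_inverse_continuous continuous_on_mult p Rc)
  have "((\<lambda>T. LINT z:fund_dom_trunc a T|lborel. p z * (R Pxx \<tau> z + R Pyy \<tau> z)) \<longlongrightarrow> LapInt \<tau>) at_top"
    unfolding LapInt_def by (rule bigF_exhaustion) (use set_integral_add(1)[OF i(1)[of Pxx] i(1)[of Pyy]] in \<open>simp add: distrib_left\<close>)
  moreover have "((\<lambda>T. LINT z:fund_dom_trunc a T|lborel. p z * R P0 \<tau> z / (complex_of_real (Im z))\<^sup>2) \<longlongrightarrow> J P0 \<tau>) at_top"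
    unfolding J_def by (rule bigF_exhaustion[OF i(2)])
  ultimately have "((\<lambda>T. \<kappa> * ((LINT z:fund_dom_trunc a T|lborel. p z * (R Pxx \<tau> z + R Pyy \<tau> z))
      + lam * (LINT z:fund_dom_trunc a T|lborel. p z * R P0 \<tau> z / (complex_of_real (Im z))\<^sup>2)
      + lam * theta0 \<tau> * hs 0 - theta0 \<tau> * of_nat a * d0
      - 2 * integral {-1/2..real a - 1/2} (\<lambda>x. p (Complex x T) * R Py \<tau> (Complex x T))))
    \<longlongrightarrow> \<kappa> * (LapInt \<tau> + lam * J P0 \<tau> + lam * theta0 \<tau> * hs 0 - theta0 \<tau> * of_nat a * d0 - 2 * 0)) at_top"
    by (intro tendsto_mult tendsto_add tendsto_diff tendsto_const strip_decay[OF assms])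
  moreover have "\<kappa> * (LapInt \<tau> + lam * J P0 \<tau> + lam * theta0 \<tau> * hs 0 - theta0 \<tau> * of_nat a * d0 - 2 * 0) = Lam \<tau>"
    by (simp add: Lam_def)
  ultimately have "((\<lambda>T. \<kappa> * ((LINT z:fund_dom_trunc a T|lborel. p z * (R Pxx \<tau> z + R Pyy \<tau> z))
      + lam * (LINT z:fund_dom_trunc a T|lborel. p z * R P0 \<tau> z / (complex_of_real (Im z))\<^sup>2)
      + lam * theta0 \<tau> * hs 0 - theta0 \<tau> * of_nat a * d0
      - 2 * integral {-1/2..real a - 1/2} (\<lambda>x. p (Complex x T) * R Py \<tau> (Complex x T)))) \<longlongrightarrow> Lam \<tau>) at_top"
    by (simp only:)
  then have "((\<lambda>T. defect \<tau> T - \<kappa> * g' T) \<longlongrightarrow> Lam \<tau>) at_top"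
  proof (rule Lim_transform_eventually)
    show "\<forall>\<^sub>F T in at_top. \<kappa> * ((LINT z:fund_dom_trunc a T|lborel. p z * (R Pxx \<tau> z + R Pyy \<tau> z))
      + lam * (LINT z:fund_dom_trunc a T|lborel. p z * R P0 \<tau> z / (complex_of_real (Im z))\<^sup>2)
      + lam * theta0 \<tau> * hs 0 - theta0 \<tau> * of_nat a * d0
      - 2 * integral {-1/2..real a - 1/2} (\<lambda>x. p (Complex x T) * R Py \<tau> (Complex x T))) = defect \<tau> T - \<kappa> * g' T"
      using eventually_ge_at_top[of 1] by eventually_elim (simp add: defect_eq[OF assms] g'_def algebra_simps)
  qed
  moreover have "((\<lambda>T. \<kappa> * g T) \<longlongrightarrow> 0) at_top"
    unfolding g_def by (rule tendsto_mult_right_zero[OF strip_decay[OF assms]])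
  moreover have "\<forall>T>1. ((\<lambda>T. \<kappa> * g T) has_vector_derivative \<kappa> * g' T) (at T)"
    using d by (auto intro!: has_vector_derivative_mult_right)
  ultimately show ?thesis by (intro exI[of _ "\<lambda>T. \<kappa> * g T"] exI[of _ "\<lambda>T. \<kappa> * g' T"] conjI)
qed

text \<open>For s' different from 0 and 1 one has \<lambda> c0 = - d0, so the boundary constant is
  what completes \<lambda> \<open>Ir P0\<close>. For s' = 0 or 1 the eigenvalue vanishes and only
  d0, equal to A or B, is left.\<close>

lemma Ir_laplace:
  assumes "Im \<tau> > 0"
  shows "4 * (- (complex_of_real (Im \<tau>))\<^sup>2 * (Ir Puu \<tau> + Ir Pvv \<tau>) + \<i> / 2 * complex_of_real (Im \<tau>) * (Ir Pu \<tau> + \<i> * Ir Pv \<tau>))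
    = - Lam \<tau> + (if s' = 0 then - (\<kappa> * theta0 \<tau> * of_nat a * A) else if s' = 1 then - (\<kappa> * theta0 \<tau> * of_nat a * B) else lam * Ir P0 \<tau>)"
proof -
  have *: "- \<kappa> * LapInt \<tau> = - Lam \<tau> + \<kappa> * (lam * J P0 \<tau> + lam * theta0 \<tau> * hs 0 - theta0 \<tau> * of_nat a * d0)"
    by (simp add: Lam_def algebra_simps)
  have "\<kappa> * (lam * J P0 \<tau> + lam * theta0 \<tau> * hs 0 - theta0 \<tau> * of_nat a * d0) = lam * Ir P0 \<tau>" if "s' \<noteq> 0" "s' \<noteq> 1"
  proof -
    have "lam * c0 = - d0"
    proof -
      have "lam * c0 = - A * (1 - s') * (s' / s') - B * s' * ((s' - 1) / (s' - 1))"
        using that by (simp add: c0_def field_simps)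
      also have "\<dots> = - d0" using that by (simp add: d0_def)
      finally show ?thesis .
    qed
    moreover have "lam * Ir P0 \<tau> = \<kappa> * (lam * J P0 \<tau> + lam * theta0 \<tau> * hs 0 + theta0 \<tau> * of_nat a * (lam * c0))"
      by (simp add: Ir_def Th_lead algebra_simps)
    ultimately show ?thesis by simp
  qed
  then show ?thesis unfolding Ir_heat[OF assms] * by (auto simp: d0_def)
qed

end

section \<open>The Maass form at the cosets of the modular group\<close>

lemma has_dir_holomorphic:
  assumes "(w has_field_derivative w') (at z)"
  shows "has_dir e w (w' * e) z"
proof -
  have "((\<lambda>t. z + e * complex_of_real t) has_vector_derivative e) (at 0)"
    by (auto intro!: derivative_eq_intros has_vector_derivative_real_field)
  from field_vector_diff_chain_at[OF this, of w w'] show ?thesis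
    using assms by (simp add: has_dir_def o_def mult.commute)
qed

lemma has_dir_Re_Im:
  assumes "has_dir e w w' z"
  shows "has_dir e (\<lambda>z. complex_of_real (Re (w z))) (of_real (Re w')) z" "has_dir e (\<lambda>z. complex_of_real (Im (w z))) (of_real (Im w')) z"
proof -
  have "bounded_linear (\<lambda>z. complex_of_real (Re z))" "bounded_linear (\<lambda>z. complex_of_real (Im z))"
    by (rule bounded_linear_compose[OF bounded_linear_of_real bounded_linear_Re] bounded_linear_compose[OF bounded_linear_of_real bounded_linear_Im])+
  then show "has_dir e (\<lambda>z. complex_of_real (Re (w z))) (of_real (Re w')) z" "has_dir e (\<lambda>z. complex_of_real (Im (w z))) (of_real (Im w')) z"
    using assms bounded_linear.has_vector_derivative unfolding has_dir_def by blast+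
qed

lemma moebius_has_field_derivative:
  assumes "det g = 1" "Im z > 0"
  shows "(moebius_act g has_field_derivative 1 / (aut g z)\<^sup>2) (at z)"
proof -
  define a b c d where "a = complex_of_real (g $ 1 $ 1)" and "b = complex_of_real (g $ 1 $ 2)"
    and "c = complex_of_real (g $ 2 $ 1)" and "d = complex_of_real (g $ 2 $ 2)"
  have n: "c * z + d \<noteq> 0" using aut_nonzero[OF assms] by (simp add: aut_def c_def d_def)
  have "a * d - b * c = complex_of_real (det g)" by (simp add: det_2 a_def b_def c_def d_def)
  then have det: "a * d - b * c = 1" using assms(1) by simp
  have "((\<lambda>z. (a * z + b) / (c * z + d)) has_field_derivative (a * (c * z + d) - (a * z + b) * c) / ((c * z + d) * (c * z + d))) (at z)"
    using n by (auto intro!: derivative_eq_intros)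
  also have "a * (c * z + d) - (a * z + b) * c = 1" using det by (simp add: algebra_simps)
  finally show ?thesis
    by (simp add: moebius_act_def[abs_def] aut_def a_def b_def c_def d_def power2_eq_square)
qed

text \<open>Conformal covariance of the Laplacian with factor |\<gamma>'|^2, derived from explicit
  second derivatives so that their continuity comes along.\<close>

lemma moebius_second_partials:
  assumes f: "C_k_on 2 f upper_half" and det: "det g = 1"
  obtains p1 p2 p11 p22 where "second_partials (\<lambda>z. f (moebius_act g z)) p1 p2 p11 p22"
    "\<And>z. Im z > 0 \<Longrightarrow> p11 z + p22 z = of_real ((cmod (1 / (aut g z)\<^sup>2))\<^sup>2)
       * (d_re (d_re f) (moebius_act g z) + d_im (d_im f) (moebius_act g z))"
proof -
  have f2: "C_k_on (Suc (Suc 0)) f upper_half" using f by (simp add: numeral_2_eq_2)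
  then have f1: "C_k_on (Suc 0) (d_re f) upper_half" "C_k_on (Suc 0) (d_im f) upper_half" by auto
  define \<gamma> w w' where "\<gamma> = moebius_act g" and "w z = 1 / (aut g z)\<^sup>2"
    and "w' z = - 2 * complex_of_real (g $ 2 $ 1) / (aut g z) ^ 3" for z
  have \<gamma>u: "Im (\<gamma> z) > 0" if "Im z > 0" for z unfolding \<gamma>_def by (rule moebius_act_upper[OF det that])
  have d\<gamma>: "(\<gamma> has_field_derivative w z) (at z)" if "Im z > 0" for z
    unfolding \<gamma>_def w_def by (rule moebius_has_field_derivative[OF det that])
  have nz: "aut g z \<noteq> 0" if "Im z > 0" for z by (rule aut_nonzero[OF det that])
  have dw: "(w has_field_derivative w' z) (at z)" if "Im z > 0" for z
  proof -
    have "(aut g has_field_derivative complex_of_real (g $ 2 $ 1)) (at z)"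
      unfolding aut_def[abs_def] by (auto intro!: derivative_eq_intros)
    then have "((\<lambda>z. 1 / (aut g z)\<^sup>2) has_field_derivative (0 * (aut g z)\<^sup>2 - 1 * (of_nat 2 * (aut g z) ^ (2 - 1) * complex_of_real (g $ 2 $ 1))) / ((aut g z)\<^sup>2 * (aut g z)\<^sup>2)) (at z)"
      using nz[OF that] by (auto intro!: derivative_eq_intros)
    also have "(0 * (aut g z)\<^sup>2 - 1 * (of_nat 2 * (aut g z) ^ (2 - 1) * complex_of_real (g $ 2 $ 1))) / ((aut g z)\<^sup>2 * (aut g z)\<^sup>2) = w' z"
      using nz[OF that] by (simp add: w'_def power2_eq_square power3_eq_cube)
    finally show ?thesis by (simp add: w_def[abs_def])
  qed
  have ac: "continuous_on upper_half (aut g)" unfolding aut_def[abs_def] by (intro continuous_intros)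
  have wc: "continuous_on upper_half w" "continuous_on upper_half w'"
    unfolding w_def[abs_def] w'_def[abs_def] by (intro continuous_intros ac; use nz in \<open>auto simp: upper_half_def\<close>)+
  have \<gamma>c: "continuous_on upper_half \<gamma>"
    by (rule continuous_at_imp_continuous_on) (use d\<gamma> DERIV_isCont in \<open>force simp: upper_half_def\<close>)
  have comp: "continuous_on upper_half (\<lambda>z. u (\<gamma> z))" if "continuous_on upper_half u" for u
    by (rule continuous_on_upper_compose[OF that \<gamma>c]) (use \<gamma>u in \<open>simp add: upper_half_def\<close>)
  have chain: "has_dir e (\<lambda>z. u (\<gamma> z)) (of_real (Re (w z * e)) * d_re u (\<gamma> z) + of_real (Im (w z * e)) * d_im u (\<gamma> z)) z"
    if "C_k_on (Suc 0) u upper_half" "Im z > 0" for u e z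
    by (rule has_dir_compose[OF open_upper _ C_k_on_has_dir[OF that(1)] _ _ d\<gamma>[OF that(2)]])
      (use \<gamma>u that in \<open>auto simp: upper_half_def\<close>)
  define f1 f2 f11 f12 f21 f22 where "f1 = d_re f" and "f2 = d_im f" and "f11 = d_re (d_re f)" and "f12 = d_im (d_re f)"
    and "f21 = d_re (d_im f)" and "f22 = d_im (d_im f)"
  have fc: "continuous_on upper_half f" "continuous_on upper_half f1" "continuous_on upper_half f2" "continuous_on upper_half f11"
      "continuous_on upper_half f12" "continuous_on upper_half f21" "continuous_on upper_half f22"
    using f2 by (auto simp: f1_def f2_def f11_def f12_def f21_def f22_def)
  have C1f: "C_k_on (Suc 0) f upper_half" using f2 by auto
  define RR II where "RR z = complex_of_real (Re (w z))" and "II z = complex_of_real (Im (w z))" for z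
  define p1 where "p1 z = RR z * f1 (\<gamma> z) + II z * f2 (\<gamma> z)" for z
  define p2 where "p2 z = - II z * f1 (\<gamma> z) + RR z * f2 (\<gamma> z)" for z
  \<comment> \<open>The terms with w', those with f12 and those with f21 occur in p11 and p22 with
    opposite signs, and each kind cancels on its own in the sum.\<close>
  define p11 where "p11 z = (RR z * (RR z * f11 (\<gamma> z) + II z * f12 (\<gamma> z)) + of_real (Re (w' z)) * f1 (\<gamma> z))
     + (II z * (RR z * f21 (\<gamma> z) + II z * f22 (\<gamma> z)) + of_real (Im (w' z)) * f2 (\<gamma> z))" for z
  define p22 where "p22 z = (- II z * (- II z * f11 (\<gamma> z) + RR z * f12 (\<gamma> z)) + - of_real (Re (w' z)) * f1 (\<gamma> z))
     + (RR z * (- II z * f21 (\<gamma> z) + RR z * f22 (\<gamma> z)) + - of_real (Im (w' z)) * f2 (\<gamma> z))" for z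
  have RIc: "continuous_on upper_half RR" "continuous_on upper_half II"
    unfolding RR_def[abs_def] II_def[abs_def] by (intro continuous_intros wc)+
  note cs = RIc fc[THEN comp]
  have RId: "has_dir e RR (of_real (Re (w' z * e))) z" "has_dir e II (of_real (Im (w' z * e))) z" if "Im z > 0" for e z
    unfolding RR_def[abs_def] II_def[abs_def] by (rule has_dir_Re_Im[OF has_dir_holomorphic[OF dw[OF that]]])+
  note ch = chain[OF C1f, folded f1_def f2_def] chain[OF f1(1), folded f1_def f11_def f12_def] chain[OF f1(2), folded f2_def f21_def f22_def]
  have neg: "has_dir e (\<lambda>z. - u z) (- u') z" if "has_dir e u u' z" for e u u' z
    using has_dir_cmult[OF that, of "- 1"] by simp
  show ?thesis
  proof (rule that[of p1 p2 p11 p22])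
    show "second_partials (\<lambda>z. f (moebius_act g z)) p1 p2 p11 p22"
      unfolding second_partials_def
    proof (intro conjI ballI allI impI)
      fix u assume "u \<in> {\<lambda>z. f (moebius_act g z), p1, p2, p11, p22}"
      moreover have "continuous_on upper_half (\<lambda>z. f (moebius_act g z))" using cs(3) by (simp add: \<gamma>_def)
      moreover have "continuous_on upper_half p1" "continuous_on upper_half p2" "continuous_on upper_half p11" "continuous_on upper_half p22"
        unfolding p1_def[abs_def] p2_def[abs_def] p11_def[abs_def] p22_def[abs_def]
        by (intro continuous_on_add continuous_on_mult continuous_on_minus continuous_on_of_real continuous_on_Re continuous_on_Im cs wc)+
      ultimately show "continuous_on upper_half u" by blast
    next
      fix z assume z: "Im z > 0"
      show "has_dir 1 (\<lambda>z. f (moebius_act g z)) (p1 z) z"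
        using ch(1)[OF z, of 1] by (simp add: p1_def RR_def II_def \<gamma>_def)
      show "has_dir \<i> (\<lambda>z. f (moebius_act g z)) (p2 z) z"
        using ch(1)[OF z, of \<i>] by (simp add: p2_def RR_def II_def \<gamma>_def)
      show "has_dir 1 p1 (p11 z) z"
        using has_dir_add[OF has_dir_mult[OF RId(1)[OF z] ch(2)[OF z]] has_dir_mult[OF RId(2)[OF z] ch(3)[OF z]], of 1]
        unfolding p1_def[abs_def] p11_def by (simp add: RR_def II_def)
      show "has_dir \<i> p2 (p22 z) z"
        using has_dir_add[OF has_dir_mult[OF neg[OF RId(2)[OF z]] ch(2)[OF z]] has_dir_mult[OF RId(1)[OF z] ch(3)[OF z]], of \<i>]
        unfolding p2_def[abs_def] p22_def by (simp add: RR_def II_def)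
    qed
    fix z assume z: "Im z > 0"
    have "complex_of_real ((cmod (w z))\<^sup>2) = (RR z)\<^sup>2 + (II z)\<^sup>2"
      unfolding cmod_power2 by (simp add: RR_def II_def)
    then show "p11 z + p22 z = of_real ((cmod (1 / (aut g z)\<^sup>2))\<^sup>2) * (d_re (d_re f) (moebius_act g z) + d_im (d_im f) (moebius_act g z))"
      unfolding w_def[symmetric] \<gamma>_def[symmetric] f11_def[symmetric] f22_def[symmetric] p11_def p22_def
      by (simp add: algebra_simps power2_eq_square)
  qed
qed

section \<open>Translations and the stabilizer of the cusp at infinity\<close>

lemma neg_matrix_mult:
  fixes g k :: "real^2^2"
  shows "(- g) ** k = - (g ** k)" "g ** (- k) = - (g ** k)"
  by (auto intro!: mat2_eqI simp: mult_nth)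

lemma adj_mult: "adj (g ** k) = adj k ** adj g"
  and adj_minus: "adj (- g) = - adj g"
  by (auto intro!: mat2_eqI simp: mult_nth)

text \<open>Translations by all integers, a group under multiplication, whereas
  \<open>trans_mat\<close> covers the natural numbers.\<close>

definition ti :: "int \<Rightarrow> real^2^2" where "ti m = mat2 1 (of_int m) 0 1"

lemma ti_add: "ti m ** ti n = ti (m + n)"
  and adj_ti: "adj (ti m) = ti (- m)"
  and ti_0: "ti 0 = mat 1"
  and trans_mat_ti: "trans_mat k = ti (int k)"
  by (auto intro!: mat2_eqI simp: ti_def trans_mat_def mult_nth mat_1_nth)

lemma ti_SL2Z: "ti m \<in> SL2Z"
  by (auto simp: SL2Z_def ti_def forall_2 det_2)

lemma act_rat_line:
  assumes "det g = 1"
  shows "act g ` rat_line X = rat_line (act g X)"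
  unfolding rat_line_def by (force simp: act_scaleR[OF assms])

lemma act_image_mult:
  assumes "det g = 1" "det k = 1"
  shows "act (g ** k) ` X = act g ` act k ` X"
  by (simp add: act_mult[OF assms] image_image)

lemma act_image_adj:
  assumes "det g = 1"
  shows "act (adj g) ` act g ` X = X" "act g ` act (adj g) ` X = X"
  by (simp_all add: act_adj[OF assms] image_image)

lemma act_u_zero:
  assumes "det g = 1"
  shows "act g u_zero = tz (- (g $ 1 $ 1 * g $ 2 $ 1)) ((g $ 1 $ 1)\<^sup>2) (- (g $ 2 $ 1)\<^sup>2)"
  by (auto intro!: mat2_eqI simp: act_eq[OF assms] u_zero_def mult_nth power2_eq_square)

lemma act_ti_line_zero: "act (ti m) ` line_zero = line_zero"
proof -
  have d: "det (ti m) = 1" by (rule SL2Z_det[OF ti_SL2Z])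
  have "act (ti m) u_zero = u_zero" unfolding act_u_zero[OF d] by (simp add: ti_def u_zero_tz)
  then show ?thesis by (simp add: line_zero_def act_rat_line[OF d])
qed

lemma act_line_zero_Iso:
  assumes "g \<in> SL2Z"
  shows "act g ` line_zero \<in> Iso N"
proof -
  note d = SL2Z_det[OF assms]
  have "g $ i $ j \<in> \<rat>" for i j using SL2Z_Ints[OF assms] Ints_subset_Rats by blast
  then have "act g u_zero \<in> V_space"
    unfolding act_u_zero[OF d] by (auto simp: V_space_def trace_2 forall_2)
  moreover have "act g u_zero \<noteq> 0"
  proof
    assume "act g u_zero = 0"
    then have "act (adj g) (act g u_zero) = act (adj g) 0" by simp
    then have "u_zero = 0 *\<^sub>R act (adj g) 0" using act_scaleR[of "adj g" 0 0] by (simp add: act_adj d det_adj)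
    then have "u_zero $ 1 $ 2 = 0" by simp
    then show False by (simp add: u_zero_def)
  qed
  moreover have "Q_form N (act g u_zero) = 0" unfolding Q_act[OF d] by (simp add: Q_form_def u_zero_def det_2)
  ultimately show ?thesis unfolding Iso_def line_zero_def act_rat_line[OF d] by blast
qed

text \<open>The image of \<open>u_zero\<close> has the negative square of the lower left entry as a
  coordinate, which must vanish; the diagonal entries are then integers with product 1.\<close>

lemma line_zero_stabilizer:
  assumes "u \<in> SL2Z" "act u ` line_zero = line_zero"
  obtains m where "u = ti m \<or> u = - ti m"
proof -
  note d = SL2Z_det[OF assms(1)]
  have "u_zero \<in> line_zero" unfolding line_zero_def rat_line_def by (auto intro!: exI[of _ 1])
  then have "act u u_zero \<in> line_zero" using assms(2) by blast
  then obtain q where "act u u_zero = q *\<^sub>R u_zero" unfolding line_zero_def rat_line_def by blast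
  then have "- (u $ 2 $ 1)\<^sup>2 = 0" unfolding act_u_zero[OF d] by (simp add: tz_scaleR u_zero_tz)
  then have c: "u $ 2 $ 1 = 0" by simp
  obtain a b e where i: "u $ 1 $ 1 = of_int a" "u $ 1 $ 2 = of_int b" "u $ 2 $ 2 = of_int e"
    using SL2Z_Ints[OF assms(1)] by (meson Ints_cases)
  have "real_of_int (a * e) = 1" using d c i by (simp add: det_2)
  then have "a * e = 1" by linarith
  then have "a = 1 \<and> e = 1 \<or> a = - 1 \<and> e = - 1" by (auto simp: zmult_eq_1_iff)
  then have "u = ti b \<or> u = - ti (- b)"
    using c i by (auto intro!: mat2_eqI simp: ti_def)
  then show ?thesis using that by blast
qed

text \<open>The hypotheses of the theorem with one component \<open>h\<close> fixed and the
  eigenvalue already written as s' (1 - s').\<close>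

locale lift =
  fixes N :: nat and L \<Gamma> :: "(real^2^2) set" and R :: "(real^2^2) set set" and \<sigma> :: "(real^2^2) set \<Rightarrow> real^2^2"
    and f :: "complex \<Rightarrow> complex" and s' :: complex and A B :: "(real^2^2) set \<Rightarrow> complex" and h :: "(real^2^2) set"
  assumes N1: "N \<ge> 1" and even: "even_lattice N L" and cong: "congruence_subgroup \<Gamma>" and compat: "compatible_group N L \<Gamma>"
    and cm: "cusp_matrices N \<sigma>" and cr: "cusp_reps N \<Gamma> R" and maass: "weak_Maass_form N \<Gamma> \<sigma> (s' * (1 - s')) f"
    and const: "\<And>l y. l \<in> Iso N \<Longrightarrow> y > 0 \<Longrightarrow> const_term \<Gamma> (\<sigma> l) f y = A l * complex_of_real y powr s' + B l * complex_of_real y powr (1 - s')"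
    and h: "h \<in> disc_group N L"
begin

text \<open>Membership in \<Gamma> up to sign, the convention behind \<open>cusp_width\<close>.
  Since - 1 acts trivially on the half plane and on matrices, invariance extends to these
  elements.\<close>

definition pm :: "real^2^2 \<Rightarrow> bool" where "pm g \<longleftrightarrow> g \<in> \<Gamma> \<or> - g \<in> \<Gamma>"

lemma \<Gamma>_SL2Z: "g \<in> \<Gamma> \<Longrightarrow> g \<in> SL2Z" and \<Gamma>_mult: "g \<in> \<Gamma> \<Longrightarrow> k \<in> \<Gamma> \<Longrightarrow> g ** k \<in> \<Gamma>"
  using cong by (auto simp: congruence_subgroup_def)

lemma \<Gamma>_adj: "g \<in> \<Gamma> \<Longrightarrow> adj g \<in> \<Gamma>"
  using cong \<Gamma>_SL2Z[of g] matrix_inv_eq_adj[OF SL2Z_det, of g] by (auto simp: congruence_subgroup_def)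

lemma \<Gamma>_1: "mat 1 \<in> \<Gamma>"
proof -
  have "mat 1 \<in> principal_congruence M" for M by (simp add: principal_congruence_def SL2Z_one)
  then show ?thesis using cong by (auto simp: congruence_subgroup_def)
qed

lemma pm_minus: "pm (- g) \<longleftrightarrow> pm g"
  by (auto simp: pm_def)

lemma pm_SL2Z: "pm g \<Longrightarrow> g \<in> SL2Z"
  unfolding pm_def using \<Gamma>_SL2Z[of g] \<Gamma>_SL2Z[of "- g"] SL2Z_minus[of "- g"] by auto

lemma pm_mult: "pm g \<Longrightarrow> pm k \<Longrightarrow> pm (g ** k)"
  unfolding pm_def using \<Gamma>_mult[of g k] \<Gamma>_mult[of "- g" k] \<Gamma>_mult[of g "- k"] \<Gamma>_mult[of "- g" "- k"]
  by (auto simp: neg_matrix_mult)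

lemma pm_adj: "pm g \<Longrightarrow> pm (adj g)"
  unfolding pm_def using \<Gamma>_adj[of g] \<Gamma>_adj[of "- g"] by (auto simp: adj_minus)

lemma act_coset:
  assumes "g \<in> \<Gamma>"
  shows "act g ` h \<subseteq> h"
proof -
  note d = SL2Z_det[OF \<Gamma>_SL2Z[OF assms]]
  have fl: "full_lattice L" using even by (simp add: even_lattice_def)
  obtain X where X: "X \<in> dual_lattice N L" "h = (+) X ` L" using h by (auto simp: disc_group_def)
  have 1: "act g X - X \<in> L" and 2: "act g ` L = L" using compat assms X(1) by (auto simp: compatible_group_def)
  show ?thesis
  proof
    fix Z assume "Z \<in> act g ` h"
    then obtain Y where Y: "Y \<in> L" "Z = act g (X + Y)" using X(2) by auto
    have "act g Y \<in> L" using 2 Y(1) by blast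
    then have "(act g X - X) + act g Y \<in> L" by (rule full_lattice_add[OF fl 1])
    moreover have "Z = X + ((act g X - X) + act g Y)" by (simp add: Y(2) act_add[OF d])
    ultimately show "Z \<in> h" unfolding X(2) by blast
  qed
qed

lemma pm_act_coset:
  assumes "pm g"
  shows "act g ` h = h"
proof -
  have *: "act g ` h = h" if "g \<in> \<Gamma>" for g
  proof
    show "h \<subseteq> act g ` h"
      using image_mono[OF act_coset[OF \<Gamma>_adj[OF that]], of "act g"] act_image_adj(2)[OF SL2Z_det[OF \<Gamma>_SL2Z[OF that]]] by simp
  qed (rule act_coset[OF that])
  show ?thesis
  proof (cases "g \<in> \<Gamma>")
    case False
    then have "- g \<in> \<Gamma>" using assms by (simp add: pm_def)
    then have "act (- g) ` h = h" by (rule *)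
    then show ?thesis using act_minus[OF SL2Z_det[OF pm_SL2Z[OF assms]]] by (simp cong: image_cong)
  qed (rule *)
qed

lemma pm_f:
  assumes "pm g" "Im z > 0"
  shows "f (moebius_act g z) = f z"
proof -
  have "\<forall>g\<in>\<Gamma>. \<forall>z\<in>upper_half. f (moebius_act g z) = f z" using maass by (simp add: weak_Maass_form_def)
  then show ?thesis using assms moebius_act_minus[of g z] unfolding pm_def upper_half_def by force
qed

text \<open>Values at g z depend only on the left coset of g modulo \<Gamma> and sign, so any group
  element may be replaced by its coset representative.\<close>

lemma pm_equiv:
  assumes "g \<in> SL2Z" "k \<in> SL2Z" "pm (g ** adj k)" "Im z > 0"
  shows "f (moebius_act g z) = f (moebius_act k z)" "Theta_L N h \<tau> (moebius_act g z) = Theta_L N h \<tau> (moebius_act k z)"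
proof -
  note d = SL2Z_det[OF assms(1)] SL2Z_det[OF assms(2)] SL2Z_det[OF pm_SL2Z[OF assms(3)]]
  have "g = g ** adj k ** k" by (simp add: matrix_mul_assoc[symmetric] adj_inverse[OF d(2)])
  then have e: "moebius_act g z = moebius_act (g ** adj k) (moebius_act k z)"
    using moebius_act_mult[OF d(3) d(2) assms(4)] by simp
  have u: "Im (moebius_act k z) > 0" by (rule moebius_act_upper[OF d(2) assms(4)])
  show "f (moebius_act g z) = f (moebius_act k z)" unfolding e by (rule pm_f[OF assms(3) u])
  show "Theta_L N h \<tau> (moebius_act g z) = Theta_L N h \<tau> (moebius_act k z)"
    unfolding e Theta_L_moebius[OF d(3) u] pm_act_coset[OF pm_adj[OF assms(3)]] ..
qed

abbreviation wd :: "(real^2^2) set \<Rightarrow> nat" where "wd l \<equiv> cusp_width \<Gamma> (\<sigma> l)"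

lemma R_Iso: "l \<in> R \<Longrightarrow> l \<in> Iso N"
  using cr by (auto simp: cusp_reps_def)

lemma \<sigma>_SL2Z: "l \<in> Iso N \<Longrightarrow> \<sigma> l \<in> SL2Z" and \<sigma>_line: "l \<in> Iso N \<Longrightarrow> act (\<sigma> l) ` line_zero = l"
  using cm by (auto simp: cusp_matrices_def)

lemma cusp_width_pm:
  assumes "s \<in> SL2Z"
  shows "cusp_width \<Gamma> s > 0" "pm (s ** ti (int (cusp_width \<Gamma> s)) ** adj s)"
    "n > 0 \<Longrightarrow> pm (s ** ti (int n) ** adj s) \<Longrightarrow> cusp_width \<Gamma> s \<le> n"
proof -
  have eq: "cusp_width \<Gamma> s = (LEAST n. n > 0 \<and> pm (s ** ti (int n) ** adj s))"
    by (simp add: cusp_width_def pm_def matrix_inv_eq_adj[OF SL2Z_det[OF assms]] trans_mat_ti)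
  obtain M where M: "M \<ge> 1" "principal_congruence M \<subseteq> \<Gamma>" using cong by (auto simp: congruence_subgroup_def)
  have "s ** trans_mat M ** adj s \<in> \<Gamma>" using principal_conjugate[OF assms, of M] M by auto
  then have "M > 0 \<and> pm (s ** ti (int M) ** adj s)" using M(1) by (simp add: pm_def trans_mat_ti)
  from LeastI[of "\<lambda>n. n > 0 \<and> pm (s ** ti (int n) ** adj s)", OF this]
  show "cusp_width \<Gamma> s > 0" "pm (s ** ti (int (cusp_width \<Gamma> s)) ** adj s)" unfolding eq by auto
  show "n > 0 \<Longrightarrow> pm (s ** ti (int n) ** adj s) \<Longrightarrow> cusp_width \<Gamma> s \<le> n" unfolding eq by (rule Least_le) simp
qed

lemma conj_ti_mult:
  assumes "det s = 1"
  shows "(s ** ti m ** adj s) ** (s ** ti n ** adj s) = s ** ti (m + n) ** adj s"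
proof -
  have "(s ** ti m ** adj s) ** (s ** ti n ** adj s) = s ** (ti m ** ((adj s ** s) ** ti n)) ** adj s"
    by (simp only: matrix_mul_assoc)
  then show ?thesis by (simp only: adj_inverse[OF assms] matrix_mul_lid ti_add)
qed

lemma adj_conj_ti: "adj (s ** ti m ** adj s) = s ** ti (- m) ** adj s"
  by (simp add: adj_mult adj_adj adj_ti matrix_mul_assoc)

lemma conj_ti_power:
  assumes "s \<in> SL2Z" "pm (s ** ti m ** adj s)"
  shows "pm (s ** ti (m * q) ** adj s)"
proof -
  note d = SL2Z_det[OF assms(1)]
  have nat: "pm (s ** ti (m * int n) ** adj s)" for n
  proof (induction n)
    case 0
    have "s ** ti (m * int 0) ** adj s = mat 1" by (simp add: ti_0 adj_inverse[OF d])
    then show ?case using \<Gamma>_1 by (simp add: pm_def)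
  next
    case (Suc n)
    show ?case using pm_mult[OF assms(2) Suc] by (simp add: conj_ti_mult[OF d] algebra_simps)
  qed
  show ?thesis
  proof (cases "q \<ge> 0")
    case True
    then show ?thesis using nat[of "nat q"] by simp
  next
    case False
    then show ?thesis using pm_adj[OF nat[of "nat (- q)"]] by (simp add: adj_conj_ti)
  qed
qed

text \<open>Together with \<open>gam\<close> this indexes representatives \<sigma>_\<l> T^j, with j
  below the cusp width, of SL2(Z) modulo \<Gamma> and sign. The domains of all cusps are thus the
  translates of one fundamental domain by these representatives.\<close>

definition I :: "((real^2^2) set \<times> nat) set" where "I = (SIGMA l:R. {..<wd l})"

definition gam :: "(real^2^2) set \<times> nat \<Rightarrow> real^2^2" where "gam i = \<sigma> (fst i) ** ti (int (snd i))"

lemma gam_SL2Z: "i \<in> I \<Longrightarrow> gam i \<in> SL2Z"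
  unfolding gam_def by (intro SL2Z_mult ti_SL2Z \<sigma>_SL2Z R_Iso) (auto simp: I_def)

lemma cusp_rep:
  assumes "l \<in> Iso N"
  shows "\<exists>r\<in>R. \<exists>k\<in>\<Gamma>. act k ` l = r"
proof -
  have "\<exists>!r. r \<in> R \<and> (\<exists>k\<in>\<Gamma>. act k ` l = r)" using cr assms by (simp add: cusp_reps_def)
  from ex1_implies_ex[OF this] show ?thesis by blast
qed

lemma cusp_rep_unique:
  assumes "l \<in> Iso N" "r \<in> R" "r' \<in> R" "\<exists>k\<in>\<Gamma>. act k ` l = r" "\<exists>k\<in>\<Gamma>. act k ` l = r'"
  shows "r = r'"
proof -
  have "\<exists>!r. r \<in> R \<and> (\<exists>k\<in>\<Gamma>. act k ` l = r)" using cr assms by (simp add: cusp_reps_def)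
  then have "\<forall>x y. (x \<in> R \<and> (\<exists>k\<in>\<Gamma>. act k ` l = x)) \<longrightarrow> (y \<in> R \<and> (\<exists>k\<in>\<Gamma>. act k ` l = y)) \<longrightarrow> y = x"
    unfolding ex1_iff_ex_Uniq Uniq_def by (rule conjunct2)
  then show ?thesis by (rule allE[of _ r'], elim allE[of _ r] impE) (intro conjI assms)+
qed

text \<open>\<Gamma> moves the line g.\<l>_0 to its representative r. After that g and \<sigma>_r
  differ by an element of the stabilizer of \<open>line_zero\<close>, a translation T^m up to sign,
  and m may be reduced modulo the width.\<close>

lemma coset_exists:
  assumes "g \<in> SL2Z"
  shows "\<exists>i\<in>I. pm (g ** adj (gam i))"
proof -
  have "act g ` line_zero \<in> Iso N" by (rule act_line_zero_Iso[OF assms])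
  from cusp_rep[OF this] obtain r k where r: "r \<in> R" and k: "k \<in> \<Gamma>" "act k ` act g ` line_zero = r" by metis
  define s where "s = \<sigma> r"
  have s: "s \<in> SL2Z" "act s ` line_zero = r" unfolding s_def using \<sigma>_SL2Z \<sigma>_line R_Iso[OF r(1)] by auto
  have kS: "k \<in> SL2Z" by (rule \<Gamma>_SL2Z[OF k(1)])
  note ds = SL2Z_det[OF s(1)] and dk = SL2Z_det[OF kS] and dg = SL2Z_det[OF assms]
  define u where "u = adj s ** (k ** g)"
  have "act u ` line_zero = act (adj s) ` act k ` act g ` line_zero"
    unfolding u_def using ds dk dg by (simp add: act_image_mult det_mul det_adj)
  also have "\<dots> = line_zero" unfolding k(2) s(2)[symmetric] act_image_adj(1)[OF ds] ..
  finally have u0: "act u ` line_zero = line_zero" .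
  have "u \<in> SL2Z" unfolding u_def by (intro SL2Z_mult SL2Z_adj s kS assms)
  then obtain m where m: "u = ti m \<or> u = - ti m" using line_zero_stabilizer[OF _ u0] by blast
  define a where "a = int (wd r)"
  have a: "a > 0" "pm (s ** ti a ** adj s)" unfolding a_def s_def using cusp_width_pm[OF s(1)] by (simp_all add: s_def)
  define j where "j = nat (m mod a)"
  have j: "int j = m mod a" "j < wd r" using a(1) by (simp_all add: j_def a_def nat_less_iff)
  have mj: "m - int j = a * (m div a)" using j(1) by (simp add: minus_mod_eq_mult_div)
  have kg: "k ** g = s ** u" unfolding u_def by (simp add: matrix_mul_assoc adj_inverse[OF ds])
  have "g ** adj (gam (r, j)) = adj k ** ((k ** g) ** ti (- int j) ** adj s)"
    by (simp add: gam_def adj_mult adj_ti s_def[symmetric] matrix_mul_assoc adj_inverse[OF dk])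
  also have "(k ** g) ** ti (- int j) ** adj s = s ** (u ** ti (- int j)) ** adj s" unfolding kg by (simp add: matrix_mul_assoc)
  finally have e: "g ** adj (gam (r, j)) = adj k ** (s ** (u ** ti (- int j)) ** adj s)" .
  have "u ** ti (- int j) = ti (a * (m div a)) \<or> u ** ti (- int j) = - ti (a * (m div a))"
    using m by (auto simp: neg_matrix_mult ti_add mj)
  then have "pm (s ** (u ** ti (- int j)) ** adj s)"
    using conj_ti_power[OF s(1) a(2), of "m div a"] by (auto simp: neg_matrix_mult pm_minus)
  moreover have "pm (adj k)" using \<Gamma>_adj[OF k(1)] by (simp add: pm_def)
  ultimately have "pm (g ** adj (gam (r, j)))" unfolding e by (rule pm_mult[rotated])
  moreover have "(r, j) \<in> I" using r(1) j(2) by (simp add: I_def)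
  ultimately show ?thesis by blast
qed

text \<open>The line attached to the coset determines the cusp. For equal cusps a translation by j -
  j' remains, and minimality of the width excludes every value but 0.\<close>

lemma coset_unique:
  assumes i: "i \<in> I" and i': "i' \<in> I" and k: "pm (gam i ** adj (gam i'))"
  shows "i = i'"
proof -
  obtain l j where e1: "i = (l, j)" by (cases i)
  obtain l' j' where e2: "i' = (l', j')" by (cases i')
  note e = e1 e2
  have lj: "l \<in> R" "j < wd l" "l' \<in> R" "j' < wd l'" using i i' by (auto simp: I_def e)
  note s = \<sigma>_SL2Z[OF R_Iso[OF lj(1)]] and s' = \<sigma>_SL2Z[OF R_Iso[OF lj(3)]]
  note d = SL2Z_det[OF s] SL2Z_det[OF s'] SL2Z_det[OF ti_SL2Z]
  have line: "act (gam i) ` line_zero = l" "act (gam i') ` line_zero = l'"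
    unfolding gam_def e using \<sigma>_line[OF R_Iso[OF lj(1)]] \<sigma>_line[OF R_Iso[OF lj(3)]]
    by (simp_all add: act_image_mult[OF d(1) d(3)] act_image_mult[OF d(2) d(3)] act_ti_line_zero)
  define g where "g = gam i ** adj (gam i')"
  have gS: "g \<in> SL2Z" using pm_SL2Z[OF k] by (simp add: g_def)
  note di = SL2Z_det[OF gam_SL2Z[OF i]] SL2Z_det[OF gam_SL2Z[OF i']]
  have "act g ` l' = act (gam i) ` act (adj (gam i')) ` act (gam i') ` line_zero"
    unfolding g_def line(2) by (rule act_image_mult) (simp_all add: di det_adj)
  also have "\<dots> = l" unfolding act_image_adj(1)[OF di(2)] by (rule line(1))
  finally have gl: "act g ` l' = l" .
  have ex1: "\<exists>g0\<in>\<Gamma>. act g0 ` l' = l"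
  proof (cases "g \<in> \<Gamma>")
    case True
    then show ?thesis using gl by blast
  next
    case False
    then have "- g \<in> \<Gamma>" using k by (simp add: pm_def g_def)
    moreover have "act (- g) ` l' = l" using gl act_minus[OF SL2Z_det[OF gS]] by (simp cong: image_cong)
    ultimately show ?thesis by blast
  qed
  have ex2: "\<exists>g0\<in>\<Gamma>. act g0 ` l' = l'" using \<Gamma>_1 by (intro bexI[of _ "mat 1"]) (simp_all add: act_1)
  have ll: "l = l'" by (rule cusp_rep_unique[OF R_Iso[OF lj(3)] lj(1) lj(3) ex1 ex2])
  have gam: "gam i ** adj (gam i') = \<sigma> l ** ti (int j - int j') ** adj (\<sigma> l)"
  proof -
    have "gam i ** adj (gam i') = \<sigma> l ** (ti (int j) ** ti (- int j')) ** adj (\<sigma> l)"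
      by (simp add: gam_def e ll adj_mult adj_ti matrix_mul_assoc)
    then show ?thesis by (simp add: ti_add)
  qed
  have "\<not> j' < j"
  proof
    assume "j' < j"
    then have "int j - int j' = int (j - j')" by simp
    then have "pm (\<sigma> l ** ti (int (j - j')) ** adj (\<sigma> l))" using k unfolding gam by metis
    then have "wd l \<le> j - j'" using \<open>j' < j\<close> by (intro cusp_width_pm(3)[OF s]) simp_all
    then show False using lj(2) \<open>j' < j\<close> by linarith
  qed
  moreover have "\<not> j < j'"
  proof
    assume "j < j'"
    then have "- (int j - int j') = int (j' - j)" by simp
    then have "pm (\<sigma> l ** ti (int (j' - j)) ** adj (\<sigma> l))" using pm_adj[OF k] unfolding gam adj_conj_ti by metis
    then have "wd l \<le> j' - j" using \<open>j < j'\<close> by (intro cusp_width_pm(3)[OF s]) simp_all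
    then show False using lj(4)[folded ll] \<open>j < j'\<close> by linarith
  qed
  ultimately show ?thesis using ll by (simp add: e)
qed

text \<open>Right multiplication by t permutes the cosets: injectivity follows by cancelling t,
  surjectivity from finiteness of \<open>I\<close>.\<close>

lemma coset_permutation:
  assumes "finite R" "t \<in> SL2Z"
  obtains \<pi> where "bij_betw \<pi> I I"
    "\<And>i z. i \<in> I \<Longrightarrow> Im z > 0 \<Longrightarrow> f (moebius_act (gam i) (moebius_act t z)) = f (moebius_act (gam (\<pi> i)) z)"
    "\<And>i \<tau> z. i \<in> I \<Longrightarrow> Im z > 0 \<Longrightarrow> Theta_L N h \<tau> (moebius_act (gam i) (moebius_act t z)) = Theta_L N h \<tau> (moebius_act (gam (\<pi> i)) z)"
proof -
  have "\<forall>i\<in>I. \<exists>i'. i' \<in> I \<and> pm (gam i ** t ** adj (gam i'))"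
    using coset_exists[OF SL2Z_mult[OF gam_SL2Z assms(2)]] by blast
  from bchoice[OF this] obtain \<pi> where "\<forall>i\<in>I. \<pi> i \<in> I \<and> pm (gam i ** t ** adj (gam (\<pi> i)))" by (elim exE)
  then have \<pi>: "\<pi> i \<in> I \<and> pm (gam i ** t ** adj (gam (\<pi> i)))" if "i \<in> I" for i using that by simp
  have "inj_on \<pi> I"
  proof (rule inj_onI)
    fix i i' assume i: "i \<in> I" "i' \<in> I" "\<pi> i = \<pi> i'"
    define g where "g = gam (\<pi> i)"
    have dg: "det g = 1" unfolding g_def using SL2Z_det gam_SL2Z \<pi> i(1) by blast
    have "pm ((gam i ** t ** adj g) ** adj (gam i' ** t ** adj g))"
      unfolding g_def by (rule pm_mult[OF _ pm_adj]) (use \<pi>[OF i(1)] \<pi>[OF i(2)] i(3) in simp_all)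
    also have "(gam i ** t ** adj g) ** adj (gam i' ** t ** adj g) = gam i ** (t ** ((adj g ** g) ** adj t)) ** adj (gam i')"
      by (simp add: adj_mult adj_adj matrix_mul_assoc)
    also have "\<dots> = gam i ** adj (gam i')"
      by (simp add: adj_inverse dg SL2Z_det[OF assms(2)])
    finally show "i = i'" by (rule coset_unique[OF i(1,2)])
  qed
  moreover have "finite I" using assms(1) by (auto simp: I_def)
  moreover have "\<pi> ` I \<subseteq> I" using \<pi> by blast
  ultimately have "bij_betw \<pi> I I" by (simp add: bij_betw_def endo_inj_surj)
  moreover have "f (moebius_act (gam i) (moebius_act t z)) = f (moebius_act (gam (\<pi> i)) z)"
      "Theta_L N h \<tau> (moebius_act (gam i) (moebius_act t z)) = Theta_L N h \<tau> (moebius_act (gam (\<pi> i)) z)"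
    if "i \<in> I" "Im z > 0" for i z \<tau>
    using pm_equiv[OF SL2Z_mult[OF gam_SL2Z[OF that(1)] assms(2)] gam_SL2Z[of "\<pi> i"] _ that(2)] \<pi>[OF that(1)]
    unfolding moebius_act_mult[OF SL2Z_det[OF gam_SL2Z[OF that(1)]] SL2Z_det[OF assms(2)] that(2)] by blast+
  ultimately show ?thesis using that by blast
qed

end

section \<open>Assembling the lift\<close>

lemma integral_periodic_shift:
  fixes k :: "real \<Rightarrow> complex"
  assumes c: "continuous_on UNIV k" and per: "\<And>x. k (x + a) = k x" and "a \<ge> 1"
  shows "integral {-1/2..a - 1/2} k = integral {0..a} k"
proof -
  have i: "k integrable_on {u..v}" for u v by (intro integrable_continuous_interval continuous_on_subset[OF c]) simp
  have 1: "integral {-1/2..0} k + integral {0..a - 1/2} k = integral {-1/2..a - 1/2} k"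
    by (rule Henstock_Kurzweil_Integration.integral_combine[OF _ _ i]) (use assms(3) in auto)
  have 2: "integral {0..a - 1/2} k + integral {a - 1/2..a} k = integral {0..a} k"
    by (rule Henstock_Kurzweil_Integration.integral_combine[OF _ _ i]) (use assms(3) in auto)
  have 3: "integral {a - 1/2..a} k = integral {-1/2..0} k"
  proof -
    have "integral {-1/2..0} (k \<circ> ((+) a)) = integral {-1/2 + a..0 + a} k" by (rule integral_shift_Icc_real)
    moreover have "k \<circ> ((+) a) = k" by (rule ext) (simp add: per add.commute[of a])
    moreover have "{-1/2 + a..0 + a} = {a - 1/2..a}" by auto
    ultimately show ?thesis by simp
  qed
  show ?thesis unfolding 1[symmetric] 2[symmetric] 3 by (rule add.commute)
qed

text \<open>A simple pole at 0 does not touch the coefficient of degree 0, which is therefore the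
  value of the analytic part.\<close>

lemma laurent_constant_term:
  assumes "H analytic_on {0}" and "(\<lambda>s. H s + k / s) has_laurent_expansion G"
  shows "fls_nth G 0 = H 0"
proof -
  have "H has_fps_expansion fps_expansion H 0" by (rule analytic_at_imp_has_fps_expansion_0[OF assms(1)])
  note e = has_laurent_expansion_fps[OF this] this
  have "(\<lambda>s. H s + k * (1 / s)) has_laurent_expansion (fps_to_fls (fps_expansion H 0) + fls_const k * (fls_const 1 / fls_X))"
    by (rule has_laurent_expansion_add[OF e(1) has_laurent_expansion_cmult_left[OF has_laurent_expansion_divide[OF has_laurent_expansion_const has_laurent_expansion_fps_X]]])
  then have "(\<lambda>s. H s + k / s) has_laurent_expansion (fps_to_fls (fps_expansion H 0) + fls_const k * (fls_const 1 / fls_X))" by simp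
  then have "G = fps_to_fls (fps_expansion H 0) + fls_const k * (fls_const 1 / fls_X)"
    by (rule has_laurent_expansion_unique[OF assms(2)])
  moreover have "fls_nth (fls_const k * (fls_const 1 / fls_X)) 0 = 0" by simp
  ultimately show ?thesis by (simp add: fps_expansion_def)
qed

text \<open>The identity theorem, applied after removal of singularities. The conclusion is about a
  punctured neighbourhood because a meromorphic function may take arbitrary values at isolated
  points; that is enough for uniqueness of the Laurent coefficients.\<close>

lemma meromorphic_zero_half_plane:
  assumes g: "g meromorphic_on UNIV" and z: "\<And>s. Re s > s0 \<Longrightarrow> g s = 0"
  shows "\<forall>\<^sub>F s in at z. g s = 0"
proof -
  define r where "r = remove_sings g"
  have iso: "isolated_singularity_at g w" for w
    by (rule meromorphic_on_isolated_singularity[OF meromorphic_on_subset[OF g]]) simp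
  have "eventually (\<lambda>w. w \<in> {s. Re s > s0}) (at (complex_of_real (s0 + 1)))"
    by (rule eventually_at_in_open') (auto intro: open_halfspace_Re_gt)
  moreover have "\<forall>\<^sub>F w in at (complex_of_real (s0 + 1)). r w = g w"
    unfolding r_def by (rule eventually_remove_sings_eq_at[OF iso])
  ultimately have "\<forall>\<^sub>F w in at (complex_of_real (s0 + 1)). r w = 0" by eventually_elim (use z in auto)
  then have "\<exists>\<^sub>F w in at (complex_of_real (s0 + 1)). r w = 0"
    by (rule eventually_frequently[OF at_neq_bot])
  moreover have "r nicely_meromorphic_on UNIV"
    unfolding r_def by (rule remove_sings_nicely_meromorphic[OF g])
  ultimately have r0: "r w = 0" for w
    by (rule frequently_eq_meromorphic_imp_constant) auto
  have "\<forall>\<^sub>F w in at z. r w = g w"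
    unfolding r_def by (rule eventually_remove_sings_eq_at[OF iso])
  then show ?thesis by (rule eventually_mono) (metis r0)
qed

lemma moebius_ti: "moebius_act (ti m) z = z + of_int m"
  by (simp add: moebius_act_def ti_def)

context lift
begin

lemma cusp_data:
  assumes l: "l \<in> Iso N"
  shows "\<exists>D p1 p2 p11 p22. cusp_eigen N D (beta_cusp L l (\<sigma> l)) (act (adj (\<sigma> l)) ` h) (wd l) (\<lambda>z. f (moebius_act (\<sigma> l) z)) s' (A l) (B l) p1 p2 p11 p22
     \<and> (\<forall>\<tau>. coset_rows.theta0 N D (act (adj (\<sigma> l)) ` h) \<tau> = theta_K_tilde N l h \<tau>)"
proof -
  note s = \<sigma>_SL2Z[OF l] note d = SL2Z_det[OF s]
  obtain D where D: "coset_rows N D (beta_cusp L l (\<sigma> l)) (act (adj (\<sigma> l)) ` h)"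
    "\<And>\<tau>. coset_rows.theta0 N D (act (adj (\<sigma> l)) ` h) \<tau> = theta_K_tilde N l h \<tau>"
    by (rule coset_at_cusp[OF N1 even cong compat h s \<sigma>_line[OF l]]) (erule that, simp)
  have "C_k_on 2 f upper_half" using maass unfolding weak_Maass_form_def smooth_real_on_def by blast
  from moebius_second_partials[OF this d] obtain p1 p2 p11 p22 where
    sp: "second_partials (\<lambda>z. f (moebius_act (\<sigma> l) z)) p1 p2 p11 p22" and
    lap: "\<And>z. Im z > 0 \<Longrightarrow> p11 z + p22 z = of_real ((cmod (1 / (aut (\<sigma> l) z)\<^sup>2))\<^sup>2)
       * (d_re (d_re f) (moebius_act (\<sigma> l) z) + d_im (d_im f) (moebius_act (\<sigma> l) z))" by blast
  define p where "p z = f (moebius_act (\<sigma> l) z)" for z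
  have pc: "continuous_on upper_half p" using second_partialsD(1)[OF sp] by (simp add: p_def[abs_def])
  \<comment> \<open>The covariance factor |\<gamma>'|^2 is 1 / J^2 = (Im w)^2 / (Im z)^2, which
    trades the weight y^2 at the image point for the one at z.\<close>
  have eigen: "p11 z + p22 z = - (s' * (1 - s')) * p z / (complex_of_real (Im z))\<^sup>2" if z: "Im z > 0" for z
  proof -
    define w J where "w = moebius_act (\<sigma> l) z" and "J = (cmod (aut (\<sigma> l) z))\<^sup>2"
    have J: "J > 0" "Im w = Im z / J" using moebius_act_coords(1,2)[OF d z] by (simp_all add: w_def J_def)
    have "w \<in> upper_half" using J z by (simp add: upper_half_def)
    then have "Delta_zero f w = s' * (1 - s') * f w" using maass unfolding weak_Maass_form_def by blast
    then have e: "(complex_of_real (Im w))\<^sup>2 * (d_re (d_re f) w + d_im (d_im f) w) = - (s' * (1 - s')) * f w"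
      by (simp add: Delta_zero_def minus_equation_iff[of _ "_ * f w"])
    have cm: "(cmod (1 / (aut (\<sigma> l) z)\<^sup>2))\<^sup>2 = 1 / J\<^sup>2"
      by (simp add: J_def norm_divide norm_power power_divide)
    have i: "1 / J\<^sup>2 = (Im w)\<^sup>2 / (Im z)\<^sup>2" using J z by (simp add: power_divide)
    have "p11 z + p22 z = of_real ((Im w)\<^sup>2 / (Im z)\<^sup>2) * (d_re (d_re f) w + d_im (d_im f) w)"
      unfolding lap[OF z] cm i w_def[symmetric] ..
    also have "\<dots> = ((complex_of_real (Im w))\<^sup>2 * (d_re (d_re f) w + d_im (d_im f) w)) / (complex_of_real (Im z))\<^sup>2"
      by simp
    finally show ?thesis unfolding e by (simp add: p_def w_def)
  qed
  have growth: "\<exists>c C Y. \<forall>z. Im z \<ge> Y \<longrightarrow> norm (p z) \<le> c * exp (C * Im z)"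
  proof -
    obtain C where "p \<in> O[filtercomap Im at_top](\<lambda>z. complex_of_real (exp (C * Im z)))"
      using maass l unfolding weak_Maass_form_def p_def[abs_def] by blast
    then obtain c where "eventually (\<lambda>z. norm (p z) \<le> c * norm (complex_of_real (exp (C * Im z)))) (filtercomap Im at_top)"
      by (elim landau_o.bigE)
    then obtain Y where "\<And>z. Im z \<ge> Y \<Longrightarrow> norm (p z) \<le> c * norm (complex_of_real (exp (C * Im z)))"
      unfolding eventually_filtercomap eventually_at_top_linorder by blast
    then show ?thesis by (intro exI[of _ c] exI[of _ C] exI[of _ Y]) simp
  qed
  have a: "wd l > 0" by (rule cusp_width_pm(1)[OF s])
  have per: "p (z + of_nat (wd l)) = p z" if z: "Im z > 0" for z
  proof -
    define k where "k = \<sigma> l ** ti (int (wd l)) ** adj (\<sigma> l)"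
    have k: "pm k" unfolding k_def by (rule cusp_width_pm(2)[OF s])
    note dk = SL2Z_det[OF pm_SL2Z[OF k]] note dt = SL2Z_det[OF ti_SL2Z]
    have ks: "\<sigma> l ** ti (int (wd l)) = k ** \<sigma> l"
      by (simp add: k_def matrix_mul_assoc[symmetric] adj_inverse[OF d])
    have "p (z + of_nat (wd l)) = f (moebius_act (\<sigma> l ** ti (int (wd l))) z)"
      unfolding p_def moebius_act_mult[OF d dt z] moebius_ti by simp
    also have "\<dots> = p z"
      unfolding ks moebius_act_mult[OF dk d z] p_def by (rule pm_f[OF k moebius_act_upper[OF d z]])
    finally show ?thesis .
  qed
  \<comment> \<open>\<open>const_term\<close> averages over [0, width]; periodicity moves the
    interval to the base of the strip.\<close>
  have ci: "integral {-1/2..real (wd l) - 1/2} (\<lambda>x. p (Complex x y)) = of_nat (wd l) * (A l * complex_of_real y powr s' + B l * complex_of_real y powr (1 - s'))"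
    if y: "y > 0" for y
  proof -
    have "integral {-1/2..real (wd l) - 1/2} (\<lambda>x. p (Complex x y)) = integral {0..real (wd l)} (\<lambda>x. p (Complex x y))"
    proof (rule integral_periodic_shift)
      show "continuous_on UNIV (\<lambda>x. p (Complex x y))"
        by (rule continuous_on_upper_compose[OF pc]) (use y in \<open>auto intro!: continuous_intros\<close>)
      fix x
      have "Complex (x + real (wd l)) y = Complex x y + of_nat (wd l)" by (simp add: complex_eq_iff)
      then show "p (Complex (x + real (wd l)) y) = p (Complex x y)" using per[of "Complex x y"] y by simp
    qed (use a in simp)
    moreover have "1 / complex_of_real (real (wd l)) * integral {0..real (wd l)} (\<lambda>x. p (Complex x y)) = A l * complex_of_real y powr s' + B l * complex_of_real y powr (1 - s')"
      using const[OF l y] by (simp only: const_term_def p_def)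
    ultimately show ?thesis using a by (simp add: field_simps)
  qed
  have "cusp_eigen N D (beta_cusp L l (\<sigma> l)) (act (adj (\<sigma> l)) ` h) (wd l) p s' (A l) (B l) p1 p2 p11 p22"
    unfolding cusp_eigen_def cusp_def cusp_axioms_def cusp_eigen_axioms_def
    using D(1) a pc growth ci sp eigen by (simp add: p_def[abs_def])
  then show ?thesis using D(2) unfolding p_def[abs_def] by blast
qed

end

text \<open>For every representative cusp a denominator and the partial derivatives are chosen once
  and for all, so that they are functions of the cusp and can be summed over
  \<open>R\<close>.\<close>

locale lift_data = lift +
  fixes D :: "(real^2^2) set \<Rightarrow> real" and p1 p2 p11 p22 :: "(real^2^2) set \<Rightarrow> complex \<Rightarrow> complex"
  assumes ce: "\<And>l. l \<in> R \<Longrightarrow> cusp_eigen N (D l) (beta_cusp L l (\<sigma> l)) (act (adj (\<sigma> l)) ` h) (wd l) (\<lambda>z. f (moebius_act (\<sigma> l) z)) s' (A l) (B l) (p1 l) (p2 l) (p11 l) (p22 l)"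
    and th: "\<And>l \<tau>. l \<in> R \<Longrightarrow> coset_rows.theta0 N (D l) (act (adj (\<sigma> l)) ` h) \<tau> = theta_K_tilde N l h \<tau>"
begin

abbreviation be where "be l \<equiv> beta_cusp L l (\<sigma> l)"
abbreviation S where "S l \<equiv> act (adj (\<sigma> l)) ` h"
abbreviation p where "p l \<equiv> (\<lambda>z. f (moebius_act (\<sigma> l) z))"

definition ka where "ka l = cusp.\<kappa> N (be l)"
definition U where "U l q \<tau> = cusp.Ir N (D l) (be l) (S l) (wd l) (p l) s' (A l) (B l) q \<tau>"
definition HH where "HH l \<tau> s = cusp.Hs N (D l) (be l) (S l) (wd l) (p l) \<tau> s"
definition hh where "hh l s = cusp.hs (wd l) (p l) s"
definition th where "th l \<tau> = theta_K_tilde N l h \<tau>"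

lemmas cu = cusp_eigen.axioms(1)[OF ce]
lemmas co = cusp.axioms(1)[OF cu]

definition E where "E \<tau> s = (\<Sum>l\<in>R. ka l * HH l \<tau> s + ka l * th l \<tau> * hh l s)"
definition c1 where "c1 \<tau> = (\<Sum>l\<in>R. ka l * th l \<tau> * of_nat (wd l) * A l)"
definition c2 where "c2 \<tau> = (\<Sum>l\<in>R. ka l * th l \<tau> * of_nat (wd l) * B l)"
definition FF where "FF \<tau> s = E \<tau> s + c1 \<tau> / (s - s') + c2 \<tau> / (s - (1 - s'))"

lemma E_entire:
  assumes "Im \<tau> > 0"
  shows "E \<tau> holomorphic_on UNIV"
  unfolding E_def HH_def hh_def
  by (intro holomorphic_on_sum holomorphic_on_add holomorphic_on_mult holomorphic_on_const)
    (use cusp.Hs_entire[OF cu assms] cusp.hs_entire[OF cu] in auto)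

lemma trunc_limit:
  assumes "Im \<tau> > 0" "l \<in> R" "Re s > Re s'" "Re s > 1 - Re s'"
  shows "((\<lambda>T. trunc_integral N \<Gamma> (\<sigma> l) f h \<tau> s T) \<longlongrightarrow>
     ka l * HH l \<tau> s + ka l * th l \<tau> * (hh l s + of_nat (wd l) * (A l / (s - s') + B l / (s - (1 - s'))))) at_top"
proof -
  have "trunc_integral N \<Gamma> (\<sigma> l) f h \<tau> s T = (LINT z:fund_dom_trunc (wd l) T|lborel.
      p l z * Theta_L N (S l) \<tau> z * complex_of_real (Im z) powr (- s) / (complex_of_real (Im z))\<^sup>2)" for T
    unfolding trunc_integral_def
  proof (rule set_lebesgue_integral_cong)
    show "fund_dom_trunc (wd l) T \<in> sets lborel" using cusp.trunc_borel[OF cu[OF assms(2)]] by simp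
  qed (use Theta_L_moebius[OF SL2Z_det[OF \<sigma>_SL2Z[OF R_Iso[OF assms(2)]]]] fund_dom_trunc_upper in simp)
  then show ?thesis
    using cusp.reg_limit[OF cu[OF assms(2)] assms(1,3,4)]
    by (simp add: ka_def HH_def hh_def th_def th[OF assms(2)])
qed

lemma FF_continuation:
  assumes "Im \<tau> > 0"
  shows "is_reg_continuation N \<Gamma> R \<sigma> f h \<tau> (FF \<tau>)"
  unfolding is_reg_continuation_def
proof (intro conjI exI allI impI ballI)
  have an: "E \<tau> meromorphic_on UNIV"
    by (intro analytic_on_imp_meromorphic_on) (use E_entire[OF assms] in \<open>simp add: analytic_on_open\<close>)
  show "FF \<tau> meromorphic_on UNIV"
    unfolding FF_def[abs_def] by (intro meromorphic_intros an)
next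
  \<comment> \<open>The threshold |Re s'| + 1 is at least Re s' and at least 1 - Re s'.\<close>
  fix s l assume s: "Re s > \<bar>Re s'\<bar> + 1" and l: "l \<in> R"
  show "((\<lambda>T. trunc_integral N \<Gamma> (\<sigma> l) f h \<tau> s T) \<longlongrightarrow>
     ka l * HH l \<tau> s + ka l * th l \<tau> * (hh l s + of_nat (wd l) * (A l / (s - s') + B l / (s - (1 - s'))))) at_top"
    by (rule trunc_limit[OF assms l]) (use s in linarith)+
next
  fix s :: complex
  show "FF \<tau> s = (\<Sum>l\<in>R. ka l * HH l \<tau> s + ka l * th l \<tau> * (hh l s + of_nat (wd l) * (A l / (s - s') + B l / (s - (1 - s')))))"
    unfolding FF_def E_def c1_def c2_def sum_divide_distrib sum.distrib[symmetric]
    by (rule sum.cong[OF refl]) (simp add: algebra_simps)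
qed

text \<open>The continuation with its polar part at s = 0 removed, so that the value at 0 is the
  constant term of the Laurent expansion.\<close>

definition HC where "HC \<tau> s = E \<tau> s + (if s' = 0 then 0 else c1 \<tau> / (s - s')) + (if s' = 1 then 0 else c2 \<tau> / (s - (1 - s')))"

lemma HC_analytic:
  assumes "Im \<tau> > 0"
  shows "HC \<tau> analytic_on {0}"
proof -
  have "E \<tau> analytic_on {0}"
    by (rule analytic_on_subset[of _ UNIV]) (use E_entire[OF assms] in \<open>simp_all add: analytic_on_open\<close>)
  then show ?thesis
    unfolding HC_def[abs_def] by (cases "s' = 0"; cases "s' = 1") (auto intro!: analytic_intros)
qed

lemma FF_split: "FF \<tau> = (\<lambda>s. HC \<tau> s + ((if s' = 0 then c1 \<tau> else 0) + (if s' = 1 then c2 \<tau> else 0)) / s)"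
  by (rule ext) (simp add: FF_def HC_def)

lemma HC_0:
  assumes "Im \<tau> > 0"
  shows "HC \<tau> 0 = (\<Sum>l\<in>R. U l P0 \<tau>)"
proof -
  have "U l P0 \<tau> = (ka l * HH l \<tau> 0 + ka l * th l \<tau> * hh l 0) + (if s' = 0 then 0 else ka l * th l \<tau> * of_nat (wd l) * A l / (0 - s'))
      + (if s' = 1 then 0 else ka l * th l \<tau> * of_nat (wd l) * B l / (0 - (1 - s')))" if "l \<in> R" for l
    using cusp.Ir_P0[OF cu[OF that] assms]
    by (simp add: U_def ka_def HH_def hh_def th_def th[OF that] cusp.c0_def[OF cu[OF that]] algebra_simps)
  then have "(\<Sum>l\<in>R. U l P0 \<tau>) = (\<Sum>l\<in>R. (ka l * HH l \<tau> 0 + ka l * th l \<tau> * hh l 0) + (if s' = 0 then 0 else ka l * th l \<tau> * of_nat (wd l) * A l / (0 - s'))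
      + (if s' = 1 then 0 else ka l * th l \<tau> * of_nat (wd l) * B l / (0 - (1 - s'))))" by (rule sum.cong[OF refl])
  also have "\<dots> = HC \<tau> 0"
    unfolding HC_def E_def c1_def c2_def sum_divide_distrib sum.distrib by simp
  finally show ?thesis by simp
qed

text \<open>\<open>I_reg\<close> is a definite description, so existence and uniqueness are both
  due. \<open>FF\<close> is a continuation; any other one agrees with it on a right half plane,
  where the limits determine the values, hence also near 0.\<close>

lemma I_reg_eq:
  assumes "Im \<tau> > 0"
  shows "I_reg N \<Gamma> R \<sigma> f h \<tau> = (\<Sum>l\<in>R. U l P0 \<tau>)"
  unfolding I_reg_def HC_0[OF assms, symmetric]
proof (rule the_equality)
  define k where "k = (if s' = 0 then c1 \<tau> else 0) + (if s' = 1 then c2 \<tau> else 0)"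
  note ct = laurent_constant_term[OF HC_analytic[OF assms], of k]
  have FFm: "FF \<tau> meromorphic_on UNIV" using FF_continuation[OF assms] by (simp add: is_reg_continuation_def)
  obtain G where G: "(\<lambda>w. FF \<tau> (0 + w)) has_laurent_expansion G" using FFm unfolding meromorphic_on_def by blast
  then have "FF \<tau> has_laurent_expansion G" by simp
  moreover have "fls_nth G 0 = HC \<tau> 0" by (rule ct) (use G in \<open>simp add: FF_split k_def\<close>)
  ultimately show "\<exists>F G. is_reg_continuation N \<Gamma> R \<sigma> f h \<tau> F \<and> F has_laurent_expansion G \<and> HC \<tau> 0 = fls_nth G 0"
    using FF_continuation[OF assms] by metis
  fix c assume "\<exists>F G. is_reg_continuation N \<Gamma> R \<sigma> f h \<tau> F \<and> F has_laurent_expansion G \<and> c = fls_nth G 0"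
  then obtain F G where F: "is_reg_continuation N \<Gamma> R \<sigma> f h \<tau> F" "F has_laurent_expansion G" "c = fls_nth G 0" by blast
  obtain s0 where s0: "\<And>s. Re s > s0 \<Longrightarrow> \<exists>c. (\<forall>l\<in>R. ((\<lambda>T. trunc_integral N \<Gamma> (\<sigma> l) f h \<tau> s T) \<longlongrightarrow> c l) at_top) \<and> F s = (\<Sum>l\<in>R. c l)"
    using F(1) unfolding is_reg_continuation_def by blast
  obtain s1 where s1: "\<And>s. Re s > s1 \<Longrightarrow> \<exists>c. (\<forall>l\<in>R. ((\<lambda>T. trunc_integral N \<Gamma> (\<sigma> l) f h \<tau> s T) \<longlongrightarrow> c l) at_top) \<and> FF \<tau> s = (\<Sum>l\<in>R. c l)"
    using FF_continuation[OF assms] unfolding is_reg_continuation_def by blast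
  have "F s - FF \<tau> s = 0" if s: "Re s > max s0 s1" for s
  proof -
    obtain c where c: "\<And>l. l \<in> R \<Longrightarrow> ((\<lambda>T. trunc_integral N \<Gamma> (\<sigma> l) f h \<tau> s T) \<longlongrightarrow> c l) at_top" "F s = (\<Sum>l\<in>R. c l)"
      using s0[of s] s by auto
    obtain c' where c': "\<And>l. l \<in> R \<Longrightarrow> ((\<lambda>T. trunc_integral N \<Gamma> (\<sigma> l) f h \<tau> s T) \<longlongrightarrow> c' l) at_top" "FF \<tau> s = (\<Sum>l\<in>R. c' l)"
      using s1[of s] s by auto
    have "c l = c' l" if "l \<in> R" for l
      by (rule tendsto_unique[OF trivial_limit_at_top_linorder c(1)[OF that] c'(1)[OF that]])
    then show ?thesis unfolding c(2) c'(2) by simp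
  qed
  moreover have "(\<lambda>s. F s - FF \<tau> s) meromorphic_on UNIV"
    using F(1) FFm by (intro meromorphic_intros) (simp_all add: is_reg_continuation_def)
  ultimately have "\<forall>\<^sub>F s in at 0. F s - FF \<tau> s = 0" by (intro meromorphic_zero_half_plane)
  then have "\<forall>\<^sub>F s in at 0. F s = FF \<tau> s" by simp
  then have "FF \<tau> has_laurent_expansion G" using has_laurent_expansion_cong[of F "FF \<tau>" G G] F(2) by simp
  then have "fls_nth G 0 = HC \<tau> 0" by (intro ct) (simp add: FF_split k_def)
  then show "c = HC \<tau> 0" by (simp add: F(3))
qed

definition UU where "UU q \<tau> = (\<Sum>l\<in>R. U l q \<tau>)"

lemma UU_has_dir:
  assumes "\<tau> \<in> upper_half"
  shows "has_dir 1 (UU P0) (UU Pu \<tau>) \<tau>" "has_dir \<i> (UU P0) (UU Pv \<tau>) \<tau>" "has_dir 1 (UU Pu) (UU Puu \<tau>) \<tau>" "has_dir \<i> (UU Pu) (UU Puv \<tau>) \<tau>"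
    "has_dir 1 (UU Pv) (UU Puv \<tau>) \<tau>" "has_dir \<i> (UU Pv) (UU Pvv \<tau>) \<tau>"
  unfolding UU_def[abs_def] U_def
  by (rule has_dir_sum, rule cusp.Ir_has_dir[OF cu assms], assumption)+

lemma UU_continuous: "continuous_on upper_half (UU q)"
  unfolding UU_def[abs_def] U_def
  by (rule continuous_on_sum) (rule cusp.Ir_continuous[OF cu])

lemma I_reg_UU: "\<tau> \<in> upper_half \<Longrightarrow> I_reg N \<Gamma> R \<sigma> f h \<tau> = UU P0 \<tau>"
  by (simp add: I_reg_eq UU_def upper_half_def)

lemma I_reg_C2: "C_k_on 2 (I_reg N \<Gamma> R \<sigma> f h) upper_half"
proof -
  have "C_k_on (Suc 0) (UU Pu) upper_half" "C_k_on (Suc 0) (UU Pv) upper_half"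
    by (rule C_k_on_SucI[OF open_upper UU_continuous UU_has_dir(3,4)]; simp add: UU_continuous)
      (rule C_k_on_SucI[OF open_upper UU_continuous UU_has_dir(5,6)]; simp add: UU_continuous)
  then have "C_k_on 2 (UU P0) upper_half"
    unfolding numeral_2_eq_2 by (intro C_k_on_SucI[OF open_upper UU_continuous UU_has_dir(1,2)])
  then show ?thesis using C_k_on_cong[OF open_upper, of "I_reg N \<Gamma> R \<sigma> f h" "UU P0" 2] I_reg_UU by blast
qed

lemma Delta_half_I_reg:
  assumes \<tau>: "\<tau> \<in> upper_half"
  shows "Delta_half (I_reg N \<Gamma> R \<sigma> f h) \<tau> = - (complex_of_real (Im \<tau>))\<^sup>2 * (UU Puu \<tau> + UU Pvv \<tau>) + \<i> / 2 * complex_of_real (Im \<tau>) * (UU Pu \<tau> + \<i> * UU Pv \<tau>)"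
proof -
  let ?I = "I_reg N \<Gamma> R \<sigma> f h"
  have 1: "has_dir 1 ?I (UU Pu \<tau>) \<tau>" "has_dir \<i> ?I (UU Pv \<tau>) \<tau>" if "\<tau> \<in> upper_half" for \<tau>
    using UU_has_dir(1,2)[OF that] has_dir_cong[OF open_upper that, of ?I "UU P0"] I_reg_UU by blast+
  then have 2: "d_re ?I \<tau> = UU Pu \<tau>" "d_im ?I \<tau> = UU Pv \<tau>" if "\<tau> \<in> upper_half" for \<tau>
    using that has_dir_d_re has_dir_d_im by blast+
  have "has_dir 1 (d_re ?I) (UU Puu \<tau>) \<tau>" "has_dir \<i> (d_im ?I) (UU Pvv \<tau>) \<tau>"
    using UU_has_dir(3,6)[OF \<tau>] has_dir_cong[OF open_upper \<tau>, of "d_re ?I" "UU Pu"] has_dir_cong[OF open_upper \<tau>, of "d_im ?I" "UU Pv"] 2 by blast+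
  then show ?thesis by (simp add: Delta_half_def 2[OF \<tau>] has_dir_d_re has_dir_d_im)
qed

definition LL where "LL l \<tau> = cusp_eigen.Lam N (D l) (be l) (S l) (wd l) (p l) s' (A l) (B l) \<tau>"
definition DD where "DD l \<tau> T = cusp_eigen.defect N (D l) (be l) (S l) (wd l) (p l) (p2 l) (p11 l) (p22 l) \<tau> T"

text \<open>The functions f and \<Theta> at \<open>gam i\<close> z are permuted by z + 1 and - 1 /
  z. The fluxes through arcs and sides therefore cancel once the sum runs over all cusps and all
  translates together.\<close>

lemma sum_defect:
  assumes fin: "finite R" and \<tau>: "Im \<tau> > 0" and T: "T \<ge> 1"
  shows "(\<Sum>l\<in>R. DD l \<tau> T) = 0"
proof -
  define Q where "Q c l z = ka l * theta_param.Th (real N) (D l) (be l) (coset_rows.om (D l) (be l) (S l)) c \<tau> z" for c l z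
  define pp qq where "pp i z = p (fst i) (z + of_nat (snd i))" and "qq c i z = Q c (fst i) (z + of_nat (snd i))" for c and i :: "(real^2^2) set \<times> nat" and z
  define pd where "pd u i z = u (fst i) (z + of_nat (snd i))" for u :: "(real^2^2) set \<Rightarrow> complex \<Rightarrow> complex" and i :: "(real^2^2) set \<times> nat" and z
  have fI: "finite I" using fin by (auto simp: I_def)
  have sp: "second_partials (pp i) (pd p1 i) (pd p2 i) (pd p11 i) (pd p22 i)" if "i \<in> I" for i
    unfolding pp_def[abs_def] pd_def[abs_def]
    by (rule second_partials_shift[OF cusp_eigen.sp[OF ce]]) (use that in \<open>auto simp: I_def\<close>)
  have sq: "second_partials (qq P0 i) (qq Px i) (qq Py i) (qq Pxx i) (qq Pyy i)" if "i \<in> I" for i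
    unfolding qq_def[abs_def] Q_def ka_def
    by (rule second_partials_shift[OF cusp_eigen.theta_partials[OF ce \<tau>]]) (use that in \<open>auto simp: I_def\<close>)
  have gm: "moebius_act (gam i) z = moebius_act (\<sigma> (fst i)) (z + of_nat (snd i))" if "i \<in> I" "Im z > 0" for i z
  proof -
    have "fst i \<in> Iso N" using that by (auto simp: I_def intro: R_Iso)
    from moebius_act_mult[OF SL2Z_det[OF \<sigma>_SL2Z[OF this]] SL2Z_det[OF ti_SL2Z] that(2), of "int (snd i)"]
    show ?thesis by (simp add: gam_def moebius_ti)
  qed
  have pf: "pp i z = f (moebius_act (gam i) z)" if "i \<in> I" "Im z > 0" for i z
    by (simp add: pp_def gm[OF that])
  have qf: "qq P0 i z = Theta_L N h \<tau> (moebius_act (gam i) z)" if i: "i \<in> I" and z: "Im z > 0" for i z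
  proof -
    have l: "fst i \<in> R" using i by (auto simp: I_def)
    have u: "Im (z + of_nat (snd i)) > 0" using z by simp
    show ?thesis
      unfolding gm[OF i z] Theta_L_moebius[OF SL2Z_det[OF \<sigma>_SL2Z[OF R_Iso[OF l]]] u]
        coset_rows.Theta_eq_Th[OF co[OF l] \<tau> u] qq_def Q_def ka_def cusp.\<kappa>_def[OF cu[OF l]] ..
  qed
  have perm: "\<exists>\<pi>. bij_betw \<pi> I I \<and> (\<forall>i z. i \<in> I \<longrightarrow> Im z > 0 \<longrightarrow> pp i (moebius_act t z) = pp (\<pi> i) z \<and> qq P0 i (moebius_act t z) = qq P0 (\<pi> i) z)"
    if t: "t \<in> SL2Z" for t
  proof -
    from coset_permutation[OF fin t] obtain \<pi> where \<pi>: "bij_betw \<pi> I I"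
      "\<And>i z. i \<in> I \<Longrightarrow> Im z > 0 \<Longrightarrow> f (moebius_act (gam i) (moebius_act t z)) = f (moebius_act (gam (\<pi> i)) z)"
      "\<And>i \<tau> z. i \<in> I \<Longrightarrow> Im z > 0 \<Longrightarrow> Theta_L N h \<tau> (moebius_act (gam i) (moebius_act t z)) = Theta_L N h \<tau> (moebius_act (gam (\<pi> i)) z)"
      by metis
    have "pp i (moebius_act t z) = pp (\<pi> i) z \<and> qq P0 i (moebius_act t z) = qq P0 (\<pi> i) z" if i: "i \<in> I" and z: "Im z > 0" for i z
    proof -
      have i': "\<pi> i \<in> I" using \<pi>(1) i by (auto simp: bij_betw_def)
      have u: "Im (moebius_act t z) > 0" by (rule moebius_act_upper[OF SL2Z_det[OF t] z])
      show ?thesis unfolding pf[OF i u] pf[OF i' z] qf[OF i u] qf[OF i' z] using \<pi>(2,3)[OF i z] by simp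
    qed
    then show ?thesis using \<pi>(1) by blast
  qed
  have m1: "moebius_act (ti 1) z = z + 1" for z by (simp add: moebius_ti)
  have mS: "moebius_act (mat2 0 (- 1) 1 0) z = - 1 / z" for z by (simp add: moebius_act_def)
  have SS: "mat2 0 (- 1) 1 0 \<in> SL2Z" by (auto simp: SL2Z_def forall_2 det_2)
  obtain \<pi> where \<pi>: "bij_betw \<pi> I I" "\<And>i z. i \<in> I \<Longrightarrow> Im z > 0 \<Longrightarrow> pp i (z + 1) = pp (\<pi> i) z \<and> qq P0 i (z + 1) = qq P0 (\<pi> i) z"
    using perm[OF ti_SL2Z[of 1]] unfolding m1 by blast
  obtain \<rho> where \<rho>: "bij_betw \<rho> I I" "\<And>i z. i \<in> I \<Longrightarrow> Im z > 0 \<Longrightarrow> pp i (- 1 / z) = pp (\<rho> i) z \<and> qq P0 i (- 1 / z) = qq P0 (\<rho> i) z"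
    using perm[OF SS] unfolding mS by blast
  have G: "(\<Sum>i\<in>I. LINT z:FT T|lborel. pp i z * (qq Pxx i z + qq Pyy i z) - qq P0 i z * (pd p11 i z + pd p22 i z))
     = (\<Sum>i\<in>I. integral {-1/2..1/2} (\<lambda>x. pp i (Complex x T) * qq Py i (Complex x T) - qq P0 i (Complex x T) * pd p2 i (Complex x T)))"
    by (rule green_permutation[OF fI T sp sq \<pi> \<rho>])
  have "(\<Sum>l\<in>R. DD l \<tau> T) = (\<Sum>l\<in>R. \<Sum>j<wd l. (LINT z:FT T|lborel. pp (l, j) z * (qq Pxx (l, j) z + qq Pyy (l, j) z) - qq P0 (l, j) z * (pd p11 (l, j) z + pd p22 (l, j) z))
     - integral {-1/2..1/2} (\<lambda>x. pp (l, j) (Complex x T) * qq Py (l, j) (Complex x T) - qq P0 (l, j) (Complex x T) * pd p2 (l, j) (Complex x T)))"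
    by (rule sum.cong[OF refl]) (simp only: DD_def cusp_eigen.defect_sum[OF ce \<tau> T] pp_def qq_def pd_def Q_def ka_def fst_conv snd_conv)
  also have "\<dots> = (\<Sum>i\<in>I. (LINT z:FT T|lborel. pp i z * (qq Pxx i z + qq Pyy i z) - qq P0 i z * (pd p11 i z + pd p22 i z))
     - integral {-1/2..1/2} (\<lambda>x. pp i (Complex x T) * qq Py i (Complex x T) - qq P0 i (Complex x T) * pd p2 i (Complex x T)))"
    unfolding I_def by (subst sum.Sigma) (use fin in \<open>simp_all add: case_prod_unfold\<close>)
  also have "\<dots> = 0" unfolding sum_subtractf G by simp
  finally show ?thesis .
qed

text \<open>As the defects add up to zero, minus the sum of the exact derivatives converges to the
  sum of the \<open>LL\<close>. It is the derivative of a function tending to 0, so this limit is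
  0.\<close>

lemma sum_Lam:
  assumes \<tau>: "Im \<tau> > 0"
  shows "(\<Sum>l\<in>R. LL l \<tau>) = 0"
\<comment> \<open>A sum over an infinite set is 0 by convention, so only the finite case has
  content.\<close>
proof (cases "finite R")
  case fin: True
  have "\<forall>l\<in>R. \<exists>GG. (\<forall>y>1. (fst GG has_vector_derivative snd GG y) (at y)) \<and> (fst GG \<longlongrightarrow> 0) at_top \<and> ((\<lambda>T. DD l \<tau> T - snd GG T) \<longlongrightarrow> LL l \<tau>) at_top"
  proof
    fix l assume l: "l \<in> R"
    from cusp_eigen.defect_limit[OF ce[OF l] \<tau>, folded DD_def LL_def] obtain G G' where
      "(\<forall>y>1. (G has_vector_derivative G' y) (at y)) \<and> (G \<longlongrightarrow> 0) at_top \<and> ((\<lambda>T. DD l \<tau> T - G' T) \<longlongrightarrow> LL l \<tau>) at_top"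
      by (elim exE)
    then show "\<exists>GG. (\<forall>y>1. (fst GG has_vector_derivative snd GG y) (at y)) \<and> (fst GG \<longlongrightarrow> 0) at_top \<and> ((\<lambda>T. DD l \<tau> T - snd GG T) \<longlongrightarrow> LL l \<tau>) at_top"
      by (intro exI[of _ "(G, G')"]) (unfold fst_conv snd_conv)
  qed
  from bchoice[OF this] obtain GG where GG: "\<forall>l\<in>R. (\<forall>y>1. (fst (GG l) has_vector_derivative snd (GG l) y) (at y)) \<and> (fst (GG l) \<longlongrightarrow> 0) at_top \<and> ((\<lambda>T. DD l \<tau> T - snd (GG l) T) \<longlongrightarrow> LL l \<tau>) at_top"
    by (elim exE)
  define g g' where "g T = - (\<Sum>l\<in>R. fst (GG l) T)" and "g' T = - (\<Sum>l\<in>R. snd (GG l) T)" for T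
  show ?thesis
  proof (rule tendsto_derivative_zero[of 1 g g'])
    show "(g has_vector_derivative g' y) (at y)" if "y > 1" for y
      unfolding g_def g'_def by (intro has_vector_derivative_minus has_vector_derivative_sum) (use GG that in auto)
    have "((\<lambda>T. - (\<Sum>l\<in>R. fst (GG l) T)) \<longlongrightarrow> - (\<Sum>l\<in>R. 0)) at_top"
      by (intro tendsto_minus tendsto_sum) (use GG in auto)
    then show "(g \<longlongrightarrow> 0) at_top" by (simp add: g_def[abs_def])
    have "((\<lambda>T. \<Sum>l\<in>R. DD l \<tau> T - snd (GG l) T) \<longlongrightarrow> (\<Sum>l\<in>R. LL l \<tau>)) at_top"
      by (intro tendsto_sum) (use GG in auto)
    then show "(g' \<longlongrightarrow> (\<Sum>l\<in>R. LL l \<tau>)) at_top"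
    proof (rule Lim_transform_eventually)
      show "\<forall>\<^sub>F T in at_top. (\<Sum>l\<in>R. DD l \<tau> T - snd (GG l) T) = g' T"
        using eventually_ge_at_top[of 1] by eventually_elim (simp add: sum_subtractf sum_defect[OF fin \<tau>] g'_def)
    qed
  qed
qed simp

text \<open>\<kappa> times the cusp width is \<epsilon> / sqrt N; this turns the boundary constants
  left at the cusps into the stated coefficients.\<close>

lemma Delta_I_reg:
  assumes \<tau>: "\<tau> \<in> upper_half"
  shows "4 * Delta_half (I_reg N \<Gamma> R \<sigma> f h) \<tau> = (if s' = 0 then - (\<Sum>l\<in>R. A l * complex_of_real (eps_cusp L \<Gamma> l (\<sigma> l) / sqrt (real N)) * theta_K_tilde N l h \<tau>)
     else if s' = 1 then - (\<Sum>l\<in>R. B l * complex_of_real (eps_cusp L \<Gamma> l (\<sigma> l) / sqrt (real N)) * theta_K_tilde N l h \<tau>)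
     else s' * (1 - s') * I_reg N \<Gamma> R \<sigma> f h \<tau>)"
proof -
  have \<tau>': "Im \<tau> > 0" using \<tau> by (simp add: upper_half_def)
  have ka: "ka l * th l \<tau> * of_nat (wd l) * C = C * complex_of_real (eps_cusp L \<Gamma> l (\<sigma> l) / sqrt (real N)) * theta_K_tilde N l h \<tau>" if "l \<in> R" for l C
    by (simp add: ka_def cusp.\<kappa>_def[OF cu[OF that]] th_def eps_cusp_def divide_inverse mult_ac)
  have "4 * Delta_half (I_reg N \<Gamma> R \<sigma> f h) \<tau> = (\<Sum>l\<in>R. 4 * (- (complex_of_real (Im \<tau>))\<^sup>2 * (U l Puu \<tau> + U l Pvv \<tau>) + \<i> / 2 * complex_of_real (Im \<tau>) * (U l Pu \<tau> + \<i> * U l Pv \<tau>)))"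
    unfolding Delta_half_I_reg[OF \<tau>] UU_def sum.distrib[symmetric] sum_distrib_left ..
  also have "\<dots> = (\<Sum>l\<in>R. - LL l \<tau> + (if s' = 0 then - (ka l * th l \<tau> * of_nat (wd l) * A l) else if s' = 1 then - (ka l * th l \<tau> * of_nat (wd l) * B l) else s' * (1 - s') * U l P0 \<tau>))"
  proof (rule sum.cong[OF refl])
    fix l assume l: "l \<in> R"
    show "4 * (- (complex_of_real (Im \<tau>))\<^sup>2 * (U l Puu \<tau> + U l Pvv \<tau>) + \<i> / 2 * complex_of_real (Im \<tau>) * (U l Pu \<tau> + \<i> * U l Pv \<tau>))
        = - LL l \<tau> + (if s' = 0 then - (ka l * th l \<tau> * of_nat (wd l) * A l) else if s' = 1 then - (ka l * th l \<tau> * of_nat (wd l) * B l) else s' * (1 - s') * U l P0 \<tau>)"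
      unfolding U_def LL_def ka_def th_def th[OF l, symmetric] by (rule cusp_eigen.Ir_laplace[OF ce[OF l] \<tau>'])
  qed
  also have "\<dots> = (\<Sum>l\<in>R. if s' = 0 then - (ka l * th l \<tau> * of_nat (wd l) * A l) else if s' = 1 then - (ka l * th l \<tau> * of_nat (wd l) * B l) else s' * (1 - s') * U l P0 \<tau>)"
    by (simp only: sum.distrib[of "\<lambda>l. - LL l \<tau>"] sum_negf[of "\<lambda>l. LL l \<tau>"] sum_Lam[OF \<tau>'] minus_zero add_0)
  also have "\<dots> = (if s' = 0 then - (\<Sum>l\<in>R. ka l * th l \<tau> * of_nat (wd l) * A l) else if s' = 1 then - (\<Sum>l\<in>R. ka l * th l \<tau> * of_nat (wd l) * B l) else s' * (1 - s') * UU P0 \<tau>)"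
    by (cases "s' = 0"; cases "s' = 1") (simp_all add: sum_negf UU_def sum_distrib_left)
  also have "(\<Sum>l\<in>R. ka l * th l \<tau> * of_nat (wd l) * A l) = (\<Sum>l\<in>R. A l * complex_of_real (eps_cusp L \<Gamma> l (\<sigma> l) / sqrt (real N)) * theta_K_tilde N l h \<tau>)"
    by (rule sum.cong[OF refl]) (rule ka)
  also have "(\<Sum>l\<in>R. ka l * th l \<tau> * of_nat (wd l) * B l) = (\<Sum>l\<in>R. B l * complex_of_real (eps_cusp L \<Gamma> l (\<sigma> l) / sqrt (real N)) * theta_K_tilde N l h \<tau>)"
    by (rule sum.cong[OF refl]) (rule ka)
  finally show ?thesis unfolding I_reg_UU[OF \<tau>] .
qed

end

text \<open>The first two conclusions back the notation of the third: the continuation exists, so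
  the description behind \<open>I_reg\<close> has an object, and C^2 regularity makes the
  derivatives in \<open>Delta_half\<close> genuine. The statement holds for every system
  \<open>R\<close> of representatives and every choice of \<sigma>.\<close>

theorem theorem5p9:
  fixes N :: nat
    and L \<Gamma> :: "(real^2^2) set"
    and R :: "(real^2^2) set set"
    and \<sigma> :: "(real^2^2) set \<Rightarrow> real^2^2"
    and f :: "complex \<Rightarrow> complex"
    and lam s' :: complex
    and A B :: "(real^2^2) set \<Rightarrow> complex"
  assumes "N \<ge> 1"
    and "even_lattice N L"
    and "congruence_subgroup \<Gamma>" and "compatible_group N L \<Gamma>"
    and "cusp_matrices N \<sigma>" and "cusp_reps N \<Gamma> R"
    and "lam = s' * (1 - s')"
    and "weak_Maass_form N \<Gamma> \<sigma> lam f"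
    and "\<forall>\<l>\<in>Iso N. \<forall>y>0. const_term \<Gamma> (\<sigma> \<l>) f y =
           A \<l> * complex_of_real y powr s' + B \<l> * complex_of_real y powr (1 - s')"
  shows "\<forall>h\<in>disc_group N L.
           (\<forall>\<tau>\<in>upper_half. \<exists>F. is_reg_continuation N \<Gamma> R \<sigma> f h \<tau> F) \<and>
           C_k_on 2 (I_reg N \<Gamma> R \<sigma> f h) upper_half \<and>
           (\<forall>\<tau>\<in>upper_half.
              4 * Delta_half (I_reg N \<Gamma> R \<sigma> f h) \<tau> =
                (if s' = 0 then
                   - (\<Sum>\<l>\<in>R. A \<l> * complex_of_real (eps_cusp L \<Gamma> \<l> (\<sigma> \<l>) / sqrt (real N))
                              * theta_K_tilde N \<l> h \<tau>)
                 else if s' = 1 then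
                   - (\<Sum>\<l>\<in>R. B \<l> * complex_of_real (eps_cusp L \<Gamma> \<l> (\<sigma> \<l>) / sqrt (real N))
                              * theta_K_tilde N \<l> h \<tau>)
                 else lam * I_reg N \<Gamma> R \<sigma> f h \<tau>))"
proof
  fix h assume h: "h \<in> disc_group N L"
  have lift: "lift N L \<Gamma> R \<sigma> f s' A B h"
    by unfold_locales (use assms h in auto)
  interpret lift N L \<Gamma> R \<sigma> f s' A B h by (rule lift)
  \<comment> \<open>All data at one cusp are packed into a single tuple, so that one application of
    choice yields them as functions of the cusp.\<close>
  define X where "X l = (\<lambda>(D, p1, p2, p11, p22). cusp_eigen N D (beta_cusp L l (\<sigma> l)) (act (adj (\<sigma> l)) ` h) (wd l) (\<lambda>z. f (moebius_act (\<sigma> l) z)) s' (A l) (B l) p1 p2 p11 p22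
     \<and> (\<forall>\<tau>. coset_rows.theta0 N D (act (adj (\<sigma> l)) ` h) \<tau> = theta_K_tilde N l h \<tau>))" for l
  have "\<exists>x. X l x" if "l \<in> R" for l
  proof -
    from cusp_data[OF R_Iso[OF that]] obtain D p1 p2 p11 p22 where "X l (D, p1, p2, p11, p22)" unfolding X_def by auto
    then show ?thesis ..
  qed
  then have "\<forall>l\<in>R. \<exists>x. X l x" by blast
  from bchoice[OF this] obtain x where x: "\<forall>l\<in>R. X l (x l)" by (elim exE)
  interpret lift_data N L \<Gamma> R \<sigma> f s' A B h "\<lambda>l. fst (x l)" "\<lambda>l. fst (snd (x l))" "\<lambda>l. fst (snd (snd (x l)))" "\<lambda>l. fst (snd (snd (snd (x l))))" "\<lambda>l. snd (snd (snd (snd (x l))))"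
  proof (rule lift_data.intro[OF lift], rule lift_data_axioms.intro)
    fix l \<tau> assume "l \<in> R"
    then have *: "X l (x l)" using x by blast
    show "cusp_eigen N (fst (x l)) (beta_cusp L l (\<sigma> l)) (act (adj (\<sigma> l)) ` h) (wd l) (\<lambda>z. f (moebius_act (\<sigma> l) z)) s' (A l) (B l)
        (fst (snd (x l))) (fst (snd (snd (x l)))) (fst (snd (snd (snd (x l))))) (snd (snd (snd (snd (x l)))))"
      using * unfolding X_def case_prod_unfold by (rule conjunct1)
    show "coset_rows.theta0 N (fst (x l)) (act (adj (\<sigma> l)) ` h) \<tau> = theta_K_tilde N l h \<tau>"
      using * unfolding X_def case_prod_unfold by simp
  qed
  show "(\<forall>\<tau>\<in>upper_half. \<exists>F. is_reg_continuation N \<Gamma> R \<sigma> f h \<tau> F) \<and>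
           C_k_on 2 (I_reg N \<Gamma> R \<sigma> f h) upper_half \<and>
           (\<forall>\<tau>\<in>upper_half.
              4 * Delta_half (I_reg N \<Gamma> R \<sigma> f h) \<tau> =
                (if s' = 0 then
                   - (\<Sum>\<l>\<in>R. A \<l> * complex_of_real (eps_cusp L \<Gamma> \<l> (\<sigma> \<l>) / sqrt (real N))
                              * theta_K_tilde N \<l> h \<tau>)
                 else if s' = 1 then
                   - (\<Sum>\<l>\<in>R. B \<l> * complex_of_real (eps_cusp L \<Gamma> \<l> (\<sigma> \<l>) / sqrt (real N))
                              * theta_K_tilde N \<l> h \<tau>)
                 else lam * I_reg N \<Gamma> R \<sigma> f h \<tau>))"
    unfolding assms(7)
  proof (intro conjI ballI)
    fix \<tau> assume "\<tau> \<in> upper_half"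
    then show "\<exists>F. is_reg_continuation N \<Gamma> R \<sigma> f h \<tau> F"
      by (intro exI[of _ "FF \<tau>"] FF_continuation) (simp add: upper_half_def)
  qed (rule I_reg_C2, rule Delta_I_reg)
qed

end
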